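(* Let $\Omega$, $V$, $\lambda$, $L_2$ and $\mu(x)$ be as in the context, and let $\mu$ be the first eigenvalue of the ordinary differential operator $$\mathcal{A}=-\frac{d^2}{dx^2}+\mu(x)$$ on the projection of $\Omega$ onto the $x$-axis with zero boundary conditions. Then there is an absolute constant $C$ such that the first Dirichlet eigenvalue $\lambda$ of $-\Delta_{x,y}+V(x,y)$ on $\Omega$ satisfies $$\mu\le\lambda\le\mu+CL_2^{-2}.$$
   Context: Domain. $\Omega\subset\mathbb{R}^2$ is a bounded convex domain with inner radius $N_1$ (radius of the largest inscribed disc) and diameter $N_2$; $N_1$ is bounded below by a fixed absolute constant and $N_2$ is at least a fixed sufficiently large absolute constant. Potential. $V(x,y)=h(x,y)^{-2}$ on $\Omega$, where $h$ is concave with $0\le h\le 1$ and $\max_\Omega h=1$ (the maximum may be attained on the boundary, $h$ being extended to the closure). Thus $V$ is convex with minimum $1$; no further regularity is assumed. $\lambda$ is the first Dirichlet eigenvalue of $-\Delta_{x,y}+V(x,y)$ on $\Omega$. Length scales. For $s\ge 0$ let $\Omega_s=\{(x,y)\in\Omega: V(x,y)\le 1+s\}$. $L_1$ is the largest value such that $\Omega_{L_1^{-2}}$ has inner radius at least $L_1$. $\tilde L_1$ is the diameter of $\Omega_{L_1^{-2}}$. Orientation: rotate so that the projection of $\Omega_{L_1^{-2}}$ onto the $y$-axis has the smallest length among its projections onto all lines. For each $x$ let $\Omega(x)$ be the cross-section of $\Omega$ at $x$ (an interval in $y$), let $\mu(x)$ be the first eigenvalue of $-\frac{d^2}{dy^2}+V(x,y)$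 on $\Omega(x)$ with zero boundary conditions, and $\mu^*=\min_x\mu(x)$. Fix a large absolute constant $\tilde C$. If $\tilde L_1<\tilde C L_1$ (i.e. $L_1,\tilde L_1$ are comparable), set $L_2=L_1$. If $\tilde L_1\ge\tilde C L_1$ (written $\tilde L_1\gg L_1$), $L_2$ is the largest value such that $\mu^*\le\mu(x)\le\mu^*+L_2^{-2}$ for all $x$ in an interval $I$ of length at least $L_2$. An absolute constant is a positive constant depending only on the fixed constants above, not on $\Omega,V,N_1,N_2,L_1,L_2$. *)

theory Defs
  imports "HOL-Analysis.Analysis"
begin

section \<open>Dirichlet eigenvalues of Schroedinger operators\<close>

text \<open>
  \<open>C1_compact U \<phi> G\<close>: \<open>\<phi>\<close> is a \<open>C\<^sup>1\<close> function with gradient \<open>G\<close> whose support is a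
  compact subset of \<open>U\<close>.
\<close>

definition C1_compact :: "'a::euclidean_space set \<Rightarrow> ('a \<Rightarrow> real) \<Rightarrow> ('a \<Rightarrow> 'a) \<Rightarrow> bool" where
  "C1_compact U \<phi> G \<longleftrightarrow>
     (\<forall>p. GDERIV \<phi> p :> G p) \<and> continuous_on UNIV G \<and>
     compact (closure {p. \<phi> p \<noteq> 0}) \<and> closure {p. \<phi> p \<noteq> 0} \<subseteq> U"

text \<open>
  The form domain of \<open>-\<Delta> + V\<close> on \<open>U\<close> with zero boundary values (for \<open>V \<ge> 0\<close>), that is,
  the closure of the compactly supported \<open>C\<^sup>1\<close> functions in the norm whose square is
  \<open>\<integral> |\<nabla>u|\<^sup>2 + u\<^sup>2 + V u\<^sup>2\<close>.  For bounded \<open>V\<close> this is the Sobolev space \<open>H\<^sup>1\<^sub>0(U)\<close>;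
  the weight \<open>V\<close> is kept because the potential may blow up at the boundary.  The second
  function \<open>g\<close> is the weak gradient of \<open>u\<close>.  Convergence is measured by the nonnegative
  integral, so it entails that \<open>u\<close>, \<open>g\<close> and \<open>sqrt V * u\<close> are square integrable over \<open>U\<close>.
\<close>

definition dirichlet_form_domain ::
    "'a::euclidean_space set \<Rightarrow> ('a \<Rightarrow> real) \<Rightarrow> ('a \<Rightarrow> real) \<Rightarrow> ('a \<Rightarrow> 'a) \<Rightarrow> bool" where
  "dirichlet_form_domain U V u g \<longleftrightarrow>
     set_borel_measurable lborel U u \<and> set_borel_measurable lborel U g \<and>
     (\<exists>\<phi> G. (\<forall>n. C1_compact U (\<phi> n) (G n)) \<and>
        (\<lambda>n::nat. \<integral>\<^sup>+p\<in>U. ennreal ((norm (G n p - g p))\<^sup>2 + (\<phi> n p - u p)\<^sup>2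
                                     + V p * (\<phi> n p - u p)\<^sup>2) \<partial>lborel)
          \<longlonglongrightarrow> 0)"

text \<open>
  \<open>l\<close> is an eigenvalue if \<open>-\<Delta>u + V u = l u\<close> holds weakly in \<open>U\<close> for some nonzero \<open>u\<close>
  with zero boundary values.  On the real line this is the operator \<open>-d\<^sup>2/dx\<^sup>2 + V\<close>.
\<close>

definition dirichlet_eigenvalue ::
    "'a::euclidean_space set \<Rightarrow> ('a \<Rightarrow> real) \<Rightarrow> real \<Rightarrow> bool" where
  "dirichlet_eigenvalue U V l \<longleftrightarrow>
     (\<exists>u g. dirichlet_form_domain U V u g \<and>
        \<not> (AE p in lborel. p \<in> U \<longrightarrow> u p = 0) \<and>
        (\<forall>\<phi> G. C1_compact U \<phi> G \<longrightarrow>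
           (LINT p:U|lborel. g p \<bullet> G p + V p * u p * \<phi> p) = l * (LINT p:U|lborel. u p * \<phi> p)))"

definition first_dirichlet_eigenvalue ::
    "'a::euclidean_space set \<Rightarrow> ('a \<Rightarrow> real) \<Rightarrow> real" where
  "first_dirichlet_eigenvalue U V = (LEAST l. dirichlet_eigenvalue U V l)"


section \<open>Geometry of planar sets\<close>

definition inner_radius :: "(real \<times> real) set \<Rightarrow> real" where
  "inner_radius S = Sup {r. 0 \<le> r \<and> (\<exists>c. ball c r \<subseteq> S)}"

text \<open>
  Length of the projection onto the line spanned by a unit vector \<open>e\<close>.  It is only used for
  bounded convex sets, whose projections are intervals, and the length of a bounded interval
  is its diameter.
\<close>

definition projection_length :: "real \<times> real \<Rightarrow> (real \<times> real) set \<Rightarrow> real" where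
  "projection_length e S = diameter ((\<lambda>p. p \<bullet> e) ` S)"


section \<open>Potential and length scales\<close>

text \<open>
  In HOL \<open>1 / 0 = 0\<close>, but a nonnegative concave function on an open convex set that is not
  identically zero has no zeros there, so this value is never taken on the domain.
\<close>

definition potential :: "(real \<times> real \<Rightarrow> real) \<Rightarrow> real \<times> real \<Rightarrow> real" where
  "potential h p = 1 / (h p)\<^sup>2"

definition low_set :: "(real \<times> real) set \<Rightarrow> (real \<times> real \<Rightarrow> real) \<Rightarrow> real \<Rightarrow> (real \<times> real) set" where
  "low_set \<Omega> V s = {p \<in> \<Omega>. V p \<le> 1 + s}"

definition scale_L1 :: "(real \<times> real) set \<Rightarrow> (real \<times> real \<Rightarrow> real) \<Rightarrow> real" where
  "scale_L1 \<Omega> V = (GREATEST L. 0 < L \<and> L \<le> inner_radius (low_set \<Omega> V (1 / L\<^sup>2)))"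

definition L1_set :: "(real \<times> real) set \<Rightarrow> (real \<times> real \<Rightarrow> real) \<Rightarrow> (real \<times> real) set" where
  "L1_set \<Omega> V = low_set \<Omega> V (1 / (scale_L1 \<Omega> V)\<^sup>2)"

definition scale_L1_tilde :: "(real \<times> real) set \<Rightarrow> (real \<times> real \<Rightarrow> real) \<Rightarrow> real" where
  "scale_L1_tilde \<Omega> V = diameter (L1_set \<Omega> V)"

definition well_oriented :: "(real \<times> real) set \<Rightarrow> (real \<times> real \<Rightarrow> real) \<Rightarrow> bool" where
  "well_oriented \<Omega> V \<longleftrightarrow>
     (\<forall>e. norm e = 1 \<longrightarrow> projection_length (0, 1) (L1_set \<Omega> V) \<le> projection_length e (L1_set \<Omega> V))"

definition cross_section :: "(real \<times> real) set \<Rightarrow> real \<Rightarrow> real set" where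
  "cross_section \<Omega> x = {y. (x, y) \<in> \<Omega>}"

definition section_eigenvalue :: "(real \<times> real) set \<Rightarrow> (real \<times> real \<Rightarrow> real) \<Rightarrow> real \<Rightarrow> real" where
  "section_eigenvalue \<Omega> V x = first_dirichlet_eigenvalue (cross_section \<Omega> x) (\<lambda>y. V (x, y))"

text \<open>
  An infimum, because the projection of the open set \<open>\<Omega>\<close> is an open interval and the least
  value may only be approached at one of its end points.
\<close>

definition mu_star :: "(real \<times> real) set \<Rightarrow> (real \<times> real \<Rightarrow> real) \<Rightarrow> real" where
  "mu_star \<Omega> V = (INF x\<in>fst ` \<Omega>. section_eigenvalue \<Omega> V x)"

text \<open>The parameter \<open>K\<close> is the threshold that decides whether the two scales are comparable.\<close>

definition scale_L2 :: "real \<Rightarrow> (real \<times> real) set \<Rightarrow> (real \<times> real \<Rightarrow> real) \<Rightarrow> real" where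
  "scale_L2 K \<Omega> V =
     (if scale_L1_tilde \<Omega> V < K * scale_L1 \<Omega> V then scale_L1 \<Omega> V
      else (GREATEST L. 0 < L \<and>
             (\<exists>I. is_interval I \<and> I \<subseteq> fst ` \<Omega> \<and> L \<le> diameter I \<and>
                (\<forall>x\<in>I. mu_star \<Omega> V \<le> section_eigenvalue \<Omega> V x \<and>
                       section_eigenvalue \<Omega> V x \<le> mu_star \<Omega> V + 1 / L\<^sup>2))))"

end

theory Submission
  imports Defs "HOL-Library.Diagonal_Subsequence" "HOL-Complex_Analysis.Great_Picard"
begin

text \<open>
  The first eigenvalue is the infimum of the Rayleigh quotients over compactly supported \<open>C\<^sup>1\<close>
  functions (\<open>first_dirichlet_eigenvalue_eq\<close>).  A minimizing sequence converges by Rellich's theorem,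
  so the infimum is an eigenvalue, and testing the weak equation shows that no eigenvalue is smaller.
  This holds in the plane, on each vertical section, and on the projection of \<open>\<Omega>\<close> with the potential
  \<open>\<mu>(x)\<close>.  All estimates below compare Rayleigh quotients.

  \<^emph>\<open>Lower bound.\<close>  For a test function \<open>\<phi>\<close> the vertical part of the energy on the section at \<open>x\<close> is at
  least \<open>\<mu>(x) f(x)\<^sup>2\<close>, where \<open>f(x)\<close> is the \<open>L\<^sup>2\<close> norm of \<open>\<phi>\<close> on that section, and \<open>|f'|\<close> is at most
  the \<open>L\<^sup>2\<close> norm of \<open>\<partial>\<phi>/\<partial>x\<close>.  Hence \<open>f\<close> is a trial function for the operator on the projection
  with an energy that is not larger (\<open>mu_le_lambda\<close>).

  \<^emph>\<open>Upper bound.\<close>  A bump function in a disc of radius comparable to \<open>L\<^sub>1\<close> on which \<open>V \<le> 1 + L\<^sub>1\<^sup>-\<^sup>2\<close>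
  gives \<open>\<lambda> \<le> 1 + C L\<^sub>1\<^sup>-\<^sup>2\<close>, and \<open>\<mu> \<ge> 1\<close>.  This settles every case with \<open>L\<^sub>2 \<le> L\<^sub>1\<close>.  If
  \<open>L\<^sub>2 > L\<^sub>1\<close>, there are two abscissae \<open>a < b\<close> at distance at least \<open>L\<^sub>2/2\<close> with \<open>\<mu>(a), \<mu>(b) < M\<close>,
  where \<open>M = \<mu>\<^sup>* + 2 L\<^sub>2\<^sup>-\<^sup>2\<close>.  Since \<open>\<mu> \<ge> \<mu>\<^sup>*\<close>, it suffices to find a trial function in the plane
  with Rayleigh quotient at most \<open>M + C (b - a)\<^sup>-\<^sup>2\<close> (\<open>two_section_bound\<close>).

  At \<open>a\<close> and \<open>b\<close> there are log-concave solutions of \<open>\<psi>'' = (V - M) \<psi>\<close> that vanish at the ends of an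
  interval inside the section (\<open>profile_exists\<close>, \<open>profile_log_concave\<close>).  Between \<open>a\<close> and \<open>b\<close> they are
  joined by the geometric sup-convolution
  \<open>G(x,y) = sup {\<psi>\<^sub>a(y\<^sub>1)\<^sup>1\<^sup>-\<^sup>t \<psi>\<^sub>b(y\<^sub>2)\<^sup>t | y = (1-t) y\<^sub>1 + t y\<^sub>2}\<close> with \<open>t = (x-a)/(b-a)\<close>.
  Convexity of \<open>V\<close> makes \<open>G(x,\<cdot>)\<close> a subsolution of the same equation on every section: at an optimal
  pair the logarithmic slopes agree, so shifting \<open>y\<^sub>1\<close> and \<open>y\<^sub>2\<close> together supports \<open>G(x,\<cdot>)\<close> from below to
  second order (\<open>lower_support\<close>).  Thus \<open>\<integral> (G\<^sub>y\<^sup>2 + V G\<^sup>2) dy \<le> M \<integral> G\<^sup>2 dy\<close> for each \<open>x\<close>.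
  Log-concavity gives \<open>G(x,y) \<le> G(x', y')\<close> whenever \<open>(x', y')\<close> lies on the segment from \<open>(x,y)\<close> to the peak
  of an end profile (\<open>contraction_right\<close>, \<open>contraction_left\<close>).  A horizontal step is therefore no worse
  than a vertical dilation about a peak, so \<open>|G\<^sub>x| \<le> C |y - m| |G\<^sub>y| / (b - a)\<close> in the middle of the
  interval.  The subsolution property also bounds \<open>\<integral> (y - m)\<^sup>2 G\<^sub>y\<^sup>2 dy\<close> by \<open>C \<integral> G\<^sup>2 dy\<close>, provided
  \<open>(M - V)(y - m)\<^sup>2\<close> is bounded above.  The orientation ensures this: the set \<open>V \<le> M\<close> lies in a horizontal
  strip of width \<open>C L\<^sub>1\<close> (\<open>low_set_strip\<close>), while \<open>M - V \<le> C L\<^sub>1\<^sup>-\<^sup>2\<close>.  Multiplication by a cutoff in \<open>x\<close>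
  then costs only \<open>C (b - a)\<^sup>-\<^sup>2\<close>.

  Neither \<open>G\<close> nor the section norm \<open>f\<close> is differentiable a priori.  For this reason trial functions are
  only required to have difference quotients that are bounded in \<open>L\<^sup>2\<close> (\<open>trial_function\<close>), and the differential
  inequality for \<open>G\<close> is used in the form that \<open>G(x,\<cdot>)\<close> lies below suitable parabolas (\<open>below_parabolas\<close>).
\<close>

section \<open>Square integrable functions\<close>

definition square_integrable :: "'m measure \<Rightarrow> ('m \<Rightarrow> 'b::euclidean_space) \<Rightarrow> bool" where
  "square_integrable M f \<longleftrightarrow> f \<in> borel_measurable M \<and> integrable M (\<lambda>x. (norm (f x))\<^sup>2)"

lemma square_integrable_inner:
  assumes "square_integrable M f" "square_integrable M g"
  shows "integrable M (\<lambda>x. f x \<bullet> g x)"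
proof (rule Bochner_Integration.integrable_bound)
  show "integrable M (\<lambda>x. (norm (f x))\<^sup>2 + (norm (g x))\<^sup>2)"
    using assms by (auto simp: square_integrable_def)
  show "(\<lambda>x. f x \<bullet> g x) \<in> borel_measurable M"
    using assms by (auto simp: square_integrable_def)
  have "\<bar>f x \<bullet> g x\<bar> \<le> (norm (f x))\<^sup>2 + (norm (g x))\<^sup>2" for x
  proof -
    have "\<bar>f x \<bullet> g x\<bar> \<le> norm (f x) * norm (g x)" by (rule Cauchy_Schwarz_ineq2)
    also have "\<dots> \<le> (norm (f x))\<^sup>2 + (norm (g x))\<^sup>2"
      using sum_squares_bound[of "norm (f x)" "norm (g x)"] mult_nonneg_nonneg[of "norm (f x)" "norm (g x)", OF norm_ge_zero norm_ge_zero] by linarith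
    finally show ?thesis .
  qed
  then show "AE x in M. norm (f x \<bullet> g x) \<le> norm ((norm (f x))\<^sup>2 + (norm (g x))\<^sup>2)"
    by (auto simp: abs_of_nonneg)
qed

lemma square_integrable_scaleR:
  "square_integrable M f \<Longrightarrow> square_integrable M (\<lambda>x. c *\<^sub>R f x)"
  by (auto simp: square_integrable_def power_mult_distrib)

lemma square_integrable_add:
  assumes "square_integrable M f" "square_integrable M g"
  shows "square_integrable M (\<lambda>x. f x + g x)"
proof -
  have "integrable M (\<lambda>x. (norm (f x))\<^sup>2 + 2 * (f x \<bullet> g x) + (norm (g x))\<^sup>2)"
    using assms square_integrable_inner[OF assms] by (auto simp: square_integrable_def)
  moreover have "(\<lambda>x. (norm (f x))\<^sup>2 + 2 * (f x \<bullet> g x) + (norm (g x))\<^sup>2) = (\<lambda>x. (norm (f x + g x))\<^sup>2)"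
    by (auto simp: power2_norm_eq_inner inner_add_left inner_add_right inner_commute)
  ultimately show ?thesis
    using assms by (auto simp: square_integrable_def)
qed

lemma square_integrable_diff:
  assumes "square_integrable M f" "square_integrable M g"
  shows "square_integrable M (\<lambda>x. f x - g x)"
  using square_integrable_add[OF assms(1) square_integrable_scaleR[OF assms(2), of "-1"]] by simp

text \<open>
  A negative leading coefficient would make the quadratic negative for large \<open>t\<close>; otherwise its minimum over
  \<open>t\<close> gives the inequality.  This form is needed both for the \<open>L\<^sup>2\<close> inner product and for the
  degenerate energy form of the eigenvalue problem.
\<close>

lemma nonneg_quadratic_discriminant:
  fixes A B C :: real
  assumes q: "\<And>t. 0 \<le> A + 2 * t * B + t\<^sup>2 * C"
  shows "B\<^sup>2 \<le> A * C"
proof (cases "C = 0")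
  case True
  have "B = 0"
  proof (rule ccontr)
    assume "B \<noteq> 0"
    with q[of "- (A + 1) / (2 * B)"] True show False by (simp add: field_simps)
  qed
  then show ?thesis using True by simp
next
  case False
  have "0 \<le> C"
  proof (rule ccontr)
    assume C: "\<not> 0 \<le> C"
    define t where "t = (\<bar>A\<bar> + 2 * \<bar>B\<bar> + 1) / - C + 1"
    have t: "t \<ge> 1" using C by (auto simp: t_def intro!: divide_nonneg_neg divide_nonpos_neg)
    have tC: "t * C = - (\<bar>A\<bar> + 2 * \<bar>B\<bar> + 1) + C" using C by (simp add: t_def field_simps)
    have "A + 2 * t * B + t\<^sup>2 * C = A + t * (2 * B + t * C)" by (simp add: power2_eq_square algebra_simps)
    also have "\<dots> \<le> \<bar>A\<bar> + t * (- \<bar>A\<bar> - 1)"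
      using t C by (intro add_mono mult_left_mono) (auto simp: tC)
    also have "\<dots> \<le> \<bar>A\<bar> + 1 * (- \<bar>A\<bar> - 1)" using t by (intro add_left_mono mult_right_mono_neg) auto
    finally show False using q[of t] by simp
  qed
  with False have C: "C > 0" by simp
  have "0 \<le> C * (A + 2 * (-B / C) * B + (-B / C)\<^sup>2 * C)" using q[of "-B / C"] C by simp
  also have "\<dots> = A * C - B\<^sup>2" using C by (simp add: field_simps power2_eq_square)
  finally show ?thesis by simp
qed

lemma integral_inner_Cauchy_Schwarz:
  assumes f: "square_integrable M f" and g: "square_integrable M g"
  shows "(\<integral>x. f x \<bullet> g x \<partial>M)\<^sup>2 \<le> (\<integral>x. (norm (f x))\<^sup>2 \<partial>M) * (\<integral>x. (norm (g x))\<^sup>2 \<partial>M)"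
proof -
  define A B C where "A = (\<integral>x. (norm (f x))\<^sup>2 \<partial>M)" and "B = (\<integral>x. f x \<bullet> g x \<partial>M)"
    and "C = (\<integral>x. (norm (g x))\<^sup>2 \<partial>M)"
  have q: "0 \<le> A + 2 * t * B + t\<^sup>2 * C" for t
  proof -
    have "0 \<le> (\<integral>x. (norm (f x + t *\<^sub>R g x))\<^sup>2 \<partial>M)"
      by (rule integral_nonneg_AE) auto
    also have "(\<lambda>x. (norm (f x + t *\<^sub>R g x))\<^sup>2) =
      (\<lambda>x. (norm (f x))\<^sup>2 + (2 * t) * (f x \<bullet> g x) + t\<^sup>2 * (norm (g x))\<^sup>2)"
      unfolding power2_norm_eq_inner
      by (rule ext) (simp add: inner_add_left inner_add_right inner_commute algebra_simps power2_eq_square)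
    also have "(\<integral>x. (norm (f x))\<^sup>2 + (2 * t) * (f x \<bullet> g x) + t\<^sup>2 * (norm (g x))\<^sup>2 \<partial>M) = A + 2 * t * B + t\<^sup>2 * C"
      using f g square_integrable_inner[OF f g] by (simp add: A_def B_def C_def square_integrable_def)
    finally show ?thesis .
  qed
  then have "B\<^sup>2 \<le> A * C" by (rule nonneg_quadratic_discriminant)
  then show ?thesis by (simp add: A_def B_def C_def)
qed

text \<open>
  Convergence of the nonnegative integrals alone carries the integrability over to the limit, because
  one of the differences is square integrable.
\<close>

lemma square_integrable_limit:
  assumes fn: "\<And>n. square_integrable M (f n)" and g: "g \<in> borel_measurable M"
    and lim: "(\<lambda>n::nat. \<integral>\<^sup>+x. ennreal ((norm (f n x - g x))\<^sup>2) \<partial>M) \<longlonglongrightarrow> 0"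
  shows "square_integrable M g" "(\<lambda>n. \<integral>x. (norm (f n x - g x))\<^sup>2 \<partial>M) \<longlonglongrightarrow> 0"
proof -
  have "eventually (\<lambda>n. (\<integral>\<^sup>+x. ennreal ((norm (f n x - g x))\<^sup>2) \<partial>M) < 1) sequentially"
    using lim by (rule order_tendstoD) simp
  then obtain n where n: "(\<integral>\<^sup>+x. ennreal ((norm (f n x - g x))\<^sup>2) \<partial>M) < 1"
    by (auto simp: eventually_sequentially)
  have meas: "f n \<in> borel_measurable M" for n using fn by (auto simp: square_integrable_def)
  have "integrable M (\<lambda>x. (norm (f n x - g x))\<^sup>2)"
    using n meas g by (intro integrableI_nonneg) (auto intro: order.strict_trans)
  then have d: "square_integrable M (\<lambda>x. f n x - g x)"
    using meas g by (auto simp: square_integrable_def)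
  show sg: "square_integrable M g"
    using square_integrable_diff[OF fn[of n] d] by simp
  have int: "integrable M (\<lambda>x. (norm (f n x - g x))\<^sup>2)" for n
    using square_integrable_diff[OF fn[of n] sg] by (auto simp: square_integrable_def)
  have "(\<lambda>n. ennreal (\<integral>x. (norm (f n x - g x))\<^sup>2 \<partial>M)) \<longlonglongrightarrow> ennreal 0"
    using lim by (subst (asm) nn_integral_eq_integral[OF int]) auto
  then show "(\<lambda>n. \<integral>x. (norm (f n x - g x))\<^sup>2 \<partial>M) \<longlonglongrightarrow> 0"
    by (subst (asm) tendsto_ennreal_iff) (auto intro!: integral_nonneg_AE)
qed

lemma L2_inner_tendsto:
  assumes f: "\<And>n. square_integrable M (f n)" "square_integrable M f'" "(\<lambda>n::nat. \<integral>x. (norm (f n x - f' x))\<^sup>2 \<partial>M) \<longlonglongrightarrow> 0"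
    and h: "\<And>n. square_integrable M (h n)" "square_integrable M h'" "(\<lambda>n::nat. \<integral>x. (norm (h n x - h' x))\<^sup>2 \<partial>M) \<longlonglongrightarrow> 0"
  shows "(\<lambda>n. \<integral>x. f n x \<bullet> h n x \<partial>M) \<longlonglongrightarrow> (\<integral>x. f' x \<bullet> h' x \<partial>M)"
proof -
  note df = square_integrable_diff[OF f(1,2)] and dh = square_integrable_diff[OF h(1,2)]
  have sq0: "X \<longlonglongrightarrow> 0" if "\<And>n. (X n)\<^sup>2 \<le> Y n" "Y \<longlonglongrightarrow> 0" for X Y :: "nat \<Rightarrow> real"
  proof -
    have "(\<lambda>n. (X n)\<^sup>2) \<longlonglongrightarrow> 0"
      by (rule tendsto_sandwich[OF _ _ tendsto_const that(2)]) (auto simp: that)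
    then show ?thesis using tendsto_real_sqrt[of "\<lambda>n. (X n)\<^sup>2" 0 sequentially] by (simp add: tendsto_rabs_zero_iff)
  qed
  have 1: "(\<lambda>n. \<integral>x. (f n x - f' x) \<bullet> (h n x - h' x) \<partial>M) \<longlonglongrightarrow> 0"
    by (rule sq0[OF integral_inner_Cauchy_Schwarz[OF df dh]]) (use tendsto_mult[OF f(3) h(3)] in simp)
  have 2: "(\<lambda>n. \<integral>x. (f n x - f' x) \<bullet> h' x \<partial>M) \<longlonglongrightarrow> 0"
    by (rule sq0[OF integral_inner_Cauchy_Schwarz[OF df h(2)]]) (use tendsto_mult[OF f(3) tendsto_const] in simp)
  have 3: "(\<lambda>n. \<integral>x. f' x \<bullet> (h n x - h' x) \<partial>M) \<longlonglongrightarrow> 0"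
    by (rule sq0[OF integral_inner_Cauchy_Schwarz[OF f(2) dh]]) (use tendsto_mult[OF tendsto_const h(3)] in simp)
  have eq: "(\<integral>x. f n x \<bullet> h n x \<partial>M) = (\<integral>x. f' x \<bullet> h' x \<partial>M) + (\<integral>x. (f n x - f' x) \<bullet> (h n x - h' x) \<partial>M)
     + (\<integral>x. (f n x - f' x) \<bullet> h' x \<partial>M) + (\<integral>x. f' x \<bullet> (h n x - h' x) \<partial>M)" for n
  proof -
    have "(\<integral>x. f' x \<bullet> h' x \<partial>M) + (\<integral>x. (f n x - f' x) \<bullet> (h n x - h' x) \<partial>M)
     + (\<integral>x. (f n x - f' x) \<bullet> h' x \<partial>M) + (\<integral>x. f' x \<bullet> (h n x - h' x) \<partial>M)
     = (\<integral>x. f' x \<bullet> h' x + (f n x - f' x) \<bullet> (h n x - h' x) + (f n x - f' x) \<bullet> h' x + f' x \<bullet> (h n x - h' x) \<partial>M)"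
      by (simp add: square_integrable_inner[OF f(2) h(2)] square_integrable_inner[OF df dh]
          square_integrable_inner[OF df h(2)] square_integrable_inner[OF f(2) dh])
    also have "\<dots> = (\<integral>x. f n x \<bullet> h n x \<partial>M)"
      by (rule Bochner_Integration.integral_cong) (auto simp: inner_diff_left inner_diff_right)
    finally show ?thesis by simp
  qed
  show ?thesis
    unfolding eq using tendsto_add[OF tendsto_add[OF tendsto_add[OF tendsto_const 1] 2] 3] by simp
qed

lemma L2_norm_tendsto:
  assumes f: "\<And>n. square_integrable M (f n)" "square_integrable M f'" "(\<lambda>n::nat. \<integral>x. (norm (f n x - f' x))\<^sup>2 \<partial>M) \<longlonglongrightarrow> 0"
  shows "(\<lambda>n. \<integral>x. (norm (f n x))\<^sup>2 \<partial>M) \<longlonglongrightarrow> (\<integral>x. (norm (f' x))\<^sup>2 \<partial>M)"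
  using L2_inner_tendsto[OF f f] by (simp add: power2_norm_eq_inner)

text \<open>
  A rapidly converging subsequence has \<open>\<Sum> 4\<^sup>k |f\<^sub>k\<^sub>+\<^sub>1 - f\<^sub>k|\<^sup>2\<close> integrable, hence finite almost everywhere,
  so it converges pointwise geometrically fast; Fatou's lemma turns pointwise convergence into \<open>L\<^sup>2\<close>
  convergence of the whole sequence.
\<close>

lemma L2_complete:
  fixes f :: "nat \<Rightarrow> 'm \<Rightarrow> 'b::euclidean_space"
  assumes f: "\<And>n. square_integrable M (f n)"
    and Cau: "\<And>e. e > 0 \<Longrightarrow> \<exists>N. \<forall>m\<ge>N. \<forall>n\<ge>N. (\<integral>x. (norm (f m x - f n x))\<^sup>2 \<partial>M) < e"
  obtains g r where "g \<in> borel_measurable M" "strict_mono (r :: nat \<Rightarrow> nat)"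
    "AE x in M. (\<lambda>k. f (r k) x) \<longlonglongrightarrow> g x"
    "(\<lambda>n. \<integral>\<^sup>+x. ennreal ((norm (f n x - g x))\<^sup>2) \<partial>M) \<longlonglongrightarrow> 0"
proof -
  have meas [measurable]: "f n \<in> borel_measurable M" for n using f by (auto simp: square_integrable_def)
  have int: "integrable M (\<lambda>x. (norm (f m x - f n x))\<^sup>2)" for m n
    using square_integrable_diff[OF f f] by (auto simp: square_integrable_def)
  have nn: "(\<integral>\<^sup>+x. ennreal ((norm (f m x - f n x))\<^sup>2) \<partial>M) = ennreal (\<integral>x. (norm (f m x - f n x))\<^sup>2 \<partial>M)" for m n
    by (rule nn_integral_eq_integral[OF int]) auto
  have "\<exists>N. \<forall>k. \<forall>m\<ge>N k. \<forall>n\<ge>N k. (\<integral>x. (norm (f m x - f n x))\<^sup>2 \<partial>M) < (1/8)^k"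
    by (rule choice) (use Cau in simp)
  then obtain N where N: "\<And>k m n. m \<ge> N k \<Longrightarrow> n \<ge> N k \<Longrightarrow> (\<integral>x. (norm (f m x - f n x))\<^sup>2 \<partial>M) < (1/8)^k"
    by blast
  define r where "r k = (\<Sum>i\<le>k. N i + 1)" for k
  have r: "strict_mono r" by (auto simp: strict_mono_Suc_iff r_def)
  have rN: "r k \<ge> N k" for k
  proof -
    have "N k + 1 \<le> r k" unfolding r_def by (rule member_le_sum) auto
    then show ?thesis by simp
  qed
  have rN': "r (Suc k) \<ge> N k" for k
    using rN[of k] strict_mono_less[OF r, of k "Suc k"] by linarith
  have small: "(\<integral>\<^sup>+x. ennreal (4^k * (norm (f (r (Suc k)) x - f (r k) x))\<^sup>2) \<partial>M) \<le> ennreal ((1/2)^k)" for k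
  proof -
    have "(\<integral>\<^sup>+x. ennreal (4^k * (norm (f (r (Suc k)) x - f (r k) x))\<^sup>2) \<partial>M) = ennreal (4^k) * ennreal (\<integral>x. (norm (f (r (Suc k)) x - f (r k) x))\<^sup>2 \<partial>M)"
      unfolding nn[symmetric] by (subst nn_integral_cmult[symmetric]) (auto simp: ennreal_mult)
    also have "\<dots> \<le> ennreal (4^k) * ennreal ((1/8)^k)"
      using N[OF rN' rN, of k] by (intro mult_left_mono ennreal_leI) auto
    also have "\<dots> = ennreal ((1/2)^k)"
      by (subst ennreal_mult[symmetric]) (auto simp flip: power_mult_distrib)
    finally show ?thesis .
  qed
  have "(\<integral>\<^sup>+x. (\<Sum>k. ennreal (4^k * (norm (f (r (Suc k)) x - f (r k) x))\<^sup>2)) \<partial>M)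
    = (\<Sum>k. (\<integral>\<^sup>+x. ennreal (4^k * (norm (f (r (Suc k)) x - f (r k) x))\<^sup>2) \<partial>M))"
    by (rule nn_integral_suminf) auto
  also have "\<dots> \<le> (\<Sum>k. ennreal ((1/2)^k))"
    by (rule suminf_le) (auto simp: small)
  also have "\<dots> = ennreal (\<Sum>k. (1/2)^k)"
    by (rule suminf_ennreal2) (auto intro!: summable_geometric)
  also have "\<dots> < \<infinity>" by simp
  finally have "AE x in M. (\<Sum>k. ennreal (4^k * (norm (f (r (Suc k)) x - f (r k) x))\<^sup>2)) \<noteq> \<infinity>"
    by (intro nn_integral_noteq_infinite) auto
  then have conv: "AE x in M. convergent (\<lambda>k. f (r k) x)"
  proof eventually_elim
    case (elim x)
    define d where "d k = 4^k * (norm (f (r (Suc k)) x - f (r k) x))\<^sup>2" for k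
    define S where "S = (\<Sum>k. ennreal (d k))"
    have fin: "S < top"
      unfolding S_def d_def less_top[symmetric] by (rule elim[unfolded infinity_ennreal_def])
    have le: "d k \<le> enn2real S" for k
    proof -
      have "ennreal (d k) = (\<Sum>i\<in>{k}. ennreal (d i))" by simp
      also have "\<dots> \<le> S"
        unfolding S_def by (rule sum_le_suminf) auto
      also have "S = ennreal (enn2real S)" using fin by simp
      finally show ?thesis by (rule ennreal_le_iff[THEN iffD1, rotated]) simp
    qed
    have "norm (f (r (Suc k)) x - f (r k) x) \<le> sqrt (enn2real S) * (1/2)^k" for k
    proof -
      have "(2^k * norm (f (r (Suc k)) x - f (r k) x))\<^sup>2 \<le> enn2real S"
      proof -
        have "((2::real)^k)\<^sup>2 = 4^k" by (simp add: power2_eq_square flip: power_mult_distrib)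
        then show ?thesis using le[of k] by (simp add: power_mult_distrib d_def)
      qed
      then have "2^k * norm (f (r (Suc k)) x - f (r k) x) \<le> sqrt (enn2real S)"
        by (rule real_le_rsqrt)
      then show ?thesis by (simp add: power_one_over pos_le_divide_eq mult.commute)
    qed
    note bound = this
    have "summable (\<lambda>k. sqrt (enn2real S) * (1/2)^k)"
      by (rule summable_mult, rule summable_geometric) simp
    then have "summable (\<lambda>k. f (r (Suc k)) x - f (r k) x)"
      by (rule summable_comparison_test'[where N=0]) (rule bound)
    then have "(\<lambda>n. \<Sum>k<n. f (r (Suc k)) x - f (r k) x) \<longlonglongrightarrow> (\<Sum>k. f (r (Suc k)) x - f (r k) x)"
      by (rule summable_LIMSEQ)
    then have "(\<lambda>n. (f (r n) x - f (r 0) x) + f (r 0) x) \<longlonglongrightarrow> (\<Sum>k. f (r (Suc k)) x - f (r k) x) + f (r 0) x"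
      unfolding sum_lessThan_telescope[of "\<lambda>n. f (r n) x"] by (rule tendsto_add[OF _ tendsto_const])
    then show ?case by (auto simp: convergent_def)
  qed
  define g where "g x = lim (\<lambda>k. f (r k) x)" for x
  have g [measurable]: "g \<in> borel_measurable M" unfolding g_def by measurable
  have ae: "AE x in M. (\<lambda>k. f (r k) x) \<longlonglongrightarrow> g x"
    using conv by eventually_elim (simp add: g_def convergent_LIMSEQ_iff)
  have "(\<lambda>n. \<integral>\<^sup>+x. ennreal ((norm (f n x - g x))\<^sup>2) \<partial>M) \<longlonglongrightarrow> 0"
  proof (rule order_tendstoI)
    fix e :: ennreal assume "0 < e"
    then obtain d where d: "0 < d" "d < e" using dense by blast
    define e' where "e' = enn2real d"
    have "d < top" by (rule order.strict_trans2[OF d(2) top_greatest])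
    then have e': "0 < e'" "ennreal e' < e" using d by (auto simp: e'_def enn2real_positive_iff)
    obtain N where N: "\<And>m n. m \<ge> N \<Longrightarrow> n \<ge> N \<Longrightarrow> (\<integral>x. (norm (f m x - f n x))\<^sup>2 \<partial>M) < e'"
      using Cau[OF e'(1)] by blast
    have "(\<integral>\<^sup>+x. ennreal ((norm (f n x - g x))\<^sup>2) \<partial>M) < e" if "n \<ge> N" for n
    proof -
      have eq: "(\<integral>\<^sup>+x. ennreal ((norm (f n x - g x))\<^sup>2) \<partial>M) = (\<integral>\<^sup>+x. liminf (\<lambda>k. ennreal ((norm (f n x - f (r k) x))\<^sup>2)) \<partial>M)"
      proof (rule nn_integral_cong_AE, rule AE_mp[OF ae], rule AE_I2, rule impI)
        fix x assume elim: "(\<lambda>k. f (r k) x) \<longlonglongrightarrow> g x"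
        have "(\<lambda>k. ennreal ((norm (f n x - f (r k) x))\<^sup>2)) \<longlonglongrightarrow> ennreal ((norm (f n x - g x))\<^sup>2)"
          by (rule tendsto_ennrealI[OF tendsto_power[OF tendsto_norm[OF tendsto_diff[OF tendsto_const elim]]]])
        then show "ennreal ((norm (f n x - g x))\<^sup>2) = liminf (\<lambda>k. ennreal ((norm (f n x - f (r k) x))\<^sup>2))"
          by (rule lim_imp_Liminf[OF trivial_limit_sequentially, symmetric])
      qed
      have "(\<integral>\<^sup>+x. ennreal ((norm (f n x - g x))\<^sup>2) \<partial>M) \<le> liminf (\<lambda>k. \<integral>\<^sup>+x. ennreal ((norm (f n x - f (r k) x))\<^sup>2) \<partial>M)"
        unfolding eq by (rule nn_integral_liminf) measurable
      also have "\<dots> \<le> limsup (\<lambda>k. \<integral>\<^sup>+x. ennreal ((norm (f n x - f (r k) x))\<^sup>2) \<partial>M)"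
        by (rule Liminf_le_Limsup) simp
      also have "\<dots> \<le> ennreal e'"
      proof (rule Limsup_bounded, rule eventually_sequentiallyI[of N])
        fix k assume "N \<le> k"
        then have "N \<le> r k" using seq_suble[OF r, of k] by linarith
        then show "(\<integral>\<^sup>+x. ennreal ((norm (f n x - f (r k) x))\<^sup>2) \<partial>M) \<le> ennreal e'"
          unfolding nn using N[OF that, of "r k"] by (intro ennreal_leI) simp
      qed
      finally show ?thesis using e'(2) by simp
    qed
    then show "\<forall>\<^sub>F n in sequentially. (\<integral>\<^sup>+x. ennreal ((norm (f n x - g x))\<^sup>2) \<partial>M) < e"
      by (auto simp: eventually_sequentially)
  qed simp
  with g r ae show ?thesis by (rule that)
qed

section \<open>Compactly supported test functions\<close>

definition compactly_supported :: "('a::euclidean_space \<Rightarrow> 'b::euclidean_space) \<Rightarrow> bool" where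
  "compactly_supported f \<longleftrightarrow> continuous_on UNIV f \<and> (\<exists>K. compact K \<and> (\<forall>x. x \<notin> K \<longrightarrow> f x = 0))"

lemma compactly_supportedI:
  "continuous_on UNIV f \<Longrightarrow> compact K \<Longrightarrow> (\<And>x. x \<notin> K \<Longrightarrow> f x = 0) \<Longrightarrow> compactly_supported f"
  by (auto simp: compactly_supported_def)

lemma compactly_supported_continuous: "compactly_supported f \<Longrightarrow> continuous_on UNIV f"
  by (simp add: compactly_supported_def)

lemma compactly_supported_measurable: "compactly_supported f \<Longrightarrow> f \<in> borel_measurable borel"
  by (intro borel_measurable_continuous_onI compactly_supported_continuous)

lemma compactly_supported_integrable:
  assumes "compactly_supported f" shows "integrable lborel f"
proof -
  from assms obtain K where K: "compact K" "\<And>x. x \<notin> K \<Longrightarrow> f x = 0" and c: "continuous_on UNIV f"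
    by (auto simp: compactly_supported_def)
  have "integrable lborel (\<lambda>x. indicator K x *\<^sub>R f x)"
    using K(1) continuous_on_subset[OF c] by (intro borel_integrable_compact) auto
  also have "(\<lambda>x. indicator K x *\<^sub>R f x) = f"
    using K(2) by (auto simp: indicator_def fun_eq_iff)
  finally show ?thesis .
qed

lemma compactly_supported_add:
  assumes "compactly_supported f" "compactly_supported g"
  shows "compactly_supported (\<lambda>x. f x + g x)"
proof -
  from assms obtain K L where "compact K" "\<And>x. x \<notin> K \<Longrightarrow> f x = 0" "compact L" "\<And>x. x \<notin> L \<Longrightarrow> g x = 0"
    by (auto simp: compactly_supported_def)
  with assms show ?thesis
    by (intro compactly_supportedI[where K = "K \<union> L"]) (auto simp: compactly_supported_def intro!: continuous_intros)
qed

lemma compactly_supported_scaleR: "compactly_supported f \<Longrightarrow> compactly_supported (\<lambda>x. c *\<^sub>R f x)"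
  by (auto simp: compactly_supported_def intro!: continuous_intros)

lemma compactly_supported_diff:
  assumes "compactly_supported f" "compactly_supported g"
  shows "compactly_supported (\<lambda>x. f x - g x)"
  using compactly_supported_add[OF assms(1) compactly_supported_scaleR[OF assms(2), of "-1"]] by simp

lemma compactly_supported_shift:
  assumes "compactly_supported f" shows "compactly_supported (\<lambda>x. f (x + h))"
proof -
  from assms obtain K where K: "compact K" "\<And>x. x \<notin> K \<Longrightarrow> f x = 0" and c: "continuous_on UNIV f"
    by (auto simp: compactly_supported_def)
  show ?thesis
  proof (rule compactly_supportedI)
    show "continuous_on UNIV (\<lambda>x. f (x + h))"
      by (rule continuous_on_compose2[OF c]) (auto intro!: continuous_intros)
    show "compact ((\<lambda>x. x - h) ` K)" using K(1) by (intro compact_continuous_image continuous_intros)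
    fix x assume "x \<notin> (\<lambda>x. x - h) ` K"
    then have "x + h \<notin> K" by (metis add_diff_cancel image_eqI)
    then show "f (x + h) = 0" by (rule K(2))
  qed
qed

lemma compactly_supported_mult_left:
  fixes f :: "'a::euclidean_space \<Rightarrow> real"
  assumes "compactly_supported f" "continuous_on UNIV g"
  shows "compactly_supported (\<lambda>x. f x * g x)"
  using assms by (auto simp: compactly_supported_def intro!: continuous_intros)

lemma compactly_supported_scaleR_left:
  fixes f :: "'a::euclidean_space \<Rightarrow> real"
  assumes "compactly_supported f" "continuous_on UNIV g"
  shows "compactly_supported (\<lambda>x. f x *\<^sub>R g x)"
  using assms by (auto simp: compactly_supported_def intro!: continuous_intros)

lemma compactly_supported_inner:
  assumes "compactly_supported f" "continuous_on UNIV g"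
  shows "compactly_supported (\<lambda>x. f x \<bullet> g x)"
  using assms by (auto simp: compactly_supported_def intro!: continuous_intros)

lemma compactly_supported_norm2:
  "compactly_supported f \<Longrightarrow> compactly_supported (\<lambda>x. (norm (f x))\<^sup>2)"
  by (auto simp: compactly_supported_def intro!: continuous_intros)

lemma compactly_supported_power2:
  fixes f :: "'a::euclidean_space \<Rightarrow> real"
  shows "compactly_supported f \<Longrightarrow> compactly_supported (\<lambda>x. (f x)\<^sup>2)"
  by (auto simp: compactly_supported_def intro!: continuous_intros)

lemma compactly_supported_square_integrable:
  "compactly_supported f \<Longrightarrow> square_integrable lborel f"
  using compactly_supported_measurable compactly_supported_integrable[OF compactly_supported_norm2]
  by (auto simp: square_integrable_def)

lemma compactly_supported_bounded:
  assumes "compactly_supported f"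
  obtains B where "B > 0" "\<And>x. norm (f x) \<le> B"
proof -
  from assms obtain K where K: "compact K" "\<And>x. x \<notin> K \<Longrightarrow> f x = 0" and c: "continuous_on UNIV f"
    by (auto simp: compactly_supported_def)
  have "bounded (f ` K)"
    using K(1) c by (intro compact_imp_bounded compact_continuous_image) (auto intro: continuous_on_subset)
  then obtain B where "B > 0" "\<And>x. x \<in> K \<Longrightarrow> norm (f x) \<le> B" by (auto simp: bounded_pos)
  then show ?thesis using K(2) by (intro that[of B]) (metis less_imp_le norm_zero)+
qed

lemma compactly_supported_uniformly_continuous:
  fixes f :: "'a::euclidean_space \<Rightarrow> 'b::euclidean_space"
  assumes "compactly_supported f" "e > 0"
  obtains d where "d > 0" "\<And>x y. dist x y < d \<Longrightarrow> dist (f x) (f y) < e"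
proof -
  from assms obtain K where K: "compact K" "\<And>x. x \<notin> K \<Longrightarrow> f x = 0" and c: "continuous_on UNIV f"
    by (auto simp: compactly_supported_def)
  define L where "L = {x + y | x y. x \<in> K \<and> y \<in> cball 0 1}"
  have L: "compact L" unfolding L_def by (rule compact_sums[OF K(1) compact_cball])
  have "uniformly_continuous_on L f"
    using L c by (intro compact_uniformly_continuous) (auto intro: continuous_on_subset)
  then obtain d where d: "d > 0" "\<And>x y. x \<in> L \<Longrightarrow> y \<in> L \<Longrightarrow> dist x y < d \<Longrightarrow> dist (f x) (f y) < e"
    using assms(2) unfolding uniformly_continuous_on_def by (metis dist_commute)
  have KL: "y \<in> L" if "x \<in> K" "dist x y \<le> 1" for x y :: 'a
  proof -
    have "x + (y - x) \<in> L" unfolding L_def using that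
      by (intro CollectI exI[of _ x] exI[of _ "y - x"]) (auto simp: dist_norm norm_minus_commute)
    then show ?thesis by simp
  qed
  show ?thesis
  proof (rule that[of "min d 1"])
    fix x y :: 'a assume "dist x y < min d 1"
    then show "dist (f x) (f y) < e"
      using d(2)[of x y] KL[of x y] KL[of y x] KL[of x x] KL[of y y] K(2)[of x] K(2)[of y] assms(2)
      by (cases "x \<in> K"; cases "y \<in> K") (auto simp: dist_commute)
  qed (use d in auto)
qed

lemma integral_lborel_shift:
  fixes f :: "'a::euclidean_space \<Rightarrow> 'b::{banach, second_countable_topology}"
  assumes "f \<in> borel_measurable borel"
  shows "(\<integral>x. f (x + h) \<partial>lborel) = (\<integral>x. f x \<partial>lborel)"
proof -
  have "(\<integral>x. f x \<partial>lborel) = (\<integral>x. f x \<partial>(distr lborel borel ((+) h)))" by (simp add: lborel_distr_plus)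
  also have "\<dots> = (\<integral>x. f (h + x) \<partial>lborel)" using assms by (intro integral_distr) auto
  finally show ?thesis by (simp add: add.commute)
qed

lemma nn_integral_lborel_shift:
  fixes f :: "'a::euclidean_space \<Rightarrow> ennreal"
  assumes "f \<in> borel_measurable borel"
  shows "(\<integral>\<^sup>+x. f (x + h) \<partial>lborel) = (\<integral>\<^sup>+x. f x \<partial>lborel)"
proof -
  have "(\<integral>\<^sup>+x. f x \<partial>lborel) = (\<integral>\<^sup>+x. f x \<partial>(distr lborel borel ((+) h)))" by (simp add: lborel_distr_plus)
  also have "\<dots> = (\<integral>\<^sup>+x. f (h + x) \<partial>lborel)" using assms by (intro nn_integral_distr) auto
  finally show ?thesis by (simp add: add.commute)
qed


lemma C1_compactI:
  assumes "\<And>p. GDERIV \<phi> p :> G p" "continuous_on UNIV G" "compact K" "K \<subseteq> U" "\<And>p. p \<notin> K \<Longrightarrow> \<phi> p = 0"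
  shows "C1_compact U \<phi> G"
proof -
  have "closure {p. \<phi> p \<noteq> 0} \<subseteq> K"
    using assms(3,5) by (intro closure_minimal) (auto simp: compact_imp_closed)
  then show ?thesis
    using assms closed_subset compact_Int_closed[OF assms(3) closed_closure, of "{p. \<phi> p \<noteq> 0}"]
    by (auto simp: C1_compact_def Int_absorb1)
qed

text \<open>
  A gradient vanishes where the function vanishes in a neighbourhood, so \<open>\<phi>\<close> and its gradient have a
  common compact support.
\<close>

lemma GDERIV_zero_outside:
  assumes "GDERIV \<phi> p :> D" "open S" "p \<in> S" "\<And>q. q \<in> S \<Longrightarrow> \<phi> q = 0"
  shows "D = 0"
proof -
  have "((\<lambda>_. 0::real) has_derivative (\<lambda>h. 0)) (at p)" by (rule has_derivative_const)
  then have "(\<phi> has_derivative (\<lambda>h. 0)) (at p)"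
    by (rule has_derivative_transform_within_open[OF _ assms(2,3)]) (simp add: assms(4))
  moreover have "(\<phi> has_derivative (\<lambda>h. h \<bullet> D)) (at p)" using assms(1) by (simp add: gderiv_def)
  ultimately have "(\<lambda>h. h \<bullet> D) = (\<lambda>h. 0)" using has_derivative_unique by blast
  then have "D \<bullet> D = 0" by meson
  then show ?thesis by simp
qed

lemma C1_compactD:
  assumes "C1_compact U \<phi> G"
  obtains K where "compact K" "K \<subseteq> U" "\<And>p. p \<notin> K \<Longrightarrow> \<phi> p = 0" "\<And>p. p \<notin> K \<Longrightarrow> G p = 0"
proof -
  define K where "K = closure {p. \<phi> p \<noteq> 0}"
  have z: "\<phi> p = 0" if "p \<notin> K" for p
    using that closure_subset[of "{p. \<phi> p \<noteq> 0}"] unfolding K_def by auto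
  have K: "compact K" "K \<subseteq> U" using assms unfolding C1_compact_def K_def by blast+
  have "G p = 0" if "p \<notin> K" for p
  proof (rule GDERIV_zero_outside)
    show "GDERIV \<phi> p :> G p" using assms by (simp add: C1_compact_def)
    show "open (- K)" using K(1) by (simp add: open_Compl compact_imp_closed)
    show "p \<in> - K" using that by simp
    show "\<phi> q = 0" if "q \<in> - K" for q using that by (intro z) simp
  qed
  with K z show ?thesis using that by blast
qed

lemma C1_compact_continuous:
  assumes "C1_compact U \<phi> G" shows "continuous_on UNIV \<phi>" "continuous_on UNIV G"
proof -
  have "isCont \<phi> p" for p
    using assms has_derivative_continuous unfolding C1_compact_def gderiv_def by blast
  then show "continuous_on UNIV \<phi>" by (simp add: continuous_at_imp_continuous_on)
qed (use assms in \<open>auto simp: C1_compact_def\<close>)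

lemma C1_compact_compactly_supported:
  assumes "C1_compact U \<phi> G" shows "compactly_supported \<phi>" "compactly_supported G"
proof -
  obtain K where "compact K" "K \<subseteq> U" "\<And>p. p \<notin> K \<Longrightarrow> \<phi> p = 0" "\<And>p. p \<notin> K \<Longrightarrow> G p = 0"
    by (rule C1_compactD[OF assms]) (rule that)
  then show "compactly_supported \<phi>" "compactly_supported G"
    using C1_compact_continuous[OF assms] by (auto intro: compactly_supportedI)
qed

lemma C1_compact_lincomb:
  assumes "C1_compact U \<phi> G" "C1_compact U \<psi> H"
  shows "C1_compact U (\<lambda>p. a * \<phi> p + b * \<psi> p) (\<lambda>p. a *\<^sub>R G p + b *\<^sub>R H p)"
proof -
  obtain K where K: "compact K" "K \<subseteq> U" "\<And>p. p \<notin> K \<Longrightarrow> \<phi> p = 0" "\<And>p. p \<notin> K \<Longrightarrow> G p = 0"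
    by (rule C1_compactD[OF assms(1)]) (rule that)
  obtain L where L: "compact L" "L \<subseteq> U" "\<And>p. p \<notin> L \<Longrightarrow> \<psi> p = 0" "\<And>p. p \<notin> L \<Longrightarrow> H p = 0"
    by (rule C1_compactD[OF assms(2)]) (rule that)
  show ?thesis
  proof (rule C1_compactI[where K = "K \<union> L"])
    fix p
    have "GDERIV \<phi> p :> G p" "GDERIV \<psi> p :> H p" using assms by (auto simp: C1_compact_def)
    then have "GDERIV (\<lambda>p. a *\<^sub>R \<phi> p + b *\<^sub>R \<psi> p) p :> (a *\<^sub>R G p + \<phi> p *\<^sub>R 0) + (b *\<^sub>R H p + \<psi> p *\<^sub>R 0)"
      unfolding gderiv_def by (auto intro!: derivative_eq_intros simp: inner_add_right)
    then show "GDERIV (\<lambda>p. a * \<phi> p + b * \<psi> p) p :> a *\<^sub>R G p + b *\<^sub>R H p" by simp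
  qed (use K L C1_compact_continuous[OF assms(1)] C1_compact_continuous[OF assms(2)] in \<open>auto intro!: continuous_intros\<close>)
qed

text \<open>
  The difference is the integral of the directional derivative along the segment; Jensen's inequality on
  the segment and translation invariance of Lebesgue measure give the bound.
\<close>

lemma integral_power2_shift_le:
  fixes \<phi> :: "'a::euclidean_space \<Rightarrow> real"
  assumes C: "C1_compact U \<phi> G"
  shows "(\<integral>p. (\<phi> (p + h) - \<phi> p)\<^sup>2 \<partial>lborel) \<le> (\<integral>p. (G p \<bullet> h)\<^sup>2 \<partial>lborel)"
proof -
  note cs = C1_compact_compactly_supported[OF C] and cont = C1_compact_continuous[OF C]
  define M where "M = restrict_space lborel {0..1::real}"
  have meas[measurable]: "G \<in> borel_measurable borel" "\<phi> \<in> borel_measurable borel"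
    using cs by (auto intro: compactly_supported_measurable)
  have contF: "continuous_on S (\<lambda>t. G (p + t *\<^sub>R h) \<bullet> h)" for p S
    by (intro continuous_intros continuous_on_compose2[OF cont(2)]) auto
  have pw: "ennreal ((\<phi> (p + h) - \<phi> p)\<^sup>2) \<le> (\<integral>\<^sup>+t. ennreal ((G (p + t *\<^sub>R h) \<bullet> h)\<^sup>2) \<partial>M)" for p
  proof -
    let ?F = "\<lambda>t. G (p + t *\<^sub>R h) \<bullet> h"
    have d: "((\<lambda>t. \<phi> (p + t *\<^sub>R h)) has_vector_derivative ?F t) (at t within {0..1})" for t
    proof -
      have "(\<phi> has_derivative (\<lambda>k. k \<bullet> G (p + t *\<^sub>R h))) (at (p + t *\<^sub>R h))"
        using C by (auto simp: C1_compact_def gderiv_def)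
      moreover have "((\<lambda>t. p + t *\<^sub>R h) has_derivative (\<lambda>s. s *\<^sub>R h)) (at t within {0..1})"
        by (auto intro!: derivative_eq_intros)
      ultimately have "((\<lambda>t. \<phi> (p + t *\<^sub>R h)) has_derivative (\<lambda>s. (s *\<^sub>R h) \<bullet> G (p + t *\<^sub>R h))) (at t within {0..1})"
        using has_derivative_compose[where g = \<phi> and f = "\<lambda>t. p + t *\<^sub>R h"] by blast
      then show ?thesis by (simp add: has_vector_derivative_def inner_commute)
    qed
    have "(\<integral>t. indicator {0..1} t *\<^sub>R ?F t \<partial>lborel) = \<phi> (p + 1 *\<^sub>R h) - \<phi> (p + 0 *\<^sub>R h)"
      by (rule integral_FTC_atLeastAtMost) (use d contF in auto)
    then have eq: "\<phi> (p + h) - \<phi> p = (\<integral>t. ?F t \<partial>M)"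
      unfolding M_def by (simp add: integral_restrict_space)
    have si: "square_integrable M ?F"
    proof -
      have "integrable lborel (\<lambda>t. indicator {0..1} t *\<^sub>R (norm (?F t))\<^sup>2)"
        by (rule borel_integrable_compact) (auto intro!: continuous_intros continuous_on_compose2[OF cont(2)])
      then have "integrable M (\<lambda>t. (norm (?F t))\<^sup>2)"
        unfolding M_def by (subst integrable_restrict_space) auto
      moreover have "?F \<in> borel_measurable M" unfolding M_def by (rule measurable_restrict_space1) measurable
      ultimately show ?thesis by (simp add: square_integrable_def)
    qed
    have one: "square_integrable M (\<lambda>t. 1::real)"
    proof -
      have "integrable lborel (\<lambda>t::real. indicator {0..1::real} t *\<^sub>R (norm (1::real))\<^sup>2)"
        by (rule borel_integrable_compact) (auto intro!: continuous_intros)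
      then have "integrable M (\<lambda>t. (norm (1::real))\<^sup>2)"
        unfolding M_def by (subst integrable_restrict_space) auto
      then show ?thesis by (simp add: square_integrable_def)
    qed
    have i1: "(\<integral>t. (norm (1::real))\<^sup>2 \<partial>M) = 1"
      unfolding M_def by (subst integral_restrict_space) auto
    have "(\<phi> (p + h) - \<phi> p)\<^sup>2 \<le> (\<integral>t. (norm (?F t))\<^sup>2 \<partial>M)"
      unfolding eq using integral_inner_Cauchy_Schwarz[OF si one] unfolding i1 by simp
    also have "ennreal \<dots> = (\<integral>\<^sup>+t. ennreal ((norm (?F t))\<^sup>2) \<partial>M)"
      using si by (intro nn_integral_eq_integral[symmetric]) (auto simp: square_integrable_def)
    finally show ?thesis by (simp add: ennreal_leI)
  qed
  have "(\<integral>\<^sup>+p. ennreal ((\<phi> (p + h) - \<phi> p)\<^sup>2) \<partial>lborel) \<le> (\<integral>\<^sup>+p. (\<integral>\<^sup>+t. ennreal ((G (p + t *\<^sub>R h) \<bullet> h)\<^sup>2) \<partial>M) \<partial>lborel)"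
    by (rule nn_integral_mono) (rule pw)
  also have "\<dots> = (\<integral>\<^sup>+p. (\<integral>\<^sup>+t. ennreal ((G (p + t *\<^sub>R h) \<bullet> h)\<^sup>2) * indicator {0..1} t \<partial>lborel) \<partial>lborel)"
    unfolding M_def by (subst nn_integral_restrict_space) (auto simp: mult.commute)
  also have "\<dots> = (\<integral>\<^sup>+t. (\<integral>\<^sup>+p. ennreal ((G (p + t *\<^sub>R h) \<bullet> h)\<^sup>2) * indicator {0..1} t \<partial>lborel) \<partial>lborel)"
    by (rule lborel_pair.Fubini'[symmetric]) measurable
  also have "\<dots> = (\<integral>\<^sup>+t. (\<integral>\<^sup>+p. ennreal ((G (p + t *\<^sub>R h) \<bullet> h)\<^sup>2) \<partial>lborel) * indicator {0..1} t \<partial>lborel)"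
    by (subst nn_integral_multc) auto
  also have "\<dots> = (\<integral>\<^sup>+t. (\<integral>\<^sup>+p. ennreal ((G p \<bullet> h)\<^sup>2) \<partial>lborel) * indicator {0..1::real} t \<partial>lborel)"
    by (subst nn_integral_lborel_shift[where f = "\<lambda>p. ennreal ((G p \<bullet> h)\<^sup>2)"]) auto
  also have "\<dots> = (\<integral>\<^sup>+p. ennreal ((G p \<bullet> h)\<^sup>2) \<partial>lborel)"
    by (subst nn_integral_cmult) auto
  finally have le: "(\<integral>\<^sup>+p. ennreal ((\<phi> (p + h) - \<phi> p)\<^sup>2) \<partial>lborel) \<le> (\<integral>\<^sup>+p. ennreal ((G p \<bullet> h)\<^sup>2) \<partial>lborel)" .
  have i1: "integrable lborel (\<lambda>p. (\<phi> (p + h) - \<phi> p)\<^sup>2)"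
    by (intro compactly_supported_integrable compactly_supported_power2 compactly_supported_diff compactly_supported_shift cs)
  have i2: "integrable lborel (\<lambda>p. (G p \<bullet> h)\<^sup>2)"
    by (intro compactly_supported_integrable compactly_supported_power2 compactly_supported_inner cs continuous_intros)
  show ?thesis
    using le unfolding nn_integral_eq_integral[OF i1 AE_I2[OF zero_le_power2]] nn_integral_eq_integral[OF i2 AE_I2[OF zero_le_power2]]
    by (subst (asm) ennreal_le_iff) (auto intro!: integral_nonneg_AE)
qed

section \<open>Mollification\<close>

text \<open>
  The square makes the truncated paraboloid \<open>C\<^sup>1\<close>.
\<close>

definition bump :: "real \<Rightarrow> 'a::euclidean_space \<Rightarrow> real" where
  "bump e q = (max 0 (e\<^sup>2 - q \<bullet> q))\<^sup>2"

definition bump_gradient :: "real \<Rightarrow> 'a::euclidean_space \<Rightarrow> 'a" where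
  "bump_gradient e q = (- 4 * max 0 (e\<^sup>2 - q \<bullet> q)) *\<^sub>R q"

lemma norm_le_of_inner_less:
  assumes "0 < e" "q \<bullet> q < e\<^sup>2" shows "norm q < e"
  using assms by (metis power2_norm_eq_inner power_less_imp_less_base less_imp_le)

lemma bump_zero: "0 < e \<Longrightarrow> q \<notin> cball 0 e \<Longrightarrow> bump e q = 0 \<and> bump_gradient e q = 0"
proof -
  assume "0 < e" "q \<notin> cball 0 e"
  then have "\<not> q \<bullet> q < e\<^sup>2" using norm_le_of_inner_less[of e q] by auto
  then have "max 0 (e\<^sup>2 - q \<bullet> q) = 0" by simp
  then show "bump e q = 0 \<and> bump_gradient e q = 0" by (simp add: bump_def bump_gradient_def)
qed

lemma continuous_bump: "continuous_on UNIV (bump e)" "continuous_on UNIV (bump_gradient e)"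
  unfolding bump_def[abs_def] bump_gradient_def[abs_def] by (auto intro!: continuous_intros)

lemma compactly_supported_bump:
  "0 < e \<Longrightarrow> compactly_supported (bump e)" "0 < e \<Longrightarrow> compactly_supported (bump_gradient e)"
  by (auto simp: bump_zero intro!: compactly_supportedI[where K="cball 0 e"] continuous_bump)

lemma bump_nonneg: "0 \<le> bump e q" by (simp add: bump_def)

text \<open>
  A first-order Taylor bound with quadratic remainder, uniform in the base point.  It gives the derivative
  of the bump and, after integration, that of every mollification.
\<close>

lemma bump_Taylor:
  fixes q v :: "'a::euclidean_space"
  assumes "0 < e" "norm v \<le> 1"
  shows "\<bar>bump e (q - v) - bump e q + bump_gradient e q \<bullet> v\<bar> \<le> ((2 * e + 3)\<^sup>2 + 2 * e\<^sup>2) * (norm v)\<^sup>2"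
proof (cases "norm q \<le> e + 1")
  case False
  have "norm (q - v) > e" using False assms norm_triangle_ineq2[of q v] by linarith
  then have "bump e (q - v) = 0" "bump e q = 0" "bump_gradient e q = 0"
    using bump_zero[OF assms(1), of q] bump_zero[OF assms(1), of "q - v"] False assms by auto
  then show ?thesis by (simp add: add_nonneg_nonneg)
next
  case True
  define s t where "s = e\<^sup>2 - q \<bullet> q" and "t = e\<^sup>2 - (q - v) \<bullet> (q - v)"
  define S T where "S = max 0 s" and "T = max 0 t"
  have ts: "t - s = 2 * (q \<bullet> v) - v \<bullet> v"
    by (simp add: s_def t_def inner_diff_left inner_diff_right inner_commute)
  have "\<bar>t - s\<bar> \<le> 2 * (norm q * norm v) + norm v * norm v"
    unfolding ts using Cauchy_Schwarz_ineq2[of q v] mult_nonneg_nonneg[of "norm v" "norm v", OF norm_ge_zero norm_ge_zero]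
    unfolding dot_square_norm power2_eq_square by linarith
  also have "\<dots> = (2 * norm q + norm v) * norm v" by (simp add: algebra_simps)
  also have "\<dots> \<le> (2 * e + 3) * norm v"
    using True assms by (intro mult_right_mono) auto
  finally have "\<bar>t - s\<bar>\<^sup>2 \<le> ((2 * e + 3) * norm v)\<^sup>2" by (intro power_mono) auto
  then have 1: "(t - s)\<^sup>2 \<le> (2 * e + 3)\<^sup>2 * (norm v)\<^sup>2" by (simp add: power_mult_distrib)
  have 2: "\<bar>T\<^sup>2 - S\<^sup>2 - 2 * S * (t - s)\<bar> \<le> (t - s)\<^sup>2"
  proof -
    have cases: "\<bar>T\<^sup>2 - S\<^sup>2 - 2 * S * (t - s)\<bar> \<le> (t - s)\<^sup>2"
      if "S = s" "T = t"
    proof -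
      have "t\<^sup>2 - s\<^sup>2 - 2 * s * (t - s) = (t - s)\<^sup>2" by (simp add: power2_eq_square algebra_simps)
      then show ?thesis using that by simp
    qed
    consider "s \<ge> 0" "t \<ge> 0" | "s \<ge> 0" "t < 0" | "s < 0" "t \<ge> 0" | "s < 0" "t < 0" by linarith
    then show ?thesis
    proof cases
      case 1
      then have "S = s" "T = t" by (auto simp: S_def T_def)
      then show ?thesis by (rule cases)
    next
      case 2
      have "- s\<^sup>2 - 2 * s * (t - s) = s * (s - 2 * t)" by (simp add: power2_eq_square algebra_simps)
      moreover have "0 \<le> s * (s - 2 * t)" using 2 by simp
      moreover have "s * (s - 2 * t) \<le> (t - s)\<^sup>2" by (simp add: power2_eq_square algebra_simps)
      ultimately show ?thesis using 2 by (simp add: S_def T_def)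
    next
      case 3
      have "t\<^sup>2 \<le> (t - s)\<^sup>2" using 3 by (intro power_mono) auto
      then show ?thesis using 3 by (simp add: S_def T_def)
    qed (simp add: S_def T_def)
  qed
  have "bump e (q - v) - bump e q + bump_gradient e q \<bullet> v = (T\<^sup>2 - S\<^sup>2 - 2 * S * (t - s)) - 2 * S * (v \<bullet> v)"
    unfolding ts by (simp add: bump_def bump_gradient_def S_def T_def s_def t_def algebra_simps)
  also have "\<bar>\<dots>\<bar> \<le> (t - s)\<^sup>2 + 2 * S * (norm v)\<^sup>2"
  proof -
    have "0 \<le> 2 * S * (v \<bullet> v)" by (simp add: S_def)
    then show ?thesis using 2 unfolding power2_norm_eq_inner by linarith
  qed
  also have "S \<le> e\<^sup>2" unfolding S_def s_def by simp
  then have "(t - s)\<^sup>2 + 2 * S * (norm v)\<^sup>2 \<le> (2 * e + 3)\<^sup>2 * (norm v)\<^sup>2 + 2 * e\<^sup>2 * (norm v)\<^sup>2"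
    using 1 by (intro add_mono mult_right_mono) auto
  finally show ?thesis by (simp add: algebra_simps)
qed

lemma GDERIV_I_quadratic:
  fixes f :: "'a::euclidean_space \<Rightarrow> real"
  assumes "\<And>v. norm v \<le> 1 \<Longrightarrow> \<bar>f (p + v) - f p - D \<bullet> v\<bar> \<le> C * (norm v)\<^sup>2"
  shows "GDERIV f p :> D"
  unfolding gderiv_def
proof (rule has_derivativeI_sandwich[where e = 1 and H = "\<lambda>y. C * norm (y - p)"])
  show "bounded_linear (\<lambda>h. h \<bullet> D)" by (rule bounded_linear_inner_left)
  fix y assume y: "y \<noteq> p" "dist y p < 1"
  have "\<bar>f (p + (y - p)) - f p - D \<bullet> (y - p)\<bar> \<le> C * (norm (y - p))\<^sup>2"
    using y by (intro assms) (auto simp: dist_norm)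
  then have "\<bar>f y - f p - (y - p) \<bullet> D\<bar> \<le> C * norm (y - p) * norm (y - p)"
    by (simp add: power2_eq_square inner_commute mult.assoc)
  then show "norm (f y - f p - (y - p) \<bullet> D) / norm (y - p) \<le> C * norm (y - p)"
    using y by (simp add: divide_le_eq)
next
  have "((\<lambda>y. C * norm (y - p)) \<longlongrightarrow> C * norm (p - p)) (at p)" by (intro tendsto_intros)
  then show "((\<lambda>y. C * norm (y - p)) \<longlongrightarrow> 0) (at p)" by simp
qed simp

lemma GDERIV_bump:
  fixes q :: "'a::euclidean_space"
  assumes "0 < e" shows "GDERIV (bump e) q :> bump_gradient e q"
proof (rule GDERIV_I_quadratic)
  fix v :: 'a assume "norm v \<le> 1"
  then show "\<bar>bump e (q + v) - bump e q - bump_gradient e q \<bullet> v\<bar> \<le> ((2 * e + 3)\<^sup>2 + 2 * e\<^sup>2) * (norm v)\<^sup>2"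
    using bump_Taylor[OF assms, of "-v" q] by simp
qed

lemma C1_compact_bump:
  fixes c :: "'a::euclidean_space"
  assumes r: "0 < r" and U: "cball c r \<subseteq> U"
  shows "C1_compact U (\<lambda>p. bump r (p - c)) (\<lambda>p. bump_gradient r (p - c))"
proof (rule C1_compactI[where K = "cball c r"])
  fix p
  have "(bump r has_derivative (\<lambda>h. h \<bullet> bump_gradient r (p - c))) (at (p - c))"
    using GDERIV_bump[OF r, of "p - c"] by (simp add: gderiv_def)
  moreover have "((\<lambda>p. p - c) has_derivative (\<lambda>h. h)) (at p)" by (auto intro!: derivative_eq_intros)
  ultimately show "GDERIV (\<lambda>p. bump r (p - c)) p :> bump_gradient r (p - c)"
    unfolding gderiv_def by (rule has_derivative_compose[rotated])
  show "bump r (p - c) = 0" if "p \<notin> cball c r"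
    using bump_zero[OF r, of "p - c"] that by (auto simp: dist_norm norm_minus_commute)
qed (use r U in \<open>auto intro!: continuous_on_compose2[OF continuous_bump(2)] continuous_intros\<close>)

lemma integral_bump_pos:
  assumes "0 < e" shows "0 < (\<integral>q. bump e (q::'a::euclidean_space) \<partial>lborel)"
proof -
  have int: "integrable lborel (bump e :: 'a \<Rightarrow> real)"
    by (rule compactly_supported_integrable[OF compactly_supported_bump(1)[OF assms]])
  have "\<not> (AE q in lborel. bump e (q::'a) = 0)"
  proof
    assume "AE q in lborel. bump e (q::'a) = 0"
    moreover have "bump e q \<noteq> 0" if "q \<in> ball 0 e" for q :: 'a
    proof -
      have "q \<bullet> q < e\<^sup>2" using that assms by (simp add: dot_square_norm power_strict_mono)
      then show ?thesis by (simp add: bump_def max_def)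
    qed
    ultimately have "AE q in lborel. (q::'a) \<notin> ball 0 e" by (auto elim: eventually_mono)
    then have "emeasure lborel (ball (0::'a) e) = 0"
      by (subst (asm) AE_iff_measurable[OF _ refl]) (auto simp: ball_def)
    moreover have "measure lborel (ball (0::'a) e) > 0"
      using content_ball_pos[OF assms, of "0::'a"] by simp
    ultimately show False by (simp add: measure_def)
  qed
  then have "(\<integral>q. bump e (q::'a) \<partial>lborel) \<noteq> 0"
    using integral_nonneg_eq_0_iff_AE[OF int] by (auto simp: bump_nonneg)
  moreover have "0 \<le> (\<integral>q. bump e (q::'a) \<partial>lborel)" by (simp add: bump_nonneg)
  ultimately show ?thesis by linarith
qed

definition mollifier :: "real \<Rightarrow> 'a::euclidean_space \<Rightarrow> real" where
  "mollifier e q = bump e q / (\<integral>r. bump e (r::'a) \<partial>lborel)"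

text \<open>
  The sign convention \<open>p + q\<close> is harmless because the kernel is even.
\<close>

definition mollify :: "real \<Rightarrow> ('a::euclidean_space \<Rightarrow> real) \<Rightarrow> 'a \<Rightarrow> real" where
  "mollify e f p = (\<integral>q. mollifier e q * f (p + q) \<partial>lborel)"

definition mollify_gradient :: "real \<Rightarrow> ('a::euclidean_space \<Rightarrow> real) \<Rightarrow> 'a \<Rightarrow> 'a" where
  "mollify_gradient e f p = (\<integral>q. f (p + q) *\<^sub>R ((- 1 / (\<integral>r. bump e (r::'a) \<partial>lborel)) *\<^sub>R bump_gradient e q) \<partial>lborel)"

lemma compactly_supported_mollifier:
  "0 < e \<Longrightarrow> compactly_supported (mollifier e :: 'a::euclidean_space \<Rightarrow> real)"
proof -
  assume "0 < e"
  then have "compactly_supported (\<lambda>q::'a. (1 / (\<integral>r. bump e (r::'a) \<partial>lborel)) *\<^sub>R bump e q)"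
    by (intro compactly_supported_scaleR compactly_supported_bump)
  then show "compactly_supported (mollifier e :: 'a \<Rightarrow> real)" by (simp add: mollifier_def[abs_def])
qed

lemma mollifier_nonneg: "0 < e \<Longrightarrow> 0 \<le> mollifier e q"
  using integral_bump_pos by (simp add: mollifier_def bump_nonneg less_imp_le)

lemma mollifier_zero: "0 < e \<Longrightarrow> q \<notin> cball 0 e \<Longrightarrow> mollifier e q = 0"
  using bump_zero[of e q] by (simp add: mollifier_def)

lemma integral_mollifier: "0 < e \<Longrightarrow> (\<integral>q. mollifier e (q::'a::euclidean_space) \<partial>lborel) = 1"
  unfolding mollifier_def using integral_bump_pos[of e, where 'a='a] by simp

lemma mollifier_Jensen:
  fixes g :: "'a::euclidean_space \<Rightarrow> real"
  assumes "0 < e" and g: "continuous_on UNIV g"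
  shows "(\<integral>q. mollifier e q * g q \<partial>lborel)\<^sup>2 \<le> (\<integral>q. mollifier e q * (g q)\<^sup>2 \<partial>lborel)"
proof -
  note k = compactly_supported_mollifier[OF assms(1), where 'a='a]
  define m where "m = (\<integral>q. mollifier e q * g q \<partial>lborel)"
  have i: "integrable lborel (\<lambda>q::'a. mollifier e q)" "integrable lborel (\<lambda>q. mollifier e q * g q)"
    "integrable lborel (\<lambda>q. mollifier e q * (g q)\<^sup>2)"
    using k g by (auto intro!: compactly_supported_integrable compactly_supported_mult_left continuous_intros)
  have "0 \<le> (\<integral>q. mollifier e q * (g q - m)\<^sup>2 \<partial>lborel)"
    using mollifier_nonneg[OF assms(1), where 'a='a] by (intro integral_nonneg_AE) auto
  also have "(\<lambda>q. mollifier e q * (g q - m)\<^sup>2) = (\<lambda>q. mollifier e q * (g q)\<^sup>2 - (2 * m) * (mollifier e q * g q) + m\<^sup>2 * mollifier e q)"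
    by (auto simp: power2_eq_square algebra_simps)
  also have "(\<integral>q. mollifier e q * (g q)\<^sup>2 - (2 * m) * (mollifier e q * g q) + m\<^sup>2 * mollifier e q \<partial>lborel)
     = (\<integral>q. mollifier e q * (g q)\<^sup>2 \<partial>lborel) - 2 * m * m + m\<^sup>2"
    using i integral_mollifier[OF assms(1), where 'a='a] by (simp add: m_def)
  finally show ?thesis by (simp add: m_def power2_eq_square)
qed

text \<open>
  An average has no larger \<open>L\<^sup>2\<close> norm than its worst member (Minkowski's inequality in the form of Jensen and
  Tonelli).  Applied to translates it bounds mollifications and their distance to the original function.
\<close>

lemma mollifier_average_L2:
  fixes h :: "'a::euclidean_space \<Rightarrow> 'a \<Rightarrow> real"
  assumes e: "0 < e" and h: "continuous_on UNIV (\<lambda>(p, q). h p q)"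
    and B: "\<And>q. norm q \<le> e \<Longrightarrow> (\<integral>\<^sup>+p. ennreal ((h p q)\<^sup>2) \<partial>lborel) \<le> B"
  shows "(\<integral>\<^sup>+p. ennreal ((\<integral>q. mollifier e q * h p q \<partial>lborel)\<^sup>2) \<partial>lborel) \<le> B"
proof -
  note k = compactly_supported_mollifier[OF e, where 'a='a]
  have hm[measurable]: "(\<lambda>(p, q). h p q) \<in> borel_measurable (borel \<Otimes>\<^sub>M borel)"
    using borel_measurable_continuous_onI[OF h] by (simp add: borel_prod)
  have km[measurable]: "mollifier e \<in> borel_measurable (borel :: 'a measure)"
    using compactly_supported_measurable[OF k] .
  have hp: "continuous_on UNIV (h p)" for p
  proof -
    have "continuous_on UNIV (\<lambda>q. (p, q))" by (rule continuous_on_Pair[OF continuous_on_const continuous_on_id])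
    from continuous_on_compose2[OF h this] show ?thesis by simp
  qed
  have "(\<integral>\<^sup>+p. ennreal ((\<integral>q. mollifier e q * h p q \<partial>lborel)\<^sup>2) \<partial>lborel) \<le> (\<integral>\<^sup>+p. (\<integral>\<^sup>+q. ennreal (mollifier e q * (h p q)\<^sup>2) \<partial>lborel) \<partial>lborel)"
  proof (rule nn_integral_mono)
    fix p
    have "integrable lborel (\<lambda>q. mollifier e q * (h p q)\<^sup>2)"
      using hp by (auto intro!: compactly_supported_integrable compactly_supported_mult_left k continuous_intros)
    then have "(\<integral>\<^sup>+q. ennreal (mollifier e q * (h p q)\<^sup>2) \<partial>lborel) = ennreal (\<integral>q. mollifier e q * (h p q)\<^sup>2 \<partial>lborel)"
      using mollifier_nonneg[OF e, where 'a='a] by (intro nn_integral_eq_integral) auto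
    then show "ennreal ((\<integral>q. mollifier e q * h p q \<partial>lborel)\<^sup>2) \<le> (\<integral>\<^sup>+q. ennreal (mollifier e q * (h p q)\<^sup>2) \<partial>lborel)"
      using mollifier_Jensen[OF e hp] by (simp add: ennreal_leI)
  qed
  also have "\<dots> = (\<integral>\<^sup>+q. (\<integral>\<^sup>+p. ennreal (mollifier e q * (h p q)\<^sup>2) \<partial>lborel) \<partial>lborel)"
    by (rule lborel_pair.Fubini'[symmetric]) measurable
  also have "\<dots> \<le> (\<integral>\<^sup>+q. ennreal (mollifier e q) * B \<partial>(lborel::'a measure))"
  proof (rule nn_integral_mono)
    fix q :: 'a
    have "(\<lambda>p. h p q) \<in> borel_measurable borel"
    proof -
      have "continuous_on UNIV (\<lambda>p. (p, q))" by (rule continuous_on_Pair[OF continuous_on_id continuous_on_const])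
      from continuous_on_compose2[OF h this] show ?thesis by (intro borel_measurable_continuous_onI) simp
    qed
    then have "(\<integral>\<^sup>+p. ennreal (mollifier e q * (h p q)\<^sup>2) \<partial>lborel) = ennreal (mollifier e q) * (\<integral>\<^sup>+p. ennreal ((h p q)\<^sup>2) \<partial>lborel)"
      by (subst nn_integral_cmult[symmetric]) (auto simp: ennreal_mult mollifier_nonneg[OF e, where 'a='a])
    then show "(\<integral>\<^sup>+p. ennreal (mollifier e q * (h p q)\<^sup>2) \<partial>lborel) \<le> ennreal (mollifier e q) * B"
      using B[of q] mollifier_zero[OF e, of q] by (cases "norm q \<le> e") (auto intro: mult_left_mono)
  qed
  also have "\<dots> = (\<integral>\<^sup>+q. ennreal (mollifier e (q::'a)) \<partial>lborel) * B"
    by (rule nn_integral_multc) auto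
  also have "(\<integral>\<^sup>+q. ennreal (mollifier e (q::'a)) \<partial>lborel) = ennreal (\<integral>q. mollifier e (q::'a) \<partial>lborel)"
    by (rule nn_integral_eq_integral[OF compactly_supported_integrable[OF k]]) (simp add: mollifier_nonneg[OF e, where 'a='a])
  finally show ?thesis using integral_mollifier[OF e, where 'a='a] by simp
qed

context
  fixes f :: "'a::euclidean_space \<Rightarrow> real" and e :: real
  assumes f: "compactly_supported f" and e: "0 < e"
begin

lemma mollify_zero:
  assumes "\<And>x. x \<notin> K \<Longrightarrow> f x = 0" "p \<notin> {x + y | x y. x \<in> K \<and> y \<in> cball 0 e}"
  shows "mollify e f p = 0"
proof -
  have "mollifier e q * f (p + q) = 0" for q
  proof (cases "q \<in> cball 0 e")
    case True
    have "p + q \<notin> K"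
    proof
      assume "p + q \<in> K"
      then have "p = (p + q) + (- q) \<and> p + q \<in> K \<and> - q \<in> cball 0 e" using True by simp
      with assms(2) show False by blast
    qed
    then show ?thesis using assms(1) by simp
  qed (simp add: mollifier_zero[OF e])
  then have "mollify e f p = (\<integral>q. 0 \<partial>(lborel :: 'a measure))" unfolding mollify_def by (intro Bochner_Integration.integral_cong) auto
  then show ?thesis by simp
qed

text \<open>
  The variable of integration is shifted so that the derivative falls on the kernel, where the uniform
  Taylor bound applies.
\<close>

lemma GDERIV_mollify: "GDERIV (mollify e f) p :> mollify_gradient e f p"
proof -
  define c where "c = (\<integral>r. bump e (r::'a) \<partial>lborel)"
  have c: "0 < c" using integral_bump_pos[OF e, where 'a='a] by (simp add: c_def)
  have fm: "f \<in> borel_measurable borel" using f by (rule compactly_supported_measurable)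
  have km: "mollifier e \<in> borel_measurable (borel :: 'a measure)"
    using compactly_supported_measurable[OF compactly_supported_mollifier[OF e]] .
  have bg: "bump_gradient e \<in> borel_measurable (borel :: 'a measure)"
    using compactly_supported_measurable[OF compactly_supported_bump(2)[OF e]] .
  have shift: "mollify e f p = (\<integral>q. mollifier e (q - p) * f q \<partial>lborel)" for p
    unfolding mollify_def
    using integral_lborel_shift[of "\<lambda>q. mollifier e (q - p) * f q" p] fm measurable_compose[OF _ km, of "\<lambda>q. q - p" borel]
    by (simp add: add.commute)
  have shiftg: "mollify_gradient e f p = (\<integral>q. f q *\<^sub>R ((- 1 / c) *\<^sub>R bump_gradient e (q - p)) \<partial>lborel)" for p
    unfolding mollify_gradient_def c_def[symmetric]
    using integral_lborel_shift[of "\<lambda>q. f q *\<^sub>R ((- 1 / c) *\<^sub>R bump_gradient e (q - p))" p] fm measurable_compose[OF _ bg, of "\<lambda>q. q - p" borel]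
    by (simp add: add.commute)
  define C where "C = ((2 * e + 3)\<^sup>2 + 2 * e\<^sup>2) / c"
  show ?thesis
  proof (rule GDERIV_I_quadratic)
    fix v :: 'a assume v: "norm v \<le> 1"
    have ck: "continuous_on UNIV (\<lambda>q. mollifier e (q - r))" for r :: 'a
      by (rule continuous_on_compose2[OF compactly_supported_continuous[OF compactly_supported_mollifier[OF e]]]) (auto intro!: continuous_intros)
    have cg: "continuous_on UNIV (\<lambda>q. bump_gradient e (q - r))" for r :: 'a
      by (rule continuous_on_compose2[OF continuous_bump(2)]) (auto intro!: continuous_intros)
    have i: "integrable lborel (\<lambda>q. mollifier e (q - r) * f q)" for r
      using compactly_supported_integrable[OF compactly_supported_mult_left[OF f ck]] by (simp add: mult.commute)
    have j: "integrable lborel (\<lambda>q. f q *\<^sub>R ((- 1 / c) *\<^sub>R bump_gradient e (q - r)))" for r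
      using cg by (intro compactly_supported_integrable compactly_supported_scaleR_left f continuous_intros)
    have "mollify e f (p + v) - mollify e f p - mollify_gradient e f p \<bullet> v
      = (\<integral>q. mollifier e (q - (p + v)) * f q - mollifier e (q - p) * f q - (f q *\<^sub>R ((- 1 / c) *\<^sub>R bump_gradient e (q - p))) \<bullet> v \<partial>lborel)"
      unfolding shift shiftg integral_inner_left[OF j, symmetric]
      using i[of "p + v"] i[of p] integrable_inner_left[OF j, of p v]
      by (subst Bochner_Integration.integral_diff[symmetric], simp, simp)+ simp
    also have "\<dots> = (\<integral>q. f q * ((bump e ((q - p) - v) - bump e (q - p) + bump_gradient e (q - p) \<bullet> v) / c) \<partial>lborel)"
      by (rule Bochner_Integration.integral_cong)
        (auto simp: mollifier_def c_def[symmetric] algebra_simps diff_divide_distrib add_divide_distrib)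
    also have "norm \<dots> \<le> (\<integral>q. \<bar>f q\<bar> * (C * (norm v)\<^sup>2) \<partial>lborel)"
    proof (rule Bochner_Integration.integral_norm_bound[THEN order_trans], rule integral_mono)
      have cc: "continuous_on UNIV (\<lambda>q. (bump e ((q - p) - v) - bump e (q - p) + bump_gradient e (q - p) \<bullet> v) / c)"
        using c by (auto intro!: continuous_intros cg continuous_on_compose2[OF continuous_bump(1)])
      then show "integrable lborel (\<lambda>q. norm (f q * ((bump e ((q - p) - v) - bump e (q - p) + bump_gradient e (q - p) \<bullet> v) / c)))"
        by (intro integrable_norm compactly_supported_integrable compactly_supported_mult_left f)
      show "integrable lborel (\<lambda>q. \<bar>f q\<bar> * (C * (norm v)\<^sup>2))"
        using compactly_supported_integrable[OF f] by auto
      fix q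
      have bd: "\<bar>bump e ((q - p) - v) - bump e (q - p) + bump_gradient e (q - p) \<bullet> v\<bar> / c \<le> C * (norm v)\<^sup>2"
        using divide_right_mono[OF bump_Taylor[OF e v, of "q - p"], of c] c by (simp add: C_def)
      then show "norm (f q * ((bump e ((q - p) - v) - bump e (q - p) + bump_gradient e (q - p) \<bullet> v) / c)) \<le> \<bar>f q\<bar> * (C * (norm v)\<^sup>2)"
        using c mult_left_mono[OF bd abs_ge_zero[of "f q"]] by (simp add: abs_mult)
    qed
    also have "\<dots> = (\<integral>q. \<bar>f q\<bar> \<partial>lborel) * C * (norm v)\<^sup>2" by simp
    finally show "\<bar>mollify e f (p + v) - mollify e f p - mollify_gradient e f p \<bullet> v\<bar> \<le> (\<integral>q. \<bar>f q\<bar> \<partial>lborel) * C * (norm v)\<^sup>2" by simp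
  qed
qed

lemma continuous_mollify_gradient: "continuous_on UNIV (mollify_gradient e f)"
proof -
  define g where "g q = (- 1 / (\<integral>r. bump e (r::'a) \<partial>lborel)) *\<^sub>R bump_gradient e q" for q :: 'a
  have g: "compactly_supported g" unfolding g_def by (intro compactly_supported_scaleR compactly_supported_bump e)
  have ng: "integrable lborel (\<lambda>q. norm (g q))" using compactly_supported_integrable[OF g] by simp
  have eq: "mollify_gradient e f p = (\<integral>q. f (p + q) *\<^sub>R g q \<partial>lborel)" for p
    by (simp add: mollify_gradient_def g_def)
  have int: "integrable lborel (\<lambda>q. f (p + q) *\<^sub>R g q)" for p
    using compactly_supported_shift[OF f, of p] compactly_supported_continuous[OF g]
    by (auto intro!: compactly_supported_integrable compactly_supported_scaleR_left simp: add.commute)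
  define A where "A = (\<integral>q. norm (g q) \<partial>lborel)"
  have A: "0 \<le> A" unfolding A_def by simp
  show ?thesis unfolding continuous_on_iff
  proof (intro ballI allI impI)
    fix p :: 'a and \<epsilon> :: real assume "0 < \<epsilon>"
    then have "0 < \<epsilon> / (A + 1)" using A by simp
    then obtain d where d: "d > 0" "\<And>x y. dist x y < d \<Longrightarrow> dist (f x) (f y) < \<epsilon> / (A + 1)"
      using compactly_supported_uniformly_continuous[OF f] by metis
    show "\<exists>d>0. \<forall>x'\<in>UNIV. dist x' p < d \<longrightarrow> dist (mollify_gradient e f x') (mollify_gradient e f p) < \<epsilon>"
    proof (intro exI[of _ d] conjI ballI impI d(1))
      fix x assume x: "dist x p < d"
      have "dist (mollify_gradient e f x) (mollify_gradient e f p) = norm (\<integral>q. (f (x + q) - f (p + q)) *\<^sub>R g q \<partial>lborel)"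
        unfolding eq dist_norm using int by (simp add: scaleR_diff_left)
      also have "\<dots> \<le> (\<integral>q. norm ((f (x + q) - f (p + q)) *\<^sub>R g q) \<partial>lborel)"
        by (rule integral_norm_bound)
      also have "\<dots> \<le> (\<integral>q. \<epsilon> / (A + 1) * norm (g q) \<partial>lborel)"
      proof (rule integral_mono)
        show "integrable lborel (\<lambda>q. norm ((f (x + q) - f (p + q)) *\<^sub>R g q))"
          unfolding scaleR_diff_left using int by auto
        show "integrable lborel (\<lambda>q. \<epsilon> / (A + 1) * norm (g q))" using ng by simp
        fix q
        have "dist (f (x + q)) (f (p + q)) < \<epsilon> / (A + 1)"
          using x by (intro d(2)) (simp add: dist_norm)
        from mult_right_mono[OF less_imp_le[OF this] norm_ge_zero[of "g q"]]
        show "norm ((f (x + q) - f (p + q)) *\<^sub>R g q) \<le> \<epsilon> / (A + 1) * norm (g q)" by (simp add: dist_norm)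
      qed
      also have "\<dots> = \<epsilon> / (A + 1) * A" by (simp add: A_def)
      also have "\<dots> < \<epsilon>" using A \<open>0 < \<epsilon>\<close> by (simp add: field_simps)
      finally show "dist (mollify_gradient e f x) (mollify_gradient e f p) < \<epsilon>" .
    qed
  qed
qed

lemma C1_compact_mollify:
  assumes "compact K" "\<And>x. x \<notin> K \<Longrightarrow> f x = 0" "{x + y | x y. x \<in> K \<and> y \<in> cball 0 e} \<subseteq> U"
  shows "C1_compact U (mollify e f) (mollify_gradient e f)"
  using GDERIV_mollify continuous_mollify_gradient compact_sums[OF assms(1) compact_cball] assms(3) mollify_zero[OF assms(2)]
  by (rule C1_compactI)

lemma mollify_close:
  assumes "\<And>q. norm q \<le> e \<Longrightarrow> \<bar>f (p + q) - f p\<bar> \<le> d"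
  shows "\<bar>mollify e f p - f p\<bar> \<le> d"
proof -
  have k: "integrable lborel (mollifier e :: 'a \<Rightarrow> real)" by (rule compactly_supported_integrable[OF compactly_supported_mollifier[OF e]])
  have i: "integrable lborel (\<lambda>q. mollifier e q * f (p + q))"
    using compactly_supported_shift[OF f, of p]
    by (intro compactly_supported_integrable compactly_supported_mult_left compactly_supported_mollifier e)
      (auto simp: add.commute compactly_supported_def)
  have "mollify e f p - f p = (\<integral>q. mollifier e q * f (p + q) - mollifier e q * f p \<partial>lborel)"
    using k i integral_mollifier[OF e, where 'a='a] by (simp add: mollify_def)
  also have "norm \<dots> \<le> (\<integral>q. norm (mollifier e q * f (p + q) - mollifier e q * f p) \<partial>lborel)"
    by (rule integral_norm_bound)
  also have "\<dots> \<le> (\<integral>q. mollifier e (q::'a) * d \<partial>lborel)"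
  proof (rule integral_mono)
    fix q :: 'a
    have "norm (mollifier e q * f (p + q) - mollifier e q * f p) = mollifier e q * \<bar>f (p + q) - f p\<bar>"
      using mollifier_nonneg[OF e, of q] by (simp add: abs_mult flip: right_diff_distrib)
    also have "\<dots> \<le> mollifier e q * d"
      using assms[of q] mollifier_nonneg[OF e, of q] mollifier_zero[OF e, of q]
      by (cases "norm q \<le> e") (auto intro: mult_left_mono)
    finally show "norm (mollifier e q * f (p + q) - mollifier e q * f p) \<le> mollifier e q * d" .
  qed (use k i in auto)
  also have "\<dots> = d" using integral_mollifier[OF e, where 'a='a] by simp
  finally show ?thesis by simp
qed

end

section \<open>Rellich compactness\<close>

lemma integral_le_of_nn_integral_le:
  assumes "integrable M f" "\<And>x. 0 \<le> f x" "(\<integral>\<^sup>+x. ennreal (f x) \<partial>M) \<le> ennreal B" "0 \<le> B"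
  shows "(\<integral>x. f x \<partial>M) \<le> B"
  using assms(3,4) unfolding nn_integral_eq_integral[OF assms(1) AE_I2[OF assms(2)]]
  by (subst (asm) ennreal_le_iff) auto

lemma nn_integral_le_of_integral_le:
  assumes "integrable M f" "\<And>x. 0 \<le> f x" "(\<integral>x. f x \<partial>M) \<le> B"
  shows "(\<integral>\<^sup>+x. ennreal (f x) \<partial>M) \<le> ennreal B"
  unfolding nn_integral_eq_integral[OF assms(1) AE_I2[OF assms(2)]] using assms(3) by (rule ennreal_leI)

lemma compactly_supported_mollify:
  assumes "compactly_supported f" "0 < e" shows "compactly_supported (mollify e f)"
proof -
  from assms(1) obtain K where "compact K" "\<And>x. x \<notin> K \<Longrightarrow> f x = 0" by (auto simp: compactly_supported_def)
  then have "C1_compact UNIV (mollify e f) (mollify_gradient e f)"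
    by (intro C1_compact_mollify assms) auto
  then show ?thesis by (rule C1_compact_compactly_supported)
qed

lemma integrable_mollifier_mult:
  assumes "continuous_on UNIV f" "0 < e"
  shows "integrable lborel (\<lambda>q::'a::euclidean_space. mollifier e q * f q)"
  using assms by (intro compactly_supported_integrable compactly_supported_mult_left compactly_supported_mollifier)

lemma continuous_shift:
  fixes f :: "'a::euclidean_space \<Rightarrow> 'b::euclidean_space"
  shows "continuous_on UNIV f \<Longrightarrow> continuous_on UNIV (\<lambda>q. f (p + q))"
  by (rule continuous_on_compose2[of UNIV f]) (auto intro!: continuous_intros)

lemma mollify_L2_le:
  fixes f :: "'a::euclidean_space \<Rightarrow> real"
  assumes f: "compactly_supported f" and e: "0 < e"
  shows "(\<integral>p. (mollify e f p)\<^sup>2 \<partial>lborel) \<le> (\<integral>p. (f p)\<^sup>2 \<partial>lborel)"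
proof (rule integral_le_of_nn_integral_le)
  note c = compactly_supported_continuous[OF f]
  have i: "integrable lborel (\<lambda>p. (f p)\<^sup>2)" by (intro compactly_supported_integrable compactly_supported_power2 f)
  show "integrable lborel (\<lambda>p. (mollify e f p)\<^sup>2)"
    by (intro compactly_supported_integrable compactly_supported_power2 compactly_supported_mollify f e)
  show "(\<integral>\<^sup>+p. ennreal ((mollify e f p)\<^sup>2) \<partial>lborel) \<le> ennreal (\<integral>p. (f p)\<^sup>2 \<partial>lborel)"
    unfolding mollify_def
  proof (rule mollifier_average_L2[OF e])
    show "continuous_on UNIV (\<lambda>(p, q). f (p + q))"
      unfolding case_prod_beta by (rule continuous_on_compose2[OF c]) (auto intro!: continuous_intros)
    fix q :: 'a
    have "(\<integral>\<^sup>+p. ennreal ((f (p + q))\<^sup>2) \<partial>lborel) = (\<integral>\<^sup>+p. ennreal ((f p)\<^sup>2) \<partial>lborel)"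
      using compactly_supported_measurable[OF f] by (intro nn_integral_lborel_shift[where f = "\<lambda>p. ennreal ((f p)\<^sup>2)"]) auto
    also have "\<dots> \<le> ennreal (\<integral>p. (f p)\<^sup>2 \<partial>lborel)" by (rule nn_integral_le_of_integral_le[OF i]) auto
    finally show "(\<integral>\<^sup>+p. ennreal ((f (p + q))\<^sup>2) \<partial>lborel) \<le> ennreal (\<integral>p. (f p)\<^sup>2 \<partial>lborel)" .
  qed
qed (auto intro!: integral_nonneg_AE)

lemma mollify_L2_dist:
  fixes f :: "'a::euclidean_space \<Rightarrow> real"
  assumes f: "compactly_supported f" and e: "0 < e" and B: "0 \<le> B"
    "\<And>q. norm q \<le> e \<Longrightarrow> (\<integral>p. (f (p + q) - f p)\<^sup>2 \<partial>lborel) \<le> B"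
  shows "(\<integral>p. (mollify e f p - f p)\<^sup>2 \<partial>lborel) \<le> B"
proof (rule integral_le_of_nn_integral_le[OF _ _ _ B(1)])
  note c = compactly_supported_continuous[OF f]
  show "integrable lborel (\<lambda>p. (mollify e f p - f p)\<^sup>2)"
    by (intro compactly_supported_integrable compactly_supported_power2 compactly_supported_diff compactly_supported_mollify f e)
  have eq: "mollify e f p - f p = (\<integral>q. mollifier e q * (f (p + q) - f p) \<partial>lborel)" for p
    using integrable_mollifier_mult[OF continuous_shift[OF c, of p] e] integral_mollifier[OF e, where 'a='a]
      compactly_supported_integrable[OF compactly_supported_mollifier[OF e, where 'a='a]]
    by (simp add: mollify_def right_diff_distrib)
  show "(\<integral>\<^sup>+p. ennreal ((mollify e f p - f p)\<^sup>2) \<partial>lborel) \<le> ennreal B"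
    unfolding eq
  proof (rule mollifier_average_L2[OF e])
    show "continuous_on UNIV (\<lambda>(p, q). f (p + q) - f p)"
      unfolding case_prod_beta by (intro continuous_intros continuous_on_compose2[OF c]) (auto intro!: continuous_intros)
    fix q :: 'a assume "norm q \<le> e"
    then show "(\<integral>\<^sup>+p. ennreal ((f (p + q) - f p)\<^sup>2) \<partial>lborel) \<le> ennreal B"
      by (intro nn_integral_le_of_integral_le B compactly_supported_integrable compactly_supported_power2 compactly_supported_diff compactly_supported_shift f) auto
  qed
qed auto

lemma integral_inner_power2_le:
  assumes "compactly_supported (G :: 'a::euclidean_space \<Rightarrow> 'a)"
  shows "(\<integral>p. (G p \<bullet> h)\<^sup>2 \<partial>lborel) \<le> (norm h)\<^sup>2 * (\<integral>p. (norm (G p))\<^sup>2 \<partial>lborel)"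
proof -
  have "(\<integral>p. (G p \<bullet> h)\<^sup>2 \<partial>lborel) \<le> (\<integral>p. (norm h)\<^sup>2 * (norm (G p))\<^sup>2 \<partial>lborel)"
  proof (rule integral_mono)
    show "integrable lborel (\<lambda>p. (G p \<bullet> h)\<^sup>2)"
      by (intro compactly_supported_integrable compactly_supported_power2 compactly_supported_inner assms continuous_intros)
    show "integrable lborel (\<lambda>p. (norm h)\<^sup>2 * (norm (G p))\<^sup>2)"
      using compactly_supported_integrable[OF compactly_supported_norm2[OF assms]] by simp
    fix p
    have "\<bar>G p \<bullet> h\<bar>\<^sup>2 \<le> (norm (G p) * norm h)\<^sup>2"
      by (intro power_mono Cauchy_Schwarz_ineq2) auto
    then show "(G p \<bullet> h)\<^sup>2 \<le> (norm h)\<^sup>2 * (norm (G p))\<^sup>2" by (simp add: power_mult_distrib mult.commute)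
  qed
  then show ?thesis by simp
qed

text \<open>
  At a fixed mollification radius an \<open>L\<^sup>2\<close> bound on function and gradient becomes a uniform and a
  Lipschitz bound, which is what the Arzela-Ascoli theorem needs.
\<close>

lemma mollify_Lipschitz_bound:
  fixes \<phi> :: "'a::euclidean_space \<Rightarrow> real"
  assumes C: "C1_compact U \<phi> G" and e: "0 < e" and S: "\<And>q::'a. mollifier e q \<le> S"
    and B: "(\<integral>p. (\<phi> p)\<^sup>2 \<partial>lborel) \<le> B" "(\<integral>p. (norm (G p))\<^sup>2 \<partial>lborel) \<le> B"
  shows "(mollify e \<phi> p)\<^sup>2 \<le> S * B" "(mollify e \<phi> p - mollify e \<phi> p')\<^sup>2 \<le> S * B * (norm (p - p'))\<^sup>2"
proof -
  note cs = C1_compact_compactly_supported[OF C]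
  note c = compactly_supported_continuous[OF cs(1)]
  have S0: "0 \<le> S" using S[of 0] mollifier_nonneg[OF e, of "0::'a"] by linarith
  have sh: "compactly_supported (\<lambda>q. \<phi> (p + q))" for p
    using compactly_supported_shift[OF cs(1), of p] by (simp add: add.commute)
  have gen: "(\<integral>q. mollifier e q * g q \<partial>lborel)\<^sup>2 \<le> S * (\<integral>q. (g q)\<^sup>2 \<partial>lborel)" if g: "compactly_supported g" for g :: "'a \<Rightarrow> real"
  proof -
    note cg = compactly_supported_continuous[OF g]
    have "(\<integral>q. mollifier e q * g q \<partial>lborel)\<^sup>2 \<le> (\<integral>q. mollifier e q * (g q)\<^sup>2 \<partial>lborel)"
      by (rule mollifier_Jensen[OF e cg])
    also have "\<dots> \<le> (\<integral>q. S * (g q)\<^sup>2 \<partial>lborel)"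
      using compactly_supported_integrable[OF compactly_supported_power2[OF g]] S cg
      by (intro integral_mono integrable_mollifier_mult e continuous_intros) (auto intro: mult_right_mono)
    finally show ?thesis by simp
  qed
  have "(mollify e \<phi> p)\<^sup>2 \<le> S * (\<integral>q. (\<phi> (p + q))\<^sup>2 \<partial>lborel)"
    unfolding mollify_def by (rule gen[OF sh])
  also have "(\<integral>q. (\<phi> (p + q))\<^sup>2 \<partial>lborel) = (\<integral>q. (\<phi> q)\<^sup>2 \<partial>lborel)"
    using integral_lborel_shift[of "\<lambda>q. (\<phi> q)\<^sup>2" p] compactly_supported_measurable[OF cs(1)] by (simp add: add.commute)
  also have "S * \<dots> \<le> S * B" using B(1) S0 by (rule mult_left_mono)
  finally show "(mollify e \<phi> p)\<^sup>2 \<le> S * B" .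
  have "mollify e \<phi> p - mollify e \<phi> p' = (\<integral>q. mollifier e q * (\<phi> (p + q) - \<phi> (p' + q)) \<partial>lborel)"
    using integrable_mollifier_mult[OF continuous_shift[OF c] e] by (simp add: mollify_def right_diff_distrib)
  then have le: "(mollify e \<phi> p - mollify e \<phi> p')\<^sup>2 \<le> S * (\<integral>q. (\<phi> (p + q) - \<phi> (p' + q))\<^sup>2 \<partial>lborel)"
    using gen[OF compactly_supported_diff[OF sh sh], of p p'] by simp
  have "(\<integral>q. (\<phi> (p + q) - \<phi> (p' + q))\<^sup>2 \<partial>lborel) = (\<integral>q. (\<phi> (q + (p - p')) - \<phi> q)\<^sup>2 \<partial>lborel)"
  proof -
    have m: "\<phi> \<in> borel_measurable borel" by (rule compactly_supported_measurable[OF cs(1)])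
    have "(\<integral>q. (\<phi> ((q + p') + (p - p')) - \<phi> (q + p'))\<^sup>2 \<partial>lborel) = (\<integral>q. (\<phi> (q + (p - p')) - \<phi> q)\<^sup>2 \<partial>lborel)"
      by (rule integral_lborel_shift[where f = "\<lambda>q. (\<phi> (q + (p - p')) - \<phi> q)\<^sup>2"])
        (use measurable_compose[OF _ m, of "\<lambda>q. q + (p - p')" borel] m in simp)
    then show ?thesis by (simp add: algebra_simps)
  qed
  also have "\<dots> \<le> (norm (p - p'))\<^sup>2 * (\<integral>p. (norm (G p))\<^sup>2 \<partial>lborel)"
    using integral_power2_shift_le[OF C] integral_inner_power2_le[OF cs(2)] by (rule order_trans)
  also have "\<dots> \<le> (norm (p - p'))\<^sup>2 * B" using B(2) by (intro mult_left_mono) auto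
  finally have bd: "(\<integral>q. (\<phi> (p + q) - \<phi> (p' + q))\<^sup>2 \<partial>lborel) \<le> (norm (p - p'))\<^sup>2 * B" .
  show "(mollify e \<phi> p - mollify e \<phi> p')\<^sup>2 \<le> S * B * (norm (p - p'))\<^sup>2"
    using order_trans[OF le mult_left_mono[OF bd S0]] by (simp add: mult_ac)
qed

text \<open>
  For a small mollification radius the functions are \<open>L\<^sup>2\<close> close to their mollifications; these have a
  uniformly convergent subsequence on a ball that contains \<open>U\<close>.
\<close>

lemma Rellich_step:
  fixes \<phi> :: "nat \<Rightarrow> 'a::euclidean_space \<Rightarrow> real"
  assumes U: "bounded U" and C: "\<And>n. C1_compact U (\<phi> n) (G n)"
    and B: "\<And>n. (\<integral>p. (\<phi> n p)\<^sup>2 \<partial>lborel) \<le> B" "\<And>n. (\<integral>p. (norm (G n p))\<^sup>2 \<partial>lborel) \<le> B" and \<epsilon>: "0 < \<epsilon>"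
  obtains r :: "nat \<Rightarrow> nat" and N where "strict_mono r"
    "\<And>m n. m \<ge> N \<Longrightarrow> n \<ge> N \<Longrightarrow> (\<integral>p. (\<phi> (r m) p - \<phi> (r n) p)\<^sup>2 \<partial>lborel) < \<epsilon>"
proof -
  note cs = C1_compact_compactly_supported[OF C]
  have B0: "0 \<le> B" using B(1)[of 0] by (rule order_trans[rotated]) auto
  \<comment> \<open>the two mollification errors contribute at most \<open>\<epsilon>/2\<close> in total, and the radius \<open>d\<close> chosen later leaves less than \<open>\<epsilon>/2\<close> for the uniform distance\<close>
  define e where "e = sqrt (\<epsilon> / (24 * (B + 1)))"
  have e: "0 < e" "12 * (e\<^sup>2 * B) < \<epsilon>" using \<epsilon> B0 by (auto simp: e_def field_simps intro!: add_pos_nonneg)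
  obtain R where R: "0 < R" "U \<subseteq> ball 0 R" using bounded_subset_ballD[OF U, of 0] by blast
  define D where "D = cball (0::'a) R"
  obtain S where S: "0 < S" "\<And>q::'a. mollifier e q \<le> S"
    using compactly_supported_bounded[OF compactly_supported_mollifier[OF e(1), where 'a='a]] by (metis abs_le_D1 real_norm_def)
  note bd = mollify_Lipschitz_bound[OF C e(1) S(2) B]
  have sb: "\<bar>x\<bar> \<le> sqrt (S * B) * a" if "x\<^sup>2 \<le> S * B * a\<^sup>2" "0 \<le> a" for x a :: real
    using that by (intro power2_le_imp_le[of "\<bar>x\<bar>"]) (auto simp: power_mult_distrib S(1) less_imp_le B0)
  obtain g r where r: "strict_mono (r :: nat \<Rightarrow> nat)"
    and lim: "\<And>d. 0 < d \<Longrightarrow> \<exists>N. \<forall>n x. n \<ge> N \<and> x \<in> D \<longrightarrow> norm (mollify e (\<phi> (r n)) x - g x) < d"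
  proof (rule Arzela_Ascoli[of D "\<lambda>n. mollify e (\<phi> n)" "sqrt (S * B)"])
    show "compact D" by (simp add: D_def)
    show "norm (mollify e (\<phi> n) x) \<le> sqrt (S * B)" for n x
      using sb[of "mollify e (\<phi> n) x" 1] bd(1)[of n x] by simp
    fix x and d :: real assume "0 < d"
    show "\<exists>d'>0. \<forall>n y. y \<in> D \<and> norm (x - y) < d' \<longrightarrow> norm (mollify e (\<phi> n) x - mollify e (\<phi> n) y) < d"
    proof (intro exI[of _ "d / (sqrt (S * B) + 1)"] conjI allI impI)
      have pos: "0 < sqrt (S * B) + 1" using S(1) B0 by (simp add: add_nonneg_pos)
      then show "0 < d / (sqrt (S * B) + 1)" using \<open>0 < d\<close> by simp
      fix n y assume "y \<in> D \<and> norm (x - y) < d / (sqrt (S * B) + 1)"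
      then have 1: "(sqrt (S * B) + 1) * norm (x - y) < d" using pos by (simp add: pos_less_divide_eq mult.commute)
      have "norm (mollify e (\<phi> n) x - mollify e (\<phi> n) y) \<le> sqrt (S * B) * norm (x - y)"
        using sb[OF bd(2)[of n x y]] by simp
      also have "\<dots> \<le> (sqrt (S * B) + 1) * norm (x - y)" by (intro mult_right_mono) auto
      finally show "norm (mollify e (\<phi> n) x - mollify e (\<phi> n) y) < d" using 1 by simp
    qed
  qed blast
  define A where "A = measure lborel D"
  have A: "0 \<le> A" by (simp add: A_def)
  define d where "d = sqrt (\<epsilon> / (48 * (A + 1)))"
  have d: "0 < d" "24 * (d\<^sup>2 * A) < \<epsilon>" using \<epsilon> A by (auto simp: d_def field_simps intro!: add_pos_nonneg)
  obtain N where N: "\<And>n x. n \<ge> N \<Longrightarrow> x \<in> D \<Longrightarrow> norm (mollify e (\<phi> (r n)) x - g x) < d" using lim[OF d(1)] by blast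
  have dist: "(\<integral>p. (mollify e (\<phi> n) p - \<phi> n p)\<^sup>2 \<partial>lborel) \<le> e\<^sup>2 * B" for n
  proof (rule mollify_L2_dist[OF cs(1) e(1)])
    fix q :: 'a assume q: "norm q \<le> e"
    have "(\<integral>p. (\<phi> n (p + q) - \<phi> n p)\<^sup>2 \<partial>lborel) \<le> (norm q)\<^sup>2 * (\<integral>p. (norm (G n p))\<^sup>2 \<partial>lborel)"
      using integral_power2_shift_le[OF C] integral_inner_power2_le[OF cs(2)] by (rule order_trans)
    also have "\<dots> \<le> e\<^sup>2 * B" using q B(2)[of n] by (intro mult_mono power_mono) (auto intro!: integral_nonneg_AE)
    finally show "(\<integral>p. (\<phi> n (p + q) - \<phi> n p)\<^sup>2 \<partial>lborel) \<le> e\<^sup>2 * B" .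
  qed (use B0 in auto)
  have isq: "integrable lborel (\<lambda>p. (mollify e (\<phi> n) p - \<phi> n p)\<^sup>2)" for n
    by (intro compactly_supported_integrable compactly_supported_power2 compactly_supported_diff compactly_supported_mollify cs e)
  have fin: "emeasure lborel D < \<infinity>" unfolding D_def by (rule emeasure_compact_finite) simp
  have iD: "integrable lborel (indicator D :: 'a \<Rightarrow> real)" by (rule integrable_real_indicator[OF _ fin]) (simp add: D_def)
  show ?thesis
  proof (rule that[OF r])
    fix m n assume mn: "m \<ge> N" "n \<ge> N"
    define X Y where "X p = mollify e (\<phi> (r m)) p - \<phi> (r m) p" and "Y p = mollify e (\<phi> (r n)) p - \<phi> (r n) p" for p
    have "(\<integral>p. (\<phi> (r m) p - \<phi> (r n) p)\<^sup>2 \<partial>lborel) \<le> (\<integral>p. 3 * (X p)\<^sup>2 + 3 * (Y p)\<^sup>2 + 12 * d\<^sup>2 * indicator D p \<partial>lborel)"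
    proof (rule integral_mono)
      show "integrable lborel (\<lambda>p. (\<phi> (r m) p - \<phi> (r n) p)\<^sup>2)"
        by (intro compactly_supported_integrable compactly_supported_power2 compactly_supported_diff cs)
      show "integrable lborel (\<lambda>p. 3 * (X p)\<^sup>2 + 3 * (Y p)\<^sup>2 + 12 * d\<^sup>2 * indicator D p)"
        using isq iD by (simp add: X_def Y_def)
      fix p
      show "(\<phi> (r m) p - \<phi> (r n) p)\<^sup>2 \<le> 3 * (X p)\<^sup>2 + 3 * (Y p)\<^sup>2 + 12 * d\<^sup>2 * indicator D p"
      proof (cases "p \<in> D")
        case True
        define z where "z = mollify e (\<phi> (r m)) p - mollify e (\<phi> (r n)) p"
        have "\<bar>z\<bar> \<le> 2 * d" using N[OF mn(1) True] N[OF mn(2) True] by (simp add: z_def)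
        then have z: "z\<^sup>2 \<le> 4 * d\<^sup>2" using power_mono[of "\<bar>z\<bar>" "2 * d" 2] by (simp add: power_mult_distrib)
        have "(\<phi> (r m) p - \<phi> (r n) p)\<^sup>2 = (Y p - X p + z)\<^sup>2" by (simp add: X_def Y_def z_def)
        also have "\<dots> \<le> 3 * (X p)\<^sup>2 + 3 * (Y p)\<^sup>2 + 3 * z\<^sup>2"
        proof -
          have "3 * (X p)\<^sup>2 + 3 * (Y p)\<^sup>2 + 3 * z\<^sup>2 - (Y p - X p + z)\<^sup>2 = (X p + Y p)\<^sup>2 + (Y p - z)\<^sup>2 + (X p + z)\<^sup>2"
            by (simp add: power2_eq_square algebra_simps)
          moreover have "0 \<le> (X p + Y p)\<^sup>2 + (Y p - z)\<^sup>2 + (X p + z)\<^sup>2" by simp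
          ultimately show ?thesis by linarith
        qed
        finally show ?thesis using z True by simp
      next
        case False
        then have "p \<notin> U" using R(2) by (auto simp: D_def)
        then have "\<phi> k p = 0" for k using C1_compactD[OF C, of k] by (metis subsetD)
        then show ?thesis by simp
      qed
    qed
    also have "\<dots> = 3 * (\<integral>p. (X p)\<^sup>2 \<partial>lborel) + 3 * (\<integral>p. (Y p)\<^sup>2 \<partial>lborel) + 12 * d\<^sup>2 * A"
      using isq iD by (simp add: X_def Y_def A_def)
    also have "\<dots> \<le> 3 * (e\<^sup>2 * B) + 3 * (e\<^sup>2 * B) + 12 * (d\<^sup>2 * A)"
      using dist[of "r m"] dist[of "r n"] unfolding X_def Y_def by linarith
    finally show "(\<integral>p. (\<phi> (r m) p - \<phi> (r n) p)\<^sup>2 \<partial>lborel) < \<epsilon>" using e(2) d(2) by linarith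
  qed
qed

text \<open>
  A bounded sequence in the Sobolev space of a bounded set has a subsequence that is Cauchy in \<open>L\<^sup>2\<close>.
  The diagonal of the subsequences for the accuracies \<open>1 / (k + 1)\<close> works.
\<close>

lemma Rellich:
  fixes \<phi> :: "nat \<Rightarrow> 'a::euclidean_space \<Rightarrow> real"
  assumes U: "bounded U" and C: "\<And>n. C1_compact U (\<phi> n) (G n)"
    and B: "\<And>n. (\<integral>p. (\<phi> n p)\<^sup>2 \<partial>lborel) \<le> B" "\<And>n. (\<integral>p. (norm (G n p))\<^sup>2 \<partial>lborel) \<le> B"
  obtains r :: "nat \<Rightarrow> nat" where "strict_mono r"
    "\<And>e. 0 < e \<Longrightarrow> \<exists>N. \<forall>m\<ge>N. \<forall>n\<ge>N. (\<integral>p. (\<phi> (r m) p - \<phi> (r n) p)\<^sup>2 \<partial>lborel) < e"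
proof -
  define P where "P k s \<longleftrightarrow> (\<exists>N. \<forall>m\<ge>N. \<forall>n\<ge>N. (\<integral>p. (\<phi> (s m) p - \<phi> (s n) p)\<^sup>2 \<partial>lborel) < 1 / real (Suc k))" for k and s :: "nat \<Rightarrow> nat"
  interpret subseqs P
  proof
    fix k and s :: "nat \<Rightarrow> nat" assume "strict_mono s"
    show "\<exists>r'. strict_mono r' \<and> P k (s \<circ> r')"
      by (rule Rellich_step[OF U, of "\<lambda>n. \<phi> (s n)" "\<lambda>n. G (s n)" B "1 / real (Suc k)"])
        (use C B in \<open>auto simp: P_def\<close>)
  qed
  have P: "P k (diagseq \<circ> (+) (Suc k))" for k
  proof (rule diagseq_holds)
    fix r s :: "nat \<Rightarrow> nat" and n assume r: "strict_mono r" and "P n s"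
    then obtain N where N: "\<forall>m\<ge>N. \<forall>k\<ge>N. (\<integral>p. (\<phi> (s m) p - \<phi> (s k) p)\<^sup>2 \<partial>lborel) < 1 / real (Suc n)" by (auto simp: P_def)
    have "N \<le> r m" if "N \<le> m" for m using that seq_suble[OF r, of m] by linarith
    then show "P n (s \<circ> r)" unfolding P_def using N by (intro exI[of _ N]) auto
  qed
  show ?thesis
  proof (rule that[OF subseq_diagseq])
    fix e :: real assume "0 < e"
    then obtain k where k: "1 / real (Suc k) < e" using nat_approx_posE by blast
    obtain N where N: "\<forall>m\<ge>N. \<forall>n\<ge>N. (\<integral>p. (\<phi> (diagseq (Suc k + m)) p - \<phi> (diagseq (Suc k + n)) p)\<^sup>2 \<partial>lborel) < 1 / real (Suc k)"
      using P[of k] by (auto simp: P_def)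
    have "(\<integral>p. (\<phi> (diagseq m) p - \<phi> (diagseq n) p)\<^sup>2 \<partial>lborel) < e" if "m \<ge> Suc k + N" "n \<ge> Suc k + N" for m n
    proof -
      have "Suc k + (m - Suc k) = m" "Suc k + (n - Suc k) = n" "m - Suc k \<ge> N" "n - Suc k \<ge> N" using that by auto
      with N have "(\<integral>p. (\<phi> (diagseq m) p - \<phi> (diagseq n) p)\<^sup>2 \<partial>lborel) < 1 / real (Suc k)" by metis
      with k show ?thesis by simp
    qed
    then show "\<exists>N. \<forall>m\<ge>N. \<forall>n\<ge>N. (\<integral>p. (\<phi> (diagseq m) p - \<phi> (diagseq n) p)\<^sup>2 \<partial>lborel) < e" by blast
  qed
qed

section \<open>The first Dirichlet eigenvalue is the infimum of the Rayleigh quotients\<close>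

definition ground_energy :: "'a::euclidean_space set \<Rightarrow> ('a \<Rightarrow> real) \<Rightarrow> real" where
  "ground_energy U V = Inf {LINT p:U|lborel. (norm (G p))\<^sup>2 + V p * (\<phi> p)\<^sup>2 | \<phi> G.
     C1_compact U \<phi> G \<and> (LINT p|lborel. (\<phi> p)\<^sup>2) = 1}"

text \<open>
  Local boundedness replaces continuity of the potential: the potential \<open>\<mu>(x)\<close> on the projection
  is only known to be upper semicontinuous.
\<close>

locale schroedinger =
  fixes U :: "'a::euclidean_space set" and V :: "'a \<Rightarrow> real"
  assumes open_U: "open U" and bounded_U: "bounded U" and U_nonempty: "U \<noteq> {}"
    and V_measurable: "set_borel_measurable lborel U V"
    and V_nonneg: "\<And>p. p \<in> U \<Longrightarrow> 0 \<le> V p"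
    and V_bounded: "\<And>K. compact K \<Longrightarrow> K \<subseteq> U \<Longrightarrow> \<exists>B. \<forall>p\<in>K. V p \<le> B"
begin

definition "M = restrict_space lborel U"
definition "energy \<phi> G = (LINT p:U|lborel. (norm (G p))\<^sup>2 + V p * (\<phi> p)\<^sup>2)"

text \<open>
  In these coordinates the form norm is an \<open>L\<^sup>2\<close> norm, so that completeness of \<open>L\<^sup>2\<close> yields
  completeness of the form domain.
\<close>

definition "state u g p = (g p :: 'a, u p :: real, sqrt (V p) * u p)"

lemma U_sets [measurable]: "U \<in> sets borel" using open_U by simp

lemma set_integral_M:
  fixes f :: "'a \<Rightarrow> 'b::{banach, second_countable_topology}"
  shows "(LINT p:U|lborel. f p) = (\<integral>p. f p \<partial>M)"
  unfolding set_lebesgue_integral_def M_def using integral_restrict_space[of U lborel f] U_sets by simp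

lemma set_measurable_M:
  fixes f :: "'a \<Rightarrow> 'b::{banach, second_countable_topology}"
  shows "set_borel_measurable lborel U f \<longleftrightarrow> f \<in> borel_measurable M"
  unfolding set_borel_measurable_def M_def using borel_measurable_restrict_space_iff[of U lborel f] U_sets by simp

lemma V_meas_M: "V \<in> borel_measurable M" using V_measurable by (simp add: set_measurable_M)

lemma meas_M: "f \<in> borel_measurable borel \<Longrightarrow> f \<in> borel_measurable M"
  unfolding M_def by (rule measurable_restrict_space1) simp

lemma space_M: "space M = U" by (simp add: M_def space_restrict_space)

lemma norm_state: "p \<in> U \<Longrightarrow> (norm (state u g p))\<^sup>2 = (norm (g p))\<^sup>2 + (u p)\<^sup>2 + V p * (u p)\<^sup>2"
  using V_nonneg[of p] by (simp add: state_def norm_Pair power_mult_distrib)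

lemma inner_state: "p \<in> U \<Longrightarrow> state u g p \<bullet> state w k p = g p \<bullet> k p + u p * w p + V p * u p * w p"
  using V_nonneg[of p] by (simp add: state_def)

lemma state_diff: "state u g p - state w k p = state (\<lambda>p. u p - w p) (\<lambda>p. g p - k p) p"
  by (simp add: state_def algebra_simps)

lemma measurable_state:
  assumes "u \<in> borel_measurable M" "g \<in> borel_measurable M"
  shows "state u g \<in> borel_measurable M"
  using assms V_meas_M unfolding state_def[abs_def] by measurable

lemma integrable_M_compactly_supported:
  fixes f :: "'a \<Rightarrow> real"
  assumes "compactly_supported f" shows "integrable M f"
  unfolding M_def using integrable_mult_indicator[OF _ compactly_supported_integrable[OF assms], of U] U_sets
  by (subst integrable_restrict_space) auto

lemma V_integrable:
  assumes "C1_compact U \<phi> G" shows "integrable M (\<lambda>p. V p * (\<phi> p)\<^sup>2)"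
proof -
  note cs = C1_compact_compactly_supported[OF assms]
  obtain K where K: "compact K" "K \<subseteq> U" "\<And>p. p \<notin> K \<Longrightarrow> \<phi> p = 0" "\<And>p. p \<notin> K \<Longrightarrow> G p = 0"
    by (rule C1_compactD[OF assms]) (rule that)
  obtain B where B: "\<forall>p\<in>K. V p \<le> B" using V_bounded[OF K(1,2)] by blast
  show ?thesis
  proof (rule Bochner_Integration.integrable_bound)
    show "integrable M (\<lambda>p. \<bar>B\<bar> * (\<phi> p)\<^sup>2)"
      using integrable_M_compactly_supported[OF compactly_supported_power2[OF cs(1)]] by simp
    show "(\<lambda>p. V p * (\<phi> p)\<^sup>2) \<in> borel_measurable M"
      using V_meas_M meas_M[OF compactly_supported_measurable[OF cs(1)]] by measurable
    have "\<bar>V p * (\<phi> p)\<^sup>2\<bar> \<le> \<bar>B\<bar> * (\<phi> p)\<^sup>2" if "p \<in> U" for p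
    proof (cases "p \<in> K")
      case True
      then have "0 \<le> V p" "V p \<le> \<bar>B\<bar>" using B V_nonneg[OF that] by (auto intro: order_trans)
      then show ?thesis by (simp add: abs_mult mult_right_mono)
    qed (simp add: K(3))
    then show "AE p in M. norm (V p * (\<phi> p)\<^sup>2) \<le> norm (\<bar>B\<bar> * (\<phi> p)\<^sup>2)"
      by (intro AE_I2) (auto simp: space_M abs_mult)
  qed
qed

lemma C1_square_integrable:
  assumes "C1_compact U \<phi> G"
  shows "square_integrable M (state \<phi> G)" "square_integrable M \<phi>"
proof -
  note cs = C1_compact_compactly_supported[OF assms]
  have m: "\<phi> \<in> borel_measurable M" "G \<in> borel_measurable M"
    using cs by (auto intro: meas_M compactly_supported_measurable)
  have i: "integrable M (\<lambda>p. (norm (G p))\<^sup>2)" "integrable M (\<lambda>p. (\<phi> p)\<^sup>2)"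
    by (auto intro: integrable_M_compactly_supported compactly_supported_norm2 compactly_supported_power2 cs)
  show "square_integrable M \<phi>" using m i by (simp add: square_integrable_def)
  have "integrable M (\<lambda>p. (norm (G p))\<^sup>2 + (\<phi> p)\<^sup>2 + V p * (\<phi> p)\<^sup>2)"
    using i V_integrable[OF assms] by simp
  then have "integrable M (\<lambda>p. (norm (state \<phi> G p))\<^sup>2)"
    by (rule Bochner_Integration.integrable_cong[THEN iffD1, rotated 2]) (auto simp: norm_state space_M)
  then show "square_integrable M (state \<phi> G)"
    using measurable_state[OF m] by (simp add: square_integrable_def)
qed

lemma integral_M_power2:
  assumes "C1_compact U \<phi> G" shows "(\<integral>p. (\<phi> p)\<^sup>2 \<partial>M) = (\<integral>p. (\<phi> p)\<^sup>2 \<partial>lborel)"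
proof -
  obtain K where K: "compact K" "K \<subseteq> U" "\<And>p. p \<notin> K \<Longrightarrow> \<phi> p = 0" "\<And>p. p \<notin> K \<Longrightarrow> G p = 0"
    by (rule C1_compactD[OF assms]) (rule that)
  then have "\<phi> p = 0 \<and> G p = 0" if "p \<notin> U" for p using that by blast
  then show ?thesis unfolding M_def using U_sets
    by (subst integral_restrict_space) (auto intro!: Bochner_Integration.integral_cong simp: indicator_def)
qed

lemma integrable_grad: "C1_compact U \<phi> G \<Longrightarrow> integrable M (\<lambda>p. (norm (G p))\<^sup>2)"
  by (intro integrable_M_compactly_supported compactly_supported_norm2 C1_compact_compactly_supported)

lemma integral_M_grad:
  assumes "C1_compact U \<phi> G" shows "(\<integral>p. (norm (G p))\<^sup>2 \<partial>M) = (\<integral>p. (norm (G p))\<^sup>2 \<partial>lborel)"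
proof -
  obtain K where K: "compact K" "K \<subseteq> U" "\<And>p. p \<notin> K \<Longrightarrow> \<phi> p = 0" "\<And>p. p \<notin> K \<Longrightarrow> G p = 0"
    by (rule C1_compactD[OF assms]) (rule that)
  then have "\<phi> p = 0 \<and> G p = 0" if "p \<notin> U" for p using that by blast
  then show ?thesis unfolding M_def using U_sets
    by (subst integral_restrict_space) (auto intro!: Bochner_Integration.integral_cong simp: indicator_def)
qed

lemma energy_alt:
  assumes "C1_compact U \<phi> G"
  shows "energy \<phi> G = (\<integral>p. (norm (G p))\<^sup>2 \<partial>lborel) + (\<integral>p. V p * (\<phi> p)\<^sup>2 \<partial>M)"
  unfolding energy_def set_integral_M
  using integrable_grad[OF assms] V_integrable[OF assms] by (simp add: integral_M_grad[OF assms])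

lemma V_integral_nonneg: "0 \<le> (\<integral>p. V p * (\<phi> p)\<^sup>2 \<partial>M)"
  by (rule integral_nonneg_AE, rule AE_I2) (auto simp: space_M V_nonneg)

lemma energy_nonneg: "C1_compact U \<phi> G \<Longrightarrow> 0 \<le> energy \<phi> G"
  using V_integral_nonneg by (simp add: energy_alt add_nonneg_nonneg)

lemma norm_state_integral:
  assumes "C1_compact U \<phi> G"
  shows "(\<integral>p. (norm (state \<phi> G p))\<^sup>2 \<partial>M) = energy \<phi> G + (\<integral>p. (\<phi> p)\<^sup>2 \<partial>lborel)"
proof -
  have "(\<integral>p. (norm (state \<phi> G p))\<^sup>2 \<partial>M) = (\<integral>p. (norm (G p))\<^sup>2 + (\<phi> p)\<^sup>2 + V p * (\<phi> p)\<^sup>2 \<partial>M)"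
    by (rule Bochner_Integration.integral_cong) (auto simp: norm_state space_M)
  also have "\<dots> = (\<integral>p. (norm (G p))\<^sup>2 \<partial>M) + (\<integral>p. (\<phi> p)\<^sup>2 \<partial>M) + (\<integral>p. V p * (\<phi> p)\<^sup>2 \<partial>M)"
    using integrable_grad[OF assms] V_integrable[OF assms] C1_square_integrable(2)[OF assms]
    by (simp add: square_integrable_def)
  finally show ?thesis by (simp add: energy_alt[OF assms] integral_M_power2[OF assms] integral_M_grad[OF assms])
qed

lemma energy_scale:
  assumes "C1_compact U \<phi> G" shows "energy (\<lambda>p. c * \<phi> p) (\<lambda>p. c *\<^sub>R G p) = c\<^sup>2 * energy \<phi> G"
proof -
  have "(\<lambda>p. (norm (c *\<^sub>R G p))\<^sup>2 + V p * (c * \<phi> p)\<^sup>2) = (\<lambda>p. c\<^sup>2 * ((norm (G p))\<^sup>2 + V p * (\<phi> p)\<^sup>2))"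
    by (auto simp: power_mult_distrib algebra_simps)
  then show ?thesis unfolding energy_def set_integral_M by simp
qed

lemma exists_unit: "\<exists>\<phi> G. C1_compact U \<phi> G \<and> (\<integral>p. (\<phi> p)\<^sup>2 \<partial>lborel) = 1"
proof -
  obtain c r where r: "0 < r" "cball c r \<subseteq> U" using open_U U_nonempty open_contains_cball by blast
  define \<phi> G where "\<phi> p = bump r (p - c)" and "G p = bump_gradient r (p - c)" for p
  have C: "C1_compact U \<phi> G" unfolding \<phi>_def G_def by (rule C1_compact_bump[OF r])
  define N where "N = (\<integral>p. (\<phi> p)\<^sup>2 \<partial>lborel)"
  have "N > 0"
  proof -
    note cs = C1_compact_compactly_supported[OF C]
    have "\<phi> c \<noteq> 0" using r(1) by (simp add: \<phi>_def bump_def)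
    obtain B where B: "B > 0" "\<And>x. norm (\<phi> x) \<le> B" using compactly_supported_bounded[OF cs(1)] by blast
    have "(\<integral>p. \<phi> p \<partial>lborel) = (\<integral>p. bump r (p::'a) \<partial>lborel)"
      using integral_lborel_shift[OF borel_measurable_continuous_onI[OF continuous_bump(1)], of r "-c"]
      by (simp add: \<phi>_def)
    then have "0 < (\<integral>p. \<phi> p \<partial>lborel)" using integral_bump_pos[OF r(1)] by simp
    moreover have "(\<integral>p. \<phi> p \<partial>lborel) = 0" if "N = 0"
    proof -
      have "AE p in lborel. (\<phi> p)\<^sup>2 = 0"
        using integral_nonneg_eq_0_iff_AE[OF compactly_supported_integrable[OF compactly_supported_power2[OF cs(1)]]] that
        by (simp add: N_def)
      then show ?thesis by (intro integral_eq_zero_AE) simp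
    qed
    moreover have "0 \<le> N" by (simp add: N_def)
    ultimately show ?thesis by fastforce
  qed
  have "C1_compact U (\<lambda>p. (1 / sqrt N) * \<phi> p + 0 * \<phi> p) (\<lambda>p. (1 / sqrt N) *\<^sub>R G p + 0 *\<^sub>R G p)"
    by (rule C1_compact_lincomb[OF C C])
  moreover have "(\<integral>p. ((1 / sqrt N) * \<phi> p + 0 * \<phi> p)\<^sup>2 \<partial>lborel) = 1"
    using \<open>N > 0\<close> by (simp add: power_divide flip: N_def)
  ultimately show ?thesis by blast
qed

lemma ground_energy_alt: "ground_energy U V = Inf {energy \<phi> G | \<phi> G. C1_compact U \<phi> G \<and> (\<integral>p. (\<phi> p)\<^sup>2 \<partial>lborel) = 1}"
  by (simp add: ground_energy_def energy_def)

lemma ground_energy_approx: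
  assumes "ground_energy U V < t"
  obtains \<phi> G where "C1_compact U \<phi> G" "(\<integral>p. (\<phi> p)\<^sup>2 \<partial>lborel) = 1" "energy \<phi> G < t"
proof -
  have "\<exists>x\<in>{energy \<phi> G | \<phi> G. C1_compact U \<phi> G \<and> (\<integral>p. (\<phi> p)\<^sup>2 \<partial>lborel) = 1}. x < t"
    using assms exists_unit unfolding ground_energy_alt by (intro cInf_lessD) auto
  then show ?thesis using that by blast
qed

lemma ground_energy_greatest:
  assumes "\<And>\<phi> G. C1_compact U \<phi> G \<Longrightarrow> (\<integral>p. (\<phi> p)\<^sup>2 \<partial>lborel) = 1 \<Longrightarrow> c \<le> energy \<phi> G"
  shows "c \<le> ground_energy U V"
  unfolding ground_energy_alt using exists_unit assms by (intro cInf_greatest) auto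

lemma ground_energy_le:
  assumes C: "C1_compact U \<phi> G"
  shows "ground_energy U V * (\<integral>p. (\<phi> p)\<^sup>2 \<partial>lborel) \<le> energy \<phi> G"
proof (cases "(\<integral>p. (\<phi> p)\<^sup>2 \<partial>lborel) = 0")
  case True
  then show ?thesis using energy_nonneg[OF C] by simp
next
  case False
  define N where "N = (\<integral>p. (\<phi> p)\<^sup>2 \<partial>lborel)"
  have "0 \<le> N" by (simp add: N_def)
  then have N: "N > 0" using False unfolding N_def by linarith
  have C': "C1_compact U (\<lambda>p. (1 / sqrt N) * \<phi> p) (\<lambda>p. (1 / sqrt N) *\<^sub>R G p)"
    using C1_compact_lincomb[OF C C, of "1 / sqrt N" 0] by simp
  have "ground_energy U V \<le> energy (\<lambda>p. (1 / sqrt N) * \<phi> p) (\<lambda>p. (1 / sqrt N) *\<^sub>R G p)"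
    unfolding ground_energy_alt
  proof (rule cInf_lower)
    show "bdd_below {energy \<phi> G | \<phi> G. C1_compact U \<phi> G \<and> (\<integral>p. (\<phi> p)\<^sup>2 \<partial>lborel) = 1}"
      using energy_nonneg by (intro bdd_belowI[of _ 0]) auto
    have "(\<integral>p. ((1 / sqrt N) * \<phi> p)\<^sup>2 \<partial>lborel) = 1"
      using N by (simp add: power_divide flip: N_def)
    with C' show "energy (\<lambda>p. (1 / sqrt N) * \<phi> p) (\<lambda>p. (1 / sqrt N) *\<^sub>R G p) \<in> {energy \<phi> G | \<phi> G. C1_compact U \<phi> G \<and> (\<integral>p. (\<phi> p)\<^sup>2 \<partial>lborel) = 1}"
      by blast
  qed
  also have "\<dots> = energy \<phi> G / N" unfolding energy_scale[OF C] using N by (simp add: power_divide)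
  finally show ?thesis using N by (simp add: N_def field_simps)
qed

text \<open>
  The nonnegative quadratic form whose kernel consists of the ground states, and its polarization.
\<close>

definition "gap \<phi> G = energy \<phi> G - ground_energy U V * (\<integral>p. (\<phi> p)\<^sup>2 \<partial>lborel)"

definition "form \<phi> G \<eta> H = (\<integral>p. state \<phi> G p \<bullet> state \<eta> H p \<partial>M) - (1 + ground_energy U V) * (\<integral>p. \<phi> p * \<eta> p \<partial>M)"

lemma gap_nonneg: "C1_compact U \<phi> G \<Longrightarrow> 0 \<le> gap \<phi> G"
  using ground_energy_le by (simp add: gap_def)

lemma gap_alt:
  "C1_compact U \<phi> G \<Longrightarrow> gap \<phi> G = (\<integral>p. (norm (state \<phi> G p))\<^sup>2 \<partial>M) - (1 + ground_energy U V) * (\<integral>p. (\<phi> p)\<^sup>2 \<partial>M)"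
  by (simp add: gap_def norm_state_integral integral_M_power2 algebra_simps)

lemma gap_lincomb:
  assumes C: "C1_compact U \<phi> G" "C1_compact U \<eta> H"
  shows "gap (\<lambda>p. \<phi> p + t * \<eta> p) (\<lambda>p. G p + t *\<^sub>R H p) = gap \<phi> G + 2 * t * form \<phi> G \<eta> H + t\<^sup>2 * gap \<eta> H"
proof -
  note s = C1_square_integrable[OF C(1)] C1_square_integrable[OF C(2)]
  have C': "C1_compact U (\<lambda>p. \<phi> p + t * \<eta> p) (\<lambda>p. G p + t *\<^sub>R H p)"
    using C1_compact_lincomb[OF C, of 1 t] by simp
  have "(norm (state (\<lambda>p. \<phi> p + t * \<eta> p) (\<lambda>p. G p + t *\<^sub>R H p) p))\<^sup>2
      = (norm (state \<phi> G p))\<^sup>2 + 2 * t * (state \<phi> G p \<bullet> state \<eta> H p) + t\<^sup>2 * (norm (state \<eta> H p))\<^sup>2" for p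
  proof -
    have "state (\<lambda>p. \<phi> p + t * \<eta> p) (\<lambda>p. G p + t *\<^sub>R H p) p = state \<phi> G p + t *\<^sub>R state \<eta> H p"
      by (simp add: state_def algebra_simps)
    then show ?thesis
      unfolding power2_norm_eq_inner by (simp add: inner_add_left inner_add_right inner_commute power2_eq_square algebra_simps)
  qed
  then have 1: "(\<integral>p. (norm (state (\<lambda>p. \<phi> p + t * \<eta> p) (\<lambda>p. G p + t *\<^sub>R H p) p))\<^sup>2 \<partial>M)
    = (\<integral>p. (norm (state \<phi> G p))\<^sup>2 \<partial>M) + 2 * t * (\<integral>p. state \<phi> G p \<bullet> state \<eta> H p \<partial>M) + t\<^sup>2 * (\<integral>p. (norm (state \<eta> H p))\<^sup>2 \<partial>M)"
    using s square_integrable_inner[OF s(1,3)] by (simp add: square_integrable_def)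
  have "(\<lambda>p. (\<phi> p + t * \<eta> p)\<^sup>2) = (\<lambda>p. (\<phi> p)\<^sup>2 + 2 * t * (\<phi> p * \<eta> p) + t\<^sup>2 * (\<eta> p)\<^sup>2)"
    by (auto simp: power2_eq_square algebra_simps)
  then have 2: "(\<integral>p. (\<phi> p + t * \<eta> p)\<^sup>2 \<partial>M) = (\<integral>p. (\<phi> p)\<^sup>2 \<partial>M) + 2 * t * (\<integral>p. \<phi> p * \<eta> p \<partial>M) + t\<^sup>2 * (\<integral>p. (\<eta> p)\<^sup>2 \<partial>M)"
    using s square_integrable_inner[OF s(2,4)] by (simp add: square_integrable_def)
  show ?thesis
    unfolding gap_alt[OF C'] gap_alt[OF C(1)] gap_alt[OF C(2)] form_def 1 2 by (simp add: algebra_simps)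
qed

lemma form_Cauchy_Schwarz:
  assumes "C1_compact U \<phi> G" "C1_compact U \<eta> H"
  shows "(form \<phi> G \<eta> H)\<^sup>2 \<le> gap \<phi> G * gap \<eta> H"
proof (rule nonneg_quadratic_discriminant)
  fix t
  have "C1_compact U (\<lambda>p. \<phi> p + t * \<eta> p) (\<lambda>p. G p + t *\<^sub>R H p)"
    using C1_compact_lincomb[OF assms, of 1 t] by simp
  then show "0 \<le> gap \<phi> G + 2 * t * form \<phi> G \<eta> H + t\<^sup>2 * gap \<eta> H"
    using gap_nonneg gap_lincomb[OF assms] by metis
qed

text \<open>
  By Rellich's theorem a minimizing sequence may be taken to converge in \<open>L\<^sup>2\<close>.  The parallelogram law for the
  gap form then makes it Cauchy in the form norm.
\<close>

lemma minimizing_sequence: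
  obtains \<phi> G where "\<And>n::nat. C1_compact U (\<phi> n) (G n)" "\<And>n. (\<integral>p. (\<phi> n p)\<^sup>2 \<partial>lborel) = 1"
    "(\<lambda>n. gap (\<phi> n) (G n)) \<longlonglongrightarrow> 0"
    "\<And>e. 0 < e \<Longrightarrow> \<exists>N. \<forall>m\<ge>N. \<forall>n\<ge>N. (\<integral>p. (norm (state (\<phi> m) (G m) p - state (\<phi> n) (G n) p))\<^sup>2 \<partial>M) < e"
proof -
  let ?L = "ground_energy U V"
  have "\<exists>\<phi>G. \<forall>n. C1_compact U (fst (\<phi>G n)) (snd (\<phi>G n)) \<and> (\<integral>p. (fst (\<phi>G n) p)\<^sup>2 \<partial>lborel) = 1 \<and> energy (fst (\<phi>G n)) (snd (\<phi>G n)) < ?L + 1 / real (Suc n)"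
  proof (rule choice, rule allI)
    fix n
    have "?L < ?L + 1 / real (Suc n)" by simp
    then obtain \<phi> G where "C1_compact U \<phi> G" "(\<integral>p. (\<phi> p)\<^sup>2 \<partial>lborel) = 1" "energy \<phi> G < ?L + 1 / real (Suc n)"
      by (rule ground_energy_approx)
    then show "\<exists>x. C1_compact U (fst x) (snd x) \<and> (\<integral>p. (fst x p)\<^sup>2 \<partial>lborel) = 1 \<and> energy (fst x) (snd x) < ?L + 1 / real (Suc n)"
      by (intro exI[of _ "(\<phi>, G)"]) simp
  qed
  then obtain \<phi>G where \<phi>G: "\<And>n. C1_compact U (fst (\<phi>G n)) (snd (\<phi>G n)) \<and> (\<integral>p. (fst (\<phi>G n) p)\<^sup>2 \<partial>lborel) = 1 \<and> energy (fst (\<phi>G n)) (snd (\<phi>G n)) < ?L + 1 / real (Suc n)"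
    by blast
  define \<phi> G where "\<phi> n = fst (\<phi>G n)" and "G n = snd (\<phi>G n)" for n
  have C: "C1_compact U (\<phi> n) (G n)" and N1: "(\<integral>p. (\<phi> n p)\<^sup>2 \<partial>lborel) = 1"
    and En: "energy (\<phi> n) (G n) < ?L + 1 / real (Suc n)" for n
    unfolding \<phi>_def G_def using \<phi>G[of n] by auto
  have L0: "0 \<le> ?L" using energy_nonneg by (intro ground_energy_greatest) auto
  have gradB: "(\<integral>p. (norm (G n p))\<^sup>2 \<partial>lborel) \<le> ?L + 1" for n
  proof -
    have "1 / real (Suc n) \<le> 1" by simp
    then show ?thesis using En[of n] V_integral_nonneg[of "\<phi> n"] unfolding energy_alt[OF C] by linarith
  qed
  have B1: "(\<integral>p. (\<phi> n p)\<^sup>2 \<partial>lborel) \<le> ?L + 1" for n using N1[of n] L0 by simp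
  obtain r where r: "strict_mono (r :: nat \<Rightarrow> nat)"
    and Cau: "\<And>e. 0 < e \<Longrightarrow> \<exists>N. \<forall>m\<ge>N. \<forall>n\<ge>N. (\<integral>p. (\<phi> (r m) p - \<phi> (r n) p)\<^sup>2 \<partial>lborel) < e"
    by (rule Rellich[OF bounded_U C B1 gradB]) (rule that)
  have gap: "gap (\<phi> n) (G n) < 1 / real (Suc n)" for n using En[of n] by (simp add: gap_def N1)
  have gr: "(\<lambda>n. gap (\<phi> (r n)) (G (r n))) \<longlonglongrightarrow> 0"
  proof (rule tendsto_sandwich[OF always_eventually always_eventually tendsto_const])
    show "\<forall>n. gap (\<phi> (r n)) (G (r n)) \<le> 1 / real (Suc n)"
    proof
      fix n
      have "1 / real (Suc (r n)) \<le> 1 / real (Suc n)" using seq_suble[OF r, of n] by (simp add: frac_le)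
      then show "gap (\<phi> (r n)) (G (r n)) \<le> 1 / real (Suc n)" using gap[of "r n"] by simp
    qed
    show "(\<lambda>n. 1 / real (Suc n)) \<longlonglongrightarrow> 0" using LIMSEQ_inverse_real_of_nat by (simp add: inverse_eq_divide)
  qed (simp add: gap_nonneg C)
  show ?thesis
  proof (rule that[of "\<lambda>n. \<phi> (r n)" "\<lambda>n. G (r n)"])
    fix e :: real assume e: "0 < e"
    define e' where "e' = e / (2 * (?L + 1))"
    have e': "0 < e'" "(1 + ?L) * e' = e / 2" using e L0 by (auto simp: e'_def field_simps)
    obtain N1 where N1: "\<And>m n. m \<ge> N1 \<Longrightarrow> n \<ge> N1 \<Longrightarrow> (\<integral>p. (\<phi> (r m) p - \<phi> (r n) p)\<^sup>2 \<partial>lborel) < e'"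
      using Cau[OF e'(1)] by blast
    have "eventually (\<lambda>n. gap (\<phi> (r n)) (G (r n)) < e / 8) sequentially" using gr e by (intro order_tendstoD) auto
    then obtain N2 where N2: "\<And>n. n \<ge> N2 \<Longrightarrow> gap (\<phi> (r n)) (G (r n)) < e / 8" by (auto simp: eventually_sequentially)
    have "(\<integral>p. (norm (state (\<phi> (r m)) (G (r m)) p - state (\<phi> (r n)) (G (r n)) p))\<^sup>2 \<partial>M) < e"
      if mn: "m \<ge> max N1 N2" "n \<ge> max N1 N2" for m n
    proof -
      let ?a = "\<phi> (r m)" and ?A = "G (r m)" and ?b = "\<phi> (r n)" and ?B = "G (r n)"
      have Cd: "C1_compact U (\<lambda>p. ?a p - ?b p) (\<lambda>p. ?A p - ?B p)"
        using C1_compact_lincomb[OF C[of "r m"] C[of "r n"], of 1 "-1"] by simp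
      have Cp: "C1_compact U (\<lambda>p. ?a p + ?b p) (\<lambda>p. ?A p + ?B p)"
        using C1_compact_lincomb[OF C[of "r m"] C[of "r n"], of 1 1] by simp
      have "gap (\<lambda>p. ?a p - ?b p) (\<lambda>p. ?A p - ?B p) + gap (\<lambda>p. ?a p + ?b p) (\<lambda>p. ?A p + ?B p) = 2 * gap ?a ?A + 2 * gap ?b ?B"
        using gap_lincomb[OF C[of "r m"] C[of "r n"], of "-1"] gap_lincomb[OF C[of "r m"] C[of "r n"], of 1] by simp
      then have "gap (\<lambda>p. ?a p - ?b p) (\<lambda>p. ?A p - ?B p) < e / 2"
        using gap_nonneg[OF Cp] N2[of m] N2[of n] mn by simp
      moreover have "(1 + ?L) * (\<integral>p. (?a p - ?b p)\<^sup>2 \<partial>M) \<le> e / 2"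
      proof -
        have "(1 + ?L) * (\<integral>p. (?a p - ?b p)\<^sup>2 \<partial>lborel) \<le> (1 + ?L) * e'"
          using N1[of m n] mn L0 by (intro mult_left_mono) auto
        then show ?thesis unfolding integral_M_power2[OF Cd] e'(2) .
      qed
      ultimately show ?thesis unfolding state_diff using gap_alt[OF Cd] by simp
    qed
    then show "\<exists>N. \<forall>m\<ge>N. \<forall>n\<ge>N. (\<integral>p. (norm (state (\<phi> (r m)) (G (r m)) p - state (\<phi> (r n)) (G (r n)) p))\<^sup>2 \<partial>M) < e"
      by blast
  qed (use C N1 gr in auto)
qed

lemma set_nn_integral_M: "(\<integral>\<^sup>+p\<in>U. f p \<partial>lborel) = (\<integral>\<^sup>+p. f p \<partial>M)"
  unfolding M_def by (subst nn_integral_restrict_space) auto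

lemma AE_M: "(AE p in M. P p) \<longleftrightarrow> (AE p in lborel. p \<in> U \<longrightarrow> P p)"
  unfolding M_def by (rule AE_restrict_space_iff) simp

text \<open>
  The limit of a minimizing sequence is normalized, and the Cauchy-Schwarz inequality for the gap form
  forces the weak equation, because the gap of the sequence tends to zero.
\<close>

lemma ground_energy_eigenvalue: "dirichlet_eigenvalue U V (ground_energy U V)"
proof -
  let ?L = "ground_energy U V"
  obtain \<phi> G where C: "\<And>n::nat. C1_compact U (\<phi> n) (G n)" and N1: "\<And>n. (\<integral>p. (\<phi> n p)\<^sup>2 \<partial>lborel) = 1"
    and gap0: "(\<lambda>n. gap (\<phi> n) (G n)) \<longlonglongrightarrow> 0"
    and Cau: "\<And>e. 0 < e \<Longrightarrow> \<exists>N. \<forall>m\<ge>N. \<forall>n\<ge>N. (\<integral>p. (norm (state (\<phi> m) (G m) p - state (\<phi> n) (G n) p))\<^sup>2 \<partial>M) < e"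
    by (rule minimizing_sequence) (rule that)
  note si = C1_square_integrable[OF C]
  obtain F r where F: "F \<in> borel_measurable M" and r: "strict_mono (r :: nat \<Rightarrow> nat)"
    and ae: "AE p in M. (\<lambda>k. state (\<phi> (r k)) (G (r k)) p) \<longlonglongrightarrow> F p"
    and lim: "(\<lambda>n. \<integral>\<^sup>+p. ennreal ((norm (state (\<phi> n) (G n) p - F p))\<^sup>2) \<partial>M) \<longlonglongrightarrow> 0"
  proof (rule L2_complete[where M = M and f = "\<lambda>n. state (\<phi> n) (G n)"])
    show "square_integrable M (state (\<phi> n) (G n))" for n by (rule si(1))
    show "\<exists>N. \<forall>m\<ge>N. \<forall>n\<ge>N. (\<integral>p. (norm (state (\<phi> m) (G m) p - state (\<phi> n) (G n) p))\<^sup>2 \<partial>M) < e" if "0 < e" for e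
      by (rule Cau[OF that])
  qed (rule that)
  define u g where "u p = fst (snd (F p))" and "g p = fst (F p)" for p
  have m: "u \<in> borel_measurable M" "g \<in> borel_measurable M"
    unfolding u_def[abs_def] g_def[abs_def]
    by (rule measurable_compose[OF F], intro borel_measurable_continuous_onI continuous_intros)+
  have Fs: "AE p in M. F p = state u g p"
    using ae
  proof eventually_elim
    case (elim p)
    have "(\<lambda>k. \<phi> (r k) p) \<longlonglongrightarrow> u p"
      using tendsto_fst[OF tendsto_snd[OF elim]] by (simp add: state_def u_def)
    then have "(\<lambda>k. sqrt (V p) * \<phi> (r k) p) \<longlonglongrightarrow> sqrt (V p) * u p" by (rule tendsto_mult_left)
    moreover have "(\<lambda>k. sqrt (V p) * \<phi> (r k) p) \<longlonglongrightarrow> snd (snd (F p))"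
      using tendsto_snd[OF tendsto_snd[OF elim]] by (simp add: state_def)
    ultimately have "snd (snd (F p)) = sqrt (V p) * u p" by (rule LIMSEQ_unique[rotated])
    then show ?case by (simp add: state_def u_def g_def prod_eq_iff)
  qed
  have lim': "(\<lambda>n. \<integral>\<^sup>+p. ennreal ((norm (state (\<phi> n) (G n) p - state u g p))\<^sup>2) \<partial>M) \<longlonglongrightarrow> 0"
  proof -
    have "(\<integral>\<^sup>+p. ennreal ((norm (state (\<phi> n) (G n) p - state u g p))\<^sup>2) \<partial>M) = (\<integral>\<^sup>+p. ennreal ((norm (state (\<phi> n) (G n) p - F p))\<^sup>2) \<partial>M)" for n
      using Fs by (intro nn_integral_cong_AE) auto
    then show ?thesis using lim by (simp only:)
  qed
  have dom: "dirichlet_form_domain U V u g"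
    unfolding dirichlet_form_domain_def set_measurable_M
  proof (intro conjI m exI[of _ \<phi>] exI[of _ G] allI C)
    have eq: "(\<integral>\<^sup>+p\<in>U. ennreal ((norm (G n p - g p))\<^sup>2 + (\<phi> n p - u p)\<^sup>2 + V p * (\<phi> n p - u p)\<^sup>2) \<partial>lborel)
       = (\<integral>\<^sup>+p. ennreal ((norm (state (\<phi> n) (G n) p - state u g p))\<^sup>2) \<partial>M)" for n
      unfolding set_nn_integral_M state_diff by (rule nn_integral_cong) (simp add: norm_state space_M)
    show "(\<lambda>n. \<integral>\<^sup>+p\<in>U. ennreal ((norm (G n p - g p))\<^sup>2 + (\<phi> n p - u p)\<^sup>2 + V p * (\<phi> n p - u p)\<^sup>2) \<partial>lborel) \<longlonglongrightarrow> 0"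
      unfolding eq by (rule lim')
  qed
  note sl = square_integrable_limit[OF si(1) measurable_state[OF m] lim']
  have limu: "(\<lambda>n. \<integral>\<^sup>+p. ennreal ((norm (\<phi> n p - u p))\<^sup>2) \<partial>M) \<longlonglongrightarrow> 0"
  proof (rule tendsto_sandwich[OF always_eventually always_eventually tendsto_const lim'])
    show "\<forall>n. (\<integral>\<^sup>+p. ennreal ((norm (\<phi> n p - u p))\<^sup>2) \<partial>M) \<le> (\<integral>\<^sup>+p. ennreal ((norm (state (\<phi> n) (G n) p - state u g p))\<^sup>2) \<partial>M)"
      unfolding state_diff by (intro allI nn_integral_mono ennreal_leI) (simp add: norm_state space_M V_nonneg)
  qed simp
  note su = square_integrable_limit[OF si(2) m(1) limu]
  have "(\<lambda>n. \<integral>p. (norm (\<phi> n p))\<^sup>2 \<partial>M) \<longlonglongrightarrow> (\<integral>p. (norm (u p))\<^sup>2 \<partial>M)"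
    by (rule L2_norm_tendsto[OF si(2) su])
  then have "(\<lambda>n::nat. 1::real) \<longlonglongrightarrow> (\<integral>p. (u p)\<^sup>2 \<partial>M)" by (simp add: integral_M_power2[OF C] N1)
  then have u1: "(\<integral>p. (u p)\<^sup>2 \<partial>M) = 1" using LIMSEQ_unique tendsto_const by blast
  have nz: "\<not> (AE p in lborel. p \<in> U \<longrightarrow> u p = 0)"
  proof
    assume "AE p in lborel. p \<in> U \<longrightarrow> u p = 0"
    then have "AE p in M. (u p)\<^sup>2 = 0" by (simp add: AE_M)
    then have "(\<integral>p. (u p)\<^sup>2 \<partial>M) = 0" by (rule integral_eq_zero_AE)
    with u1 show False by simp
  qed
  have weak: "(LINT p:U|lborel. g p \<bullet> H p + V p * u p * \<eta> p) = ?L * (LINT p:U|lborel. u p * \<eta> p)" if Ce: "C1_compact U \<eta> H" for \<eta> H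
  proof -
    note se = C1_square_integrable[OF Ce]
    have 1: "(\<lambda>n. \<integral>p. state (\<phi> n) (G n) p \<bullet> state \<eta> H p \<partial>M) \<longlonglongrightarrow> (\<integral>p. state u g p \<bullet> state \<eta> H p \<partial>M)"
      by (rule L2_inner_tendsto[OF si(1) sl]) (use se in auto)
    have 2: "(\<lambda>n. \<integral>p. \<phi> n p \<bullet> \<eta> p \<partial>M) \<longlonglongrightarrow> (\<integral>p. u p \<bullet> \<eta> p \<partial>M)"
      by (rule L2_inner_tendsto[OF si(2) su]) (use se in auto)
    have "(\<lambda>n. form (\<phi> n) (G n) \<eta> H) \<longlonglongrightarrow> (\<integral>p. state u g p \<bullet> state \<eta> H p \<partial>M) - (1 + ?L) * (\<integral>p. u p * \<eta> p \<partial>M)"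
      unfolding form_def using 2 by (intro tendsto_intros 1) simp
    moreover have "(\<lambda>n. form (\<phi> n) (G n) \<eta> H) \<longlonglongrightarrow> 0"
    proof -
      have "(\<lambda>n. (form (\<phi> n) (G n) \<eta> H)\<^sup>2) \<longlonglongrightarrow> 0"
        by (rule tendsto_sandwich[OF _ _ tendsto_const, of _ _ _ "\<lambda>n. gap (\<phi> n) (G n) * gap \<eta> H"])
          (use form_Cauchy_Schwarz[OF C Ce] tendsto_mult_right[OF gap0, of "gap \<eta> H"] in auto)
      then show ?thesis using tendsto_real_sqrt[of "\<lambda>n. (form (\<phi> n) (G n) \<eta> H)\<^sup>2" 0 sequentially] by (simp add: tendsto_rabs_zero_iff)
    qed
    ultimately have eq: "(\<integral>p. state u g p \<bullet> state \<eta> H p \<partial>M) = (1 + ?L) * (\<integral>p. u p * \<eta> p \<partial>M)"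
      using LIMSEQ_unique by fastforce
    have i: "integrable M (\<lambda>p. state u g p \<bullet> state \<eta> H p)" "integrable M (\<lambda>p. u p * \<eta> p)"
      using square_integrable_inner[OF sl(1) se(1)] square_integrable_inner[OF su(1) se(2)] by auto
    have "(\<integral>p. g p \<bullet> H p + V p * u p * \<eta> p \<partial>M) = (\<integral>p. state u g p \<bullet> state \<eta> H p - u p * \<eta> p \<partial>M)"
      by (rule Bochner_Integration.integral_cong) (auto simp: inner_state space_M)
    also have "\<dots> = (1 + ?L) * (\<integral>p. u p * \<eta> p \<partial>M) - (\<integral>p. u p * \<eta> p \<partial>M)" using i eq by simp
    finally show ?thesis unfolding set_integral_M by (simp add: algebra_simps)
  qed
  show ?thesis unfolding dirichlet_eigenvalue_def using dom nz weak by blast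
qed

text \<open>
  Testing the equation with the functions that approximate an eigenfunction \<open>u\<close> identifies the energy of \<open>u\<close> as
  \<open>l\<close> times its squared norm; the gap form is nonnegative on the closure of the test functions.
\<close>

lemma ground_energy_le_eigenvalue:
  assumes "dirichlet_eigenvalue U V l"
  shows "ground_energy U V \<le> l"
proof -
  let ?L = "ground_energy U V"
  from assms obtain u g where dom: "dirichlet_form_domain U V u g" and nz: "\<not> (AE p in lborel. p \<in> U \<longrightarrow> u p = 0)"
    and weak: "\<And>\<eta> H. C1_compact U \<eta> H \<Longrightarrow> (LINT p:U|lborel. g p \<bullet> H p + V p * u p * \<eta> p) = l * (LINT p:U|lborel. u p * \<eta> p)"
    unfolding dirichlet_eigenvalue_def by blast
  from dom obtain \<phi> G where m: "u \<in> borel_measurable M" "g \<in> borel_measurable M" and C: "\<And>n::nat. C1_compact U (\<phi> n) (G n)"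
    and lim0: "(\<lambda>n. \<integral>\<^sup>+p\<in>U. ennreal ((norm (G n p - g p))\<^sup>2 + (\<phi> n p - u p)\<^sup>2 + V p * (\<phi> n p - u p)\<^sup>2) \<partial>lborel) \<longlonglongrightarrow> 0"
    unfolding dirichlet_form_domain_def set_measurable_M by blast
  note si = C1_square_integrable[OF C]
  have eq: "(\<integral>\<^sup>+p\<in>U. ennreal ((norm (G n p - g p))\<^sup>2 + (\<phi> n p - u p)\<^sup>2 + V p * (\<phi> n p - u p)\<^sup>2) \<partial>lborel)
       = (\<integral>\<^sup>+p. ennreal ((norm (state (\<phi> n) (G n) p - state u g p))\<^sup>2) \<partial>M)" for n
    unfolding set_nn_integral_M state_diff by (rule nn_integral_cong) (simp add: norm_state space_M)
  have lim': "(\<lambda>n. \<integral>\<^sup>+p. ennreal ((norm (state (\<phi> n) (G n) p - state u g p))\<^sup>2) \<partial>M) \<longlonglongrightarrow> 0"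
    using lim0 unfolding eq .
  note sl = square_integrable_limit[OF si(1) measurable_state[OF m] lim']
  have limu: "(\<lambda>n. \<integral>\<^sup>+p. ennreal ((norm (\<phi> n p - u p))\<^sup>2) \<partial>M) \<longlonglongrightarrow> 0"
  proof (rule tendsto_sandwich[OF always_eventually always_eventually tendsto_const lim'])
    show "\<forall>n. (\<integral>\<^sup>+p. ennreal ((norm (\<phi> n p - u p))\<^sup>2) \<partial>M) \<le> (\<integral>\<^sup>+p. ennreal ((norm (state (\<phi> n) (G n) p - state u g p))\<^sup>2) \<partial>M)"
      unfolding state_diff by (intro allI nn_integral_mono ennreal_leI) (simp add: norm_state space_M V_nonneg)
  qed simp
  note su = square_integrable_limit[OF si(2) m(1) limu]
  define A B where "A = (\<integral>p. (norm (state u g p))\<^sup>2 \<partial>M)" and "B = (\<integral>p. (u p)\<^sup>2 \<partial>M)"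
  have a: "(\<lambda>n. \<integral>p. (norm (state (\<phi> n) (G n) p))\<^sup>2 \<partial>M) \<longlonglongrightarrow> A"
    unfolding A_def by (rule L2_norm_tendsto[OF si(1) sl])
  have b: "(\<lambda>n. \<integral>p. (\<phi> n p)\<^sup>2 \<partial>M) \<longlonglongrightarrow> B"
    unfolding B_def using L2_norm_tendsto[OF si(2) su] by simp
  have "(\<lambda>n. gap (\<phi> n) (G n)) \<longlonglongrightarrow> A - (1 + ?L) * B"
    unfolding gap_alt[OF C] by (intro tendsto_intros a b)
  then have 1: "0 \<le> A - (1 + ?L) * B"
    by (rule LIMSEQ_le_const) (auto simp: gap_nonneg C)
  have c0: "(\<lambda>n::nat. \<integral>p. (norm (state u g p - state u g p))\<^sup>2 \<partial>M) \<longlonglongrightarrow> 0" "(\<lambda>n::nat. \<integral>p. (norm (u p - u p))\<^sup>2 \<partial>M) \<longlonglongrightarrow> 0" by auto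
  have a': "(\<lambda>n. \<integral>p. state u g p \<bullet> state (\<phi> n) (G n) p \<partial>M) \<longlonglongrightarrow> A"
    unfolding A_def power2_norm_eq_inner by (rule L2_inner_tendsto[OF sl(1) sl(1) c0(1) si(1) sl])
  have b': "(\<lambda>n. \<integral>p. u p * \<phi> n p \<partial>M) \<longlonglongrightarrow> B"
    using L2_inner_tendsto[OF su(1) su(1) c0(2) si(2) su] by (simp add: B_def power2_eq_square)
  have "(\<integral>p. state u g p \<bullet> state (\<phi> n) (G n) p \<partial>M) = (1 + l) * (\<integral>p. u p * \<phi> n p \<partial>M)" for n
  proof -
    have i: "integrable M (\<lambda>p. state u g p \<bullet> state (\<phi> n) (G n) p)" "integrable M (\<lambda>p. u p * \<phi> n p)"
      using square_integrable_inner[OF sl(1) si(1)] square_integrable_inner[OF su(1) si(2)] by auto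
    have "l * (\<integral>p. u p * \<phi> n p \<partial>M) = (\<integral>p. g p \<bullet> G n p + V p * u p * \<phi> n p \<partial>M)"
      using weak[OF C] by (simp add: set_integral_M)
    also have "\<dots> = (\<integral>p. state u g p \<bullet> state (\<phi> n) (G n) p - u p * \<phi> n p \<partial>M)"
      by (rule Bochner_Integration.integral_cong) (auto simp: inner_state space_M)
    also have "\<dots> = (\<integral>p. state u g p \<bullet> state (\<phi> n) (G n) p \<partial>M) - (\<integral>p. u p * \<phi> n p \<partial>M)" using i by simp
    finally show ?thesis by (simp add: algebra_simps)
  qed
  then have "(\<lambda>n. (1 + l) * (\<integral>p. u p * \<phi> n p \<partial>M)) \<longlonglongrightarrow> A" using a' by simp
  moreover have "(\<lambda>n. (1 + l) * (\<integral>p. u p * \<phi> n p \<partial>M)) \<longlonglongrightarrow> (1 + l) * B" by (intro tendsto_intros b')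
  ultimately have 2: "A = (1 + l) * B" by (rule LIMSEQ_unique)
  have "B \<noteq> 0"
  proof
    assume "B = 0"
    then have "AE p in M. (u p)\<^sup>2 = 0"
      using su(1) integral_nonneg_eq_0_iff_AE[of M "\<lambda>p. (u p)\<^sup>2"] by (simp add: B_def square_integrable_def)
    then show False using nz by (simp add: AE_M)
  qed
  moreover have "0 \<le> B" by (simp add: B_def)
  ultimately have "0 < B" by simp
  moreover have "0 \<le> (l - ?L) * B" using 1 2 by (simp add: algebra_simps)
  ultimately show ?thesis by (simp add: zero_le_mult_iff)
qed

theorem first_dirichlet_eigenvalue_eq: "first_dirichlet_eigenvalue U V = ground_energy U V"
  unfolding first_dirichlet_eigenvalue_def
  using ground_energy_eigenvalue ground_energy_le_eigenvalue by (rule Least_equality)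

end

section \<open>Trial functions with square integrable difference quotients\<close>

context schroedinger
begin

text \<open>
  Mollification does not increase the \<open>L\<^sup>2\<close> norm of a difference quotient, and Fatou's lemma passes to the
  derivative of the mollified function.
\<close>

lemma mollified_trial:
  fixes f :: "'a \<Rightarrow> real" and E :: "'a \<Rightarrow> real"
  assumes f: "compactly_supported f" and e: "0 < e"
    and dq: "\<And>i d. i \<in> Basis \<Longrightarrow> 0 < d \<Longrightarrow> \<exists>r0>0. \<forall>r. 0 < r \<and> r < r0 \<longrightarrow> (\<integral>p. (f (p + r *\<^sub>R i) - f p)\<^sup>2 \<partial>lborel) \<le> r\<^sup>2 * (E i + d)"
  shows "(\<integral>p. (norm (mollify_gradient e f p))\<^sup>2 \<partial>lborel) \<le> (\<Sum>i\<in>Basis. E i)"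
proof -
  let ?F = "mollify e f" and ?G = "mollify_gradient e f"
  obtain K where K: "compact K" "\<And>x. x \<notin> K \<Longrightarrow> f x = 0" using f by (auto simp: compactly_supported_def)
  have C: "C1_compact UNIV ?F ?G" by (rule C1_compact_mollify[OF f e K]) auto
  note cs = C1_compact_compactly_supported[OF C]
  have csi: "compactly_supported (\<lambda>p. (?G p \<bullet> i)\<^sup>2)" for i
    by (intro compactly_supported_power2 compactly_supported_inner cs continuous_intros)
  have part: "(\<integral>p. (?G p \<bullet> i)\<^sup>2 \<partial>lborel) \<le> E i + d" if i: "i \<in> Basis" and d: "0 < d" for i d
  proof -
    obtain r0 where r0: "0 < r0" "\<And>r. 0 < r \<Longrightarrow> r < r0 \<Longrightarrow> (\<integral>p. (f (p + r *\<^sub>R i) - f p)\<^sup>2 \<partial>lborel) \<le> r\<^sup>2 * (E i + d)"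
      using dq[OF i d] by blast
    define r where "r n = r0 / real (n + 2)" for n
    have r: "0 < r n" "r n < r0" for n using r0(1) by (auto simp: r_def field_simps intro!: add_pos_nonneg)
    have rlim: "r \<longlonglongrightarrow> 0" unfolding r_def by real_asymp
    define D where "D n p = (?F (p + r n *\<^sub>R i) - ?F p) / r n" for n p
    have csD: "compactly_supported (\<lambda>p. (D n p)\<^sup>2)" for n
    proof -
      have "compactly_supported (\<lambda>p. (1 / r n) *\<^sub>R (?F (p + r n *\<^sub>R i) - ?F p))"
        by (intro compactly_supported_scaleR compactly_supported_diff compactly_supported_shift cs)
      then show ?thesis unfolding D_def by (intro compactly_supported_power2) simp
    qed
    have DB: "(\<integral>p. (D n p)\<^sup>2 \<partial>lborel) \<le> E i + d" for n
    proof -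
      define h where "h p = f (p + r n *\<^sub>R i) - f p" for p
      have h: "compactly_supported h" unfolding h_def by (intro compactly_supported_diff compactly_supported_shift f)
      have eq: "?F (p + r n *\<^sub>R i) - ?F p = mollify e h p" for p
      proof -
        note im = integrable_mollifier_mult[OF continuous_shift[OF compactly_supported_continuous[OF f]] e]
        have "?F (p + r n *\<^sub>R i) - ?F p = (\<integral>q. mollifier e q * f (p + r n *\<^sub>R i + q) - mollifier e q * f (p + q) \<partial>lborel)"
          unfolding mollify_def by (rule Bochner_Integration.integral_diff[OF im im, symmetric])
        also have "\<dots> = mollify e h p"
          unfolding mollify_def by (rule Bochner_Integration.integral_cong) (auto simp: h_def algebra_simps)
        finally show ?thesis .
      qed
      have "(\<integral>p. (D n p)\<^sup>2 \<partial>lborel) = (\<integral>p. (mollify e h p)\<^sup>2 \<partial>lborel) / (r n)\<^sup>2"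
        unfolding D_def eq by (simp add: power_divide)
      also have "\<dots> \<le> (\<integral>p. (h p)\<^sup>2 \<partial>lborel) / (r n)\<^sup>2"
        by (intro divide_right_mono mollify_L2_le h e) auto
      also have "\<dots> \<le> ((r n)\<^sup>2 * (E i + d)) / (r n)\<^sup>2"
        unfolding h_def using r0(2)[OF r] by (intro divide_right_mono) auto
      also have "\<dots> = E i + d" using r(1)[of n] by simp
      finally show ?thesis .
    qed
    have lim: "(\<lambda>n. D n p) \<longlonglongrightarrow> ?G p \<bullet> i" for p
    proof -
      have d1: "(?F has_derivative (\<lambda>h. h \<bullet> ?G p)) (at (p + 0 *\<^sub>R i))"
        using C by (auto simp: C1_compact_def gderiv_def)
      have d2: "((\<lambda>t. p + t *\<^sub>R i) has_derivative (\<lambda>s. s *\<^sub>R i)) (at 0)" by (auto intro!: derivative_eq_intros)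
      have "((\<lambda>t. ?F (p + t *\<^sub>R i)) has_derivative (\<lambda>s. (s *\<^sub>R i) \<bullet> ?G p)) (at 0)"
        by (rule has_derivative_compose[OF d2 d1])
      moreover have "(\<lambda>s. (s *\<^sub>R i) \<bullet> ?G p) = (*) (?G p \<bullet> i)" by (auto simp: inner_commute mult.commute)
      ultimately have "((\<lambda>t. ?F (p + t *\<^sub>R i)) has_field_derivative (?G p \<bullet> i)) (at 0)"
        by (simp add: has_field_derivative_def)
      then have "((\<lambda>h. (?F (p + h *\<^sub>R i) - ?F p) / h) \<longlongrightarrow> ?G p \<bullet> i) (at 0)"
        by (simp add: DERIV_def)
      moreover have "filterlim r (at 0) sequentially"
        using rlim r(1) by (auto simp: filterlim_at less_imp_neq[symmetric] eventually_sequentially intro!: exI[of _ 0] dest: less_imp_neq)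
      ultimately show ?thesis unfolding D_def by (rule filterlim_compose)
    qed
    have EI: "0 \<le> E i + d" using DB[of 0] by (rule order_trans[rotated]) (auto intro!: integral_nonneg_AE)
    show ?thesis
    proof (rule integral_le_of_nn_integral_le[OF compactly_supported_integrable[OF csi] _ _ EI])
      have "(\<integral>\<^sup>+p. ennreal ((?G p \<bullet> i)\<^sup>2) \<partial>lborel) = (\<integral>\<^sup>+p. liminf (\<lambda>n. ennreal ((D n p)\<^sup>2)) \<partial>lborel)"
      proof (rule nn_integral_cong)
        fix p
        have "(\<lambda>n. ennreal ((D n p)\<^sup>2)) \<longlonglongrightarrow> ennreal ((?G p \<bullet> i)\<^sup>2)"
          by (rule tendsto_ennrealI[OF tendsto_power[OF lim]])
        then show "ennreal ((?G p \<bullet> i)\<^sup>2) = liminf (\<lambda>n. ennreal ((D n p)\<^sup>2))"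
          by (rule lim_imp_Liminf[OF trivial_limit_sequentially, symmetric])
      qed
      also have "\<dots> \<le> liminf (\<lambda>n. \<integral>\<^sup>+p. ennreal ((D n p)\<^sup>2) \<partial>lborel)"
        using compactly_supported_measurable[OF csD] by (intro nn_integral_liminf) auto
      also have "\<dots> \<le> limsup (\<lambda>n. \<integral>\<^sup>+p. ennreal ((D n p)\<^sup>2) \<partial>lborel)" by (rule Liminf_le_Limsup) simp
      also have "\<dots> \<le> ennreal (E i + d)"
        by (rule Limsup_bounded, rule always_eventually, rule allI, rule nn_integral_le_of_integral_le)
          (use compactly_supported_integrable[OF csD] DB in auto)
      finally show "(\<integral>\<^sup>+p. ennreal ((?G p \<bullet> i)\<^sup>2) \<partial>lborel) \<le> ennreal (E i + d)" .
    qed auto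
  qed
  have part': "(\<integral>p. (?G p \<bullet> i)\<^sup>2 \<partial>lborel) \<le> E i" if i: "i \<in> Basis" for i
    by (rule field_le_epsilon) (rule part[OF i])
  have "(\<lambda>p. (norm (?G p))\<^sup>2) = (\<lambda>p. \<Sum>i\<in>Basis. (?G p \<bullet> i)\<^sup>2)"
    unfolding power2_norm_eq_inner by (rule ext, subst euclidean_inner) (simp add: power2_eq_square)
  then have "(\<integral>p. (norm (?G p))\<^sup>2 \<partial>lborel) = (\<Sum>i\<in>Basis. \<integral>p. (?G p \<bullet> i)\<^sup>2 \<partial>lborel)"
    using compactly_supported_integrable[OF csi] by simp
  also have "\<dots> \<le> (\<Sum>i\<in>Basis. E i)" by (rule sum_mono) (rule part')
  finally show ?thesis .
qed

text \<open>
  A continuous function with compact support is admissible in the Rayleigh quotient as soon as its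
  difference quotients are bounded in \<open>L\<^sup>2\<close>; the error \<open>d\<close> lets the bound hold only in the limit of small
  steps.  The mollifications are test functions and converge uniformly.
\<close>

lemma trial_function:
  fixes f :: "'a \<Rightarrow> real" and E :: "'a \<Rightarrow> real"
  assumes cont: "continuous_on UNIV f" and K: "compact K" "K \<subseteq> U" "\<And>x. x \<notin> K \<Longrightarrow> f x = 0"
    and dq: "\<And>i d. i \<in> Basis \<Longrightarrow> 0 < d \<Longrightarrow> \<exists>r0>0. \<forall>r. 0 < r \<and> r < r0 \<longrightarrow> (\<integral>p. (f (p + r *\<^sub>R i) - f p)\<^sup>2 \<partial>lborel) \<le> r\<^sup>2 * (E i + d)"
  shows "ground_energy U V * (\<integral>p. (f p)\<^sup>2 \<partial>lborel) \<le> (\<Sum>i\<in>Basis. E i) + (\<integral>p. V p * (f p)\<^sup>2 \<partial>M)"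
proof -
  have f: "compactly_supported f" by (rule compactly_supportedI[OF cont K(1,3)])
  obtain e0 where e0: "0 < e0" "(\<Union>x\<in>K. cball x e0) \<subseteq> U"
    using compact_subset_open_imp_cball_epsilon_subset[OF K(1) open_U K(2)] by blast
  define K' where "K' = {x + y | x y. x \<in> K \<and> y \<in> cball 0 e0}"
  have K': "compact K'" unfolding K'_def by (rule compact_sums[OF K(1) compact_cball])
  have K'U: "K' \<subseteq> U"
  proof
    fix z assume "z \<in> K'"
    then obtain x y where "z = x + y" "x \<in> K" "norm y \<le> e0" by (auto simp: K'_def)
    then have "z \<in> cball x e0" "x \<in> K" by (auto simp: dist_norm)
    then show "z \<in> U" using e0(2) by blast
  qed
  obtain B where B: "B > 0" "\<And>x. norm (f x) \<le> B" using compactly_supported_bounded[OF f] by blast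
  obtain BV where BV: "\<And>p. p \<in> K' \<Longrightarrow> V p \<le> BV" using V_bounded[OF K' K'U] by blast
  define e where "e n = e0 / real (n + 2)" for n
  have e: "0 < e n" "e n < e0" for n using e0(1) by (auto simp: e_def field_simps intro!: add_pos_nonneg)
  have elim: "e \<longlonglongrightarrow> 0" unfolding e_def by real_asymp
  define F where "F n = mollify (e n) f" for n
  have C: "C1_compact U (F n) (mollify_gradient (e n) f)" for n
    unfolding F_def
  proof (rule C1_compact_mollify[OF f e(1) K(1) K(3)])
    have "{x + y |x y. x \<in> K \<and> y \<in> cball 0 (e n)} \<subseteq> K'"
      using e(2)[of n] by (fastforce simp: K'_def)
    then show "{x + y |x y. x \<in> K \<and> y \<in> cball 0 (e n)} \<subseteq> U" using K'U by blast
  qed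
  have F0: "F n p = 0" if "p \<notin> K'" for n p
    unfolding F_def
  proof (rule mollify_zero[OF f e(1) K(3)])
    have "{x + y |x y. x \<in> K \<and> y \<in> cball 0 (e n)} \<subseteq> K'"
      using e(2)[of n] by (fastforce simp: K'_def)
    then show "p \<notin> {x + y |x y. x \<in> K \<and> y \<in> cball 0 (e n)}" using that by blast
  qed
  have FB: "\<bar>F n p\<bar> \<le> 3 * B" for n p
  proof -
    have "\<bar>F n p - f p\<bar> \<le> 2 * B" unfolding F_def
    proof (rule mollify_close[OF f e(1)])
      fix q show "\<bar>f (p + q) - f p\<bar> \<le> 2 * B" using B(2)[of "p + q"] B(2)[of p] by simp
    qed
    then show ?thesis using B(2)[of p] by simp
  qed
  have Flim: "(\<lambda>n. F n p) \<longlonglongrightarrow> f p" for p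
  proof (rule LIMSEQ_I)
    fix d :: real assume d: "0 < d"
    obtain \<delta> where \<delta>: "\<delta> > 0" "\<And>x y. dist x y < \<delta> \<Longrightarrow> dist (f x) (f y) < d / 2"
      using compactly_supported_uniformly_continuous[OF f, of "d / 2"] d by auto
    have "eventually (\<lambda>n. e n < \<delta>) sequentially" using elim \<delta>(1) by (rule order_tendstoD)
    then obtain N where N: "\<And>n. n \<ge> N \<Longrightarrow> e n < \<delta>" by (auto simp: eventually_sequentially)
    have "norm (F n p - f p) < d" if "n \<ge> N" for n
    proof -
      have "\<bar>F n p - f p\<bar> \<le> d / 2" unfolding F_def
      proof (rule mollify_close[OF f e(1)])
        fix q :: 'a assume "norm q \<le> e n"
        then have "dist (p + q) p < \<delta>" using N[OF that] by (simp add: dist_norm)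
        from \<delta>(2)[OF this] show "\<bar>f (p + q) - f p\<bar> \<le> d / 2" by (simp add: dist_norm)
      qed
      then show ?thesis using d by simp
    qed
    then show "\<exists>no. \<forall>n\<ge>no. norm (F n p - f p) < d" by blast
  qed
  have le: "ground_energy U V * (\<integral>p. (F n p)\<^sup>2 \<partial>lborel) \<le> (\<Sum>i\<in>Basis. E i) + (\<integral>p. V p * (F n p)\<^sup>2 \<partial>M)" for n
    using ground_energy_le[OF C[of n]] mollified_trial[OF f e(1) dq, of n] unfolding energy_alt[OF C] by linarith
  have Fm: "F n \<in> borel_measurable borel" for n
    using compactly_supported_measurable[OF C1_compact_compactly_supported(1)[OF C]] .
  have fm: "f \<in> borel_measurable borel" by (rule compactly_supported_measurable[OF f])
  have fin: "emeasure lborel K' < \<infinity>" by (rule emeasure_compact_finite[OF K'])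
  have K's: "K' \<in> sets borel" using K' by (simp add: compact_imp_closed)
  have iK: "integrable lborel (indicator K' :: 'a \<Rightarrow> real)"
    by (rule integrable_real_indicator[OF _ fin]) (use K's in simp)
  have lim1: "(\<lambda>n. \<integral>p. (F n p)\<^sup>2 \<partial>lborel) \<longlonglongrightarrow> (\<integral>p. (f p)\<^sup>2 \<partial>lborel)"
  proof (rule integral_dominated_convergence[where w = "\<lambda>p. (3 * B)\<^sup>2 * indicator K' p"])
    show "integrable lborel (\<lambda>p. (3 * B)\<^sup>2 * indicator K' p)" using iK by simp
    show "AE p in lborel. (\<lambda>n. (F n p)\<^sup>2) \<longlonglongrightarrow> (f p)\<^sup>2" by (intro AE_I2 tendsto_power Flim)
    show "AE p in lborel. norm ((F n p)\<^sup>2) \<le> (3 * B)\<^sup>2 * indicator K' p" for n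
    proof (rule AE_I2)
      fix p show "norm ((F n p)\<^sup>2) \<le> (3 * B)\<^sup>2 * indicator K' p"
        using power_mono[OF FB[of n p] abs_ge_zero, of 2] F0[of p n] by (cases "p \<in> K'") auto
    qed
  qed (use Fm fm in auto)
  have lim2: "(\<lambda>n. \<integral>p. V p * (F n p)\<^sup>2 \<partial>M) \<longlonglongrightarrow> (\<integral>p. V p * (f p)\<^sup>2 \<partial>M)"
  proof (rule integral_dominated_convergence[where w = "\<lambda>p. \<bar>BV\<bar> * ((3 * B)\<^sup>2 * indicator K' p)"])
    have "integrable M (indicator K' :: 'a \<Rightarrow> real)"
      unfolding M_def using integrable_mult_indicator[OF _ iK, of U] U_sets
      by (subst integrable_restrict_space) auto
    then show "integrable M (\<lambda>p. \<bar>BV\<bar> * ((3 * B)\<^sup>2 * indicator K' p))" by simp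
    show "AE p in M. (\<lambda>n. V p * (F n p)\<^sup>2) \<longlonglongrightarrow> V p * (f p)\<^sup>2" by (intro AE_I2 tendsto_mult_left tendsto_power Flim)
    show "AE p in M. norm (V p * (F n p)\<^sup>2) \<le> \<bar>BV\<bar> * ((3 * B)\<^sup>2 * indicator K' p)" for n
    proof (rule AE_I2)
      fix p assume p: "p \<in> space M"
      show "norm (V p * (F n p)\<^sup>2) \<le> \<bar>BV\<bar> * ((3 * B)\<^sup>2 * indicator K' p)"
      proof (cases "p \<in> K'")
        case True
        have "\<bar>V p\<bar> \<le> \<bar>BV\<bar>" using BV[OF True] V_nonneg[of p] p by (simp add: space_M)
        moreover have "(F n p)\<^sup>2 \<le> (3 * B)\<^sup>2" using power_mono[OF FB[of n p] abs_ge_zero, of 2] by simp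
        ultimately show ?thesis using True by (simp add: abs_mult mult_mono del: power_mult_distrib)
      qed (simp add: F0)
    qed
  qed (use meas_M[OF Fm] meas_M[OF fm] V_meas_M in auto)
  have "(\<lambda>n. ground_energy U V * (\<integral>p. (F n p)\<^sup>2 \<partial>lborel)) \<longlonglongrightarrow> ground_energy U V * (\<integral>p. (f p)\<^sup>2 \<partial>lborel)"
    by (intro tendsto_mult_left lim1)
  moreover have "(\<lambda>n. (\<Sum>i\<in>Basis. E i) + (\<integral>p. V p * (F n p)\<^sup>2 \<partial>M)) \<longlonglongrightarrow> (\<Sum>i\<in>Basis. E i) + (\<integral>p. V p * (f p)\<^sup>2 \<partial>M)"
    by (intro tendsto_add tendsto_const lim2)
  ultimately show ?thesis by (rule LIMSEQ_le) (use le in auto)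
qed

lemma ground_energy_ge:
  assumes "\<And>p. p \<in> U \<Longrightarrow> c \<le> V p"
  shows "c \<le> ground_energy U V"
proof (rule ground_energy_greatest)
  fix \<phi> G assume C: "C1_compact U \<phi> G" and 1: "(\<integral>p. (\<phi> p)\<^sup>2 \<partial>lborel) = 1"
  have "c * (\<integral>p. (\<phi> p)\<^sup>2 \<partial>M) = (\<integral>p. c * (\<phi> p)\<^sup>2 \<partial>M)" by simp
  also have "\<dots> \<le> (\<integral>p. V p * (\<phi> p)\<^sup>2 \<partial>M)"
    using C1_square_integrable(2)[OF C] V_integrable[OF C] assms
    by (intro integral_mono) (auto simp: square_integrable_def space_M intro!: mult_right_mono)
  also have "\<dots> \<le> energy \<phi> G" unfolding energy_alt[OF C] by simp
  finally show "c \<le> energy \<phi> G" by (simp add: integral_M_power2[OF C] 1)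
qed

end

section \<open>Sections of a planar domain and the lower bound\<close>

lemma set_borel_measurable_continuous_open:
  fixes V :: "'a::euclidean_space \<Rightarrow> real"
  assumes "open U" "continuous_on U V" shows "set_borel_measurable lborel U V"
  unfolding set_borel_measurable_def using borel_measurable_continuous_on_indicator[OF _ assms(2)] assms(1) by simp

lemma schroedinger_continuous:
  fixes V :: "'a::euclidean_space \<Rightarrow> real"
  assumes "open U" "bounded U" "U \<noteq> {}" "continuous_on U V" "\<And>p. p \<in> U \<Longrightarrow> 0 \<le> V p"
  shows "schroedinger U V"
proof
  show "set_borel_measurable lborel U V" using assms(1,4) by (rule set_borel_measurable_continuous_open)
  fix K assume "compact K" "K \<subseteq> U"
  then have "compact (V ` K)" using assms(4) by (intro compact_continuous_image) (auto intro: continuous_on_subset)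
  then obtain B where "\<forall>p\<in>K. \<bar>V p\<bar> \<le> B" by (auto dest!: compact_imp_bounded simp: bounded_iff)
  then show "\<exists>B. \<forall>p\<in>K. V p \<le> B" by (intro exI[of _ B]) (auto simp: abs_le_iff)
qed (use assms in auto)

lemma compactly_supported_mult_potential:
  fixes V f :: "'a::euclidean_space \<Rightarrow> real"
  assumes U: "open U" and V: "continuous_on U V" and f: "continuous_on UNIV f"
    and K: "compact K" "K \<subseteq> U" "\<And>x. x \<notin> K \<Longrightarrow> f x = 0"
  shows "compactly_supported (\<lambda>p. indicator U p * V p * f p)"
proof (rule compactly_supportedI[OF _ K(1)])
  have "continuous_on (U \<union> - K) (\<lambda>p. if p \<in> U then V p * f p else 0)"
  proof (rule continuous_on_open_Un)
    show "continuous_on U (\<lambda>p. if p \<in> U then V p * f p else 0)"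
      by (rule continuous_on_eq[of _ "\<lambda>p. V p * f p"]) (auto intro!: continuous_intros V continuous_on_subset[OF f])
    show "continuous_on (- K) (\<lambda>p. if p \<in> U then V p * f p else 0)"
      by (rule continuous_on_eq[of _ "\<lambda>p. 0"]) (auto simp: K(3))
    show "open (- K)" using K(1) by (simp add: open_Compl compact_imp_closed)
  qed (rule U)
  moreover have U: "U \<union> - K = UNIV" using K(2) by auto
  moreover have eq: "(\<lambda>p. if p \<in> U then V p * f p else 0) = (\<lambda>p. indicator U p * V p * f p)" by (auto simp: indicator_def)
  ultimately show "continuous_on UNIV (\<lambda>p. indicator U p * V p * f p)" by (simp only: U eq)
qed (use K in auto)

lemma integral_lborel_prod:
  fixes f :: "'a::euclidean_space \<times> 'b::euclidean_space \<Rightarrow> real"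
  assumes "integrable lborel f"
  shows "integrable lborel (\<lambda>x. \<integral>y. f (x, y) \<partial>lborel)" "(\<integral>x. \<integral>y. f (x, y) \<partial>lborel \<partial>lborel) = (\<integral>p. f p \<partial>lborel)"
  using lborel_pair.integrable_fst'[of f] lborel_pair.integral_fst'[of f] assms by (auto simp: lborel_prod)

lemma compactly_supported_slice:
  fixes f :: "'a::euclidean_space \<times> 'b::euclidean_space \<Rightarrow> 'c::euclidean_space"
  assumes "compactly_supported f" shows "compactly_supported (\<lambda>y. f (x, y))"
proof -
  from assms obtain K where K: "compact K" "\<And>p. p \<notin> K \<Longrightarrow> f p = 0" and c: "continuous_on UNIV f"
    by (auto simp: compactly_supported_def)
  show ?thesis
  proof (rule compactly_supportedI)
    have "continuous_on UNIV (\<lambda>y. (x, y))" by (rule continuous_on_Pair[OF continuous_on_const continuous_on_id])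
    from continuous_on_compose2[OF c this] show "continuous_on UNIV (\<lambda>y. f (x, y))" by simp
    show "compact (snd ` K)" using K(1) by (intro compact_continuous_image continuous_intros)
    fix y assume "y \<notin> snd ` K"
    then have "(x, y) \<notin> K" by force
    then show "f (x, y) = 0" by (rule K(2))
  qed
qed

locale planar_schroedinger =
  fixes \<Omega> :: "(real \<times> real) set" and V :: "real \<times> real \<Rightarrow> real"
  assumes open_\<Omega>: "open \<Omega>" and bounded_\<Omega>: "bounded \<Omega>" and \<Omega>_nonempty: "\<Omega> \<noteq> {}"
    and V_continuous: "continuous_on \<Omega> V" and V_ge_1: "\<And>p. p \<in> \<Omega> \<Longrightarrow> 1 \<le> V p"
begin

lemma V_nonneg_\<Omega>: "p \<in> \<Omega> \<Longrightarrow> 0 \<le> V p" using V_ge_1[of p] by simp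

sublocale plane: schroedinger \<Omega> V
  by (rule schroedinger_continuous[OF open_\<Omega> bounded_\<Omega> \<Omega>_nonempty V_continuous V_nonneg_\<Omega>])

lemma open_cross_section: "open (cross_section \<Omega> x)"
proof -
  have "cross_section \<Omega> x = (\<lambda>y. (x, y)) -` \<Omega>" by (auto simp: cross_section_def)
  moreover have "open ((\<lambda>y. (x, y)) -` \<Omega>)"
    by (rule open_vimage[OF open_\<Omega>]) (rule continuous_on_Pair[OF continuous_on_const continuous_on_id])
  ultimately show ?thesis by simp
qed

lemma section_schroedinger:
  assumes "x \<in> fst ` \<Omega>" shows "schroedinger (cross_section \<Omega> x) (\<lambda>y. V (x, y))"
proof (rule schroedinger_continuous)
  show "open (cross_section \<Omega> x)" by (rule open_cross_section)
  have "cross_section \<Omega> x \<subseteq> snd ` \<Omega>" by (force simp: cross_section_def)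
  then show "bounded (cross_section \<Omega> x)" using bounded_snd[OF bounded_\<Omega>] bounded_subset by blast
  show "cross_section \<Omega> x \<noteq> {}" using assms by (auto simp: cross_section_def)
  show "continuous_on (cross_section \<Omega> x) (\<lambda>y. V (x, y))"
    by (rule continuous_on_compose2[OF V_continuous continuous_on_Pair[OF continuous_on_const continuous_on_id]])
       (auto simp: cross_section_def)
qed (auto simp: cross_section_def V_nonneg_\<Omega>)

abbreviation "mu \<equiv> section_eigenvalue \<Omega> V"

lemma mu_eq: "x \<in> fst ` \<Omega> \<Longrightarrow> mu x = ground_energy (cross_section \<Omega> x) (\<lambda>y. V (x, y))"
  unfolding section_eigenvalue_def by (rule schroedinger.first_dirichlet_eigenvalue_eq[OF section_schroedinger])

lemma mu_ge_1: assumes "x \<in> fst ` \<Omega>" shows "1 \<le> mu x"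
  unfolding mu_eq[OF assms]
  by (rule schroedinger.ground_energy_ge[OF section_schroedinger[OF assms]]) (auto simp: cross_section_def V_ge_1)

text \<open>
  A near-optimal test function on one section has compact support, so it is also a test function on the
  neighbouring sections, with almost the same energy.
\<close>

lemma mu_upper_semicontinuous:
  assumes x0: "x0 \<in> fst ` \<Omega>" and t: "mu x0 < t"
  shows "\<exists>d>0. \<forall>x. \<bar>x - x0\<bar> < d \<longrightarrow> x \<in> fst ` \<Omega> \<and> mu x < t"
proof -
  interpret S: schroedinger "cross_section \<Omega> x0" "\<lambda>y. V (x0, y)" by (rule section_schroedinger[OF x0])
  obtain \<phi> G where C: "C1_compact (cross_section \<Omega> x0) \<phi> G" and N: "(\<integral>y. (\<phi> y)\<^sup>2 \<partial>lborel) = 1" and E: "S.energy \<phi> G < t"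
    using S.ground_energy_approx[of t] t unfolding mu_eq[OF x0] by blast
  obtain K where K: "compact K" "K \<subseteq> cross_section \<Omega> x0" "\<And>p. p \<notin> K \<Longrightarrow> \<phi> p = 0" "\<And>p. p \<notin> K \<Longrightarrow> G p = 0"
    by (rule C1_compactD[OF C]) (rule that)
  note cs = C1_compact_compactly_supported[OF C]
  have KO: "{x0} \<times> K \<subseteq> \<Omega>" using K(2) by (auto simp: cross_section_def)
  obtain r where r: "0 < r" "(\<Union>p\<in>{x0} \<times> K. cball p r) \<subseteq> \<Omega>"
    using compact_subset_open_imp_cball_epsilon_subset[OF compact_Times[OF _ K(1)] open_\<Omega> KO] by auto
  define D where "D = cball x0 r \<times> K"
  have D: "D \<subseteq> \<Omega>"
  proof
    fix p assume "p \<in> D"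
    then have "p \<in> cball (x0, snd p) r" "(x0, snd p) \<in> {x0} \<times> K"
      by (auto simp: D_def dist_prod_def dist_real_def)
    then show "p \<in> \<Omega>" using r(2) by blast
  qed
  have "uniformly_continuous_on D V"
    using D V_continuous K(1) unfolding D_def
    by (intro compact_uniformly_continuous compact_Times compact_cball) (auto intro: continuous_on_subset)
  moreover define e where "e = (t - S.energy \<phi> G) / 2"
  have e: "0 < e" using E by (simp add: e_def)
  ultimately obtain d where d: "0 < d" "\<And>p q. p \<in> D \<Longrightarrow> q \<in> D \<Longrightarrow> dist p q < d \<Longrightarrow> dist (V p) (V q) < e"
    unfolding uniformly_continuous_on_def by (metis dist_commute)
  show ?thesis
  proof (intro exI[of _ "min d r"] conjI allI impI)
    show "0 < min d r" using d r by simp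
    fix x assume x: "\<bar>x - x0\<bar> < min d r"
    have xD: "(x, y) \<in> D" "(x0, y) \<in> D" if "y \<in> K" for y using x that r by (auto simp: D_def dist_real_def)
    have Kne: "K \<noteq> {}"
    proof
      assume "K = {}"
      then have "\<phi> = (\<lambda>_. 0)" using K(3) by auto
      then show False using N by simp
    qed
    then show xO: "x \<in> fst ` \<Omega>" using xD(1) D by force
    interpret X: schroedinger "cross_section \<Omega> x" "\<lambda>y. V (x, y)" by (rule section_schroedinger[OF xO])
    have CX: "C1_compact (cross_section \<Omega> x) \<phi> G"
      using C1_compactI[of \<phi> G K "cross_section \<Omega> x"] C K(1,3) xD D by (auto simp: C1_compact_def cross_section_def)
    have eX: "X.energy \<phi> G = (\<integral>y. (norm (G y))\<^sup>2 \<partial>lborel) + (\<integral>y. indicator (cross_section \<Omega> x) y * V (x, y) * (\<phi> y)\<^sup>2 \<partial>lborel)"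
      unfolding X.energy_alt[OF CX] X.M_def using X.U_sets
      by (subst integral_restrict_space) (auto simp: mult.assoc)
    have eS: "S.energy \<phi> G = (\<integral>y. (norm (G y))\<^sup>2 \<partial>lborel) + (\<integral>y. indicator (cross_section \<Omega> x0) y * V (x0, y) * (\<phi> y)\<^sup>2 \<partial>lborel)"
      unfolding S.energy_alt[OF C] S.M_def using S.U_sets
      by (subst integral_restrict_space) (auto simp: mult.assoc)
    have cont: "continuous_on (cross_section \<Omega> z) (\<lambda>y. V (z, y))" for z
      by (rule continuous_on_compose2[OF V_continuous continuous_on_Pair[OF continuous_on_const continuous_on_id]])
        (auto simp: cross_section_def)
    have csq: "continuous_on UNIV (\<lambda>y. (\<phi> y)\<^sup>2)" by (intro continuous_intros compactly_supported_continuous cs)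
    have iV: "integrable lborel (\<lambda>y. indicator (cross_section \<Omega> z) y * V (z, y) * (\<phi> y)\<^sup>2)" if "K \<subseteq> cross_section \<Omega> z" for z
      by (intro compactly_supported_integrable compactly_supported_mult_potential[OF open_cross_section cont csq K(1) that])
        (simp add: K(3))
    have Kx: "K \<subseteq> cross_section \<Omega> x" using xD D by (auto simp: cross_section_def)
    have isq: "integrable lborel (\<lambda>y. e * (\<phi> y)\<^sup>2)" using compactly_supported_integrable[OF compactly_supported_power2[OF cs(1)]] by simp
    have "(\<integral>y. indicator (cross_section \<Omega> x) y * V (x, y) * (\<phi> y)\<^sup>2 \<partial>lborel)
      \<le> (\<integral>y. indicator (cross_section \<Omega> x0) y * V (x0, y) * (\<phi> y)\<^sup>2 + e * (\<phi> y)\<^sup>2 \<partial>lborel)"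
    proof (rule integral_mono)
      show "integrable lborel (\<lambda>y. indicator (cross_section \<Omega> x) y * V (x, y) * (\<phi> y)\<^sup>2)" by (rule iV[OF Kx])
      show "integrable lborel (\<lambda>y. indicator (cross_section \<Omega> x0) y * V (x0, y) * (\<phi> y)\<^sup>2 + e * (\<phi> y)\<^sup>2)"
        using iV[OF K(2)] isq by simp
      fix y
      show "indicator (cross_section \<Omega> x) y * V (x, y) * (\<phi> y)\<^sup>2 \<le> indicator (cross_section \<Omega> x0) y * V (x0, y) * (\<phi> y)\<^sup>2 + e * (\<phi> y)\<^sup>2"
      proof (cases "y \<in> K")
        case True
        have "dist (x, y) (x0, y) < d" using x by (simp add: dist_prod_def dist_real_def)
        then have "V (x, y) \<le> V (x0, y) + e" using d(2)[OF xD[OF True]] by (simp add: dist_real_def abs_less_iff)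
        then have "V (x, y) * (\<phi> y)\<^sup>2 \<le> (V (x0, y) + e) * (\<phi> y)\<^sup>2" by (intro mult_right_mono) auto
        then show ?thesis using True K(2) Kx by (auto simp: indicator_def algebra_simps)
      qed (simp add: K(3))
    qed
    also have "\<dots> = (\<integral>y. indicator (cross_section \<Omega> x0) y * V (x0, y) * (\<phi> y)\<^sup>2 \<partial>lborel) + e"
      using iV[OF K(2)] isq N by simp
    finally have "X.energy \<phi> G \<le> S.energy \<phi> G + e" unfolding eX eS by simp
    moreover have "ground_energy (cross_section \<Omega> x) (\<lambda>y. V (x, y)) \<le> X.energy \<phi> G"
      using X.ground_energy_le[OF CX] N by simp
    ultimately show "mu x < t" unfolding mu_eq[OF xO] using E by (simp add: e_def field_simps)
  qed
qed

lemma open_projection: "open (fst ` \<Omega>)" using open_\<Omega> by (rule open_image_fst)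

text \<open>
  Upper semicontinuity gives both measurability and local boundedness of the effective potential.
\<close>

sublocale line: schroedinger "fst ` \<Omega>" mu
proof
  show "open (fst ` \<Omega>)" by (rule open_projection)
  show "bounded (fst ` \<Omega>)" by (rule bounded_fst[OF bounded_\<Omega>])
  show "fst ` \<Omega> \<noteq> {}" using \<Omega>_nonempty by simp
  show "0 \<le> mu x" if "x \<in> fst ` \<Omega>" for x using mu_ge_1[OF that] by simp
  have op: "open {x \<in> fst ` \<Omega>. mu x < t}" for t
    unfolding open_dist
  proof
    fix x0 assume "x0 \<in> {x \<in> fst ` \<Omega>. mu x < t}"
    then obtain d where "d > 0" "\<forall>x. \<bar>x - x0\<bar> < d \<longrightarrow> x \<in> fst ` \<Omega> \<and> mu x < t"
      using mu_upper_semicontinuous[of x0 t] by blast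
    then show "\<exists>e>0. \<forall>y. dist y x0 < e \<longrightarrow> y \<in> {x \<in> fst ` \<Omega>. mu x < t}"
      by (intro exI[of _ d]) (auto simp: dist_real_def)
  qed
  show "set_borel_measurable lborel (fst ` \<Omega>) mu"
    unfolding set_borel_measurable_def borel_measurable_iff_less
  proof
    fix a
    have "{w \<in> space lborel. indicator (fst ` \<Omega>) w *\<^sub>R mu w < a} = {x \<in> fst ` \<Omega>. mu x < a} \<union> (if 0 < a then - fst ` \<Omega> else {})"
      by (auto simp: indicator_def)
    also have "\<dots> \<in> sets borel" using op[of a] open_projection by auto
    finally show "{w \<in> space lborel. indicator (fst ` \<Omega>) w *\<^sub>R mu w < a} \<in> sets lborel" by simp
  qed
  fix K assume K: "compact K" "K \<subseteq> fst ` \<Omega>"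
  have "K \<subseteq> (\<Union>n::nat. {x \<in> fst ` \<Omega>. mu x < real n})"
  proof
    fix x assume "x \<in> K"
    moreover obtain n where "mu x < real n" using reals_Archimedean2 by blast
    ultimately show "x \<in> (\<Union>n::nat. {x \<in> fst ` \<Omega>. mu x < real n})" using K(2) by blast
  qed
  then obtain F where F: "finite F" "K \<subseteq> (\<Union>n\<in>F. {x \<in> fst ` \<Omega>. mu x < real n})"
    using compactE_image[OF K(1), of UNIV "\<lambda>n::nat. {x \<in> fst ` \<Omega>. mu x < real n}"] op by auto
  have "mu x \<le> real (\<Sum>F)" if "x \<in> K" for x
  proof -
    obtain n where "n \<in> F" "mu x < real n" using F(2) \<open>x \<in> K\<close> by blast
    moreover have "n \<le> \<Sum>F" using \<open>n \<in> F\<close> F(1) by (intro member_le_sum) auto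
    ultimately show ?thesis by linarith
  qed
  then show "\<exists>B. \<forall>p\<in>K. mu p \<le> B" by blast
qed

lemma mu_le_slice_energy:
  assumes C: "C1_compact \<Omega> \<phi> G" and x: "x \<in> fst ` \<Omega>"
  shows "mu x * (\<integral>y. (\<phi> (x, y))\<^sup>2 \<partial>lborel) \<le> (\<integral>y. (snd (G (x, y)))\<^sup>2 + indicator \<Omega> (x, y) * V (x, y) * (\<phi> (x, y))\<^sup>2 \<partial>lborel)"
proof -
  interpret S: schroedinger "cross_section \<Omega> x" "\<lambda>y. V (x, y)" by (rule section_schroedinger[OF x])
  obtain K where K: "compact K" "K \<subseteq> \<Omega>" "\<And>p. p \<notin> K \<Longrightarrow> \<phi> p = 0" "\<And>p. p \<notin> K \<Longrightarrow> G p = 0"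
    by (rule C1_compactD[OF C]) (rule that)
  note cs = C1_compact_compactly_supported[OF C]
  define L where "L = {y. (x, y) \<in> K}"
  have "L = (\<lambda>y. (x, y)) -` K" by (auto simp: L_def)
  moreover have "closed ((\<lambda>y. (x, y)) -` K)"
    using compact_imp_closed[OF K(1)] by (rule closed_vimage) (rule continuous_on_Pair[OF continuous_on_const continuous_on_id])
  moreover have "L \<subseteq> snd ` K" by (force simp: L_def)
  moreover have "bounded (snd ` K)" using K(1) by (intro bounded_snd compact_imp_bounded)
  ultimately have L: "compact L" by (auto simp: compact_eq_bounded_closed intro: bounded_subset)
  have CS: "C1_compact (cross_section \<Omega> x) (\<lambda>y. \<phi> (x, y)) (\<lambda>y. snd (G (x, y)))"
  proof (rule C1_compactI[OF _ _ L])
    fix y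
    have "(\<phi> has_derivative (\<lambda>h. h \<bullet> G (x, y))) (at (x, y))" using C by (auto simp: C1_compact_def gderiv_def)
    moreover have "((\<lambda>y. (x, y)) has_derivative (\<lambda>h. (0, h))) (at y)" by (auto intro!: derivative_eq_intros)
    ultimately have "((\<lambda>y. \<phi> (x, y)) has_derivative (\<lambda>h. (0, h) \<bullet> G (x, y))) (at y)"
      using has_derivative_compose[where g = \<phi> and f = "\<lambda>y. (x, y)" and s = UNIV] by blast
    then show "GDERIV (\<lambda>y. \<phi> (x, y)) y :> snd (G (x, y))"
      by (simp add: gderiv_def inner_prod_def mult.commute del: gderiv_deriv)
    show "continuous_on UNIV (\<lambda>y. snd (G (x, y)))"
      using compactly_supported_continuous[OF compactly_supported_slice[OF cs(2)]] by (rule continuous_on_snd)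
    show "L \<subseteq> cross_section \<Omega> x" using K(2) by (auto simp: L_def cross_section_def)
  qed (auto simp: L_def K(3))
  have csV: "compactly_supported (\<lambda>p. indicator \<Omega> p * V p * (\<phi> p)\<^sup>2)"
    by (rule compactly_supported_mult_potential[OF open_\<Omega> V_continuous _ K(1,2)])
      (simp_all add: K(3) continuous_on_power[OF compactly_supported_continuous[OF cs(1)]])
  have csn: "compactly_supported (\<lambda>y. (norm (snd (G (x, y))))\<^sup>2)"
    by (rule compactly_supported_norm2[OF C1_compact_compactly_supported(2)[OF CS]])
  have "S.energy (\<lambda>y. \<phi> (x, y)) (\<lambda>y. snd (G (x, y))) = (\<integral>y. (norm (snd (G (x, y))))\<^sup>2 \<partial>lborel) + (\<integral>y. indicator \<Omega> (x, y) * V (x, y) * (\<phi> (x, y))\<^sup>2 \<partial>lborel)"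
    unfolding S.energy_alt[OF CS] S.M_def using S.U_sets
    by (subst integral_restrict_space) (auto simp: mult.assoc cross_section_def indicator_def)
  also have "\<dots> = (\<integral>y. (snd (G (x, y)))\<^sup>2 + indicator \<Omega> (x, y) * V (x, y) * (\<phi> (x, y))\<^sup>2 \<partial>lborel)"
    using compactly_supported_integrable[OF csn] compactly_supported_integrable[OF compactly_supported_slice[OF csV]]
    by simp
  finally show ?thesis using S.ground_energy_le[OF CS] by (simp add: mu_eq[OF x])
qed

text \<open>
  The trial function on the projection is the \<open>L\<^sup>2\<close> norm of the section.  By the triangle inequality its
  difference quotients are bounded by those of \<open>\<phi>\<close> in the \<open>x\<close> direction, and the vertical energy of each
  section is at least \<open>\<mu>(x)\<close> times the square of this norm.
\<close>

theorem mu_le_lambda: "ground_energy (fst ` \<Omega>) mu \<le> ground_energy \<Omega> V"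
proof (rule plane.ground_energy_greatest)
  fix \<phi> G assume C: "C1_compact \<Omega> \<phi> G" and N: "(\<integral>p. (\<phi> p)\<^sup>2 \<partial>lborel) = 1"
  obtain K where K: "compact K" "K \<subseteq> \<Omega>" "\<And>p. p \<notin> K \<Longrightarrow> \<phi> p = 0" "\<And>p. p \<notin> K \<Longrightarrow> G p = 0"
    by (rule C1_compactD[OF C]) (rule that)
  note cs = C1_compact_compactly_supported[OF C]
  define f where "f x = sqrt (\<integral>y. (\<phi> (x, y))\<^sup>2 \<partial>lborel)" for x
  have f2: "(f x)\<^sup>2 = (\<integral>y. (\<phi> (x, y))\<^sup>2 \<partial>lborel)" for x by (simp add: f_def)
  have csx: "compactly_supported (\<lambda>y. \<phi> (x, y))" for x by (rule compactly_supported_slice[OF cs(1)])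
  have csd: "compactly_supported (\<lambda>y. \<phi> (x, y) - \<phi> (x', y))" for x x' by (rule compactly_supported_diff[OF csx csx])
  have tri: "(f x - f x')\<^sup>2 \<le> (\<integral>y. (\<phi> (x, y) - \<phi> (x', y))\<^sup>2 \<partial>lborel)" for x x'
  proof -
    note si = compactly_supported_square_integrable[OF csx]
    have i: "integrable lborel (\<lambda>y. (\<phi> (z, y))\<^sup>2)" "integrable lborel (\<lambda>y. \<phi> (z, y) * \<phi> (w, y))" for z w
      using si square_integrable_inner[OF si si] by (auto simp: square_integrable_def)
    have "(\<integral>y. \<phi> (x, y) * \<phi> (x', y) \<partial>lborel)\<^sup>2 \<le> (f x)\<^sup>2 * (f x')\<^sup>2"
      using integral_inner_Cauchy_Schwarz[OF si si, of x x'] by (simp add: f2)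
    then have "(\<integral>y. \<phi> (x, y) * \<phi> (x', y) \<partial>lborel)\<^sup>2 \<le> (f x * f x')\<^sup>2" by (simp only: power_mult_distrib)
    then have "\<bar>\<integral>y. \<phi> (x, y) * \<phi> (x', y) \<partial>lborel\<bar> \<le> \<bar>f x * f x'\<bar>" by (simp only: abs_le_square_iff)
    moreover have "0 \<le> f x * f x'" by (simp add: f_def)
    ultimately have "\<bar>\<integral>y. \<phi> (x, y) * \<phi> (x', y) \<partial>lborel\<bar> \<le> f x * f x'" by linarith
    then have "(f x - f x')\<^sup>2 \<le> (f x)\<^sup>2 - 2 * (\<integral>y. \<phi> (x, y) * \<phi> (x', y) \<partial>lborel) + (f x')\<^sup>2"
      by (simp add: power2_diff abs_le_iff)
    also have "\<dots> = (\<integral>y. (\<phi> (x, y))\<^sup>2 - 2 * (\<phi> (x, y) * \<phi> (x', y)) + (\<phi> (x', y))\<^sup>2 \<partial>lborel)"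
      using i by (simp add: f2)
    also have "\<dots> = (\<integral>y. (\<phi> (x, y) - \<phi> (x', y))\<^sup>2 \<partial>lborel)"
      by (rule Bochner_Integration.integral_cong) (auto simp: power2_diff)
    finally show ?thesis .
  qed
  have Kf: "compact (fst ` K)" "fst ` K \<subseteq> fst ` \<Omega>" using K by (auto intro!: compact_continuous_image continuous_intros)
  have f0: "f x = 0" if "x \<notin> fst ` K" for x
  proof -
    have "\<phi> (x, y) = 0" for y using that K(3)[of "(x, y)"] by force
    then show ?thesis by (simp add: f_def)
  qed
  obtain R where R: "\<And>p. p \<in> K \<Longrightarrow> norm p \<le> R" using compact_imp_bounded[OF K(1)] by (auto simp: bounded_iff)
  define A where "A = measure lborel {-R..R}"
  have A: "0 \<le> A" by (simp add: A_def)
  have cf: "continuous_on UNIV f"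
    unfolding continuous_on_iff
  proof (intro ballI allI impI)
    fix x e :: real assume e: "0 < e"
    define e' where "e' = e / sqrt (A + 1)"
    have e': "0 < e'" "e'\<^sup>2 * A < e\<^sup>2" using e A by (auto simp: e'_def power_divide field_simps)
    obtain d where d: "0 < d" "\<And>p q. dist p q < d \<Longrightarrow> dist (\<phi> p) (\<phi> q) < e'"
      using compactly_supported_uniformly_continuous[OF cs(1) e'(1)] by blast
    show "\<exists>d>0. \<forall>x'\<in>UNIV. dist x' x < d \<longrightarrow> dist (f x') (f x) < e"
    proof (intro exI[of _ d] conjI ballI impI d(1))
      fix x' assume x': "dist x' x < d"
      have "(f x' - f x)\<^sup>2 \<le> (\<integral>y. (\<phi> (x', y) - \<phi> (x, y))\<^sup>2 \<partial>lborel)" by (rule tri)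
      also have "\<dots> \<le> (\<integral>y. e'\<^sup>2 * indicator {-R..R} y \<partial>lborel)"
      proof (rule integral_mono)
        show "integrable lborel (\<lambda>y. (\<phi> (x', y) - \<phi> (x, y))\<^sup>2)" by (intro compactly_supported_integrable compactly_supported_power2 csd)
        have "integrable lborel (indicator {-R..R} :: real \<Rightarrow> real)"
          by (rule integrable_real_indicator) (simp_all add: emeasure_lborel_Icc_eq)
        then show "integrable lborel (\<lambda>y. e'\<^sup>2 * indicator {-R..R} y)" by simp
        fix y
        show "(\<phi> (x', y) - \<phi> (x, y))\<^sup>2 \<le> e'\<^sup>2 * indicator {-R..R} y"
        proof (cases "y \<in> {-R..R}")
          case True
          have "\<bar>\<phi> (x', y) - \<phi> (x, y)\<bar> \<le> e'"
            using d(2)[of "(x', y)" "(x, y)"] x' by (simp add: dist_prod_def dist_real_def)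
          then show ?thesis using True power_mono[of "\<bar>\<phi> (x', y) - \<phi> (x, y)\<bar>" e' 2] by simp
        next
          case False
          have "\<phi> (z, y) = 0" for z
          proof (rule K(3), rule notI)
            assume "(z, y) \<in> K"
            from R[OF this] have "\<bar>y\<bar> \<le> R" using norm_snd_le[of y z] by simp
            then show False using False by auto
          qed
          then show ?thesis by simp
        qed
      qed
      also have "\<dots> = e'\<^sup>2 * A" by (simp add: A_def)
      also have "\<dots> < e\<^sup>2" by (rule e'(2))
      finally have "\<bar>f x' - f x\<bar>\<^sup>2 < e\<^sup>2" by simp
      then have "\<bar>f x' - f x\<bar> < e" using e by (intro power2_less_imp_less[of _ e]) auto
      then show "dist (f x') (f x) < e" by (simp add: dist_real_def)
    qed
  qed
  define E where "E = (\<integral>p. (fst (G p))\<^sup>2 \<partial>lborel)"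
  have dq: "\<exists>r0>0. \<forall>r. 0 < r \<and> r < r0 \<longrightarrow> (\<integral>x. (f (x + r *\<^sub>R i) - f x)\<^sup>2 \<partial>lborel) \<le> r\<^sup>2 * (E + d)" if "i \<in> Basis" "0 < d" for i d :: real
  proof (intro exI[of _ 1] conjI allI impI)
    fix r :: real assume "0 < r \<and> r < 1"
    have i: "i = 1" using that by simp
    have int: "integrable lborel (\<lambda>p. (\<phi> (p + (r, 0)) - \<phi> p)\<^sup>2)"
      by (intro compactly_supported_integrable compactly_supported_power2 compactly_supported_diff compactly_supported_shift cs)
    have "(\<integral>x. (f (x + r) - f x)\<^sup>2 \<partial>lborel) \<le> (\<integral>x. \<integral>y. (\<phi> ((x, y) + (r, 0)) - \<phi> (x, y))\<^sup>2 \<partial>lborel \<partial>lborel)"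
      by (rule integral_mono'[OF integral_lborel_prod(1)[OF int]]) (use tri in \<open>auto intro!: integral_nonneg_AE\<close>)
    also have "\<dots> = (\<integral>p. (\<phi> (p + (r, 0)) - \<phi> p)\<^sup>2 \<partial>lborel)" by (rule integral_lborel_prod(2)[OF int])
    also have "\<dots> \<le> (\<integral>p. (G p \<bullet> (r, 0))\<^sup>2 \<partial>lborel)" by (rule integral_power2_shift_le[OF C])
    also have "\<dots> = r\<^sup>2 * E" by (simp add: E_def inner_prod_def power_mult_distrib mult.commute)
    also have "\<dots> \<le> r\<^sup>2 * (E + d)" using that by (intro mult_left_mono) auto
    finally show "(\<integral>x. (f (x + r *\<^sub>R i) - f x)\<^sup>2 \<partial>lborel) \<le> r\<^sup>2 * (E + d)" by (simp add: i)
  qed simp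
  have "ground_energy (fst ` \<Omega>) mu * (\<integral>x. (f x)\<^sup>2 \<partial>lborel) \<le> (\<Sum>i\<in>(Basis :: real set). E) + (\<integral>x. mu x * (f x)\<^sup>2 \<partial>line.M)"
    by (rule line.trial_function[OF cf Kf f0 dq])
  moreover have "(\<integral>x. (f x)\<^sup>2 \<partial>lborel) = 1"
    unfolding f2 using integral_lborel_prod(2)[OF compactly_supported_integrable[OF compactly_supported_power2[OF cs(1)]]] N by simp
  moreover have "(\<integral>x. mu x * (f x)\<^sup>2 \<partial>line.M) \<le> (\<integral>p. (snd (G p))\<^sup>2 + indicator \<Omega> p * V p * (\<phi> p)\<^sup>2 \<partial>lborel)"
  proof -
    have csV: "compactly_supported (\<lambda>p. indicator \<Omega> p * V p * (\<phi> p)\<^sup>2)"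
      by (rule compactly_supported_mult_potential[OF open_\<Omega> V_continuous _ K(1,2)])
        (simp_all add: K(3) continuous_on_power[OF compactly_supported_continuous[OF cs(1)]])
    have csG: "compactly_supported (\<lambda>p. (snd (G p))\<^sup>2)"
      by (rule compactly_supportedI[OF _ K(1)]) (auto simp: K(4) intro!: continuous_on_power continuous_on_snd compactly_supported_continuous[OF cs(2)])
    let ?H = "\<lambda>p. (snd (G p))\<^sup>2 + indicator \<Omega> p * V p * (\<phi> p)\<^sup>2"
    have iH: "integrable lborel ?H"
      by (rule compactly_supported_integrable[OF compactly_supported_add[OF csG csV]])
    have H0: "0 \<le> ?H p" for p using V_nonneg_\<Omega>[of p] by (auto simp: indicator_def)
    have "(\<integral>x. mu x * (f x)\<^sup>2 \<partial>line.M) = (\<integral>x. indicator (fst ` \<Omega>) x * (mu x * (f x)\<^sup>2) \<partial>lborel)"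
      unfolding line.M_def using line.U_sets by (subst integral_restrict_space) auto
    also have "\<dots> \<le> (\<integral>x. \<integral>y. ?H (x, y) \<partial>lborel \<partial>lborel)"
    proof (rule integral_mono'[OF integral_lborel_prod(1)[OF iH]])
      fix x
      show nn: "0 \<le> (\<integral>y. ?H (x, y) \<partial>lborel)" by (rule integral_nonneg_AE, rule AE_I2, rule H0)
      show "indicator (fst ` \<Omega>) x * (mu x * (f x)\<^sup>2) \<le> (\<integral>y. ?H (x, y) \<partial>lborel)"
        using mu_le_slice_energy[OF C, of x] nn unfolding f2 by (cases "x \<in> fst ` \<Omega>") auto
    qed
    also have "\<dots> = (\<integral>p. ?H p \<partial>lborel)" by (rule integral_lborel_prod(2)[OF iH])
    finally show ?thesis .
  qed
  moreover have "plane.energy \<phi> G = E + (\<integral>p. (snd (G p))\<^sup>2 + indicator \<Omega> p * V p * (\<phi> p)\<^sup>2 \<partial>lborel)"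
  proof -
    have csV: "compactly_supported (\<lambda>p. indicator \<Omega> p * V p * (\<phi> p)\<^sup>2)"
      by (rule compactly_supported_mult_potential[OF open_\<Omega> V_continuous _ K(1,2)])
        (simp_all add: K(3) continuous_on_power[OF compactly_supported_continuous[OF cs(1)]])
    have csG: "compactly_supported (\<lambda>p. (snd (G p))\<^sup>2)" "compactly_supported (\<lambda>p. (fst (G p))\<^sup>2)"
      by (rule compactly_supportedI[OF _ K(1)], auto simp: K(4) intro!: continuous_on_power continuous_on_snd continuous_on_fst compactly_supported_continuous[OF cs(2)])+
    have "plane.energy \<phi> G = (\<integral>p. (norm (G p))\<^sup>2 \<partial>lborel) + (\<integral>p. indicator \<Omega> p * V p * (\<phi> p)\<^sup>2 \<partial>lborel)"
      unfolding plane.energy_alt[OF C] plane.M_def using plane.U_sets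
      by (subst integral_restrict_space) (auto simp: mult.assoc)
    also have "(\<lambda>p. (norm (G p))\<^sup>2) = (\<lambda>p. (fst (G p))\<^sup>2 + (snd (G p))\<^sup>2)"
      by (auto simp: norm_prod_def)
    finally show ?thesis
      using compactly_supported_integrable[OF csV] compactly_supported_integrable[OF csG(1)] compactly_supported_integrable[OF csG(2)]
      by (simp add: E_def)
  qed
  ultimately show "ground_energy (fst ` \<Omega>) mu \<le> plane.energy \<phi> G" by simp
qed

end

section \<open>Energy of a well that contains a disc\<close>

text \<open>
  The Rayleigh quotient of the bump on the ball: its squared gradient is at most \<open>16 r\<^sup>6\<close>, while its square is at
  least \<open>(3/4)\<^sup>4 r\<^sup>8\<close> on the concentric ball of half the radius.
\<close>

lemma (in schroedinger) ground_energy_le_ball: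
  assumes r: "0 < r" and ball: "cball c r \<subseteq> U" and s: "\<And>p. p \<in> cball c r \<Longrightarrow> V p \<le> s"
  shows "ground_energy U V \<le> s + 51 * 2 ^ DIM('a) / r\<^sup>2"
proof -
  define \<phi> G where "\<phi> p = bump r (p - c)" and "G p = bump_gradient r (p - c)" for p
  have C: "C1_compact U \<phi> G" unfolding \<phi>_def G_def by (rule C1_compact_bump[OF r ball])
  note cs = C1_compact_compactly_supported[OF C]
  define m where "m = measure lborel (cball c r)"
  have m2: "measure lborel (cball c (r/2)) = m / 2 ^ DIM('a)"
    using r by (simp add: m_def content_cball power_divide)
  have m: "0 < m" using r by (simp add: m_def content_cball unit_ball_vol_pos)
  have fin: "emeasure lborel (cball c t) < \<infinity>" for t by (rule emeasure_compact_finite) simp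
  have ind: "integrable lborel (indicator (cball c t) :: 'a \<Rightarrow> real)" for t
    by (rule integrable_real_indicator[OF _ fin]) simp
  have zero: "\<phi> p = 0" "G p = 0" if "p \<notin> cball c r" for p
    using bump_zero[OF r, of "p - c"] that by (auto simp: \<phi>_def G_def dist_norm norm_minus_commute)
  have grad: "(\<integral>p. (norm (G p))\<^sup>2 \<partial>lborel) \<le> 16 * r ^ 6 * m"
  proof -
    have "(\<integral>p. (norm (G p))\<^sup>2 \<partial>lborel) \<le> (\<integral>p. 16 * r ^ 6 * indicator (cball c r) p \<partial>lborel)"
    proof (rule integral_mono)
      show "integrable lborel (\<lambda>p. (norm (G p))\<^sup>2)" by (intro compactly_supported_integrable compactly_supported_norm2 cs)
      show "integrable lborel (\<lambda>p. 16 * r ^ 6 * indicator (cball c r) p)" using ind by simp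
      fix p
      show "(norm (G p))\<^sup>2 \<le> 16 * r ^ 6 * indicator (cball c r) p"
      proof (cases "p \<in> cball c r")
        case True
        define q where "q = p - c"
        have q: "norm q \<le> r" using True by (simp add: q_def dist_norm norm_minus_commute)
        have "norm (G p) = 4 * max 0 (r\<^sup>2 - q \<bullet> q) * norm q" by (simp add: G_def bump_gradient_def q_def)
        also have "\<dots> \<le> 4 * r\<^sup>2 * r" using q by (intro mult_mono) auto
        finally have "(norm (G p))\<^sup>2 \<le> (4 * r\<^sup>2 * r)\<^sup>2" by (intro power_mono) auto
        also have "(4 * r\<^sup>2 * r)\<^sup>2 = 16 * r ^ 6" by (simp add: power2_eq_square eval_nat_numeral)
        finally show ?thesis using True by simp
      qed (simp add: zero)
    qed
    then show ?thesis by (simp add: m_def)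
  qed
  define N where "N = (\<integral>p. (\<phi> p)\<^sup>2 \<partial>lborel)"
  have N: "81 / 256 * r ^ 8 * (m / 2 ^ DIM('a)) \<le> N"
  proof -
    have "(\<integral>p. 81 / 256 * r ^ 8 * indicator (cball c (r/2)) p \<partial>lborel) \<le> N"
      unfolding N_def
    proof (rule integral_mono)
      show "integrable lborel (\<lambda>p. (\<phi> p)\<^sup>2)" by (intro compactly_supported_integrable compactly_supported_power2 cs)
      show "integrable lborel (\<lambda>p. 81 / 256 * r ^ 8 * indicator (cball c (r/2)) p)" using ind by simp
      fix p
      show "81 / 256 * r ^ 8 * indicator (cball c (r/2)) p \<le> (\<phi> p)\<^sup>2"
      proof (cases "p \<in> cball c (r/2)")
        case True
        define q where "q = p - c"
        have "norm q \<le> r / 2" using True by (simp add: q_def dist_norm norm_minus_commute)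
        then have "(norm q)\<^sup>2 \<le> (r / 2)\<^sup>2" by (intro power_mono) auto
        then have "3 / 4 * r\<^sup>2 \<le> max 0 (r\<^sup>2 - q \<bullet> q)" by (simp add: power2_norm_eq_inner power_divide le_max_iff_disj)
        then have "(3 / 4 * r\<^sup>2) ^ 4 \<le> (max 0 (r\<^sup>2 - q \<bullet> q)) ^ 4" by (intro power_mono) auto
        also have "\<dots> = (\<phi> p)\<^sup>2" by (simp add: \<phi>_def bump_def q_def)
        also have "(3 / 4 * r\<^sup>2) ^ 4 = 81 / 256 * r ^ 8" by (simp add: power_mult_distrib power_divide)
        finally show ?thesis using True by simp
      qed simp
    qed
    then show ?thesis by (simp add: m2)
  qed
  have N0: "0 < N" using N m r by (intro less_le_trans[OF _ N]) auto
  have pot: "(\<integral>p. V p * (\<phi> p)\<^sup>2 \<partial>M) \<le> s * N"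
  proof -
    have "(\<integral>p. V p * (\<phi> p)\<^sup>2 \<partial>M) \<le> (\<integral>p. s * (\<phi> p)\<^sup>2 \<partial>M)"
    proof (rule integral_mono)
      show "integrable M (\<lambda>p. V p * (\<phi> p)\<^sup>2)" by (rule V_integrable[OF C])
      show "integrable M (\<lambda>p. s * (\<phi> p)\<^sup>2)" using C1_square_integrable(2)[OF C] by (simp add: square_integrable_def)
      fix p show "V p * (\<phi> p)\<^sup>2 \<le> s * (\<phi> p)\<^sup>2"
        using s[of p] by (cases "p \<in> cball c r") (auto simp: zero intro!: mult_right_mono)
    qed
    then show ?thesis by (simp add: integral_M_power2[OF C] N_def)
  qed
  have "ground_energy U V * N \<le> 16 * r ^ 6 * m + s * N"
    using ground_energy_le[OF C] grad pot unfolding energy_alt[OF C] N_def by linarith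
  also have "16 * r ^ 6 * m \<le> 51 * 2 ^ DIM('a) / r\<^sup>2 * N"
  proof -
    have "16 * r ^ 6 * m \<le> 51 * 2 ^ DIM('a) / r\<^sup>2 * (81 / 256 * r ^ 8 * (m / 2 ^ DIM('a)))"
      using r m by (simp add: field_simps eval_nat_numeral)
    also have "\<dots> \<le> 51 * 2 ^ DIM('a) / r\<^sup>2 * N" by (intro mult_left_mono N) auto
    finally show ?thesis .
  qed
  finally have "ground_energy U V * N \<le> (s + 51 * 2 ^ DIM('a) / r\<^sup>2) * N" by (simp add: algebra_simps)
  then show ?thesis using N0 by simp
qed

section \<open>Inner radius and width\<close>

lemma radius_le:
  fixes S :: "(real \<times> real) set"
  assumes "S \<subseteq> ball 0 B" "ball c r \<subseteq> S" "0 < B" shows "r \<le> B"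
proof -
  have "ball c r \<subseteq> ball 0 B" using assms by blast
  then have "dist c 0 + r \<le> B \<or> r \<le> 0" by (simp only: ball_subset_ball_iff)
  then show ?thesis using assms(3) zero_le_dist[of c 0] by linarith
qed

lemma inner_radius_set_bdd:
  fixes S :: "(real \<times> real) set"
  assumes "bounded S" shows "bdd_above {r. 0 \<le> r \<and> (\<exists>c. ball c r \<subseteq> S)}"
proof -
  obtain B where B: "0 < B" "S \<subseteq> ball 0 B" using bounded_subset_ballD[OF assms, of 0] by blast
  show ?thesis by (rule bdd_aboveI[of _ B]) (use radius_le[OF B(2) _ B(1)] in blast)
qed

lemma inner_radius_ge:
  assumes "bounded S" "ball c r \<subseteq> S" "0 \<le> r" shows "r \<le> inner_radius S"
  unfolding inner_radius_def using assms by (intro cSup_upper inner_radius_set_bdd CollectI conjI exI[of _ c])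

lemma ball_of_less_inner_radius:
  assumes "bounded S" "r < inner_radius S" obtains c where "ball c r \<subseteq> S"
proof -
  have "0 \<in> {r. 0 \<le> r \<and> (\<exists>c. ball c r \<subseteq> S)}" by auto
  then have "\<exists>r'\<in>{r. 0 \<le> r \<and> (\<exists>c. ball c r \<subseteq> S)}. r < r'"
    using assms(2) unfolding inner_radius_def by (intro less_cSupD) auto
  then obtain r' c where "r < r'" "ball c r' \<subseteq> S" by auto
  then show ?thesis using that[of c] subset_ball[of r r' c] by auto
qed

lemma convexD_3:
  assumes K: "convex K" "P \<in> K" "Q \<in> K" "R \<in> K" and abc: "0 \<le> a" "0 < b" "0 \<le> c" "a + b + c = (1::real)"
  shows "a *\<^sub>R P + (b *\<^sub>R Q + c *\<^sub>R R) \<in> K"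
proof -
  have bc: "0 < b + c" using abc by simp
  have X: "(b / (b + c)) *\<^sub>R Q + (c / (b + c)) *\<^sub>R R \<in> K"
    using abc bc by (intro convexD[OF K(1)] K) (auto simp flip: add_divide_distrib)
  have "a *\<^sub>R P + (b + c) *\<^sub>R ((b / (b + c)) *\<^sub>R Q + (c / (b + c)) *\<^sub>R R) \<in> K"
    using abc bc by (intro convexD[OF K(1) K(2) X]) auto
  then show ?thesis using bc by (simp add: scaleR_add_right)
qed

text \<open>
  Take \<open>P\<close>, \<open>Q\<close> almost realizing the diameter.  If some point \<open>R\<close> were far from the line through \<open>P\<close> and \<open>Q\<close>,
  the triangle \<open>P Q R\<close> would contain a ball of radius \<open>\<rho>\<close> about its centroid; otherwise the set is thin in the
  direction normal to that line.
\<close>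

lemma convex_thin_of_no_ball:
  fixes K :: "(real \<times> real) set"
  assumes K: "convex K" "bounded K" and no: "\<And>c. \<not> ball c \<rho> \<subseteq> K" and \<rho>: "0 < \<rho>"
  shows "\<exists>e. norm e = 1 \<and> projection_length e K \<le> 30 * \<rho>"
proof (cases "diameter K \<le> 0")
  case True
  have "projection_length (0, 1) K \<le> 30 * \<rho>" unfolding projection_length_def
  proof (rule diameter_le)
    fix x y assume "x \<in> (\<lambda>p. p \<bullet> (0, 1)) ` K" "y \<in> (\<lambda>p. p \<bullet> (0, 1)) ` K"
    then obtain p q where pq: "p \<in> K" "q \<in> K" "x = p \<bullet> (0, 1)" "y = q \<bullet> (0, 1)" by blast
    have "dist p q = 0" using diameter_bounded_bound[OF K(2) pq(1,2)] True zero_le_dist[of p q] by linarith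
    then show "norm (x - y) \<le> 30 * \<rho>" using pq \<rho> by simp
  qed (use \<rho> in simp)
  then show ?thesis by (intro exI[of _ "(0, 1)"]) simp
next
  case False
  define d where "d = diameter K"
  have d: "0 < d" using False by (simp add: d_def)
  have dle: "norm (x - y) \<le> d" if "x \<in> K" "y \<in> K" for x y
    using diameter_bounded_bound[OF K(2) that] by (simp add: d_def dist_norm)
  obtain P Q where PQ: "P \<in> K" "Q \<in> K" "d / 2 < dist P Q"
    using diameter_bounded(2)[OF K(2), rule_format, of "d / 2"] d by (auto simp: d_def)
  define D where "D = norm (Q - P)"
  have D: "d / 2 < D" "0 < D" using PQ(3) d by (auto simp: D_def dist_norm norm_minus_commute)
  define u v where "u = fst (Q - P) / D" and "v = snd (Q - P) / D"
  have QP: "Q - P = (D * u, D * v)" using D by (simp add: u_def v_def prod_eq_iff)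
  have "norm (D * u, D * v) = D" unfolding QP[symmetric] by (rule D_def[symmetric])
  moreover have "(norm (D * u, D * v))\<^sup>2 = (D * u)\<^sup>2 + (D * v)\<^sup>2" by (simp add: norm_Pair)
  ultimately have "D\<^sup>2 = (D * u)\<^sup>2 + (D * v)\<^sup>2" by (simp only:)
  then have "D\<^sup>2 * (u\<^sup>2 + v\<^sup>2) = D\<^sup>2 * 1" by (simp add: power_mult_distrib algebra_simps)
  then have uv: "u\<^sup>2 + v\<^sup>2 = 1" using D(2) by simp
  define e where "e = (- v, u)"
  have ne: "norm e = 1" using uv by (simp add: e_def norm_prod_def add.commute)
  have "projection_length e K \<le> 30 * \<rho>" unfolding projection_length_def
  proof (rule diameter_le)
    fix x y assume "x \<in> (\<lambda>p. p \<bullet> e) ` K" "y \<in> (\<lambda>p. p \<bullet> e) ` K"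
    then obtain A B where AB: "A \<in> K" "B \<in> K" "x = A \<bullet> e" "y = B \<bullet> e" by blast
    show "norm (x - y) \<le> 30 * \<rho>"
    proof (rule ccontr)
      assume "\<not> norm (x - y) \<le> 30 * \<rho>"
      then have "30 * \<rho> < \<bar>(A - P) \<bullet> e - (B - P) \<bullet> e\<bar>" by (simp add: AB inner_diff_left)
      then have "15 * \<rho> < \<bar>(A - P) \<bullet> e\<bar> \<or> 15 * \<rho> < \<bar>(B - P) \<bullet> e\<bar>" by linarith
      then obtain R where R: "R \<in> K" "15 * \<rho> < \<bar>(R - P) \<bullet> e\<bar>" using AB by blast
      define a b where "a = (R - P) \<bullet> (u, v)" and "b = (R - P) \<bullet> e"
      have nuv: "norm (u, v) = 1" using uv by (simp add: norm_prod_def)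
      have a: "\<bar>a\<bar> \<le> 2 * D"
      proof -
        have "\<bar>a\<bar> \<le> norm (R - P)" unfolding a_def using Cauchy_Schwarz_ineq2[of "R - P" "(u, v)"] nuv by simp
        also have "\<dots> \<le> d" by (rule dle[OF R(1) PQ(1)])
        finally show ?thesis using D by simp
      qed
      have b: "15 * \<rho> < \<bar>b\<bar>" "\<bar>b\<bar> \<le> 2 * D"
      proof -
        have "\<bar>b\<bar> \<le> norm (R - P)" unfolding b_def using Cauchy_Schwarz_ineq2[of "R - P" e] ne by simp
        also have "\<dots> \<le> d" by (rule dle[OF R(1) PQ(1)])
        finally show "\<bar>b\<bar> \<le> 2 * D" using D by simp
      qed (use R in \<open>simp add: b_def\<close>)
      have b0: "b \<noteq> 0" using b(1) \<rho> by auto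
      have RP: "R - P = (a * u - b * v, a * v + b * u)"
      proof -
        obtain r1 r2 where r: "R - P = (r1, r2)" by (cases "R - P")
        have ab: "a = r1 * u + r2 * v" "b = r2 * u - r1 * v" unfolding a_def b_def r e_def by (simp_all add: algebra_simps)
        have "a * u - b * v = r1 * (u\<^sup>2 + v\<^sup>2)" "a * v + b * u = r2 * (u\<^sup>2 + v\<^sup>2)"
          unfolding ab by (simp_all add: algebra_simps power2_eq_square)
        then show ?thesis using uv r by simp
      qed
      define c where "c = P + (1/3) *\<^sub>R (Q - P) + (1/3) *\<^sub>R (R - P)"
      have "ball c \<rho> \<subseteq> K"
      proof
        fix z assume "z \<in> ball c \<rho>"
        then have nz: "norm (z - c) < \<rho>" by (simp add: dist_norm norm_minus_commute)
        define \<alpha> \<beta> where "\<alpha> = (z - c) \<bullet> (u, v)" and "\<beta> = (z - c) \<bullet> e"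
        have \<alpha>: "\<bar>\<alpha>\<bar> \<le> \<rho>" unfolding \<alpha>_def using Cauchy_Schwarz_ineq2[of "z - c" "(u, v)"] nuv nz by simp
        have \<beta>: "\<bar>\<beta>\<bar> \<le> \<rho>" unfolding \<beta>_def using Cauchy_Schwarz_ineq2[of "z - c" e] ne nz by simp
        have zc: "z - c = (\<alpha> * u - \<beta> * v, \<alpha> * v + \<beta> * u)"
        proof -
          obtain r1 r2 where r: "z - c = (r1, r2)" by (cases "z - c")
          have ab: "\<alpha> = r1 * u + r2 * v" "\<beta> = r2 * u - r1 * v" unfolding \<alpha>_def \<beta>_def r e_def by (simp_all add: algebra_simps)
          have "\<alpha> * u - \<beta> * v = r1 * (u\<^sup>2 + v\<^sup>2)" "\<alpha> * v + \<beta> * u = r2 * (u\<^sup>2 + v\<^sup>2)"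
            unfolding ab by (simp_all add: algebra_simps power2_eq_square)
          then show ?thesis using uv r by simp
        qed
        \<comment> \<open>coordinates of \<open>z - c\<close> in the basis \<open>Q - P\<close>, \<open>R - P\<close>; as they are at most \<open>4/15\<close> and \<open>1/15\<close> in modulus, all barycentric coordinates of \<open>z\<close> are nonnegative\<close>
        define t s where "t = \<beta> / b" and "s = (\<alpha> - t * a) / D"
        have t: "\<bar>t\<bar> \<le> 1/15"
        proof -
          have "\<bar>t\<bar> = \<bar>\<beta>\<bar> / \<bar>b\<bar>" by (simp add: t_def)
          also have "\<dots> \<le> \<rho> / (15 * \<rho>)" using \<beta> b \<rho> by (intro frac_le) auto
          finally show ?thesis using \<rho> by simp
        qed
        have s: "\<bar>s\<bar> \<le> 4/15"
        proof -
          have "\<rho> \<le> 2 * D / 15" using b by linarith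
          moreover have "\<bar>t * a\<bar> \<le> 1/15 * (2 * D)" unfolding abs_mult using t a by (intro mult_mono) auto
          ultimately have "\<bar>\<alpha> - t * a\<bar> \<le> 4/15 * D" using \<alpha> by linarith
          then show ?thesis using D(2) by (simp add: s_def field_simps)
        qed
        have "z - c = s *\<^sub>R (Q - P) + t *\<^sub>R (R - P)"
          unfolding zc QP RP using D(2) b0 by (simp add: s_def t_def field_simps)
        then have zz: "z = P + (1/3) *\<^sub>R (Q - P) + (1/3) *\<^sub>R (R - P) + (s *\<^sub>R (Q - P) + t *\<^sub>R (R - P))"
          unfolding c_def[symmetric] by (metis add.commute diff_add_cancel)
        have "z = (1/3 - s - t) *\<^sub>R P + ((1/3 + s) *\<^sub>R Q + (1/3 + t) *\<^sub>R R)"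
        proof (rule prod_eqI)
          show "fst z = fst ((1/3 - s - t) *\<^sub>R P + ((1/3 + s) *\<^sub>R Q + (1/3 + t) *\<^sub>R R))"
            using arg_cong[OF zz, of fst] by (simp add: algebra_simps)
          show "snd z = snd ((1/3 - s - t) *\<^sub>R P + ((1/3 + s) *\<^sub>R Q + (1/3 + t) *\<^sub>R R))"
            using arg_cong[OF zz, of snd] by (simp add: algebra_simps)
        qed
        moreover have "(1/3 - s - t) *\<^sub>R P + ((1/3 + s) *\<^sub>R Q + (1/3 + t) *\<^sub>R R) \<in> K"
          using t s by (intro convexD_3[OF K(1)] PQ R) auto
        ultimately show "z \<in> K" by simp
      qed
      then show False using no by blast
    qed
  qed (use \<rho> in simp)
  with ne show ?thesis by blast
qed


section \<open>Sublevel sets of the potential\<close>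

text \<open>
  The tangent of \<open>1 / x\<^sup>2\<close> at \<open>s\<close> is \<open>(3 s - 2 x) / s\<^sup>3\<close>; the difference factors as a square times a positive
  number.
\<close>

lemma inverse_square_convex:
  fixes a b t :: real
  assumes "0 < a" "0 < b" "0 \<le> t" "t \<le> 1"
  shows "1 / ((1 - t) * a + t * b)\<^sup>2 \<le> (1 - t) * (1 / a\<^sup>2) + t * (1 / b\<^sup>2)"
proof -
  define s where "s = (1 - t) * a + t * b"
  have s: "0 < s"
  proof (cases "t = 0")
    case False
    then have "0 < t * b" using assms by simp
    moreover have "0 \<le> (1 - t) * a" using assms by simp
    ultimately show ?thesis unfolding s_def by linarith
  qed (use assms in \<open>simp add: s_def\<close>)
  have tangent: "(3 * s - 2 * x) / s ^ 3 \<le> 1 / x\<^sup>2" if "0 < x" for x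
  proof -
    have "0 \<le> (s - x)\<^sup>2 * (s + 2 * x)" using that s by simp
    also have "\<dots> = s ^ 3 - x\<^sup>2 * (3 * s - 2 * x)" by (simp add: power2_eq_square power3_eq_cube algebra_simps)
    finally have "x\<^sup>2 * (3 * s - 2 * x) \<le> s ^ 3" by simp
    then show ?thesis using that s by (simp add: field_simps)
  qed
  have "1 / s\<^sup>2 = (3 * s - 2 * s) / s ^ 3" using s by (simp add: field_simps eval_nat_numeral)
  also have "3 * s - 2 * s = (1 - t) * (3 * s - 2 * a) + t * (3 * s - 2 * b)" by (simp add: s_def algebra_simps)
  also have "\<dots> / s ^ 3 = (1 - t) * ((3 * s - 2 * a) / s ^ 3) + t * ((3 * s - 2 * b) / s ^ 3)"
    by (simp add: add_divide_distrib)
  also have "\<dots> \<le> (1 - t) * (1 / a\<^sup>2) + t * (1 / b\<^sup>2)"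
    using assms by (intro add_mono mult_left_mono tangent) auto
  finally show ?thesis by (simp add: s_def)
qed

text \<open>
  The point \<open>p0\<close>, where the potential reaches its minimum, may lie on the boundary of \<open>\<Omega>\<close>.
\<close>

locale concave_well =
  fixes \<Omega> :: "(real \<times> real) set" and h :: "real \<times> real \<Rightarrow> real" and p0 :: "real \<times> real"
  assumes open_O: "open \<Omega>" and convex_O: "convex \<Omega>" and bounded_O: "bounded \<Omega>" and nonempty_O: "\<Omega> \<noteq> {}"
    and h_concave: "concave_on (closure \<Omega>) h" and h_range: "\<And>p. p \<in> closure \<Omega> \<Longrightarrow> 0 \<le> h p \<and> h p \<le> 1"
    and p0: "p0 \<in> closure \<Omega>" "h p0 = 1"
begin

abbreviation "W \<equiv> potential h"

lemma in_closure: "p \<in> \<Omega> \<Longrightarrow> p \<in> closure \<Omega>" using closure_subset by blast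

lemma h_pos: assumes p: "p \<in> \<Omega>" shows "0 < h p"
proof -
  obtain e where e: "0 < e" "ball p e \<subseteq> \<Omega>" using open_O p by (auto simp: open_contains_ball)
  define N where "N = norm (p - p0) + 1"
  have n: "0 < N" by (simp add: N_def add_nonneg_pos)
  define s where "s = e / (2 * N)"
  have s: "0 < s" using e n by (simp add: s_def)
  define q where "q = p + s *\<^sub>R (p - p0)"
  have "s * norm (p - p0) \<le> e / 2"
  proof -
    have "s * norm (p - p0) \<le> s * N" using s by (intro mult_left_mono) (auto simp: N_def)
    also have "\<dots> = e / 2" using n by (simp add: s_def)
    finally show ?thesis .
  qed
  then have "q \<in> ball p e" using e s by (simp add: q_def dist_norm)
  then have q: "q \<in> closure \<Omega>" using e(2) in_closure by blast
  define t where "t = s / (1 + s)"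
  have t: "0 < t" "t < 1" using s by (auto simp: t_def)
  have "p = (1 - t) *\<^sub>R q + t *\<^sub>R p0"
  proof -
    have t1: "(1 + s) * (1 - t) = 1" "(1 + s) * t = s" using s by (simp_all add: t_def field_simps)
    have "(1 + s) *\<^sub>R ((1 - t) *\<^sub>R q + t *\<^sub>R p0) = q + s *\<^sub>R p0"
      by (simp add: scaleR_add_right t1)
    also have "\<dots> = (1 + s) *\<^sub>R p" by (simp add: q_def algebra_simps)
    finally show ?thesis using s by (simp add: add_eq_0_iff)
  qed
  then have "(1 - t) * h q + t * h p0 \<le> h p"
    using concave_onD[OF h_concave, of t q p0] t q p0 by simp
  moreover have "0 \<le> (1 - t) * h q" using h_range[OF q] t by simp
  ultimately show ?thesis using p0(2) t by simp
qed

lemma W_ge_1: "p \<in> \<Omega> \<Longrightarrow> 1 \<le> W p"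
  using h_pos[of p] h_range[OF in_closure, of p] by (simp add: potential_def field_simps power_le_one)

lemma W_convex: "convex_on \<Omega> W"
proof (rule convex_onI[OF _ convex_O])
  fix t :: real and x y assume t: "0 < t" "t < 1" and xy: "x \<in> \<Omega>" "y \<in> \<Omega>"
  have pos: "0 < (1 - t) * h x + t * h y" using t h_pos[OF xy(1)] h_pos[OF xy(2)] by (intro add_pos_pos) auto
  have le: "(1 - t) * h x + t * h y \<le> h ((1 - t) *\<^sub>R x + t *\<^sub>R y)"
    using t xy by (intro concave_onD[OF h_concave]) (auto intro: in_closure)
  have "W ((1 - t) *\<^sub>R x + t *\<^sub>R y) \<le> 1 / ((1 - t) * h x + t * h y)\<^sup>2"
    unfolding potential_def using pos le by (intro divide_left_mono power_mono) auto
  also have "\<dots> \<le> (1 - t) * W x + t * W y"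
    unfolding potential_def using t h_pos xy by (intro inverse_square_convex) auto
  finally show "W ((1 - t) *\<^sub>R x + t *\<^sub>R y) \<le> (1 - t) * W x + t * W y" .
qed

lemma W_continuous: "continuous_on \<Omega> W" using open_O W_convex by (rule convex_on_continuous)

sublocale planar_schroedinger \<Omega> W
  by standard (use open_O bounded_O nonempty_O W_continuous W_ge_1 in auto)

text \<open>
  Contracting towards the minimum point multiplies the excess \<open>V - 1\<close> by at most the contraction factor.
\<close>

lemma contraction:
  assumes p: "p \<in> \<Omega>" and t: "0 < t" "t \<le> 1"
  shows "(1 - t) *\<^sub>R p0 + t *\<^sub>R p \<in> \<Omega>" "W ((1 - t) *\<^sub>R p0 + t *\<^sub>R p) \<le> (1 - t) + t * W p"
proof -
  have "p0 - t *\<^sub>R (p0 - p) \<in> interior \<Omega>"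
    using p t p0(1) open_O by (intro mem_interior_closure_convex_shrink convex_O) (auto simp: interior_open)
  moreover have eq: "p0 - t *\<^sub>R (p0 - p) = (1 - t) *\<^sub>R p0 + t *\<^sub>R p" by (simp add: algebra_simps)
  ultimately show q: "(1 - t) *\<^sub>R p0 + t *\<^sub>R p \<in> \<Omega>" using open_O by (simp add: interior_open)
  have hp: "0 < h p" by (rule h_pos[OF p])
  have le: "(1 - t) * 1 + t * h p \<le> h ((1 - t) *\<^sub>R p0 + t *\<^sub>R p)"
    using concave_onD[OF h_concave, of t p0 p] t p in_closure p0 by auto
  have pos: "0 < (1 - t) * 1 + t * h p" using hp t by (intro add_nonneg_pos) auto
  have "W ((1 - t) *\<^sub>R p0 + t *\<^sub>R p) \<le> 1 / ((1 - t) * 1 + t * h p)\<^sup>2"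
    unfolding potential_def using pos le by (intro divide_left_mono power_mono) auto
  also have "\<dots> \<le> (1 - t) * (1 / 1\<^sup>2) + t * (1 / (h p)\<^sup>2)"
    using hp t by (intro inverse_square_convex) auto
  finally show "W ((1 - t) *\<^sub>R p0 + t *\<^sub>R p) \<le> (1 - t) + t * W p" by (simp add: potential_def)
qed

text \<open>
  Sublevel sets at different heights are comparable: shrinking a higher one towards \<open>p0\<close> by the ratio of
  the heights lands in the lower one.
\<close>

lemma low_set_contraction:
  assumes "p \<in> low_set \<Omega> W s" "0 < t" "t \<le> 1" "t * s \<le> s'"
  shows "(1 - t) *\<^sub>R p0 + t *\<^sub>R p \<in> low_set \<Omega> W s'"
proof -
  have p: "p \<in> \<Omega>" "W p \<le> 1 + s" using assms(1) by (auto simp: low_set_def)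
  have "t * W p \<le> t * (1 + s)" using p(2) assms(2) by (intro mult_left_mono) auto
  then have "(1 - t) + t * W p \<le> 1 + s'" using assms(4) by (simp add: algebra_simps)
  then show ?thesis using contraction[OF p(1) assms(2,3)] by (auto simp: low_set_def)
qed

lemma bounded_low_set: "bounded (low_set \<Omega> W s)"
  using bounded_O by (rule bounded_subset) (auto simp: low_set_def)

definition "L1_admissible L \<longleftrightarrow> 0 < L \<and> L \<le> inner_radius (low_set \<Omega> W (1 / L\<^sup>2))"

lemma L1_admissible_exists: "\<exists>L. L1_admissible L"
proof -
  obtain c where c: "c \<in> \<Omega>" using nonempty_O by blast
  obtain r where r: "0 < r" "cball c r \<subseteq> \<Omega>" using open_O c by (auto simp: open_contains_cball)
  obtain B where B: "\<And>p. p \<in> cball c r \<Longrightarrow> W p \<le> B" using plane.V_bounded[OF compact_cball r(2)] by blast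
  define L where "L = min r (1 / sqrt (\<bar>B\<bar> + 1))"
  have L: "0 < L" "L \<le> r" using r by (auto simp: L_def)
  have "L\<^sup>2 \<le> (1 / sqrt (\<bar>B\<bar> + 1))\<^sup>2" using L by (intro power_mono) (auto simp: L_def)
  then have "\<bar>B\<bar> + 1 \<le> 1 / L\<^sup>2" using L by (simp add: power_divide field_simps)
  then have bl: "\<bar>B\<bar> + 1 \<le> 1 / L\<^sup>2" .
  have "ball c L \<subseteq> low_set \<Omega> W (1 / L\<^sup>2)"
  proof (intro subsetI)
    fix p assume "p \<in> ball c L"
    then have p: "p \<in> cball c r" using L by auto
    then have "W p \<le> 1 + 1 / L\<^sup>2" using B[OF p] bl by linarith
    then show "p \<in> low_set \<Omega> W (1 / L\<^sup>2)" using p r by (auto simp: low_set_def)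
  qed
  then have "L1_admissible L" using L inner_radius_ge[OF bounded_low_set, of c L] by (auto simp: L1_admissible_def)
  then show ?thesis by blast
qed

lemma L1_admissible_bounded: "\<exists>B. \<forall>L. L1_admissible L \<longrightarrow> L \<le> B"
proof -
  obtain B where B: "0 < B" "\<Omega> \<subseteq> ball 0 B" using bounded_subset_ballD[OF bounded_O, of 0] by blast
  have "L \<le> B" if "L1_admissible L" for L
  proof (rule ccontr)
    assume "\<not> L \<le> B"
    then have "B < inner_radius (low_set \<Omega> W (1 / L\<^sup>2))" using that by (simp add: L1_admissible_def)
    then obtain r where r: "B < r" "r < inner_radius (low_set \<Omega> W (1 / L\<^sup>2))" using dense by blast
    then obtain c where "ball c r \<subseteq> low_set \<Omega> W (1 / L\<^sup>2)" using ball_of_less_inner_radius[OF bounded_low_set] by blast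
    then have "r \<le> B" using B by (intro radius_le[of \<Omega>]) (auto simp: low_set_def)
    then show False using r by simp
  qed
  then show ?thesis by blast
qed

text \<open>
  Centres of almost optimal discs accumulate by compactness, and an open disc about the limit centre
  consists of points that lie in almost all of the approximating discs.  This makes the defining
  \<open>GREATEST\<close> meaningful.
\<close>

lemma L1_admissible_greatest: "\<exists>L. L1_admissible L \<and> (\<forall>L'. L1_admissible L' \<longrightarrow> L' \<le> L)"
proof -
  define X where "X = Collect L1_admissible"
  have X: "X \<noteq> {}" "bdd_above X" using L1_admissible_exists L1_admissible_bounded by (auto simp: X_def bdd_above_def)
  define L where "L = Sup X"
  have up: "L' \<le> L" if "L1_admissible L'" for L' unfolding L_def using X that by (intro cSup_upper) (auto simp: X_def)
  have L: "0 < L"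
  proof -
    obtain L' where "L1_admissible L'" using L1_admissible_exists by blast
    then show ?thesis using up[of L'] by (auto simp: L1_admissible_def)
  qed
  have "\<exists>l. L1_admissible l \<and> L - L / real (n + 2) < l" for n
  proof -
    have "L - L / real (n + 2) < Sup X" using L by (simp add: L_def)
    then show ?thesis using less_cSupD[OF X(1)] by (auto simp: X_def)
  qed
  then obtain l where l: "\<And>n. L1_admissible (l n)" "\<And>n. L - L / real (n + 2) < l n" by metis
  have llim: "l \<longlonglongrightarrow> L"
  proof (rule tendsto_sandwich[OF always_eventually always_eventually _ tendsto_const])
    show "\<forall>n. L - L / real (n + 2) \<le> l n" using l(2) by (auto intro: less_imp_le)
    show "\<forall>n. l n \<le> L" using up l(1) by blast
    show "(\<lambda>n. L - L / real (n + 2)) \<longlonglongrightarrow> L" by real_asymp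
  qed
  define r where "r n = l n - L / real (n + 2)" for n
  have rlim: "r \<longlonglongrightarrow> L"
  proof -
    have "(\<lambda>n. L / real (n + 2)) \<longlonglongrightarrow> 0" by real_asymp
    from tendsto_diff[OF llim this] show ?thesis by (simp add: r_def[abs_def])
  qed
  have "\<exists>c. ball c (r n) \<subseteq> low_set \<Omega> W (1 / (l n)\<^sup>2)" for n
  proof -
    have "0 < L / real (n + 2)" using L by simp
    then have "r n < inner_radius (low_set \<Omega> W (1 / (l n)\<^sup>2))"
      using l(1)[of n] unfolding r_def L1_admissible_def by linarith
    then show ?thesis using ball_of_less_inner_radius[OF bounded_low_set] by metis
  qed
  then obtain c where c: "\<And>n. ball (c n) (r n) \<subseteq> low_set \<Omega> W (1 / (l n)\<^sup>2)" by metis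
  have rpos: "0 < r n" for n
  proof -
    have "2 * (L / real (n + 2)) \<le> L" using L by (simp add: field_simps)
    then show ?thesis using l(2)[of n] by (simp add: r_def)
  qed
  have cO: "c n \<in> closure \<Omega>" for n
  proof -
    have "c n \<in> ball (c n) (r n)" using rpos[of n] by simp
    then have "c n \<in> \<Omega>" using c[of n] unfolding low_set_def by blast
    then show ?thesis by (rule in_closure)
  qed
  obtain c' \<rho> where c': "strict_mono (\<rho> :: nat \<Rightarrow> nat)" "(c \<circ> \<rho>) \<longlonglongrightarrow> c'"
    using cO bounded_O by (metis compact_closure compact_def seq_compact_def compact_imp_seq_compact)
  have "ball c' L \<subseteq> low_set \<Omega> W (1 / L\<^sup>2)"
  proof
    fix p assume p: "p \<in> ball c' L"
    have d: "(\<lambda>n. dist (c (\<rho> n)) p) \<longlonglongrightarrow> dist c' p" using tendsto_dist[OF c'(2) tendsto_const] by (simp add: o_def)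
    have rr: "(\<lambda>n. r (\<rho> n)) \<longlonglongrightarrow> L" using LIMSEQ_subseq_LIMSEQ[OF rlim c'(1)] by (simp add: o_def)
    have ll: "(\<lambda>n. l (\<rho> n)) \<longlonglongrightarrow> L" using LIMSEQ_subseq_LIMSEQ[OF llim c'(1)] by (simp add: o_def)
    have "(\<lambda>n. r (\<rho> n) - dist (c (\<rho> n)) p) \<longlonglongrightarrow> L - dist c' p" by (intro tendsto_diff d rr)
    then have ev: "eventually (\<lambda>n. 0 < r (\<rho> n) - dist (c (\<rho> n)) p) sequentially"
      using p by (intro order_tendstoD(1)) auto
    then have ev': "eventually (\<lambda>n. p \<in> \<Omega> \<and> W p \<le> 1 + 1 / (l (\<rho> n))\<^sup>2) sequentially"
    proof eventually_elim
      case (elim n)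
      then have "p \<in> ball (c (\<rho> n)) (r (\<rho> n))" by simp
      then have "p \<in> low_set \<Omega> W (1 / (l (\<rho> n))\<^sup>2)" using c[of "\<rho> n"] by blast
      then show ?case by (simp add: low_set_def)
    qed
    have "(\<lambda>n. 1 + 1 / (l (\<rho> n))\<^sup>2) \<longlonglongrightarrow> 1 + 1 / L\<^sup>2" using L by (intro tendsto_intros ll) auto
    then have "W p \<le> 1 + 1 / L\<^sup>2"
      by (rule tendsto_lowerbound) (use ev' in \<open>auto elim: eventually_mono\<close>)
    moreover have "p \<in> \<Omega>" using ev' eventually_happens[OF ev'] by auto
    ultimately show "p \<in> low_set \<Omega> W (1 / L\<^sup>2)" by (simp add: low_set_def)
  qed
  then have "L1_admissible L" using L inner_radius_ge[OF bounded_low_set] by (auto simp: L1_admissible_def)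
  with up show ?thesis by blast
qed

abbreviation "L1 \<equiv> scale_L1 \<Omega> W"

lemma L1_attained: "0 < L1" "L1 \<le> inner_radius (low_set \<Omega> W (1 / L1\<^sup>2))"
  and L1_greatest: "\<And>L. 0 < L \<Longrightarrow> L \<le> inner_radius (low_set \<Omega> W (1 / L\<^sup>2)) \<Longrightarrow> L \<le> L1"
proof -
  obtain L where L: "L1_admissible L" "\<And>L'. L1_admissible L' \<Longrightarrow> L' \<le> L" using L1_admissible_greatest by blast
  have "L1 = L" unfolding scale_L1_def
    by (rule Greatest_equality) (use L in \<open>auto simp: L1_admissible_def\<close>)
  then show "0 < L1" "L1 \<le> inner_radius (low_set \<Omega> W (1 / L1\<^sup>2))"
    "\<And>L. 0 < L \<Longrightarrow> L \<le> inner_radius (low_set \<Omega> W (1 / L\<^sup>2)) \<Longrightarrow> L \<le> L1"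
    using L by (auto simp: L1_admissible_def)
qed

lemma L1_ball: obtains c where "cball c (L1 / 2) \<subseteq> \<Omega>" "\<And>p. p \<in> cball c (L1 / 2) \<Longrightarrow> W p \<le> 1 + 1 / L1\<^sup>2"
proof -
  have "3 / 4 * L1 < inner_radius (low_set \<Omega> W (1 / L1\<^sup>2))" using L1_attained by simp
  then obtain c where "ball c (3 / 4 * L1) \<subseteq> low_set \<Omega> W (1 / L1\<^sup>2)"
    using ball_of_less_inner_radius[OF bounded_low_set] by blast
  moreover have "cball c (L1 / 2) \<subseteq> ball c (3 / 4 * L1)" using L1_attained by auto
  ultimately have "cball c (L1 / 2) \<subseteq> low_set \<Omega> W (1 / L1\<^sup>2)" by blast
  then show ?thesis by (intro that[of c]) (auto simp: low_set_def)
qed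

text \<open>
  Contracting a disc of radius \<open>8 L\<^sub>1\<close> by the factor \<open>1/4\<close> gives a disc of radius \<open>2 L\<^sub>1\<close> in the sublevel
  set of height \<open>(2 L\<^sub>1)\<^sup>-\<^sup>2\<close>, against the maximality of \<open>L\<^sub>1\<close>.
\<close>

lemma no_big_ball: "\<not> ball c (8 * L1) \<subseteq> L1_set \<Omega> W"
proof
  assume ball: "ball c (8 * L1) \<subseteq> L1_set \<Omega> W"
  have "ball ((3/4) *\<^sub>R p0 + (1/4) *\<^sub>R c) (2 * L1) \<subseteq> low_set \<Omega> W (1 / (2 * L1)\<^sup>2)"
  proof
    fix q assume q: "q \<in> ball ((3/4) *\<^sub>R p0 + (1/4) *\<^sub>R c) (2 * L1)"
    define p where "p = 4 *\<^sub>R q - 3 *\<^sub>R p0"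
    have qp: "q = (1 - 1/4) *\<^sub>R p0 + (1/4) *\<^sub>R p" by (simp add: p_def algebra_simps)
    have "c - p = 4 *\<^sub>R (((3/4) *\<^sub>R p0 + (1/4) *\<^sub>R c) - q)" by (simp add: p_def algebra_simps)
    then have "norm (c - p) = 4 * norm (((3/4) *\<^sub>R p0 + (1/4) *\<^sub>R c) - q)" by (simp only: norm_scaleR abs_numeral)
    then have "p \<in> ball c (8 * L1)" using q by (simp add: dist_norm)
    then have "p \<in> low_set \<Omega> W (1 / L1\<^sup>2)" using ball by (auto simp: L1_set_def)
    then show "q \<in> low_set \<Omega> W (1 / (2 * L1)\<^sup>2)"
      unfolding qp by (rule low_set_contraction) (auto simp: power_mult_distrib)
  qed
  then have "2 * L1 \<le> inner_radius (low_set \<Omega> W (1 / (2 * L1)\<^sup>2))"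
    using L1_attained(1) by (intro inner_radius_ge[OF bounded_low_set]) auto
  then show False using L1_greatest[of "2 * L1"] L1_attained(1) by simp
qed

lemma convex_low_set: "convex (low_set \<Omega> W s)"
  unfolding convex_alt
proof (intro ballI allI impI)
  fix x y and u :: real assume xy: "x \<in> low_set \<Omega> W s" "y \<in> low_set \<Omega> W s" and u: "0 \<le> u \<and> u \<le> 1"
  have "W ((1 - u) *\<^sub>R x + u *\<^sub>R y) \<le> (1 - u) * W x + u * W y"
    using xy u by (intro convex_onD[OF W_convex]) (auto simp: low_set_def)
  also have "\<dots> \<le> (1 - u) * (1 + s) + u * (1 + s)"
    using xy u by (intro add_mono mult_left_mono) (auto simp: low_set_def)
  finally show "(1 - u) *\<^sub>R x + u *\<^sub>R y \<in> low_set \<Omega> W s"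
    using xy u convexD_alt[OF convex_O, of x y u] by (auto simp: low_set_def algebra_simps)
qed

text \<open>
  The sublevel set at height \<open>L\<^sub>1\<^sup>-\<^sup>2\<close> contains no large disc, so it is thin in some direction, hence in the
  vertical one by the choice of orientation.  Higher sublevel sets reduce to this one by contraction.
\<close>

lemma low_set_strip:
  assumes wo: "well_oriented \<Omega> W" and k: "1 \<le> k"
    and p: "p \<in> low_set \<Omega> W (k / L1\<^sup>2)" and q: "q \<in> low_set \<Omega> W (k / L1\<^sup>2)"
  shows "\<bar>snd p - snd q\<bar> \<le> 240 * k * L1"
proof -
  obtain e where e: "norm e = 1" "projection_length e (L1_set \<Omega> W) \<le> 30 * (8 * L1)"
    using convex_thin_of_no_ball[of "L1_set \<Omega> W" "8 * L1"] no_big_ball convex_low_set bounded_low_set L1_attained(1)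
    by (auto simp: L1_set_def)
  then have w: "projection_length (0, 1) (L1_set \<Omega> W) \<le> 240 * L1"
    using wo unfolding well_oriented_def by fastforce
  have base: "\<bar>snd x - snd y\<bar> \<le> 240 * L1" if "x \<in> L1_set \<Omega> W" "y \<in> L1_set \<Omega> W" for x y
  proof -
    have b: "bounded ((\<lambda>p. p \<bullet> (0, 1)) ` L1_set \<Omega> W)"
      using bounded_low_set unfolding L1_set_def by (intro bounded_linear_image[OF _ bounded_linear_inner_left])
    have "dist (x \<bullet> (0, 1)) (y \<bullet> (0, 1)) \<le> diameter ((\<lambda>p. p \<bullet> (0, 1)) ` L1_set \<Omega> W)"
      using that by (intro diameter_bounded_bound[OF b]) auto
    then show ?thesis using w by (simp add: projection_length_def dist_real_def inner_prod_def)
  qed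
  have in_L1: "(1 - 1/k) *\<^sub>R p0 + (1/k) *\<^sub>R x \<in> L1_set \<Omega> W" if "x \<in> low_set \<Omega> W (k / L1\<^sup>2)" for x
    unfolding L1_set_def using that k by (intro low_set_contraction[OF that]) auto
  have "\<bar>(1/k) * (snd p - snd q)\<bar> \<le> 240 * L1"
    using base[OF in_L1[OF p] in_L1[OF q]] by (simp add: algebra_simps)
  then show ?thesis using k by (simp add: abs_mult field_simps)
qed

end

section \<open>Log-concave subsolutions on an interval\<close>

text \<open>
  In the weighted norm \<open>sup |v(y)| e\<^sup>-\<^sup>k\<^sup>y\<close> the integral operator of the initial value problem has norm
  of order \<open>1 / k\<close>; this estimate is the reason.
\<close>

lemma exp_integral_le:
  fixes k :: real
  assumes "0 < k" "l \<le> z"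
  shows "integral {l..z} (\<lambda>s. exp (k * s)) \<le> exp (k * z) / k"
proof -
  have "((\<lambda>s. exp (k * s)) has_integral exp (k * z) / k - exp (k * l) / k) {l..z}"
    using assms by (intro fundamental_theorem_of_calculus)
      (auto intro!: derivative_eq_intros simp flip: has_real_derivative_iff_has_vector_derivative)
  then show ?thesis using assms(1) by (simp add: integral_unique)
qed

text \<open>
  The equation \<open>v'' = c v\<close> with \<open>v(l) = 0\<close>, \<open>v'(l) = 1\<close> is equivalent to
  \<open>v(y) = y - l + \<integral> (y - s) c(s) v(s) ds\<close> over \<open>[l, y]\<close>, and the right-hand side is a contraction in
  a weighted sup norm.
\<close>

lemma linear_initial_value_problem:
  fixes c :: "real \<Rightarrow> real"
  assumes lr: "l < r" and c: "continuous_on {l..r} c"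
  shows "\<exists>v v'. continuous_on {l..r} v \<and> continuous_on {l..r} v' \<and> v l = 0 \<and> v' l = 1 \<and>
    (\<forall>y\<in>{l<..<r}. (v has_real_derivative v' y) (at y) \<and> (v' has_real_derivative c y * v y) (at y))"
proof -
  obtain C where C: "0 < C" "\<And>y. y \<in> {l..r} \<Longrightarrow> \<bar>c y\<bar> \<le> C"
    using compact_imp_bounded[OF compact_continuous_image[OF c compact_Icc]] by (auto simp: bounded_pos)
  define d where "d = r - l"
  have d: "0 < d" using lr by (simp add: d_def)
  define k where "k = 2 * C * d"
  have k: "0 < k" using C d by (simp add: k_def)
  \<comment> \<open>the fixed point theorem is applied to bounded continuous functions on the whole line, extended constantly outside \<open>[l, r]\<close>; the unknown is \<open>w = e\<^sup>-\<^sup>k\<^sup>y v\<close>\<close>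
  define z where "z y = max l (min r y)" for y :: real
  have z: "z y \<in> {l..r}" for y using lr by (auto simp: z_def)
  have cz: "continuous_on UNIV z" unfolding z_def[abs_def] by (intro continuous_intros)
  define I1 I2 where "I1 w x = integral {l..x} (\<lambda>s. c s * (exp (k * s) * apply_bcontfun w s))"
    and "I2 w x = integral {l..x} (\<lambda>s. s * (c s * (exp (k * s) * apply_bcontfun w s)))" for w :: "real \<Rightarrow>\<^sub>C real" and x
  have cw: "continuous_on S (apply_bcontfun w)" for S and w :: "real \<Rightarrow>\<^sub>C real"
    by (rule continuous_on_apply_bcontfun)
  have c1: "continuous_on {l..r} (\<lambda>s. c s * (exp (k * s) * apply_bcontfun w s))"
    and c2: "continuous_on {l..r} (\<lambda>s. s * (c s * (exp (k * s) * apply_bcontfun w s)))" for w :: "real \<Rightarrow>\<^sub>C real"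
    by (intro continuous_intros c cw)+
  have int1: "(\<lambda>s. c s * (exp (k * s) * apply_bcontfun w s)) integrable_on {l..x}"
    and int2: "(\<lambda>s. s * (c s * (exp (k * s) * apply_bcontfun w s))) integrable_on {l..x}" if "x \<in> {l..r}" for w :: "real \<Rightarrow>\<^sub>C real" and x
    using that by (auto intro!: integrable_continuous_real continuous_on_subset[OF c1] continuous_on_subset[OF c2])
  have cI1: "continuous_on {l..r} (I1 w)" and cI2: "continuous_on {l..r} (I2 w)" for w
    unfolding I1_def[abs_def] I2_def[abs_def]
    by (intro indefinite_integral_continuous_1 integrable_continuous_real c1 c2)+
  define g where "g w x = exp (- k * x) * ((x - l) + x * I1 w x - I2 w x)" for w x
  have cg: "continuous_on {l..r} (g w)" for w
    unfolding g_def[abs_def] by (intro continuous_intros cI1 cI2)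
  define T where "T w = Bcontfun (\<lambda>y. g w (z y))" for w
  have T: "apply_bcontfun (T w) y = g w (z y)" for w y
  proof -
    have "(\<lambda>y. g w (z y)) \<in> bcontfun"
    proof -
      have "continuous_on UNIV (\<lambda>y. g w (z y))" by (rule continuous_on_compose2[OF cg cz]) (use z in auto)
      moreover have "bounded (range (\<lambda>y. g w (z y)))"
      proof (rule bounded_subset)
        show "bounded (g w ` {l..r})" by (intro compact_imp_bounded compact_continuous_image cg compact_Icc)
        show "range (\<lambda>y. g w (z y)) \<subseteq> g w ` {l..r}" using z by blast
      qed
      ultimately show ?thesis by (simp add: bcontfun_def)
    qed
    then show ?thesis by (simp add: T_def Bcontfun_inverse)
  qed
  have contr: "dist (T w1) (T w2) \<le> 1/2 * dist w1 w2" for w1 w2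
  proof (rule dist_bound)
    fix y
    define x where "x = z y"
    have x: "x \<in> {l..r}" unfolding x_def by (rule z)
    define D where "D = dist w1 w2"
    let ?h = "\<lambda>s. (x - s) * (c s * (exp (k * s) * (apply_bcontfun w1 s - apply_bcontfun w2 s)))"
    have "g w1 x - g w2 x = exp (- k * x) * (x * (I1 w1 x - I1 w2 x) - (I2 w1 x - I2 w2 x))"
      by (simp add: g_def algebra_simps)
    also have "x * (I1 w1 x - I1 w2 x) - (I2 w1 x - I2 w2 x) = integral {l..x} ?h"
    proof -
      have "I1 w1 x - I1 w2 x = integral {l..x} (\<lambda>s. c s * (exp (k * s) * apply_bcontfun w1 s) - c s * (exp (k * s) * apply_bcontfun w2 s))"
        unfolding I1_def by (rule Henstock_Kurzweil_Integration.integral_diff[symmetric]) (intro int1[OF x])+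
      moreover have "I2 w1 x - I2 w2 x = integral {l..x} (\<lambda>s. s * (c s * (exp (k * s) * apply_bcontfun w1 s)) - s * (c s * (exp (k * s) * apply_bcontfun w2 s)))"
        unfolding I2_def by (rule Henstock_Kurzweil_Integration.integral_diff[symmetric]) (intro int2[OF x])+
      moreover have "integral {l..x} ?h = integral {l..x} (\<lambda>s. x * (c s * (exp (k * s) * apply_bcontfun w1 s) - c s * (exp (k * s) * apply_bcontfun w2 s))
          - (s * (c s * (exp (k * s) * apply_bcontfun w1 s)) - s * (c s * (exp (k * s) * apply_bcontfun w2 s))))"
        by (rule integral_cong) (simp add: algebra_simps)
      moreover have "\<dots> = x * integral {l..x} (\<lambda>s. c s * (exp (k * s) * apply_bcontfun w1 s) - c s * (exp (k * s) * apply_bcontfun w2 s))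
          - integral {l..x} (\<lambda>s. s * (c s * (exp (k * s) * apply_bcontfun w1 s)) - s * (c s * (exp (k * s) * apply_bcontfun w2 s)))"
        by (subst Henstock_Kurzweil_Integration.integral_diff)
          (intro integrable_diff int1[OF x] int2[OF x] integrable_on_mult_right, intro integrable_diff int2[OF x], simp)
      ultimately show ?thesis by simp
    qed
    also have "\<bar>exp (- k * x) * integral {l..x} ?h\<bar> = exp (- k * x) * \<bar>integral {l..x} ?h\<bar>" by (simp add: abs_mult)
    also have "\<dots> \<le> exp (- k * x) * (d * C * D * (exp (k * x) / k))"
    proof (rule mult_left_mono)
      have "norm (integral {l..x} ?h) \<le> integral {l..x} (\<lambda>s. d * C * D * exp (k * s))"
      proof (rule integral_norm_bound_integral)
        show "?h integrable_on {l..x}"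
          using x by (intro integrable_continuous_real continuous_intros continuous_on_subset[OF c] cw) auto
        show "(\<lambda>s. d * C * D * exp (k * s)) integrable_on {l..x}" by (intro integrable_continuous_real continuous_intros)
        fix s assume s: "s \<in> {l..x}"
        have 1: "\<bar>x - s\<bar> \<le> d" using s x by (auto simp: d_def)
        have 2: "\<bar>c s\<bar> \<le> C" using s x by (intro C) auto
        have 3: "\<bar>apply_bcontfun w1 s - apply_bcontfun w2 s\<bar> \<le> D"
          using dist_bounded[of w1 s w2] by (simp add: D_def dist_real_def)
        have "\<bar>x - s\<bar> * (\<bar>c s\<bar> * (exp (k * s) * \<bar>apply_bcontfun w1 s - apply_bcontfun w2 s\<bar>)) \<le> d * (C * (exp (k * s) * D))"
          using 1 2 3 d C by (intro mult_mono) auto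
        then show "norm (?h s) \<le> d * C * D * exp (k * s)" by (simp add: abs_mult mult_ac)
      qed
      also have "\<dots> = d * C * D * integral {l..x} (\<lambda>s. exp (k * s))" by simp
      also have "\<dots> \<le> d * C * D * (exp (k * x) / k)"
        using x d C by (intro mult_left_mono exp_integral_le k) (auto simp: D_def)
      finally show "\<bar>integral {l..x} ?h\<bar> \<le> d * C * D * (exp (k * x) / k)" by simp
    qed simp
    also have "\<dots> = 1/2 * D" using C d by (simp add: k_def exp_minus field_simps)
    finally show "dist (apply_bcontfun (T w1) y) (apply_bcontfun (T w2) y) \<le> 1/2 * dist w1 w2"
      unfolding T dist_real_def x_def D_def by simp
  qed
  obtain w where w: "T w = w" using banach_fix_type[of "1/2" T] contr by auto
  define v where "v y = exp (k * y) * apply_bcontfun w y" for y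
  define v' where "v' y = 1 + I1 w y" for y
  have v: "v y = (y - l) + y * I1 w y - I2 w y" if "y \<in> {l..r}" for y
  proof -
    have "z y = y" using that by (auto simp: z_def)
    then have "apply_bcontfun w y = g w y" using T[of w y] w by simp
    then show ?thesis by (simp add: v_def g_def exp_minus field_simps)
  qed
  show ?thesis
  proof (rule exI[of _ v], rule exI[of _ v'], intro conjI ballI)
    show "continuous_on {l..r} v" unfolding v_def[abs_def] by (intro continuous_intros cw)
    show "continuous_on {l..r} v'" unfolding v'_def[abs_def] by (intro continuous_intros cI1)
    show "v l = 0" using v[of l] lr by (simp add: I1_def I2_def)
    show "v' l = 1" by (simp add: v'_def I1_def)
    fix y assume y: "y \<in> {l<..<r}"
    then have yy: "y \<in> {l..r}" by simp
    have at: "at y within {l..r} = at y" using y by (intro at_within_interior) auto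
    have d1: "(I1 w has_real_derivative c y * v y) (at y)"
      using integral_has_real_derivative[OF c1 yy, of w] unfolding at I1_def[abs_def] v_def by simp
    have d2: "(I2 w has_real_derivative y * (c y * v y)) (at y)"
      using integral_has_real_derivative[OF c2 yy, of w] unfolding at I2_def[abs_def] v_def by simp
    show "(v' has_real_derivative c y * v y) (at y)"
      unfolding v'_def[abs_def] by (rule derivative_eq_intros d1 refl)+ simp
    have "((\<lambda>y. (y - l) + y * I1 w y - I2 w y) has_real_derivative v' y) (at y)"
      by (rule derivative_eq_intros d1 d2 refl)+ (simp add: v'_def algebra_simps)
    then show "(v has_real_derivative v' y) (at y)"
      by (rule has_field_derivative_transform_within_open[of _ _ _ "{l<..<r}"]) (use y v in auto)
  qed
qed

lemma second_derivative_at_max: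
  fixes f f' :: "real \<Rightarrow> real"
  assumes d: "0 < d" and f: "\<And>s. \<bar>s - y\<bar> < d \<Longrightarrow> (f has_real_derivative f' s) (at s)"
    and f': "(f' has_real_derivative D) (at y)" and max: "\<And>s. \<bar>s - y\<bar> < d \<Longrightarrow> f s \<le> f y"
  shows "f' y = 0" "D \<le> 0"
proof -
  show z: "f' y = 0"
    by (rule DERIV_local_max[OF f[of y] d]) (use d max in \<open>auto simp: abs_minus_commute\<close>)
  show "D \<le> 0"
  proof (rule ccontr)
    assume "\<not> D \<le> 0"
    then obtain e where e: "0 < e" "\<And>h. 0 < h \<Longrightarrow> h < e \<Longrightarrow> f' y < f' (y + h)"
      using DERIV_pos_inc_right[OF f'] by auto
    define h where "h = min d e / 2"
    have h: "0 < h" "h < d" "h < e" using d e by (auto simp: h_def)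
    have "\<exists>t. y < t \<and> t < y + h \<and> f (y + h) - f y = (y + h - y) * f' t"
      using h by (intro MVT2) (auto intro!: f)
    then obtain t where t: "y < t" "t < y + h" "f (y + h) - f y = h * f' t" by auto
    have "0 < f' t" using e(2)[of "t - y"] t h z by simp
    then have "0 < h * f' t" using h by simp
    then have "f y < f (y + h)" using t by simp
    then show False using max[of "y + h"] h by simp
  qed
qed

text \<open>
  A normalized positive solution of \<open>\<psi>'' = c \<psi>\<close> between two consecutive zeros, extended by zero, with
  its maximum at \<open>m\<close>.
\<close>

definition profile :: "(real \<Rightarrow> real) \<Rightarrow> (real \<Rightarrow> real) \<Rightarrow> (real \<Rightarrow> real) \<Rightarrow> real \<Rightarrow> real \<Rightarrow> real \<Rightarrow> bool" where
  "profile c \<psi> \<psi>' l r m \<longleftrightarrow> m \<in> {l<..<r} \<and> continuous_on UNIV \<psi> \<and>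
     (\<forall>y\<in>{l<..<r}. 0 < \<psi> y \<and> (\<psi> has_real_derivative \<psi>' y) (at y) \<and> (\<psi>' has_real_derivative c y * \<psi> y) (at y)) \<and>
     (\<forall>y. y \<notin> {l<..<r} \<longrightarrow> \<psi> y = 0) \<and> (\<forall>y. \<psi> y \<le> 1) \<and> \<psi> m = 1"

lemma positive_after_start:
  fixes v v' :: "real \<Rightarrow> real"
  assumes lr: "l < r" and v: "continuous_on {l..r} v" "continuous_on {l..r} v'" "v l = 0" "v' l = 1"
      "\<And>y. y \<in> {l<..<r} \<Longrightarrow> (v has_real_derivative v' y) (at y)"
  shows "\<exists>e>0. l + e < r \<and> (\<forall>y\<in>{l<..l+e}. 0 < v y)"
proof -
  obtain e where e: "0 < e" "\<And>y. y \<in> {l..r} \<Longrightarrow> dist y l < e \<Longrightarrow> dist (v' y) (v' l) < 1"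
    using v(2) lr unfolding continuous_on_iff by (metis atLeastAtMost_iff less_imp_le order_refl zero_less_one)
  define e' where "e' = min e (r - l) / 2"
  have e': "0 < e'" "e' < e" "l + e' < r" using e lr by (auto simp: e'_def min_def field_simps)
  have "0 < v y" if y: "y \<in> {l<..l+e'}" for y
  proof -
    have "v l < v y"
    proof (rule DERIV_pos_imp_increasing_open[where f=v])
      show "continuous_on {l..y} v" using v(1) y e' by (auto intro: continuous_on_subset)
      fix x assume x: "l < x" "x < y"
      have "dist (v' x) 1 < 1" using e(2)[of x] v(4) x y e' by (auto simp: dist_real_def)
      then have "0 < v' x" by (auto simp: dist_real_def)
      moreover have "(v has_real_derivative v' x) (at x)" using x y e' by (intro v(5)) auto
      ultimately show "\<exists>d. (v has_real_derivative d) (at x) \<and> 0 < d" by blast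
    qed (use y in auto)
    then show ?thesis using v(3) by simp
  qed
  then show ?thesis using e' by blast
qed

text \<open>
  Picone's identity: with a positive solution \<open>v\<close> the integrand is \<open>(G - \<phi> v'/v)\<^sup>2\<close> up to the derivative of
  \<open>\<phi>\<^sup>2 v'/v\<close>.
\<close>

lemma Picone_nonneg:
  fixes c \<phi> G :: "real \<Rightarrow> real"
  assumes lr: "l < r" and C: "C1_compact {l<..<r} \<phi> G"
    and c: "continuous_on {l..r} c"
    and v: "\<And>y. y \<in> {l<..<r} \<Longrightarrow> (v has_real_derivative v' y) (at y)" "\<And>y. y \<in> {l<..<r} \<Longrightarrow> (v' has_real_derivative c y * v y) (at y)"
      "\<And>y. y \<in> {l<..<r} \<Longrightarrow> 0 < v y"
  shows "0 \<le> integral {l..r} (\<lambda>y. (G y)\<^sup>2 + c y * (\<phi> y)\<^sup>2)"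
proof -
  let ?f = "\<lambda>y. (G y)\<^sup>2 + c y * (\<phi> y)\<^sup>2"
  obtain K where K: "compact K" "K \<subseteq> {l<..<r}" "\<And>p. p \<notin> K \<Longrightarrow> \<phi> p = 0" "\<And>p. p \<notin> K \<Longrightarrow> G p = 0"
    by (rule C1_compactD[OF C]) (rule that)
  note cs = C1_compact_continuous[OF C]
  show ?thesis
  proof (cases "K = {}")
    case True
    then have "?f = (\<lambda>y. 0)" using K(3,4) by auto
    then show ?thesis by simp
  next
    case False
    obtain k1 where k1: "k1 \<in> K" "\<And>y. y \<in> K \<Longrightarrow> k1 \<le> y" using compact_attains_inf[OF K(1) False] by blast
    obtain k2 where k2: "k2 \<in> K" "\<And>y. y \<in> K \<Longrightarrow> y \<le> k2" using compact_attains_sup[OF K(1) False] by blast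
    define l' r' where "l' = (l + k1) / 2" and "r' = (k2 + r) / 2"
    have b: "l < l'" "l' < k1" "k1 \<le> k2" "k2 < r'" "r' < r" using k1 k2 K(2) by (auto simp: l'_def r'_def)
    have out: "y \<notin> K" if "y \<le> l' \<or> r' \<le> y" for y
      using that b k1(2)[of y] k2(2)[of y] by auto
    have sub: "{l'..r'} \<subseteq> {l<..<r}" using b by auto
    have contv: "continuous_on {l'..r'} v" "continuous_on {l'..r'} v'"
      using sub by (intro continuous_at_imp_continuous_on ballI DERIV_isCont[OF v(1)] DERIV_isCont[OF v(2)]; blast)+
    define F where "F y = (\<phi> y)\<^sup>2 * v' y / v y" for y
    define F' where "F' y = 2 * \<phi> y * G y * v' y / v y + (\<phi> y)\<^sup>2 * (c y - (v' y / v y)\<^sup>2)" for y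
    have dF: "(F has_real_derivative F' y) (at y)" if y: "y \<in> {l'..r'}" for y
    proof -
      have y': "y \<in> {l<..<r}" using y sub by blast
      have d\<phi>: "(\<phi> has_real_derivative G y) (at y)" using C by (auto simp: C1_compact_def)
      have vy: "v y \<noteq> 0" using v(3)[OF y'] by simp
      show ?thesis unfolding F_def[abs_def] F'_def
        by (rule derivative_eq_intros d\<phi> v(1)[OF y'] v(2)[OF y'] refl | use vy in \<open>simp add: field_simps power2_eq_square\<close>)+
    qed
    have "(F' has_integral F r' - F l') {l'..r'}"
      using b dF by (intro fundamental_theorem_of_calculus)
        (auto simp flip: has_real_derivative_iff_has_vector_derivative intro: has_field_derivative_at_within)
    moreover have "F r' = 0" "F l' = 0" using out[of r'] out[of l'] K(3) by (auto simp: F_def)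
    ultimately have iF: "(F' has_integral 0) {l'..r'}" by simp
    have cf: "continuous_on {l'..r'} ?f"
      using b by (intro continuous_intros continuous_on_subset[OF c] continuous_on_subset[OF cs(1)] continuous_on_subset[OF cs(2)]) auto
    have fI: "(?f has_integral integral {l'..r'} ?f) {l'..r'}"
      by (rule integrable_integral[OF integrable_continuous_real[OF cf]])
    have hd: "((\<lambda>y. ?f y - F' y) has_integral integral {l'..r'} ?f - 0) {l'..r'}"
      by (rule has_integral_diff[OF fI iF])
    have "0 \<le> ?f y - F' y" if y: "y \<in> {l'..r'}" for y
    proof -
      have "?f y - F' y = (G y - \<phi> y * (v' y / v y))\<^sup>2"
        by (simp add: F'_def power2_eq_square algebra_simps)
      then show ?thesis by simp
    qed
    then have "0 \<le> integral {l'..r'} ?f - 0" by (rule has_integral_nonneg[OF hd])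
    then have "0 \<le> integral {l'..r'} ?f" by simp
    moreover have "(?f has_integral integral {l'..r'} ?f) {l..r}"
    proof (rule has_integral_on_superset[OF fI])
      fix y assume "y \<notin> {l'..r'}"
      then have "y \<notin> K" by (intro out) auto
      then show "?f y = 0" using K(3,4) by simp
    qed (use b in auto)
    ultimately show ?thesis by (simp add: integral_unique)
  qed
qed

text \<open>
  A solution without zeros would make every energy nonnegative, by Picone's identity.
\<close>

lemma first_zero:
  fixes c \<phi> G :: "real \<Rightarrow> real"
  assumes lr: "l < r" and c: "continuous_on {l..r} c" and C: "C1_compact {l<..<r} \<phi> G"
    and neg: "integral {l..r} (\<lambda>y. (G y)\<^sup>2 + c y * (\<phi> y)\<^sup>2) < 0"
    and v: "continuous_on {l..r} v" "continuous_on {l..r} v'" "v l = 0" "v' l = 1"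
      "\<And>y. y \<in> {l<..<r} \<Longrightarrow> (v has_real_derivative v' y) (at y)" "\<And>y. y \<in> {l<..<r} \<Longrightarrow> (v' has_real_derivative c y * v y) (at y)"
  shows "\<exists>z\<in>{l<..<r}. v z = 0 \<and> (\<forall>y\<in>{l<..<z}. 0 < v y)"
proof -
  obtain e where e: "0 < e" "l + e < r" "\<And>y. y \<in> {l<..l+e} \<Longrightarrow> 0 < v y"
    using positive_after_start[OF lr v(1-5)] by blast
  have IV: "\<exists>z\<in>{l+e..y}. v z = 0" if y: "l + e \<le> y" "y < r" "v y \<le> 0" for y
  proof -
    have "\<exists>x. l + e \<le> x \<and> x \<le> y \<and> v x = 0"
      using y e by (intro IVT2') (auto intro: continuous_on_subset[OF v(1)] less_imp_le)
    then show ?thesis by auto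
  qed
  have "\<exists>y\<in>{l<..<r}. v y \<le> 0"
    using Picone_nonneg[OF lr C c v(5,6)] neg by (meson not_le)
  then obtain y where y: "y \<in> {l<..<r}" "v y \<le> 0" by blast
  then have "l + e \<le> y" using e(3)[of y] by (cases "y \<le> l + e") auto
  then obtain z1 where z1: "z1 \<in> {l+e..y}" "v z1 = 0" using IV[of y] y by auto
  define Z where "Z = {x \<in> {l+e..z1}. v x = 0}"
  have "closed Z" unfolding Z_def
    using z1 y e by (intro continuous_closed_preimage_constant continuous_on_subset[OF v(1)]) auto
  then have Zc: "compact Z" unfolding compact_eq_bounded_closed by (auto simp: Z_def intro: bounded_subset[OF bounded_closed_interval[of "l+e" z1]])
  have Zn: "Z \<noteq> {}" using z1 by (auto simp: Z_def)
  obtain z where z: "z \<in> Z" "\<And>x. x \<in> Z \<Longrightarrow> z \<le> x" using compact_attains_inf[OF Zc Zn] by blast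
  have zlr: "z \<in> {l<..<r}" "v z = 0" using z(1) z1 y e by (auto simp: Z_def)
  have "0 < v x" if x: "x \<in> {l<..<z}" for x
  proof (rule ccontr)
    assume neg: "\<not> 0 < v x"
    then have "l + e \<le> x" using e(3)[of x] x by (cases "x \<le> l + e") auto
    then obtain x' where "x' \<in> {l+e..x}" "v x' = 0" using IV[of x] neg x zlr by auto
    moreover then have "x' \<in> Z" using x z(1) by (auto simp: Z_def)
    ultimately show False using z(2)[of x'] x by auto
  qed
  with zlr show ?thesis by blast
qed

text \<open>
  If the form with potential \<open>c\<close> is negative somewhere, then the solution that starts at \<open>l\<close> vanishes again before
  \<open>r\<close>.  With \<open>c = V - M\<close> this applies to any \<open>M\<close> above the ground energy.
\<close>

lemma profile_exists:
  fixes c \<phi> G :: "real \<Rightarrow> real"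
  assumes lr: "l < r" and c: "continuous_on {l..r} c" and C: "C1_compact {l<..<r} \<phi> G"
    and neg: "integral {l..r} (\<lambda>y. (G y)\<^sup>2 + c y * (\<phi> y)\<^sup>2) < 0"
  shows "\<exists>\<psi> \<psi>' z m. z < r \<and> profile c \<psi> \<psi>' l z m"
proof -
  obtain v v' where v: "continuous_on {l..r} v" "continuous_on {l..r} v'" "v l = 0" "v' l = 1"
      and dv: "\<And>y. y \<in> {l<..<r} \<Longrightarrow> (v has_real_derivative v' y) (at y)" "\<And>y. y \<in> {l<..<r} \<Longrightarrow> (v' has_real_derivative c y * v y) (at y)"
    using linear_initial_value_problem[OF lr c] by blast
  obtain z where z: "z \<in> {l<..<r}" "v z = 0" "\<And>y. y \<in> {l<..<z} \<Longrightarrow> 0 < v y"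
    using first_zero[OF lr c C neg v dv] by blast
  have cz: "continuous_on {l..z} v" using z by (auto intro: continuous_on_subset[OF v(1)])
  obtain m where m: "m \<in> {l..z}" "\<And>y. y \<in> {l..z} \<Longrightarrow> v y \<le> v m"
    using continuous_attains_sup[OF compact_Icc _ cz] z(1) by force
  define S where "S = v m"
  have "0 < v ((l + z) / 2)" using z by (intro z(3)) auto
  also have "\<dots> \<le> S" unfolding S_def using z by (intro m(2)) auto
  finally have S: "0 < S" .
  have mi: "m \<in> {l<..<z}" using m(1) S z(2) v(3) by (auto simp: S_def less_le)
  define t where "t y = max l (min z y)" for y
  define \<psi> \<psi>' where "\<psi> y = v (t y) / S" and "\<psi>' y = v' y / S" for y
  have t: "t y \<in> {l..z}" for y using z(1) by (auto simp: t_def)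
  have tin: "t y = y" if "y \<in> {l..z}" for y using that by (auto simp: t_def)
  have "profile c \<psi> \<psi>' l z m" unfolding profile_def
  proof (intro conjI ballI allI impI mi)
    have "continuous_on UNIV (\<lambda>y. v (t y))"
      by (rule continuous_on_compose2[OF cz]) (use t in \<open>auto simp: t_def intro!: continuous_intros\<close>)
    then show "continuous_on UNIV \<psi>" unfolding \<psi>_def[abs_def] using S by (intro continuous_intros) auto
    show "\<psi> m = 1" using S m(1) by (simp add: \<psi>_def tin S_def)
    show "\<psi> y \<le> 1" for y using m(2)[OF t] S by (simp add: \<psi>_def S_def)
    show "\<psi> y = 0" if "y \<notin> {l<..<z}" for y
    proof -
      have "t y = l \<or> t y = z" using that z(1) by (auto simp: t_def)
      then show ?thesis using v(3) z(2) by (auto simp: \<psi>_def)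
    qed
    fix y assume y: "y \<in> {l<..<z}"
    then have yr: "y \<in> {l<..<r}" and yz: "y \<in> {l..z}" using z by auto
    show "0 < \<psi> y" using z(3)[OF y] S by (simp add: \<psi>_def tin[OF yz])
    have "((\<lambda>y. v y / S) has_real_derivative v' y / S) (at y)" using dv(1)[OF yr] by (rule DERIV_cdivide)
    then show "(\<psi> has_real_derivative \<psi>' y) (at y)"
      unfolding \<psi>'_def by (rule has_field_derivative_transform_within_open[of _ _ _ "{l<..<z}"]) (use y in \<open>auto simp: \<psi>_def tin\<close>)
    have "((\<lambda>y. v' y / S) has_real_derivative c y * v y / S) (at y)" using dv(2)[OF yr] by (rule DERIV_cdivide)
    then show "(\<psi>' has_real_derivative c y * \<psi> y) (at y)" by (simp add: \<psi>'_def[abs_def] \<psi>_def tin[OF yz])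
  qed
  then show ?thesis using z by auto
qed

text \<open>
  Log-concavity means \<open>c \<psi>\<^sup>2 \<le> \<psi>'\<^sup>2\<close>.  If this failed at \<open>y\<^sub>0\<close>, then \<open>c(y\<^sub>0) = k\<^sup>2 > 0\<close>, and by convexity
  \<open>c \<ge> k\<^sup>2\<close> on one side of \<open>y\<^sub>0\<close>.  On that side \<open>\<psi>\<close> could not decay faster than \<open>e\<^sup>-\<^sup>k\<^sup>y\<close>, so it would not
  reach zero at the end of the interval.
\<close>

lemma profile_log_concave:
  assumes P: "profile c \<psi> \<psi>' l r m" and c: "convex_on {l<..<r} c"
  shows "concave_on {l<..<r} (\<lambda>y. ln (\<psi> y))"
proof -
  have pos: "0 < \<psi> y" and d1: "(\<psi> has_real_derivative \<psi>' y) (at y)" and d2: "(\<psi>' has_real_derivative c y * \<psi> y) (at y)"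
    if "y \<in> {l<..<r}" for y using P that by (auto simp: profile_def)
  have z: "\<psi> l = 0" "\<psi> r = 0" using P by (auto simp: profile_def)
  have cont: "continuous_on S \<psi>" for S using P by (auto simp: profile_def intro: continuous_on_subset)
  have key: "c y0 * (\<psi> y0)\<^sup>2 \<le> (\<psi>' y0)\<^sup>2" if y0: "y0 \<in> {l<..<r}" for y0
  proof (rule ccontr)
    assume neg: "\<not> c y0 * (\<psi> y0)\<^sup>2 \<le> (\<psi>' y0)\<^sup>2"
    then have "0 < c y0 * (\<psi> y0)\<^sup>2" by (simp add: not_le le_less_trans[OF zero_le_power2])
    then have c0: "0 < c y0" by (simp add: zero_less_mult_iff)
    define k where "k = sqrt (c y0)"
    have k: "0 < k" "k\<^sup>2 = c y0" using c0 by (auto simp: k_def)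
    have "(\<psi>' y0)\<^sup>2 < (k * \<psi> y0)\<^sup>2" using neg k by (simp add: power_mult_distrib)
    then have "\<bar>\<psi>' y0\<bar>\<^sup>2 < (k * \<psi> y0)\<^sup>2" by simp
    then have slope: "\<bar>\<psi>' y0\<bar> < k * \<psi> y0" using k pos[OF y0] by (intro power2_less_imp_less[of "\<bar>\<psi>' y0\<bar>"]) auto
    have side: "(\<forall>y\<in>{y0<..<r}. c y0 \<le> c y) \<or> (\<forall>y\<in>{l<..<y0}. c y0 \<le> c y)"
    proof (rule ccontr)
      assume "\<not> ?thesis"
      then obtain y1 y2 where y1: "y1 \<in> {y0<..<r}" "c y1 < c y0" and y2: "y2 \<in> {l<..<y0}" "c y2 < c y0" by (auto simp: not_le)
      define t where "t = (y0 - y2) / (y1 - y2)"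
      have t: "0 < t" "t < 1" using y1 y2 by (auto simp: t_def field_simps)
      have "t * (y1 - y2) = y0 - y2" using y1 y2 by (simp add: t_def)
      then have "y0 = (1 - t) * y2 + t * y1" by (simp add: algebra_simps)
      then have "c y0 \<le> (1 - t) * c y2 + t * c y1"
        using convex_onD[OF c, of t y2 y1] t y1 y2 y0 by auto
      also have "\<dots> < (1 - t) * c y0 + t * c y0"
        using t y1 y2 by (intro add_strict_mono mult_strict_left_mono) auto
      finally show False by (simp add: algebra_simps)
    qed
    then show False
    proof
      assume right: "\<forall>y\<in>{y0<..<r}. c y0 \<le> c y"
      have gp: "0 < \<psi>' y + k * \<psi> y" if y: "y \<in> {y0<..<r}" for y
      proof -
        have "(\<psi>' y0 + k * \<psi> y0) * exp (- k * y0) \<le> (\<psi>' y + k * \<psi> y) * exp (- k * y)"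
        proof (rule DERIV_nonneg_imp_increasing_open[where f="\<lambda>y. (\<psi>' y + k * \<psi> y) * exp (- k * y)"])
          show "y0 \<le> y" using y by simp
          have D: "((\<lambda>y. (\<psi>' y + k * \<psi> y) * exp (- k * y)) has_real_derivative (c x - k\<^sup>2) * \<psi> x * exp (- k * x)) (at x)" if "x \<in> {l<..<r}" for x
            by (rule derivative_eq_intros d1[OF that] d2[OF that] refl)+ (simp add: algebra_simps power2_eq_square)
          show "continuous_on {y0..y} (\<lambda>y. (\<psi>' y + k * \<psi> y) * exp (- k * y))"
            using y y0 by (intro DERIV_continuous_on[OF has_field_derivative_at_within[OF D]]) auto
          fix x assume x: "y0 < x" "x < y"
          have xr: "x \<in> {l<..<r}" "x \<in> {y0<..<r}" using x y y0 by auto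
          have "0 \<le> (c x - k\<^sup>2) * \<psi> x * exp (- k * x)" using right xr pos[OF xr(1)] k by simp
          then show "\<exists>d. ((\<lambda>y. (\<psi>' y + k * \<psi> y) * exp (- k * y)) has_real_derivative d) (at x) \<and> 0 \<le> d"
            using D[OF xr(1)] by blast
        qed
        moreover have "0 < (\<psi>' y0 + k * \<psi> y0) * exp (- k * y0)" using slope by simp
        ultimately have "0 < (\<psi>' y + k * \<psi> y) * exp (- k * y)" by linarith
        then show ?thesis by (simp add: zero_less_mult_iff)
      qed
      have "\<psi> y0 * exp (k * y0) < \<psi> r * exp (k * r)"
      proof (rule DERIV_pos_imp_increasing_open[where f="\<lambda>y. \<psi> y * exp (k * y)"])
        fix x assume x: "y0 < x" "x < r"
        then have xr: "x \<in> {l<..<r}" using y0 by auto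
        have "((\<lambda>y. \<psi> y * exp (k * y)) has_real_derivative (\<psi>' x + k * \<psi> x) * exp (k * x)) (at x)"
          by (rule derivative_eq_intros d1[OF xr] refl)+ (simp add: algebra_simps)
        then show "\<exists>d. ((\<lambda>y. \<psi> y * exp (k * y)) has_real_derivative d) (at x) \<and> 0 < d" using gp[of x] x by (auto intro!: exI)
      qed (use y0 in \<open>auto intro!: continuous_intros cont\<close>)
      then show False using z pos[OF y0] by (simp add: mult_less_0_iff not_less less_imp_le)
    next
      assume left: "\<forall>y\<in>{l<..<y0}. c y0 \<le> c y"
      have gp: "\<psi>' y - k * \<psi> y < 0" if y: "y \<in> {l<..<y0}" for y
      proof -
        have "(\<psi>' y - k * \<psi> y) * exp (k * y) \<le> (\<psi>' y0 - k * \<psi> y0) * exp (k * y0)"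
        proof (rule DERIV_nonneg_imp_increasing_open[where f="\<lambda>y. (\<psi>' y - k * \<psi> y) * exp (k * y)"])
          show "y \<le> y0" using y by simp
          have D: "((\<lambda>y. (\<psi>' y - k * \<psi> y) * exp (k * y)) has_real_derivative (c x - k\<^sup>2) * \<psi> x * exp (k * x)) (at x)" if "x \<in> {l<..<r}" for x
            by (rule derivative_eq_intros d1[OF that] d2[OF that] refl)+ (simp add: algebra_simps power2_eq_square)
          show "continuous_on {y..y0} (\<lambda>y. (\<psi>' y - k * \<psi> y) * exp (k * y))"
            using y y0 by (intro DERIV_continuous_on[OF has_field_derivative_at_within[OF D]]) auto
          fix x assume x: "y < x" "x < y0"
          have xr: "x \<in> {l<..<r}" "x \<in> {l<..<y0}" using x y y0 by auto
          have "0 \<le> (c x - k\<^sup>2) * \<psi> x * exp (k * x)" using left xr pos[OF xr(1)] k by simp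
          then show "\<exists>d. ((\<lambda>y. (\<psi>' y - k * \<psi> y) * exp (k * y)) has_real_derivative d) (at x) \<and> 0 \<le> d"
            using D[OF xr(1)] by blast
        qed
        moreover have "(\<psi>' y0 - k * \<psi> y0) * exp (k * y0) < 0" using slope by (simp add: mult_less_0_iff)
        ultimately have "(\<psi>' y - k * \<psi> y) * exp (k * y) < 0" by linarith
        then show ?thesis by (simp add: mult_less_0_iff)
      qed
      have "- (\<psi> l * exp (- k * l)) < - (\<psi> y0 * exp (- k * y0))"
      proof (rule DERIV_pos_imp_increasing_open[where f="\<lambda>y. - (\<psi> y * exp (- k * y))"])
        fix x assume x: "l < x" "x < y0"
        then have xr: "x \<in> {l<..<r}" using y0 by auto
        have "((\<lambda>y. - (\<psi> y * exp (- k * y))) has_real_derivative - ((\<psi>' x - k * \<psi> x) * exp (- k * x))) (at x)"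
          by (rule derivative_eq_intros d1[OF xr] refl)+ (simp add: algebra_simps)
        moreover have "0 < - ((\<psi>' x - k * \<psi> x) * exp (- k * x))" using gp[of x] x by (simp add: mult_less_0_iff)
        ultimately show "\<exists>d. ((\<lambda>y. - (\<psi> y * exp (- k * y))) has_real_derivative d) (at x) \<and> 0 < d" by blast
      qed (use y0 in \<open>auto intro!: continuous_intros cont\<close>)
      then show False using z pos[OF y0] by (simp add: mult_less_0_iff not_less less_imp_le)
    qed
  qed
  show ?thesis unfolding concave_on_def
  proof (rule f''_ge0_imp_convex)
    fix y assume y: "y \<in> {l<..<r}"
    show "((\<lambda>y. - ln (\<psi> y)) has_real_derivative - (\<psi>' y / \<psi> y)) (at y)"
      by (rule derivative_eq_intros d1[OF y] refl pos[OF y])+ (simp add: divide_inverse)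
    show "((\<lambda>y. - (\<psi>' y / \<psi> y)) has_real_derivative - ((c y * \<psi> y * \<psi> y - \<psi>' y * \<psi>' y) / (\<psi> y * \<psi> y))) (at y)"
      using pos[OF y] by (auto intro!: derivative_eq_intros d1[OF y] d2[OF y])
    show "0 \<le> - ((c y * \<psi> y * \<psi> y - \<psi>' y * \<psi>' y) / (\<psi> y * \<psi> y))"
      using key[OF y] by (simp add: divide_nonpos_nonneg power2_eq_square mult.assoc)
  qed simp
qed

section \<open>Geometric interpolation between two sections\<close>

text \<open>
  The supremum of \<open>f(y\<^sub>1)\<^sup>1\<^sup>-\<^sup>t g(y\<^sub>2)\<^sup>t\<close> over all \<open>y = (1 - t) y\<^sub>1 + t y\<^sub>2\<close>, parametrized by \<open>y\<^sub>1\<close>.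
\<close>

definition interp :: "(real \<Rightarrow> real) \<Rightarrow> (real \<Rightarrow> real) \<Rightarrow> real \<Rightarrow> real \<Rightarrow> real" where
  "interp f g t y = (SUP z. f z powr (1 - t) * g ((y - (1 - t) * z) / t) powr t)"

locale profile_pair =
  fixes c1 \<psi>1 \<psi>1' l1 r1 m1 c2 \<psi>2 \<psi>2' l2 r2 m2
  assumes P1: "profile c1 \<psi>1 \<psi>1' l1 r1 m1" and P2: "profile c2 \<psi>2 \<psi>2' l2 r2 m2"
    and lc1: "concave_on {l1<..<r1} (\<lambda>y. ln (\<psi>1 y))" and lc2: "concave_on {l2<..<r2} (\<lambda>y. ln (\<psi>2 y))"
begin

abbreviation "F \<equiv> interp \<psi>1 \<psi>2"

lemma profile_nonneg: "0 \<le> \<psi>1 y" "0 \<le> \<psi>2 y"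
proof -
  show "0 \<le> \<psi>1 y" using P1 unfolding profile_def by (cases "y \<in> {l1<..<r1}") (force simp: less_imp_le)+
  show "0 \<le> \<psi>2 y" using P2 unfolding profile_def by (cases "y \<in> {l2<..<r2}") (force simp: less_imp_le)+
qed

lemma profile_le_1: "\<psi>1 y \<le> 1" "\<psi>2 y \<le> 1"
  using P1 P2 unfolding profile_def by blast+

lemma profile_max: "\<psi>1 m1 = 1" "\<psi>2 m2 = 1" "m1 \<in> {l1<..<r1}" "m2 \<in> {l2<..<r2}"
  using P1 P2 unfolding profile_def by blast+

lemma profile_pos_iff: "0 < \<psi>1 y \<longleftrightarrow> y \<in> {l1<..<r1}" "0 < \<psi>2 y \<longleftrightarrow> y \<in> {l2<..<r2}"
  using P1 P2 unfolding profile_def by (metis less_irrefl)+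

lemma profile_continuous: "continuous_on S \<psi>1" "continuous_on S \<psi>2"
  using P1 P2 unfolding profile_def by (meson continuous_on_subset subset_UNIV)+

definition q where "q t y z = \<psi>1 z powr (1 - t) * \<psi>2 ((y - (1 - t) * z) / t) powr t"

lemma q_bounds: "0 \<le> q t y z" "0 < t \<Longrightarrow> t < 1 \<Longrightarrow> q t y z \<le> 1"
  unfolding q_def using profile_nonneg profile_le_1 by (auto intro!: mult_le_one powr_le1)

lemma q_continuous: "continuous_on ({0<..<1} \<times> UNIV \<times> UNIV) (\<lambda>(t, y, z). q t y z)"
  unfolding q_def case_prod_unfold
  by (intro continuous_on_mult continuous_on_powr' continuous_on_compose2[OF profile_continuous(1)[of UNIV]]
      continuous_on_compose2[OF profile_continuous(2)[of UNIV]] continuous_intros) (auto simp: profile_nonneg)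

lemma q_zero: "z \<notin> {l1<..<r1} \<Longrightarrow> q t y z = 0"
  using P1 unfolding q_def profile_def by simp

lemma q_le: "0 < t \<Longrightarrow> t < 1 \<Longrightarrow> q t y z \<le> F t y"
  unfolding interp_def q_def[symmetric] by (rule cSUP_upper) (auto intro!: bdd_aboveI[of _ 1] q_bounds)

lemma le_interp:
  assumes t: "0 < t" "t < 1"
  shows "\<psi>1 y1 powr (1 - t) * \<psi>2 y2 powr t \<le> F t ((1 - t) * y1 + t * y2)"
  using q_le[OF t, of "(1 - t) * y1 + t * y2" y1] t by (simp add: q_def)

lemma attained:
  assumes t: "0 < t" "t < 1"
  obtains z where "z \<in> {l1..r1}" "F t y = q t y z"
proof -
  have ne: "{l1..r1} \<noteq> {}" using profile_max(3) by auto
  have "continuous_on {l1..r1} (\<lambda>z. (\<lambda>(t, y, z). q t y z) (t, y, z))"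
    by (rule continuous_on_compose2[OF q_continuous]) (use t in \<open>auto intro!: continuous_intros\<close>)
  then have c: "continuous_on {l1..r1} (q t y)" by simp
  obtain z where z: "z \<in> {l1..r1}" "\<And>z'. z' \<in> {l1..r1} \<Longrightarrow> q t y z' \<le> q t y z"
    using continuous_attains_sup[OF compact_Icc ne c] by blast
  have "q t y z' \<le> q t y z" for z'
  proof (cases "z' \<in> {l1..r1}")
    case False
    then have "q t y z' = 0" by (intro q_zero) auto
    then show ?thesis using q_bounds(1) by simp
  qed (rule z(2))
  then have "F t y \<le> q t y z" unfolding interp_def q_def[symmetric] by (intro cSUP_least) auto
  then show ?thesis using q_le[OF t, of y z] z(1) by (intro that[of z]) auto
qed

lemma decompose:
  assumes t: "0 < t" "t < 1"
  obtains y1 y2 where "y = (1 - t) * y1 + t * y2" "F t y = \<psi>1 y1 powr (1 - t) * \<psi>2 y2 powr t"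
proof -
  obtain z where z: "F t y = q t y z" by (rule attained[OF t])
  show ?thesis by (rule that[of z "(y - (1 - t) * z) / t"]) (use z t in \<open>auto simp: q_def\<close>)
qed

lemma interp_bounds:
  assumes t: "0 < t" "t < 1"
  shows "0 \<le> F t y" "F t y \<le> 1"
proof -
  obtain z where z: "F t y = q t y z" by (rule attained[OF t])
  show "0 \<le> F t y" "F t y \<le> 1" unfolding z using q_bounds t by auto
qed

lemma decompose_pos:
  assumes t: "0 < t" "t < 1" and p: "0 < F t y"
  obtains y1 y2 where "y = (1 - t) * y1 + t * y2" "F t y = \<psi>1 y1 powr (1 - t) * \<psi>2 y2 powr t"
    "y1 \<in> {l1<..<r1}" "y2 \<in> {l2<..<r2}"
proof -
  obtain y1 y2 where y: "y = (1 - t) * y1 + t * y2" "F t y = \<psi>1 y1 powr (1 - t) * \<psi>2 y2 powr t"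
    by (rule decompose[OF t])
  have "\<psi>1 y1 \<noteq> 0" "\<psi>2 y2 \<noteq> 0" using p y(2) by auto
  then have "0 < \<psi>1 y1" "0 < \<psi>2 y2" using profile_nonneg(1)[of y1] profile_nonneg(2)[of y2] by auto
  then show ?thesis unfolding profile_pos_iff by (intro that[OF y])
qed

lemma interp_peak:
  assumes t: "0 < t" "t < 1"
  shows "F t ((1 - t) * m1 + t * m2) = 1"
  using le_interp[OF t, of m1 m2] interp_bounds(2)[OF t, of "(1 - t) * m1 + t * m2"] by (simp add: profile_max)

text \<open>
  The competing values are uniformly continuous in all variables as \<open>y\<^sub>1\<close> ranges over a compact interval,
  so an optimal \<open>y\<^sub>1\<close> at one point is almost optimal at nearby points.
\<close>

lemma interp_continuous: "continuous_on ({0<..<1} \<times> UNIV) (\<lambda>(t, y). F t y)"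
proof -
  have "continuous (at (t0, y0)) (\<lambda>(t, y). F t y)" if t0: "t0 \<in> {0<..<1}" for t0 y0
  proof -
    obtain d where d: "0 < d" "cball t0 d \<subseteq> {0<..<1}" using open_contains_cball t0 open_greaterThanLessThan by meson
    define B where "B = cball t0 d \<times> cball y0 1 \<times> {l1..r1}"
    have uc: "uniformly_continuous_on B (\<lambda>(t, y, z). q t y z)"
      unfolding B_def using d(2) by (intro compact_uniformly_continuous continuous_on_subset[OF q_continuous] compact_Times) auto
    show ?thesis unfolding continuous_at_eps_delta
    proof (intro allI impI)
      fix e :: real assume e: "0 < e"
      obtain s where s: "0 < s" "\<And>p p'. p \<in> B \<Longrightarrow> p' \<in> B \<Longrightarrow> dist p' p < s \<Longrightarrow> dist ((\<lambda>(t, y, z). q t y z) p') ((\<lambda>(t, y, z). q t y z) p) < e"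
        using uc e unfolding uniformly_continuous_on_def by meson
      have comp: "F t y < F t' y' + e" if "t \<in> cball t0 d" "y \<in> cball y0 1" "t' \<in> cball t0 d" "y' \<in> cball y0 1" "dist (t, y) (t', y') < s" for t y t' y'
      proof -
        have t: "0 < t" "t < 1" "0 < t'" "t' < 1" using that d(2) by (auto simp: subset_iff)
        obtain z where z: "z \<in> {l1..r1}" "F t y = q t y z" by (rule attained[OF t(1,2)])
        have "dist (q t y z) (q t' y' z) < e"
          using s(2)[of "(t', y', z)" "(t, y, z)"] that z by (simp add: B_def dist_Pair_Pair)
        then have "q t y z < q t' y' z + e" by (simp add: dist_real_def abs_less_iff)
        then show ?thesis using q_le[OF t(3,4), of y' z] z by simp
      qed
      define \<delta> where "\<delta> = min s (min d 1)"
      have "dist (F t y) (F t0 y0) < e" if h: "dist (t, y) (t0, y0) < \<delta>" for t y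
      proof -
        have "dist t t0 \<le> dist (t, y) (t0, y0)" "dist y y0 \<le> dist (t, y) (t0, y0)"
          using dist_fst_le[of "(t, y)" "(t0, y0)"] dist_snd_le[of "(t, y)" "(t0, y0)"] by auto
        then have "t \<in> cball t0 d" "y \<in> cball y0 1" "dist (t, y) (t0, y0) < s" using h by (auto simp: \<delta>_def dist_commute)
        moreover have "t0 \<in> cball t0 d" "y0 \<in> cball y0 1" using d by auto
        ultimately have "F t y < F t0 y0 + e" "F t0 y0 < F t y + e"
          by (intro comp; simp add: dist_commute)+
        then show ?thesis by (simp add: dist_real_def abs_less_iff)
      qed
      then have "\<forall>p. dist p (t0, y0) < \<delta> \<longrightarrow> dist ((\<lambda>(t, y). F t y) p) (F t0 y0) < e" by auto
      moreover have "0 < \<delta>" using s d by (simp add: \<delta>_def)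
      ultimately show "\<exists>d>0. \<forall>p. dist p (t0, y0) < d \<longrightarrow> dist ((\<lambda>(t, y). F t y) p) ((\<lambda>(t, y). F t y) (t0, y0)) < e"
        by (auto intro!: exI[of _ \<delta>])
    qed
  qed
  then show ?thesis by (intro continuous_at_imp_continuous_on) auto
qed

text \<open>
  Keep \<open>y\<^sub>1\<close> and move \<open>y\<^sub>2\<close> towards the peak \<open>m2\<close>.  Log-concavity of the second profile shows that the new
  competitor has at least the value \<open>F\<^sup>1\<^sup>-\<^sup>\<theta>\<close>, and \<open>F \<le> 1\<close>.
\<close>

lemma contraction_right:
  assumes t: "0 < t" "t < 1" and \<theta>: "0 \<le> \<theta>" "\<theta> < 1"
  shows "F t y \<le> F (t + \<theta> * (1 - t)) ((1 - \<theta>) * y + \<theta> * m2)"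
proof -
  define t' where "t' = t + \<theta> * (1 - t)"
  have t1: "1 - t' = (1 - \<theta>) * (1 - t)" by (simp add: t'_def algebra_simps)
  have t': "0 < t'" "t' < 1" using t \<theta> mult_pos_pos[of "1 - \<theta>" "1 - t"] by (auto simp: t'_def add_pos_nonneg t1[symmetric] t'_def)
  show ?thesis
  proof (cases "0 < F t y")
    case False
    then show ?thesis using interp_bounds(1)[OF t', of "(1 - \<theta>) * y + \<theta> * m2"] by (simp add: t'_def)
  next
    case True
    obtain y1 y2 where y: "y = (1 - t) * y1 + t * y2" "F t y = \<psi>1 y1 powr (1 - t) * \<psi>2 y2 powr t"
      "y1 \<in> {l1<..<r1}" "y2 \<in> {l2<..<r2}" by (rule decompose_pos[OF t True])
    \<comment> \<open>the weight for which the new pair \<open>y1\<close>, \<open>\<sigma> y2 + (1 - \<sigma>) m2\<close> has the weighted mean \<open>(1 - \<theta>) y + \<theta> m2\<close>\<close>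
    define \<sigma> where "\<sigma> = (1 - \<theta>) * t / t'"
    have \<sigma>t: "\<sigma> * t' = (1 - \<theta>) * t" using t' by (simp add: \<sigma>_def)
    have "(1 - \<theta>) * t \<le> t'" using \<theta> by (simp add: t'_def algebra_simps)
    then have \<sigma>: "0 \<le> \<sigma>" "\<sigma> \<le> 1" using t t' \<theta> by (auto simp: \<sigma>_def)
    define y2' where "y2' = \<sigma> * y2 + (1 - \<sigma>) * m2"
    have pos: "0 < \<psi>1 y1" "0 < \<psi>2 y2" using y by (auto simp: profile_pos_iff)
    have in2: "y2' \<in> {l2<..<r2}"
      unfolding y2'_def using convexD[OF convex_real_interval(8)[of l2 r2] y(4) profile_max(4) \<sigma>(1), of "1 - \<sigma>"] \<sigma> by auto
    then have pos2: "0 < \<psi>2 y2'" by (simp add: profile_pos_iff)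
    have "\<sigma> * ln (\<psi>2 y2) + (1 - \<sigma>) * ln (\<psi>2 m2) \<le> ln (\<psi>2 y2')"
      using concave_onD[OF lc2, of "1 - \<sigma>" y2 m2] \<sigma> y(4) profile_max(4) by (simp add: y2'_def)
    then have "\<sigma> * ln (\<psi>2 y2) \<le> ln (\<psi>2 y2')" by (simp add: profile_max)
    then have "t' * (\<sigma> * ln (\<psi>2 y2)) \<le> t' * ln (\<psi>2 y2')" using t' by (intro mult_left_mono) auto
    then have A: "(1 - \<theta>) * (t * ln (\<psi>2 y2)) \<le> t' * ln (\<psi>2 y2')" using \<sigma>t by (metis mult.commute mult.left_commute)
    have B: "(1 - \<theta>) * ((1 - t) * ln (\<psi>1 y1)) = (1 - t') * ln (\<psi>1 y1)" by (simp add: t1)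
    have e: "F t y = exp ((1 - t) * ln (\<psi>1 y1) + t * ln (\<psi>2 y2))"
      unfolding y(2) using pos by (simp add: powr_def exp_add)
    have "(1 - t) * ln (\<psi>1 y1) + t * ln (\<psi>2 y2) \<le> 0" using interp_bounds(2)[OF t, of y] unfolding e by simp
    then have "(1 - t) * ln (\<psi>1 y1) + t * ln (\<psi>2 y2) \<le> (1 - \<theta>) * ((1 - t) * ln (\<psi>1 y1) + t * ln (\<psi>2 y2))"
      using mult_nonneg_nonpos[OF \<theta>(1)] by (simp add: left_diff_distrib)
    also have "\<dots> \<le> (1 - t') * ln (\<psi>1 y1) + t' * ln (\<psi>2 y2')" unfolding distrib_left using A B by linarith
    finally have "F t y \<le> exp ((1 - t') * ln (\<psi>1 y1) + t' * ln (\<psi>2 y2'))" unfolding e by simp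
    also have "\<dots> = \<psi>1 y1 powr (1 - t') * \<psi>2 y2' powr t'" using pos pos2 by (simp add: powr_def exp_add)
    also have "\<dots> \<le> F t' ((1 - t') * y1 + t' * y2')" by (rule le_interp[OF t'])
    also have "(1 - t') * y1 + t' * y2' = (1 - \<theta>) * y + \<theta> * m2"
    proof -
      have "t' * y2' = (\<sigma> * t') * y2 + (t' - \<sigma> * t') * m2" by (simp add: y2'_def algebra_simps)
      also have "t' - \<sigma> * t' = \<theta>" unfolding \<sigma>t by (simp add: t'_def algebra_simps)
      finally show ?thesis unfolding \<sigma>t t1 y(1) by (simp add: algebra_simps)
    qed
    finally show ?thesis by (simp add: t'_def)
  qed
qed

text \<open>
  Shifting both points of an optimal pair gives a smooth competitor that touches \<open>F\<close> from below, so its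
  second derivative bounds that of \<open>F\<close> from below in the weak sense.
\<close>

lemma lower_support:
  assumes t: "0 < t" "t < 1" and p: "0 < F t y"
    and \<zeta>: "\<And>y1 y2. y1 \<in> {l1<..<r1} \<Longrightarrow> y2 \<in> {l2<..<r2} \<Longrightarrow> y = (1 - t) * y1 + t * y2 \<Longrightarrow> \<zeta> \<le> (1 - t) * c1 y1 + t * c2 y2"
  shows "\<exists>\<theta> \<theta>' D d. 0 < d \<and> (\<forall>s. \<bar>s\<bar> < d \<longrightarrow> (\<theta> has_real_derivative \<theta>' s) (at s) \<and> \<theta> s \<le> F t (y + s)) \<and> \<theta> 0 = F t y
    \<and> (\<theta>' has_real_derivative D) (at 0) \<and> \<zeta> * F t y \<le> D"
proof -
  obtain y1 y2 where y: "y = (1 - t) * y1 + t * y2" "F t y = \<psi>1 y1 powr (1 - t) * \<psi>2 y2 powr t"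
      "y1 \<in> {l1<..<r1}" "y2 \<in> {l2<..<r2}" by (rule decompose_pos[OF t p])
  define d0 where "d0 = min (min (y1 - l1) (r1 - y1)) (min (y2 - l2) (r2 - y2))"
  have d0: "0 < d0" using y(3,4) by (auto simp: d0_def)
  have in1: "y1 + s \<in> {l1<..<r1}" and in2: "y2 + s \<in> {l2<..<r2}" if "\<bar>s\<bar> < d0" for s
    using that by (auto simp: d0_def)
  have pos: "0 < \<psi>1 z" and d1: "(\<psi>1 has_real_derivative \<psi>1' z) (at z)" "(\<psi>1' has_real_derivative c1 z * \<psi>1 z) (at z)" if "z \<in> {l1<..<r1}" for z
    using P1 that by (auto simp: profile_def)
  have pos2: "0 < \<psi>2 z" and d2: "(\<psi>2 has_real_derivative \<psi>2' z) (at z)" "(\<psi>2' has_real_derivative c2 z * \<psi>2 z) (at z)" if "z \<in> {l2<..<r2}" for z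
    using P2 that by (auto simp: profile_def)
  define \<alpha> \<beta> where "\<alpha> z = \<psi>1' z / \<psi>1 z" and "\<beta> z = \<psi>2' z / \<psi>2 z" for z
  have D1: "((\<lambda>s. ln (\<psi>1 (y1 + k * s))) has_real_derivative k * \<alpha> (y1 + k * s)) (at s)" if "\<bar>k * s\<bar> < d0" for s k
  proof -
    have "((\<lambda>s. \<psi>1 (y1 + k * s)) has_real_derivative \<psi>1' (y1 + k * s) * k) (at s)"
      by (rule DERIV_chain2[where f=\<psi>1 and g="\<lambda>s. y1 + k * s", OF d1(1)[OF in1[OF that]]]) (auto intro!: derivative_eq_intros)
    from DERIV_chain2[where f=ln and g="\<lambda>s. \<psi>1 (y1 + k * s)", OF DERIV_ln[OF pos[OF in1[OF that]]] this] show ?thesis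
      by (simp add: \<alpha>_def divide_inverse mult_ac)
  qed
  have D2: "((\<lambda>s. ln (\<psi>2 (y2 + k * s))) has_real_derivative k * \<beta> (y2 + k * s)) (at s)" if "\<bar>k * s\<bar> < d0" for s k
  proof -
    have "((\<lambda>s. \<psi>2 (y2 + k * s)) has_real_derivative \<psi>2' (y2 + k * s) * k) (at s)"
      by (rule DERIV_chain2[where f=\<psi>2 and g="\<lambda>s. y2 + k * s", OF d2(1)[OF in2[OF that]]]) (auto intro!: derivative_eq_intros)
    from DERIV_chain2[where f=ln and g="\<lambda>s. \<psi>2 (y2 + k * s)", OF DERIV_ln[OF pos2[OF in2[OF that]]] this] show ?thesis
      by (simp add: \<beta>_def divide_inverse mult_ac)
  qed
  define L where "L k j s = (1 - t) * ln (\<psi>1 (y1 + k * s)) + t * ln (\<psi>2 (y2 + j * s))" for k j s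
  have DL: "(L k j has_real_derivative (1 - t) * (k * \<alpha> (y1 + k * s)) + t * (j * \<beta> (y2 + j * s))) (at s)"
    if "\<bar>k * s\<bar> < d0" "\<bar>j * s\<bar> < d0" for k j s
    unfolding L_def[abs_def] by (intro DERIV_add DERIV_cmult D1 D2 that)
  have eL: "exp (L k j s) \<le> F t (y + ((1 - t) * k + t * j) * s)" if "\<bar>k * s\<bar> < d0" "\<bar>j * s\<bar> < d0" for k j s
  proof -
    have "exp (L k j s) = \<psi>1 (y1 + k * s) powr (1 - t) * \<psi>2 (y2 + j * s) powr t"
      using pos[OF in1[OF that(1)]] pos2[OF in2[OF that(2)]] by (simp add: L_def powr_def exp_add)
    also have "\<dots> \<le> F t ((1 - t) * (y1 + k * s) + t * (y2 + j * s))" by (rule le_interp[OF t])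
    finally show ?thesis by (simp add: y(1) algebra_simps)
  qed
  have e0: "F t y = exp (L k j 0)" for k j
    unfolding y(2) using pos[OF y(3)] pos2[OF y(4)] by (simp add: L_def powr_def exp_add)
  \<comment> \<open>moving the optimal pair in opposite directions, with speeds \<open>t\<close> and \<open>1 - t\<close>, keeps the mean \<open>y\<close> fixed\<close>
  have \<alpha>\<beta>: "\<alpha> y1 = \<beta> y2"
  proof -
    have "(1 - t) * (t * \<alpha> (y1 + t * 0)) + t * (- (1 - t) * \<beta> (y2 + - (1 - t) * 0)) = 0"
    proof (rule DERIV_local_max[OF DL d0])
      show "\<forall>s. \<bar>0 - s\<bar> < d0 \<longrightarrow> L t (- (1 - t)) s \<le> L t (- (1 - t)) 0"
      proof (intro allI impI)
        fix s :: real assume s: "\<bar>0 - s\<bar> < d0"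
        have k1: "\<bar>t * s\<bar> < d0" "\<bar>- (1 - t) * s\<bar> < d0"
          using s t mult_right_mono[of t 1 "\<bar>s\<bar>"] mult_right_mono[of "1 - t" 1 "\<bar>s\<bar>"] by (auto simp: abs_mult)
        have "exp (L t (- (1 - t)) s) \<le> F t (y + ((1 - t) * t + t * - (1 - t)) * s)" by (rule eL[OF k1])
        also have "(1 - t) * t + t * - (1 - t) = 0" by (simp add: algebra_simps)
        finally show "L t (- (1 - t)) s \<le> L t (- (1 - t)) 0" using e0[of t "- (1 - t)"] by simp
      qed
    qed (use d0 in auto)
    then have "(t * (1 - t)) * (\<alpha> y1 - \<beta> y2) = 0" by (simp add: algebra_simps)
    then show ?thesis using t by simp
  qed
  have dL: "(L 1 1 has_real_derivative (1 - t) * \<alpha> (y1 + s) + t * \<beta> (y2 + s)) (at s)" if "\<bar>s\<bar> < d0" for s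
    using DL[of 1 s 1] that by simp
  define m where "m s = (1 - t) * \<alpha> (y1 + s) + t * \<beta> (y2 + s)" for s
  \<comment> \<open>both points move with the mean; because the slopes agree, the first-order terms in the second derivative cancel and \<open>(1 - t) c1 + t c2\<close> remains\<close>
  define \<theta> \<theta>' where "\<theta> s = exp (L 1 1 s)" and "\<theta>' s = exp (L 1 1 s) * m s" for s
  have d\<theta>: "(\<theta> has_real_derivative \<theta>' s) (at s)" if "\<bar>s\<bar> < d0" for s
    unfolding \<theta>_def[abs_def] \<theta>'_def m_def using dL[OF that] by (rule DERIV_fun_exp)
  have d\<alpha>: "(\<alpha> has_real_derivative c1 y1 - (\<alpha> y1)\<^sup>2) (at y1)"
    unfolding \<alpha>_def[abs_def] using d1[OF y(3)] pos[OF y(3)]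
    by (auto intro!: derivative_eq_intros simp: field_simps power2_eq_square)
  have d\<beta>: "(\<beta> has_real_derivative c2 y2 - (\<beta> y2)\<^sup>2) (at y2)"
    unfolding \<beta>_def[abs_def] using d2[OF y(4)] pos2[OF y(4)]
    by (auto intro!: derivative_eq_intros simp: field_simps power2_eq_square)
  have "((\<lambda>s. \<alpha> (y1 + s)) has_real_derivative c1 y1 - (\<alpha> y1)\<^sup>2) (at 0)" using d\<alpha> DERIV_shift[of \<alpha> _ 0 y1] by (simp add: add.commute)
  moreover have "((\<lambda>s. \<beta> (y2 + s)) has_real_derivative c2 y2 - (\<beta> y2)\<^sup>2) (at 0)" using d\<beta> DERIV_shift[of \<beta> _ 0 y2] by (simp add: add.commute)
  ultimately have dm: "(m has_real_derivative (1 - t) * (c1 y1 - (\<alpha> y1)\<^sup>2) + t * (c2 y2 - (\<beta> y2)\<^sup>2)) (at 0)"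
    unfolding m_def[abs_def] by (intro DERIV_add DERIV_cmult)
  define D where "D = \<theta>' 0 * m 0 + ((1 - t) * (c1 y1 - (\<alpha> y1)\<^sup>2) + t * (c2 y2 - (\<beta> y2)\<^sup>2)) * \<theta> 0"
  have dd: "(\<theta>' has_real_derivative D) (at 0)"
    unfolding \<theta>'_def[abs_def] D_def \<theta>_def[symmetric] using DERIV_mult[OF d\<theta>[of 0] dm] d0 by (simp add: \<theta>'_def \<theta>_def)
  have "D = ((1 - t) * c1 y1 + t * c2 y2) * F t y"
    unfolding D_def \<theta>'_def \<theta>_def e0[of 1 1] m_def using \<alpha>\<beta> by (simp add: algebra_simps power2_eq_square)
  moreover have "\<zeta> * F t y \<le> ((1 - t) * c1 y1 + t * c2 y2) * F t y"
    using \<zeta>[OF y(3,4,1)] p by (intro mult_right_mono) auto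
  ultimately have "\<zeta> * F t y \<le> D" by simp
  moreover have "\<theta> s \<le> F t (y + s)" if "\<bar>s\<bar> < d0" for s using eL[of 1 s 1] that by (simp add: \<theta>_def)
  moreover have "\<theta> 0 = F t y" using e0[of 1 1] by (simp add: \<theta>_def)
  ultimately show ?thesis using d\<theta> dd d0 by blast
qed

end

lemma profile_pair_swap:
  assumes "profile_pair c1 \<psi>1 \<psi>1' l1 r1 m1 c2 \<psi>2 \<psi>2' l2 r2 m2"
  shows "profile_pair c2 \<psi>2 \<psi>2' l2 r2 m2 c1 \<psi>1 \<psi>1' l1 r1 m1"
  using assms by (simp add: profile_pair_def)

context profile_pair
begin

lemma interp_swap:
  assumes t: "0 < t" "t < 1"
  shows "interp \<psi>2 \<psi>1 (1 - t) y = F t y"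
proof -
  interpret s: profile_pair c2 \<psi>2 \<psi>2' l2 r2 m2 c1 \<psi>1 \<psi>1' l1 r1 m1 by (rule profile_pair_swap) unfold_locales
  have t': "0 < 1 - t" "1 - t < 1" using t by auto
  obtain y1 y2 where y: "y = (1 - t) * y1 + t * y2" "F t y = \<psi>1 y1 powr (1 - t) * \<psi>2 y2 powr t" by (rule decompose[OF t])
  obtain z1 z2 where z: "y = (1 - (1 - t)) * z1 + (1 - t) * z2" "s.F (1 - t) y = \<psi>2 z1 powr (1 - (1 - t)) * \<psi>1 z2 powr (1 - t)"
    by (rule s.decompose[OF t'])
  have "F t y \<le> s.F (1 - t) y" using s.le_interp[OF t', of y2 y1] y by (simp add: mult.commute add.commute)
  moreover have "s.F (1 - t) y \<le> F t y" using le_interp[OF t, of z2 z1] z by (simp add: mult.commute add.commute)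
  ultimately show ?thesis by simp
qed

lemma contraction_left:
  assumes t: "0 < t" "t < 1" and \<theta>: "0 \<le> \<theta>" "\<theta> < 1"
  shows "F t y \<le> F ((1 - \<theta>) * t) ((1 - \<theta>) * y + \<theta> * m1)"
proof -
  interpret s: profile_pair c2 \<psi>2 \<psi>2' l2 r2 m2 c1 \<psi>1 \<psi>1' l1 r1 m1 by (rule profile_pair_swap) unfold_locales
  have t': "0 < 1 - t" "1 - t < 1" using t by auto
  have "(1 - \<theta>) * t \<le> 1 * t" using t \<theta> by (intro mult_right_mono) auto
  then have t2: "0 < (1 - \<theta>) * t" "(1 - \<theta>) * t < 1" using t \<theta> by (simp, linarith)
  have e: "1 - t + \<theta> * (1 - (1 - t)) = 1 - (1 - \<theta>) * t" by (simp add: algebra_simps)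
  show ?thesis using s.contraction_right[OF t' \<theta>, of y] unfolding e interp_swap[OF t] interp_swap[OF t2] .
qed

end

text \<open>
  Maximum principle: the difference of \<open>f\<close> and the parabola cannot have a positive interior maximum, since the lower
  support would have a second derivative at most \<open>c\<close> there.
\<close>

lemma below_parabola:
  fixes f \<zeta> :: "real \<Rightarrow> real"
  assumes f: "continuous_on {l..r} f"
    and sup: "\<And>y. y \<in> {l<..<r} \<Longrightarrow> \<exists>\<theta> \<theta>' D d. 0 < d \<and> (\<forall>s. \<bar>s\<bar> < d \<longrightarrow> (\<theta> has_real_derivative \<theta>' s) (at s) \<and> \<theta> s \<le> f (y + s)) \<and> \<theta> 0 = f y
      \<and> (\<theta>' has_real_derivative D) (at 0) \<and> c < D"
    and y: "y \<in> {l..r}" and lr: "l < r"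
  shows "f y \<le> (r - y) / (r - l) * f l + (y - l) / (r - l) * f r + c / 2 * ((y - l) * (y - r))"
proof -
  define B where "B = (f r - f l) / (r - l)"
  define g where "g y = f y - (f l + B * (y - l) + c / 2 * ((y - l) * (y - r)))" for y
  have Br: "B * (r - l) = f r - f l" using lr by (simp add: B_def)
  have "continuous_on {l..r} g" unfolding g_def[abs_def] by (intro continuous_intros f)
  then obtain z where z: "z \<in> {l..r}" "\<And>y. y \<in> {l..r} \<Longrightarrow> g y \<le> g z"
    using continuous_attains_sup[OF compact_Icc _ \<open>continuous_on {l..r} g\<close>] lr by force
  have "g z \<le> 0"
  proof (rule ccontr)
    assume gz: "\<not> g z \<le> 0"
    have "g l = 0" "g r = 0" using Br by (auto simp: g_def)
    then have zi: "z \<in> {l<..<r}" using z(1) gz by (auto simp: less_le)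
    obtain \<theta> \<theta>' D d where d: "0 < d" and \<theta>: "\<And>s. \<bar>s\<bar> < d \<Longrightarrow> (\<theta> has_real_derivative \<theta>' s) (at s)"
        "\<And>s. \<bar>s\<bar> < d \<Longrightarrow> \<theta> s \<le> f (z + s)" "\<theta> 0 = f z" "(\<theta>' has_real_derivative D) (at 0)" "c < D"
      using sup[OF zi] by blast
    define e where "e = min d (min (z - l) (r - z))"
    have e: "0 < e" using d zi by (auto simp: e_def)
    have ed: "\<bar>s\<bar> < d" and ez: "z + s \<in> {l..r}" if "\<bar>s\<bar> < e" for s using that by (auto simp: e_def)
    let ?k = "\<lambda>s. \<theta> s - (f l + B * (z + s - l) + c / 2 * ((z + s - l) * (z + s - r)))"
    let ?k' = "\<lambda>s. \<theta>' s - (B + c / 2 * (2 * s + 2 * z - l - r))"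
    have "D - c \<le> 0"
    proof (rule second_derivative_at_max(2)[OF e, of 0 ?k ?k'])
      fix s assume "\<bar>s - 0\<bar> < e"
      then have s: "\<bar>s\<bar> < e" by simp
      show "(?k has_real_derivative ?k' s) (at s)"
        by (rule derivative_eq_intros \<theta>(1)[OF ed[OF s]] refl)+ (simp add: algebra_simps)
      have "?k s \<le> g (z + s)" using \<theta>(2)[OF ed[OF s]] by (simp add: g_def)
      also have "\<dots> \<le> g z" by (rule z(2)[OF ez[OF s]])
      also have "\<dots> = ?k 0" using \<theta>(3) by (simp add: g_def)
      finally show "?k s \<le> ?k 0" .
    next
      show "(?k' has_real_derivative D - c) (at 0)"
        by (rule derivative_eq_intros \<theta>(4) refl)+ simp
    qed
    then show False using \<theta>(5) by simp
  qed
  then have "f y \<le> f l + B * (y - l) + c / 2 * ((y - l) * (y - r))" using z(2)[OF y] by (simp add: g_def)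
  also have "f l + B * (y - l) = (r - y) / (r - l) * f l + (y - l) / (r - l) * f r"
  proof -
    have "(r - y) / (r - l) = 1 - (y - l) / (r - l)" using lr by (simp add: field_simps)
    then show ?thesis by (simp add: B_def algebra_simps diff_divide_distrib add_divide_distrib)
  qed
  finally show ?thesis .
qed

section \<open>Energy of functions that lie below parabolas\<close>

text \<open>
  A weak form of \<open>g'' \<ge> Z\<close>: where \<open>Z > c\<close>, the function \<open>g\<close> lies below every parabola with second
  derivative \<open>c\<close> that agrees with it at two points.  In contrast to the differential inequality it makes
  sense for functions that are merely continuous.
\<close>

definition below_parabolas :: "(real \<Rightarrow> real) \<Rightarrow> (real \<Rightarrow> real) \<Rightarrow> bool" where
  "below_parabolas Z g \<longleftrightarrow> (\<forall>l r p c. 0 \<le> p \<and> p \<le> 1 \<and> (\<forall>z\<in>closed_segment l r. c < Z z) \<longrightarrow>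
     g ((1 - p) * l + p * r) \<le> (1 - p) * g l + p * g r - c / 2 * (p * (1 - p) * (r - l)\<^sup>2))"

lemma below_parabolasD:
  "below_parabolas Z g \<Longrightarrow> 0 \<le> p \<Longrightarrow> p \<le> 1 \<Longrightarrow> (\<And>z. z \<in> closed_segment l r \<Longrightarrow> c < Z z) \<Longrightarrow>
    g ((1 - p) * l + p * r) \<le> (1 - p) * g l + p * g r - c / 2 * (p * (1 - p) * (r - l)\<^sup>2)"
  unfolding below_parabolas_def by blast

lemma below_parabolasI:
  assumes *: "\<And>l r y c. l < r \<Longrightarrow> y \<in> {l..r} \<Longrightarrow> (\<And>z. z \<in> {l..r} \<Longrightarrow> c < Z z) \<Longrightarrow>
    g y \<le> (r - y) / (r - l) * g l + (y - l) / (r - l) * g r + c / 2 * ((y - l) * (y - r))"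
  shows "below_parabolas Z g"
  unfolding below_parabolas_def
proof (intro allI impI)
  have lt: "g ((1 - p) * l + p * r) \<le> (1 - p) * g l + p * g r - c / 2 * (p * (1 - p) * (r - l)\<^sup>2)"
    if p: "0 \<le> p" "p \<le> 1" and lr: "l < r" and c: "\<And>z. z \<in> {l..r} \<Longrightarrow> c < Z z" for l r p c
  proof -
    define y where "y = (1 - p) * l + p * r"
    have y1: "y - l = p * (r - l)" by (simp add: y_def algebra_simps)
    have y2: "r - y = (1 - p) * (r - l)" by (simp add: y_def algebra_simps)
    have y3: "y - r = - ((1 - p) * (r - l))" using y2 by simp
    have "0 \<le> p * (r - l)" "0 \<le> (1 - p) * (r - l)" using p lr by auto
    then have "0 \<le> y - l" "0 \<le> r - y" unfolding y1 y2 .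
    then have "y \<in> {l..r}" by simp
    then have "g y \<le> (r - y) / (r - l) * g l + (y - l) / (r - l) * g r + c / 2 * ((y - l) * (y - r))"
      using lr c by (intro *) auto
    also have "(r - y) / (r - l) = 1 - p" unfolding y2 using lr by simp
    also have "(y - l) / (r - l) = p" unfolding y1 using lr by simp
    also have "(y - l) * (y - r) = - (p * (1 - p) * (r - l)\<^sup>2)" unfolding y1 y3 by (simp add: power2_eq_square)
    finally show ?thesis by (simp add: y_def)
  qed
  fix l r p c :: real assume h: "0 \<le> p \<and> p \<le> 1 \<and> (\<forall>z\<in>closed_segment l r. c < Z z)"
  consider "l < r" | "r < l" | "l = r" by linarith
  then show "g ((1 - p) * l + p * r) \<le> (1 - p) * g l + p * g r - c / 2 * (p * (1 - p) * (r - l)\<^sup>2)"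
  proof cases
    case 1
    then show ?thesis using h by (intro lt) (auto simp: closed_segment_eq_real_ivl)
  next
    case 2
    have "g ((1 - (1 - p)) * r + (1 - p) * l) \<le> (1 - (1 - p)) * g r + (1 - p) * g l - c / 2 * ((1 - p) * (1 - (1 - p)) * (l - r)\<^sup>2)"
      using 2 h by (intro lt) (auto simp: closed_segment_eq_real_ivl)
    then show ?thesis by (simp add: power2_commute[of l r] algebra_simps)
  next
    case 3
    have "(1 - p) * r + p * r = r" "(1 - p) * g r + p * g r = g r" by (auto simp: algebra_simps)
    then show ?thesis using 3 by simp
  qed
qed

lemma below_parabolas_scale:
  assumes P: "below_parabolas Z g" and k: "0 \<le> k"
  shows "below_parabolas (\<lambda>z. k * Z z) (\<lambda>z. k * g z)"
  unfolding below_parabolas_def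
proof (intro allI impI)
  fix l r p c :: real assume h: "0 \<le> p \<and> p \<le> 1 \<and> (\<forall>z\<in>closed_segment l r. c < k * Z z)"
  show "k * g ((1 - p) * l + p * r) \<le> (1 - p) * (k * g l) + p * (k * g r) - c / 2 * (p * (1 - p) * (r - l)\<^sup>2)"
  proof (cases "k = 0")
    case True
    then have "c < 0" using h by (auto dest: bspec[of _ _ l])
    then have "c / 2 * (p * (1 - p) * (r - l)\<^sup>2) \<le> 0" using h by (intro mult_nonpos_nonneg) auto
    then show ?thesis using True by simp
  next
    case False
    then have k0: "0 < k" using k by simp
    have "g ((1 - p) * l + p * r) \<le> (1 - p) * g l + p * g r - (c / k) / 2 * (p * (1 - p) * (r - l)\<^sup>2)"
      using h k0 by (intro below_parabolasD[OF P]) (auto simp: field_simps)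
    then have "k * g ((1 - p) * l + p * r) \<le> k * ((1 - p) * g l + p * g r - (c / k) / 2 * (p * (1 - p) * (r - l)\<^sup>2))"
      using k by (rule mult_left_mono)
    also have "\<dots> = (1 - p) * (k * g l) + p * (k * g r) - (k * (c / k)) / 2 * (p * (1 - p) * (r - l)\<^sup>2)"
      by (simp add: algebra_simps)
    finally show ?thesis using k0 by simp
  qed
qed

context
  fixes g Z :: "real \<Rightarrow> real" and d \<omega> :: real
  assumes g: "compactly_supported g" and g0: "\<And>z. 0 \<le> g z" and Z: "continuous_on UNIV Z"
    and P: "below_parabolas Z g" and \<omega>: "0 < \<omega>" and mod: "\<And>z z'. \<bar>z - z'\<bar> < d \<Longrightarrow> \<bar>Z z - Z z'\<bar> < \<omega>"
begin

text \<open>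
  Writing \<open>z\<close> as the midpoint of \<open>z - s\<close> and \<open>z + s\<close>, multiplying by \<open>g\<close> and integrating is a discrete
  integration by parts; in the limit it reads \<open>\<integral> g'\<^sup>2 \<le> - \<integral> Z g\<close>.  The modulus of continuity of \<open>Z\<close>
  accounts for the error \<open>\<omega>\<close>.
\<close>

lemma translation_energy:
  assumes s: "0 < s" "s < d"
  shows "(\<integral>z. (g (z + s) - g z)\<^sup>2 \<partial>lborel) \<le> s\<^sup>2 * ((\<integral>z. - Z z * g z \<partial>lborel) + \<omega> * (\<integral>z. g z \<partial>lborel))"
proof -
  note gs = compactly_supported_shift[OF g, of s] and gs' = compactly_supported_shift[OF g, of "- s"]
  note gc = compactly_supported_continuous[OF g]
  note cc = compactly_supported_continuous[OF gs] compactly_supported_continuous[OF gs']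
  define A J where "A = (\<integral>z. (g z)\<^sup>2 \<partial>lborel)" and "J = (\<integral>z. g z * g (z + s) \<partial>lborel)"
  have iA: "integrable lborel (\<lambda>z. (g z)\<^sup>2)" and iJ: "integrable lborel (\<lambda>z. g z * g (z + s))" and iJ': "integrable lborel (\<lambda>z. g z * g (z + - s))"
    and iZ: "integrable lborel (\<lambda>z. g z * Z z)" and ig: "integrable lborel g" and iS: "integrable lborel (\<lambda>z. (g (z + s))\<^sup>2)"
    using g gs Z cc by (auto intro!: compactly_supported_integrable compactly_supported_power2 compactly_supported_mult_left)
  have J': "(\<integral>z. g z * g (z + - s) \<partial>lborel) = J"
  proof -
    have "(\<integral>z. g z * g (z + - s) \<partial>lborel) = (\<integral>z. g (z + s) * g (z + s + - s) \<partial>lborel)"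
      by (rule integral_lborel_shift[symmetric]) (intro borel_measurable_continuous_onI continuous_on_mult gc cc)
    then show ?thesis by (simp add: J_def mult.commute)
  qed
  have S: "(\<integral>z. (g (z + s))\<^sup>2 \<partial>lborel) = A"
    unfolding A_def by (rule integral_lborel_shift[where f="\<lambda>z. (g z)\<^sup>2"]) (intro borel_measurable_continuous_onI continuous_on_power gc)
  have "A \<le> (\<integral>z. 1/2 * (g z * g (z + - s)) + 1/2 * (g z * g (z + s)) - s\<^sup>2 / 2 * (g z * Z z) + s\<^sup>2 / 2 * \<omega> * g z \<partial>lborel)"
    unfolding A_def
  proof (rule integral_mono)
    fix z
    have "g ((1 - 1/2) * (z - s) + 1/2 * (z + s)) \<le> (1 - 1/2) * g (z - s) + 1/2 * g (z + s) - (Z z - \<omega>) / 2 * (1/2 * (1 - 1/2) * (z + s - (z - s))\<^sup>2)"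
    proof (rule below_parabolasD[OF P])
      fix z' assume "z' \<in> closed_segment (z - s) (z + s)"
      then have "\<bar>z - z'\<bar> < d" using s by (auto simp: closed_segment_eq_real_ivl)
      from mod[OF this] show "Z z - \<omega> < Z z'" by (simp add: abs_less_iff)
    qed auto
    moreover have "(1 - 1/2) * (z - s) + 1/2 * (z + s) = z" by (simp add: field_simps)
    ultimately have "g z \<le> 1/2 * g (z - s) + 1/2 * g (z + s) - (Z z - \<omega>) / 2 * s\<^sup>2"
      by (simp add: power_mult_distrib)
    then have "g z * g z \<le> g z * (1/2 * g (z - s) + 1/2 * g (z + s) - (Z z - \<omega>) / 2 * s\<^sup>2)" by (rule mult_left_mono[OF _ g0])
    then show "(g z)\<^sup>2 \<le> 1/2 * (g z * g (z + - s)) + 1/2 * (g z * g (z + s)) - s\<^sup>2 / 2 * (g z * Z z) + s\<^sup>2 / 2 * \<omega> * g z"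
      by (simp add: power2_eq_square algebra_simps add_divide_distrib diff_divide_distrib)
  qed (intro iA iJ iJ' iZ ig Bochner_Integration.integrable_add Bochner_Integration.integrable_diff integrable_mult_right)+
  also have "\<dots> = J - s\<^sup>2 / 2 * (\<integral>z. g z * Z z \<partial>lborel) + s\<^sup>2 / 2 * \<omega> * (\<integral>z. g z \<partial>lborel)"
    using iJ iJ' iZ ig J' by (simp add: J_def)
  finally have 1: "2 * A - 2 * J \<le> s\<^sup>2 * (- (\<integral>z. g z * Z z \<partial>lborel) + \<omega> * (\<integral>z. g z \<partial>lborel))"
    by (simp add: algebra_simps)
  have "(\<integral>z. (g (z + s) - g z)\<^sup>2 \<partial>lborel) = (\<integral>z. (g (z + s))\<^sup>2 + (g z)\<^sup>2 - 2 * (g z * g (z + s)) \<partial>lborel)"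
    by (rule Bochner_Integration.integral_cong) (auto simp: power2_eq_square algebra_simps)
  also have "\<dots> = 2 * A - 2 * J" using iS iA iJ S by (simp add: A_def J_def)
  finally show ?thesis using 1 by (simp add: mult.commute[of "Z _"])
qed

text \<open>
  The same argument for dilations about \<open>m\<close>, where \<open>z\<close> is written as a convex combination of its images
  under the dilation and its inverse.  In the limit it reads
  \<open>\<integral> (z - m)\<^sup>2 g'\<^sup>2 \<le> 3 (\<integral> g\<^sup>2 - \<integral> (z - m)\<^sup>2 Z g)\<close>.
\<close>

lemma dilation_energy:
  assumes \<rho>: "1/2 \<le> \<rho>" "\<rho> \<le> 2" and R: "\<And>z. g z \<noteq> 0 \<Longrightarrow> \<bar>z - m\<bar> \<le> R" "R * \<bar>\<rho> - 1 / \<rho>\<bar> < d"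
  shows "(\<integral>z. (g z - g (m + \<rho> * (z - m)))\<^sup>2 \<partial>lborel)
    \<le> 3 * (\<rho> - 1)\<^sup>2 * ((\<integral>z. (g z)\<^sup>2 \<partial>lborel) + (\<integral>z. - Z z * (z - m)\<^sup>2 * g z \<partial>lborel) + \<omega> * (\<integral>z. (z - m)\<^sup>2 * g z \<partial>lborel))"
proof -
  have \<rho>0: "0 < \<rho>" using \<rho> by simp
  note gc = compactly_supported_continuous[OF g]
  have ch: "continuous_on UNIV (\<lambda>z. g (m + \<rho> * (z - m)))" and ch': "continuous_on UNIV (\<lambda>z. g (m + (z - m) / \<rho>))"
    by (intro continuous_on_compose2[OF gc] continuous_intros; use \<rho>0 in auto)+
  define A J where "A = (\<integral>z. (g z)\<^sup>2 \<partial>lborel)" and "J = (\<integral>z. g z * g (m + \<rho> * (z - m)) \<partial>lborel)"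
  define Q1 Q2 where "Q1 = (\<integral>z. g z * ((z - m)\<^sup>2 * Z z) \<partial>lborel)" and "Q2 = (\<integral>z. g z * (z - m)\<^sup>2 \<partial>lborel)"
  have iA: "integrable lborel (\<lambda>z. (g z)\<^sup>2)" and iJ: "integrable lborel (\<lambda>z. g z * g (m + \<rho> * (z - m)))"
    and iJ': "integrable lborel (\<lambda>z. g z * g (m + (z - m) / \<rho>))"
    and iQ1: "integrable lborel (\<lambda>z. g z * ((z - m)\<^sup>2 * Z z))" and iQ2: "integrable lborel (\<lambda>z. g z * (z - m)\<^sup>2)"
    by (intro compactly_supported_integrable compactly_supported_power2 compactly_supported_mult_left g ch ch' continuous_intros Z)+
  have J': "(\<integral>z. g z * g (m + (z - m) / \<rho>) \<partial>lborel) = \<rho> * J"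
  proof -
    have "(\<integral>z. g z * g (m + (z - m) / \<rho>) \<partial>lborel) = \<bar>\<rho>\<bar> *\<^sub>R (\<integral>z. g (m - \<rho> * m + \<rho> * z) * g (m + (m - \<rho> * m + \<rho> * z - m) / \<rho>) \<partial>lborel)"
      by (rule lborel_integral_real_affine) (use \<rho>0 in simp)
    also have "(\<lambda>z. g (m - \<rho> * m + \<rho> * z) * g (m + (m - \<rho> * m + \<rho> * z - m) / \<rho>)) = (\<lambda>z. g z * g (m + \<rho> * (z - m)))"
    proof
      fix z
      have e1: "m + (m - \<rho> * m + \<rho> * z - m) / \<rho> = z" using \<rho>0 by (simp add: field_simps)
      have e2: "m - \<rho> * m + \<rho> * z = m + \<rho> * (z - m)" by (simp add: algebra_simps)
      show "g (m - \<rho> * m + \<rho> * z) * g (m + (m - \<rho> * m + \<rho> * z - m) / \<rho>) = g z * g (m + \<rho> * (z - m))"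
        unfolding e1 unfolding e2 by (rule mult.commute)
    qed
    finally show ?thesis using \<rho>0 by (simp add: J_def)
  qed
  have aff: "(\<lambda>z. (g (m - \<rho> * m + \<rho> * z))\<^sup>2) = (\<lambda>z. (g (m + \<rho> * (z - m)))\<^sup>2)" by (simp add: algebra_simps)
  have S: "A = \<rho> * (\<integral>z. (g (m + \<rho> * (z - m)))\<^sup>2 \<partial>lborel)"
    using lborel_integral_real_affine[of \<rho> "\<lambda>z. (g z)\<^sup>2" "m - \<rho> * m"] \<rho>0 unfolding aff by (simp add: A_def)
  have iS: "integrable lborel (\<lambda>z. (g (m + \<rho> * (z - m)))\<^sup>2)"
    using lborel_integrable_real_affine[OF iA, of \<rho> "m - \<rho> * m"] \<rho>0 unfolding aff by simp
  \<comment> \<open>the weight with \<open>(1 - p) / \<rho> + p \<rho> = 1\<close>\<close>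
  define p where "p = 1 / (\<rho> + 1)"
  have p: "0 \<le> p" "p \<le> 1" "1 - p = \<rho> * p" using \<rho>0 by (auto simp: p_def field_simps)
  have p1: "p * (\<rho> + 1) = 1" using \<rho>0 by (simp add: p_def)
  define \<kappa> where "\<kappa> = (\<rho> - 1)\<^sup>2 / (2 * \<rho>)"
  have pt: "(g z)\<^sup>2 \<le> \<rho> * p * (g z * g (m + (z - m) / \<rho>)) + p * (g z * g (m + \<rho> * (z - m))) - \<kappa> * (g z * ((z - m)\<^sup>2 * Z z)) + \<kappa> * \<omega> * (g z * (z - m)\<^sup>2)" for z
  proof (cases "g z = 0")
    case False
    define D where "D = z - m"
    define l r where "l = m + D / \<rho>" and "r = m + \<rho> * D"
    have rl: "r - l = D * (\<rho> - 1 / \<rho>)" by (simp add: l_def r_def algebra_simps)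
    have zz: "(1 - p) * l + p * r = z"
    proof -
      have "(1 - p) * l + p * r = m + (1 - p) * (D / \<rho>) + p * (\<rho> * D)" by (simp add: l_def r_def algebra_simps)
      also have "(1 - p) * (D / \<rho>) = p * D" using \<rho>0 p(3) by simp
      also have "m + p * D + p * (\<rho> * D) = m + (p * (\<rho> + 1)) * D" by (simp add: algebra_simps)
      finally show ?thesis using p1 by (simp add: D_def)
    qed
    have "g ((1 - p) * l + p * r) \<le> (1 - p) * g l + p * g r - (Z z - \<omega>) / 2 * (p * (1 - p) * (r - l)\<^sup>2)"
    proof (rule below_parabolasD[OF P p(1,2)])
      fix z' assume z': "z' \<in> closed_segment l r"
      have "z \<in> closed_segment l r" unfolding closed_segment_def using zz p by (auto intro!: exI[of _ p])
      then have "\<bar>z - z'\<bar> \<le> \<bar>r - l\<bar>" using z' by (auto simp: closed_segment_eq_real_ivl split: if_splits)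
      also have "\<dots> \<le> R * \<bar>\<rho> - 1 / \<rho>\<bar>" unfolding rl abs_mult using R(1)[OF False] by (intro mult_right_mono) (auto simp: D_def)
      also note R(2)
      finally have "\<bar>z - z'\<bar> < d" .
      from mod[OF this] show "Z z - \<omega> < Z z'" by (simp add: abs_less_iff)
    qed
    also have "p * (1 - p) * (r - l)\<^sup>2 = 2 * \<kappa> * D\<^sup>2"
    proof -
      have "p * (1 - p) * (r - l)\<^sup>2 = \<rho> * (p * (\<rho> - 1 / \<rho>))\<^sup>2 * D\<^sup>2" by (simp add: p(3) rl power2_eq_square)
      also have "p * (\<rho> - 1 / \<rho>) = (p * (\<rho> + 1)) * ((\<rho> - 1) / \<rho>)" using \<rho>0 by (simp add: field_simps)
      also have "\<rho> * (p * (\<rho> + 1) * ((\<rho> - 1) / \<rho>))\<^sup>2 = 2 * \<kappa>" unfolding p1 \<kappa>_def using \<rho>0 by (simp add: power2_eq_square)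
      finally show ?thesis by simp
    qed
    finally have "g z \<le> (1 - p) * g l + p * g r - (Z z - \<omega>) / 2 * (2 * \<kappa> * D\<^sup>2)" unfolding zz .
    then have "g z * g z \<le> g z * ((1 - p) * g l + p * g r - (Z z - \<omega>) / 2 * (2 * \<kappa> * D\<^sup>2))" by (rule mult_left_mono[OF _ g0])
    also have "\<dots> = \<rho> * p * (g z * g l) + p * (g z * g r) - \<kappa> * (g z * (D\<^sup>2 * Z z)) + \<kappa> * \<omega> * (g z * D\<^sup>2)"
      unfolding p(3) by (simp add: algebra_simps diff_divide_distrib)
    finally show ?thesis unfolding l_def r_def D_def by (simp add: power2_eq_square)
  qed simp
  have "A \<le> (\<integral>z. \<rho> * p * (g z * g (m + (z - m) / \<rho>)) + p * (g z * g (m + \<rho> * (z - m))) - \<kappa> * (g z * ((z - m)\<^sup>2 * Z z)) + \<kappa> * \<omega> * (g z * (z - m)\<^sup>2) \<partial>lborel)"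
    unfolding A_def by (rule integral_mono[OF iA _ pt])
      (intro iJ iJ' iQ1 iQ2 Bochner_Integration.integrable_add Bochner_Integration.integrable_diff integrable_mult_right)
  also have "\<dots> = \<rho> * p * (\<rho> * J) + p * J - \<kappa> * Q1 + \<kappa> * \<omega> * Q2"
    using iJ iJ' iQ1 iQ2 by (simp add: J' J_def Q1_def Q2_def)
  finally have AJ: "A \<le> p * (\<rho>\<^sup>2 + 1) * J - \<kappa> * (Q1 - \<omega> * Q2)" by (simp add: power2_eq_square algebra_simps)
  define B where "B = A - (Q1 - \<omega> * Q2)"
  have E: "(\<integral>z. (g z - g (m + \<rho> * (z - m)))\<^sup>2 \<partial>lborel) = A + A / \<rho> - 2 * J"
  proof -
    have "(\<integral>z. (g z - g (m + \<rho> * (z - m)))\<^sup>2 \<partial>lborel) = (\<integral>z. (g z)\<^sup>2 + (g (m + \<rho> * (z - m)))\<^sup>2 - 2 * (g z * g (m + \<rho> * (z - m))) \<partial>lborel)"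
      by (rule Bochner_Integration.integral_cong) (auto simp: power2_eq_square algebra_simps)
    also have "\<dots> = A + (\<integral>z. (g (m + \<rho> * (z - m)))\<^sup>2 \<partial>lborel) - 2 * J" using iS iA iJ by (simp add: A_def J_def)
    finally show ?thesis using S \<rho>0 by simp
  qed
  define X where "X = (\<integral>z. (g z - g (m + \<rho> * (z - m)))\<^sup>2 \<partial>lborel)"
  have X0: "0 \<le> X" by (simp add: X_def)
  \<comment> \<open>the inequality \<open>AJ\<close> for \<open>J\<close>, multiplied by \<open>2 \<rho> (\<rho> + 1)\<close> to clear denominators\<close>
  have XB: "\<rho> * (\<rho>\<^sup>2 + 1) * X \<le> (\<rho> + 1) * (\<rho> - 1)\<^sup>2 * B"
  proof -
    have "(\<rho> + 1) * A \<le> (\<rho> + 1) * (p * (\<rho>\<^sup>2 + 1) * J - \<kappa> * (Q1 - \<omega> * Q2))" using AJ \<rho>0 by (intro mult_left_mono) auto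
    also have "\<dots> = (p * (\<rho> + 1)) * (\<rho>\<^sup>2 + 1) * J - (\<rho> + 1) * \<kappa> * (Q1 - \<omega> * Q2)" by (simp add: algebra_simps)
    finally have "2 * \<rho> * ((\<rho> + 1) * A) \<le> 2 * \<rho> * ((\<rho>\<^sup>2 + 1) * J - (\<rho> + 1) * \<kappa> * (Q1 - \<omega> * Q2))" unfolding p1 using \<rho>0 by (intro mult_left_mono) auto
    moreover have "2 * \<rho> * ((\<rho> + 1) * \<kappa> * (Q1 - \<omega> * Q2)) = (\<rho> + 1) * (\<rho> - 1)\<^sup>2 * (Q1 - \<omega> * Q2)" using \<rho>0 by (simp add: \<kappa>_def)
    ultimately have *: "2 * \<rho> * ((\<rho> + 1) * A) + (\<rho> + 1) * (\<rho> - 1)\<^sup>2 * (Q1 - \<omega> * Q2) \<le> 2 * \<rho> * ((\<rho>\<^sup>2 + 1) * J)" by (simp add: algebra_simps)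
    have "\<rho> * X = \<rho> * A + A - 2 * \<rho> * J" unfolding X_def E using \<rho>0 by (simp add: algebra_simps)
    then have "\<rho> * (\<rho>\<^sup>2 + 1) * X = (\<rho>\<^sup>2 + 1) * (\<rho> * A + A - 2 * \<rho> * J)" by (metis mult.assoc mult.commute)
    also have "\<dots> = (\<rho>\<^sup>2 + 1) * (\<rho> + 1) * A - 2 * \<rho> * ((\<rho>\<^sup>2 + 1) * J)" by (simp add: algebra_simps)
    also have "\<dots> \<le> (\<rho>\<^sup>2 + 1) * (\<rho> + 1) * A - (2 * \<rho> * ((\<rho> + 1) * A) + (\<rho> + 1) * (\<rho> - 1)\<^sup>2 * (Q1 - \<omega> * Q2))" using * by linarith
    also have "\<dots> = (\<rho> + 1) * (\<rho> - 1)\<^sup>2 * B" by (simp add: B_def power2_eq_square algebra_simps)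
    finally show ?thesis .
  qed
  have "X \<le> 3 * (\<rho> - 1)\<^sup>2 * B"
  proof (cases "\<rho> = 1")
    case True
    then show ?thesis by (simp add: X_def)
  next
    case False
    then have sq: "0 < (\<rho> - 1)\<^sup>2" by simp
    have "0 \<le> (\<rho> + 1) * (\<rho> - 1)\<^sup>2 * B" using XB X0 \<rho>0 by (meson mult_nonneg_nonneg order_trans less_imp_le add_nonneg_nonneg zero_le_power2 zero_le_one)
    moreover have "0 < (\<rho> + 1) * (\<rho> - 1)\<^sup>2" using \<rho>0 sq by (intro mult_pos_pos) auto
    ultimately have B0: "0 \<le> B" by (meson mult_neg_pos mult.commute mult_pos_neg not_le)
    have "\<rho> * 1 \<le> \<rho> * (\<rho>\<^sup>2 + 1)" using \<rho>0 by (intro mult_left_mono) auto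
    then have "\<rho> + 1 \<le> 3 * (\<rho> * (\<rho>\<^sup>2 + 1))" using \<rho> by linarith
    then have "(\<rho> + 1) * ((\<rho> - 1)\<^sup>2 * B) \<le> 3 * (\<rho> * (\<rho>\<^sup>2 + 1)) * ((\<rho> - 1)\<^sup>2 * B)" using B0 by (intro mult_right_mono) auto
    moreover have "(\<rho> + 1) * ((\<rho> - 1)\<^sup>2 * B) = (\<rho> + 1) * (\<rho> - 1)\<^sup>2 * B" by simp
    moreover have "3 * (\<rho> * (\<rho>\<^sup>2 + 1)) * ((\<rho> - 1)\<^sup>2 * B) = \<rho> * (\<rho>\<^sup>2 + 1) * (3 * (\<rho> - 1)\<^sup>2 * B)" by (simp only: mult_ac)
    ultimately have "\<rho> * (\<rho>\<^sup>2 + 1) * X \<le> \<rho> * (\<rho>\<^sup>2 + 1) * (3 * (\<rho> - 1)\<^sup>2 * B)" using XB by linarith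
    moreover have "0 < \<rho> * (\<rho>\<^sup>2 + 1)" using \<rho>0 by (intro mult_pos_pos add_nonneg_pos) auto
    ultimately show ?thesis by (rule mult_left_le_imp_le)
  qed
  moreover have "(\<integral>z. - Z z * (z - m)\<^sup>2 * g z \<partial>lborel) = - Q1"
  proof -
    have "(\<integral>z. - Z z * (z - m)\<^sup>2 * g z \<partial>lborel) = (\<integral>z. - (g z * ((z - m)\<^sup>2 * Z z)) \<partial>lborel)"
      by (rule Bochner_Integration.integral_cong) auto
    then show ?thesis by (simp add: Q1_def)
  qed
  moreover have "(\<integral>z. (z - m)\<^sup>2 * g z \<partial>lborel) = Q2" by (simp add: Q2_def mult.commute)
  ultimately show ?thesis unfolding X_def B_def A_def by (simp add: algebra_simps)
qed

end

text \<open>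
  A pointwise comparison along a contraction loses at most the contraction factor in mass.
\<close>

lemma contraction_mass:
  fixes g1 g2 :: "real \<Rightarrow> real"
  assumes g: "compactly_supported g1" "compactly_supported g2" and nn: "\<And>y. 0 \<le> g1 y" and \<theta>: "0 \<le> \<theta>" "\<theta> < 1"
    and le: "\<And>y. g1 y \<le> g2 ((1 - \<theta>) * y + \<theta> * m)"
  shows "(1 - \<theta>) * (\<integral>y. (g1 y)\<^sup>2 \<partial>lborel) \<le> (\<integral>y. (g2 y)\<^sup>2 \<partial>lborel)"
proof -
  have i2: "integrable lborel (\<lambda>y. (g2 y)\<^sup>2)" by (rule compactly_supported_integrable[OF compactly_supported_power2[OF g(2)]])
  have "(\<integral>y. (g1 y)\<^sup>2 \<partial>lborel) \<le> (\<integral>y. (g2 (\<theta> * m + (1 - \<theta>) * y))\<^sup>2 \<partial>lborel)"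
  proof (rule integral_mono)
    show "integrable lborel (\<lambda>y. (g1 y)\<^sup>2)" by (rule compactly_supported_integrable[OF compactly_supported_power2[OF g(1)]])
    show "integrable lborel (\<lambda>y. (g2 (\<theta> * m + (1 - \<theta>) * y))\<^sup>2)" using lborel_integrable_real_affine[OF i2, of "1 - \<theta>" "\<theta> * m"] \<theta> by simp
    show "(g1 y)\<^sup>2 \<le> (g2 (\<theta> * m + (1 - \<theta>) * y))\<^sup>2" for y using le[of y] nn by (intro power_mono) (auto simp: add.commute)
  qed
  then have "(1 - \<theta>) * (\<integral>y. (g1 y)\<^sup>2 \<partial>lborel) \<le> (1 - \<theta>) * (\<integral>y. (g2 (\<theta> * m + (1 - \<theta>) * y))\<^sup>2 \<partial>lborel)"
    using \<theta> by (intro mult_left_mono) auto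
  also have "\<dots> = (\<integral>y. (g2 y)\<^sup>2 \<partial>lborel)"
    using lborel_integral_real_affine[of "1 - \<theta>" "\<lambda>y. (g2 y)\<^sup>2" "\<theta> * m"] \<theta> by simp
  finally show ?thesis .
qed

section \<open>The trial function between two sections\<close>

lemma compactly_supported_dilation:
  fixes g :: "real \<Rightarrow> real"
  assumes g: "compactly_supported g" and \<rho>: "\<rho> \<noteq> 0"
  shows "compactly_supported (\<lambda>y. g (m + \<rho> * (y - m)))"
proof -
  from g obtain C where C: "compact C" "\<And>y. y \<notin> C \<Longrightarrow> g y = 0" and c: "continuous_on UNIV g"
    by (auto simp: compactly_supported_def)
  show ?thesis
  proof (rule compactly_supportedI)
    show "continuous_on UNIV (\<lambda>y. g (m + \<rho> * (y - m)))" by (rule continuous_on_compose2[OF c]) (auto intro!: continuous_intros)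
    show "compact ((\<lambda>z. m + (z - m) / \<rho>) ` C)" using \<rho> by (intro compact_continuous_image continuous_intros C) auto
    fix y assume y: "y \<notin> (\<lambda>z. m + (z - m) / \<rho>) ` C"
    have "y = m + (m + \<rho> * (y - m) - m) / \<rho>" using \<rho> by simp
    then have "m + \<rho> * (y - m) \<notin> C" using y by blast
    then show "g (m + \<rho> * (y - m)) = 0" by (rule C)
  qed
qed

text \<open>
  The properties of the interpolated profiles \<open>G x\<close> that enter the energy estimate.  The points \<open>ma\<close> and
  \<open>mb\<close> are the peaks at the two ends.
\<close>

locale subsolution_family = planar_schroedinger \<Omega> V for \<Omega> V +
  fixes G :: "real \<Rightarrow> real \<Rightarrow> real" and M a b ma mb k :: real and T :: "(real \<times> real) set"
  assumes ab: "a < b" and G_continuous: "continuous_on ({a<..<b} \<times> UNIV) (\<lambda>(x, y). G x y)"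
    and G_nonneg: "\<And>x y. a < x \<Longrightarrow> x < b \<Longrightarrow> 0 \<le> G x y"
    and T: "compact T" "T \<subseteq> \<Omega>" and G_support: "\<And>x y. a < x \<Longrightarrow> x < b \<Longrightarrow> G x y \<noteq> 0 \<Longrightarrow> (x, y) \<in> T"
    and G_below: "\<And>x. a < x \<Longrightarrow> x < b \<Longrightarrow> below_parabolas (\<lambda>y. (V (x, y) - M) * G x y) (G x)"
    and G_right: "\<And>x y \<theta>. a < x \<Longrightarrow> x < b \<Longrightarrow> 0 \<le> \<theta> \<Longrightarrow> \<theta> < 1 \<Longrightarrow> G x y \<le> G (x + \<theta> * (b - x)) ((1 - \<theta>) * y + \<theta> * mb)"
    and G_left: "\<And>x y \<theta>. a < x \<Longrightarrow> x < b \<Longrightarrow> 0 \<le> \<theta> \<Longrightarrow> \<theta> < 1 \<Longrightarrow> G x y \<le> G (x - \<theta> * (x - a)) ((1 - \<theta>) * y + \<theta> * ma)"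
    and G_nontrivial: "\<exists>y. G ((a + b) / 2) y \<noteq> 0"
    and weight: "\<And>x y m. (x, y) \<in> \<Omega> \<Longrightarrow> m \<in> {ma, mb} \<Longrightarrow> (M - V (x, y)) * (y - m)\<^sup>2 \<le> k" and k: "0 \<le> k"
begin

text \<open>
  Only the middle half of \<open>(a, b)\<close> carries the trial function \<open>u\<close>; \<open>H\<close> is \<open>G\<close> with \<open>x\<close> confined to
  a slightly longer interval, so that it is defined and continuous on the whole plane.
\<close>

definition h where "h = (b - a) / 4"
definition mid where "mid = (a + b) / 2"
definition clamp where "clamp x = max (a + h / 2) (min (b - h / 2) x)" for x
definition H where "H x y = G (clamp x) y" for x y
definition \<eta> where "\<eta> x = max 0 (h - \<bar>x - mid\<bar>)" for x
definition u where "u p = \<eta> (fst p) * H (fst p) (snd p)" for p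
definition Z where "Z p = (V p - M) * u p" for p

lemma h_width: "0 < h" "mid - a = 2 * h" "b - mid = 2 * h" "b - a = 4 * h"
  using ab by (auto simp: h_def mid_def field_simps)

lemma clamp_bounds: "a < clamp x" "clamp x < b" "h / 2 \<le> clamp x - a" "h / 2 \<le> b - clamp x"
  using h_width by (auto simp: clamp_def max_def min_def)

lemma clamp_eq:
  assumes "\<bar>x - mid\<bar> \<le> 3 * h / 2"
  shows "clamp x = x"
proof -
  have "a + h / 2 \<le> x" "x \<le> b - h / 2" using assms h_width by linarith+
  then show ?thesis by (simp add: clamp_def max_def min_def)
qed

lemma H_nonneg: "0 \<le> H x y" unfolding H_def by (rule G_nonneg[OF clamp_bounds(1,2)])

lemma H_continuous: "continuous_on UNIV (\<lambda>p. H (fst p) (snd p))"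
proof -
  have "continuous_on UNIV (\<lambda>p. (\<lambda>(x, y). G x y) (clamp (fst p), snd p))"
    by (rule continuous_on_compose2[OF G_continuous]) (use clamp_bounds in \<open>auto simp: clamp_def intro!: continuous_intros\<close>)
  then show ?thesis by (simp add: H_def)
qed

lemma H_support: "y \<notin> snd ` T \<Longrightarrow> H x y = 0"
  unfolding H_def using G_support[OF clamp_bounds(1,2), of x y] by force

lemma compact_snd_T: "compact (snd ` T)"
  using T(1) by (intro compact_continuous_image continuous_intros)

lemma H_slice: "compactly_supported (H x)"
proof (rule compactly_supportedI[OF _ compact_snd_T])
  have "continuous_on UNIV (\<lambda>y. (x, y))" by (intro continuous_intros)
  from continuous_on_compose2[OF H_continuous this] show "continuous_on UNIV (H x)" by simp
qed (rule H_support)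

lemma \<eta>_nonneg: "0 \<le> \<eta> x" by (simp add: \<eta>_def)

lemma \<eta>_pos: "\<eta> x \<noteq> 0 \<longleftrightarrow> \<bar>x - mid\<bar> < h" by (auto simp: \<eta>_def max_def)

lemma \<eta>_continuous: "continuous_on S \<eta>" unfolding \<eta>_def[abs_def] by (intro continuous_intros)

lemma \<eta>_diff: "\<bar>\<eta> x - \<eta> y\<bar> \<le> \<bar>x - y\<bar>" by (auto simp: \<eta>_def max_def abs_le_iff)

definition K where "K = T \<inter> (cball mid h \<times> UNIV)"

lemma K_compact_subset: "compact K" "K \<subseteq> \<Omega>"
  unfolding K_def using T by (auto intro!: compact_Int_closed closed_Times)

lemma u_support: "p \<notin> K \<Longrightarrow> u p = 0"
proof (rule ccontr)
  assume p: "p \<notin> K" "u p \<noteq> 0"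
  obtain x y where xy: "p = (x, y)" by (cases p)
  have c: "\<eta> x \<noteq> 0" "H x y \<noteq> 0" using p(2) by (auto simp: u_def xy)
  then have x: "\<bar>x - mid\<bar> < h" by (simp add: \<eta>_pos)
  then have "clamp x = x" using h_width by (intro clamp_eq) auto
  then have "(x, y) \<in> T" using G_support[of x y] clamp_bounds[of x] c(2) by (simp add: H_def)
  then show False using p(1) x by (simp add: xy K_def dist_real_def abs_minus_commute)
qed

lemma u_nonneg: "0 \<le> u p" unfolding u_def by (intro mult_nonneg_nonneg \<eta>_nonneg H_nonneg)

lemma u_continuous: "continuous_on UNIV u"
  unfolding u_def[abs_def] by (intro continuous_on_mult H_continuous continuous_on_compose2[OF \<eta>_continuous[of UNIV]] continuous_intros) auto

lemma u_compact: "compactly_supported u"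
  by (rule compactly_supportedI[OF u_continuous K_compact_subset(1) u_support])

lemma u_slice: "compactly_supported (\<lambda>y. u (x, y))" by (rule compactly_supported_slice[OF u_compact])

lemma Z_compact: "compactly_supported Z"
proof -
  have "compactly_supported (\<lambda>p. indicator \<Omega> p * V p * u p - M *\<^sub>R u p)"
    by (intro compactly_supported_diff compactly_supported_scaleR u_compact
        compactly_supported_mult_potential[OF open_\<Omega> V_continuous u_continuous K_compact_subset u_support])
  also have "(\<lambda>p. indicator \<Omega> p * V p * u p - M *\<^sub>R u p) = Z"
    using u_support K_compact_subset(2) by (auto simp: Z_def fun_eq_iff indicator_def algebra_simps)
  finally show ?thesis .
qed

lemma Z_slice: "continuous_on UNIV (\<lambda>y. Z (x, y))"
  by (rule compactly_supported_continuous[OF compactly_supported_slice[OF Z_compact]])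

lemma u_below: "below_parabolas (\<lambda>y. Z (x, y)) (\<lambda>y. u (x, y))"
proof (cases "\<eta> x = 0")
  case True
  then show ?thesis using below_parabolas_scale[OF G_below[OF clamp_bounds(1,2)], of 0 x] by (simp add: Z_def u_def)
next
  case False
  then have "clamp x = x" using h_width by (intro clamp_eq) (auto simp: \<eta>_pos)
  then show ?thesis using below_parabolas_scale[OF G_below[OF clamp_bounds(1,2)], of "\<eta> x" x] \<eta>_nonneg
    by (simp add: Z_def u_def H_def mult_ac)
qed

lemma Z_modulus:
  assumes "0 < \<omega>"
  obtains d where "0 < d" "\<And>x z z'. \<bar>z - z'\<bar> < d \<Longrightarrow> \<bar>Z (x, z) - Z (x, z')\<bar> < \<omega>"
proof -
  obtain d where d: "d > 0" "\<And>p q. dist p q < d \<Longrightarrow> dist (Z p) (Z q) < \<omega>"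
    by (rule compactly_supported_uniformly_continuous[OF Z_compact assms]) (rule that)
  show ?thesis by (rule that[OF d(1)]) (use d(2)[of "(x, z)" "(x, z')" for x z z'] in \<open>simp add: dist_Pair_Pair dist_real_def\<close>)
qed

definition N where "N = (\<integral>p. (u p)\<^sup>2 \<partial>lborel)"
definition W where "W = (\<integral>y. (H mid y)\<^sup>2 \<partial>lborel)"

text \<open>
  By contraction towards the peaks all sections in the middle of the interval have comparable mass.
\<close>

lemma slice_mass: "(\<integral>y. (H x y)\<^sup>2 \<partial>lborel) \<le> 2 * W" "W \<le> 4 * (\<integral>y. (H x y)\<^sup>2 \<partial>lborel)"
proof -
  define c where "c = clamp x"
  have c: "a < c" "c < b" "h / 2 \<le> c - a" "h / 2 \<le> b - c" using clamp_bounds[of x] by (auto simp: c_def)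
  have am: "a < mid" "mid < b" using h_width by auto
  have cm: "clamp mid = mid" using h_width by (intro clamp_eq) auto
  have Hx: "H x = G c" and Hm: "H mid = G mid" by (auto simp: H_def c_def cm)
  define I where "I = (\<integral>y. (H x y)\<^sup>2 \<partial>lborel)"
  have I0: "0 \<le> I" "0 \<le> W" by (auto simp: I_def W_def)
  have "1/2 * I \<le> W \<and> 1/4 * W \<le> I"
  proof (cases "c \<le> mid")
    case True
    define \<theta> \<theta>' where "\<theta> = (mid - c) / (b - c)" and "\<theta>' = (mid - c) / (mid - a)"
    have \<theta>: "0 \<le> \<theta>" "\<theta> < 1" "1/2 \<le> 1 - \<theta>" "\<theta> * (b - c) = mid - c" using True c am h_width by (auto simp: \<theta>_def field_simps)
    have \<theta>': "0 \<le> \<theta>'" "\<theta>' < 1" "1/4 \<le> 1 - \<theta>'" "\<theta>' * (mid - a) = mid - c" using True c am h_width by (auto simp: \<theta>'_def field_simps)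
    have "(1 - \<theta>) * I \<le> W" unfolding I_def W_def
    proof (rule contraction_mass[OF H_slice H_slice H_nonneg \<theta>(1,2)])
      show "H x y \<le> H mid ((1 - \<theta>) * y + \<theta> * mb)" for y
        using G_right[OF c(1,2) \<theta>(1,2), of y] unfolding Hx Hm \<theta>(4) by simp
    qed
    moreover have "(1 - \<theta>') * W \<le> I" unfolding I_def W_def
    proof (rule contraction_mass[OF H_slice H_slice H_nonneg \<theta>'(1,2)])
      show "H mid y \<le> H x ((1 - \<theta>') * y + \<theta>' * ma)" for y
        using G_left[OF am \<theta>'(1,2), of y] unfolding Hx Hm \<theta>'(4) by simp
    qed
    ultimately show ?thesis using mult_right_mono[OF \<theta>(3) I0(1)] mult_right_mono[OF \<theta>'(3) I0(2)] by linarith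
  next
    case False
    define \<theta> \<theta>' where "\<theta> = (c - mid) / (c - a)" and "\<theta>' = (c - mid) / (b - mid)"
    have \<theta>: "0 \<le> \<theta>" "\<theta> < 1" "1/2 \<le> 1 - \<theta>" "\<theta> * (c - a) = c - mid" using False c am h_width by (auto simp: \<theta>_def field_simps)
    have \<theta>': "0 \<le> \<theta>'" "\<theta>' < 1" "1/4 \<le> 1 - \<theta>'" "\<theta>' * (b - mid) = c - mid" using False c am h_width by (auto simp: \<theta>'_def field_simps)
    have "(1 - \<theta>) * I \<le> W" unfolding I_def W_def
    proof (rule contraction_mass[OF H_slice H_slice H_nonneg \<theta>(1,2)])
      show "H x y \<le> H mid ((1 - \<theta>) * y + \<theta> * ma)" for y
        using G_left[OF c(1,2) \<theta>(1,2), of y] unfolding Hx Hm \<theta>(4) by simp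
    qed
    moreover have "(1 - \<theta>') * W \<le> I" unfolding I_def W_def
    proof (rule contraction_mass[OF H_slice H_slice H_nonneg \<theta>'(1,2)])
      show "H mid y \<le> H x ((1 - \<theta>') * y + \<theta>' * mb)" for y
        using G_right[OF am \<theta>'(1,2), of y] unfolding Hx Hm \<theta>'(4) by simp
    qed
    ultimately show ?thesis using mult_right_mono[OF \<theta>(3) I0(1)] mult_right_mono[OF \<theta>'(3) I0(2)] by linarith
  qed
  then show "(\<integral>y. (H x y)\<^sup>2 \<partial>lborel) \<le> 2 * W" "W \<le> 4 * (\<integral>y. (H x y)\<^sup>2 \<partial>lborel)" by (auto simp: I_def)
qed

lemma W_pos: "0 < W"
proof -
  obtain y0 where y0: "G mid y0 \<noteq> 0" using G_nontrivial by (auto simp: mid_def)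
  have cm: "clamp mid = mid" using h_width by (intro clamp_eq) auto
  have "H mid y0 \<noteq> 0" using y0 by (simp add: H_def cm)
  then have e: "0 < H mid y0" using H_nonneg[of mid y0] by simp
  obtain d where d: "0 < d" "\<And>y z. dist y z < d \<Longrightarrow> dist (H mid y) (H mid z) < H mid y0 / 2"
    by (rule compactly_supported_uniformly_continuous[OF H_slice[of mid], of "H mid y0 / 2"]) (use e that in auto)
  have "(H mid y0 / 2)\<^sup>2 * d = (\<integral>y. indicator {y0 .. y0 + d} y *\<^sub>R ((H mid y0 / 2)\<^sup>2) \<partial>lborel)"
    using d(1) by simp
  also have "(\<integral>y. indicator {y0 .. y0 + d} y *\<^sub>R ((H mid y0 / 2)\<^sup>2) \<partial>lborel) = (\<integral>y. indicator {y0 ..< y0 + d} y *\<^sub>R ((H mid y0 / 2)\<^sup>2) \<partial>lborel)"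
    using d(1) by simp
  also have "\<dots> \<le> W" unfolding W_def
  proof (rule integral_mono)
    show "integrable lborel (\<lambda>y. (H mid y)\<^sup>2)" by (rule compactly_supported_integrable[OF compactly_supported_power2[OF H_slice]])
    show "integrable lborel (\<lambda>y. indicator {y0 ..< y0 + d} y *\<^sub>R ((H mid y0 / 2)\<^sup>2))"
      by (rule integrable_scaleR_left) (use d(1) in \<open>auto intro!: integrable_real_indicator\<close>)
    fix y
    show "indicator {y0 ..< y0 + d} y *\<^sub>R ((H mid y0 / 2)\<^sup>2) \<le> (H mid y)\<^sup>2"
    proof (cases "y \<in> {y0 ..< y0 + d}")
      case True
      then have "dist (H mid y0) (H mid y) < H mid y0 / 2" by (intro d(2)) (auto simp: dist_real_def)
      then have "H mid y0 / 2 \<le> H mid y" unfolding dist_real_def by linarith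
      then show ?thesis using True e by (auto intro!: power_mono)
    qed simp
  qed
  finally have "(H mid y0 / 2)\<^sup>2 * d \<le> W" .
  moreover have "0 < (H mid y0 / 2)\<^sup>2 * d" using e d(1) by (intro mult_pos_pos) auto
  ultimately show ?thesis by linarith
qed

lemma slice_power2: "(\<integral>y. (u (x, y))\<^sup>2 \<partial>lborel) = (\<eta> x)\<^sup>2 * (\<integral>y. (H x y)\<^sup>2 \<partial>lborel)"
  by (simp add: u_def power_mult_distrib)

lemma mass_bound: "W * h ^ 3 \<le> 16 * N"
proof -
  have iu: "integrable lborel (\<lambda>p. (u p)\<^sup>2)" by (rule compactly_supported_integrable[OF compactly_supported_power2[OF u_compact]])
  have "(h\<^sup>2 / 4 * (W / 4)) * h = (\<integral>x. indicator {mid - h / 2 .. mid + h / 2} x *\<^sub>R (h\<^sup>2 / 4 * (W / 4)) \<partial>lborel)"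
    using h_width(1) by simp
  also have "\<dots> \<le> (\<integral>x. \<integral>y. (u (x, y))\<^sup>2 \<partial>lborel \<partial>lborel)"
  proof (rule integral_mono)
    show "integrable lborel (\<lambda>x. \<integral>y. (u (x, y))\<^sup>2 \<partial>lborel)" by (rule integral_lborel_prod(1)[OF iu])
    show "integrable lborel (\<lambda>x. indicator {mid - h / 2 .. mid + h / 2} x *\<^sub>R (h\<^sup>2 / 4 * (W / 4)))"
      by (rule integrable_scaleR_left) (use h_width in \<open>auto intro!: integrable_real_indicator\<close>)
    fix x
    show "indicator {mid - h / 2 .. mid + h / 2} x *\<^sub>R (h\<^sup>2 / 4 * (W / 4)) \<le> (\<integral>y. (u (x, y))\<^sup>2 \<partial>lborel)"
    proof (cases "x \<in> {mid - h / 2 .. mid + h / 2}")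
      case True
      then have "mid - h / 2 \<le> x" "x \<le> mid + h / 2" by auto
      then have "h / 2 \<le> h - \<bar>x - mid\<bar>" by linarith
      then have "h / 2 \<le> \<eta> x" unfolding \<eta>_def by (rule max.coboundedI2)
      then have "(h / 2)\<^sup>2 \<le> (\<eta> x)\<^sup>2" using h_width by (intro power_mono) auto
      then have "(h / 2)\<^sup>2 * (W / 4) \<le> (\<eta> x)\<^sup>2 * (\<integral>y. (H x y)\<^sup>2 \<partial>lborel)"
        using slice_mass(2)[of x] W_pos by (intro mult_mono) auto
      then show ?thesis using True by (simp add: slice_power2 power_divide)
    qed simp
  qed
  also have "\<dots> = N" unfolding N_def by (rule integral_lborel_prod(2)[OF iu])
  finally show ?thesis by (simp add: power2_eq_square power3_eq_cube mult_ac)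
qed

lemma N_pos: "0 < N" using mass_bound W_pos mult_pos_pos[OF W_pos zero_less_power[OF h_width(1), of 3]] by linarith

text \<open>
  On each section the trial function is a subsolution, so its vertical energy is at most
  \<open>\<integral> (M - V) u\<^sup>2\<close>.
\<close>

lemma vertical_energy:
  assumes \<epsilon>: "0 < \<epsilon>"
  shows "\<exists>r0>0. \<forall>r. 0 < r \<and> r < r0 \<longrightarrow> (\<integral>p. (u (p + r *\<^sub>R (0, 1)) - u p)\<^sup>2 \<partial>lborel) \<le> r\<^sup>2 * ((\<integral>p. (M - V p) * (u p)\<^sup>2 \<partial>lborel) + \<epsilon>)"
proof -
  define I where "I = (\<integral>p. u p \<partial>lborel)"
  have I0: "0 \<le> I" unfolding I_def by (intro integral_nonneg_AE) (auto simp: u_nonneg)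
  define \<omega> where "\<omega> = \<epsilon> / (I + 1)"
  have \<omega>: "0 < \<omega>" "\<omega> * I \<le> \<epsilon>" using I0 \<epsilon> by (auto simp: \<omega>_def field_simps)
  obtain d where d: "0 < d" "\<And>x z z'. \<bar>z - z'\<bar> < d \<Longrightarrow> \<bar>Z (x, z) - Z (x, z')\<bar> < \<omega>" using Z_modulus[OF \<omega>(1)] by blast
  have "(\<integral>p. (u (p + r *\<^sub>R (0, 1)) - u p)\<^sup>2 \<partial>lborel) \<le> r\<^sup>2 * ((\<integral>p. (M - V p) * (u p)\<^sup>2 \<partial>lborel) + \<epsilon>)" if r: "0 < r" "r < d" for r
  proof -
    have i1: "integrable lborel (\<lambda>p. (u (p + r *\<^sub>R (0, 1)) - u p)\<^sup>2)"
      by (intro compactly_supported_integrable compactly_supported_power2 compactly_supported_diff compactly_supported_shift u_compact)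
    have i2: "integrable lborel (\<lambda>p. - (Z p * u p))" and i3: "integrable lborel u"
      by (intro integrable_minus compactly_supported_integrable compactly_supported_mult_left Z_compact u_continuous u_compact)+
    have i2': "integrable lborel (\<lambda>p. - Z p * u p)" using i2 by simp
    have "(\<integral>p. (u (p + r *\<^sub>R (0, 1)) - u p)\<^sup>2 \<partial>lborel) = (\<integral>x. \<integral>y. (u (x, y + r) - u (x, y))\<^sup>2 \<partial>lborel \<partial>lborel)"
      using integral_lborel_prod(2)[OF i1] by simp
    also have "\<dots> \<le> (\<integral>x. r\<^sup>2 * ((\<integral>y. - Z (x, y) * u (x, y) \<partial>lborel) + \<omega> * (\<integral>y. u (x, y) \<partial>lborel)) \<partial>lborel)"
    proof (rule integral_mono)
      show "integrable lborel (\<lambda>x. \<integral>y. (u (x, y + r) - u (x, y))\<^sup>2 \<partial>lborel)" using integral_lborel_prod(1)[OF i1] by simp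
      show "integrable lborel (\<lambda>x. r\<^sup>2 * ((\<integral>y. - Z (x, y) * u (x, y) \<partial>lborel) + \<omega> * (\<integral>y. u (x, y) \<partial>lborel)))"
        by (intro integrable_mult_right Bochner_Integration.integrable_add integral_lborel_prod(1)[OF i2'] integral_lborel_prod(1)[OF i3])
      show "(\<integral>y. (u (x, y + r) - u (x, y))\<^sup>2 \<partial>lborel) \<le> r\<^sup>2 * ((\<integral>y. - Z (x, y) * u (x, y) \<partial>lborel) + \<omega> * (\<integral>y. u (x, y) \<partial>lborel))" for x
        by (rule translation_energy[OF u_slice u_nonneg Z_slice u_below \<omega>(1) d(2) r])
    qed
    also have "\<dots> = r\<^sup>2 * ((\<integral>p. - Z p * u p \<partial>lborel) + \<omega> * I)"
      using integral_lborel_prod[OF i2'] integral_lborel_prod[OF i3] by (simp add: I_def)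
    also have "\<dots> \<le> r\<^sup>2 * ((\<integral>p. - Z p * u p \<partial>lborel) + \<epsilon>)" using \<omega>(2) by (intro mult_left_mono) auto
    also have "(\<integral>p. - Z p * u p \<partial>lborel) = (\<integral>p. (M - V p) * (u p)\<^sup>2 \<partial>lborel)"
      by (rule Bochner_Integration.integral_cong) (auto simp: Z_def power2_eq_square algebra_simps)
    finally show ?thesis .
  qed
  then show ?thesis using d(1) by blast
qed

lemma squeeze_square: fixes lo t up :: real assumes "lo \<le> t" "t \<le> up" shows "t\<^sup>2 \<le> lo\<^sup>2 + up\<^sup>2"
proof (cases "0 \<le> t")
  case True
  then have "t\<^sup>2 \<le> up\<^sup>2" using assms by (intro power_mono) auto
  then show ?thesis by (simp add: add_increasing)
next
  case False
  then have "(- t)\<^sup>2 \<le> (- lo)\<^sup>2" using assms by (intro power_mono) auto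
  then show ?thesis by (simp add: add_increasing2)
qed

text \<open>
  By contraction towards \<open>mb\<close> and \<open>ma\<close>, the function at \<open>x + r\<close> lies between two vertical dilations of the function
  at \<open>x\<close>.
\<close>

lemma horizontal_difference:
  assumes x: "\<bar>x - mid\<bar> < h" and r: "0 < r" "r \<le> h / 4"
  defines "\<rho>1 \<equiv> 1 - r / (x + r - a)" and "\<rho>2 \<equiv> (b - x) / (b - x - r)"
  shows "(H (x + r) y - H x y)\<^sup>2 \<le> (H x y - H x (mb + \<rho>2 * (y - mb)))\<^sup>2 + (H x y - H x (ma + \<rho>1 * (y - ma)))\<^sup>2"
proof -
  have xx: "h < x - a" "h < b - x" using x h_width by (auto simp: abs_less_iff)
  have c1: "clamp x = x" using x h_width by (intro clamp_eq) auto
  have c2: "clamp (x + r) = x + r" using x r h_width by (intro clamp_eq) linarith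
  have lo: "H x (mb + \<rho>2 * (y - mb)) \<le> H (x + r) y"
  proof -
    define \<theta> where "\<theta> = r / (b - x)"
    have \<theta>: "0 \<le> \<theta>" "\<theta> < 1" "\<theta> * (b - x) = r" using xx r h_width by (auto simp: \<theta>_def field_simps)
    have bx: "b - x \<noteq> 0" "b - x - r \<noteq> 0" using xx r h_width by linarith+
    have "1 - \<theta> = (b - x - r) / (b - x)" using bx(1) by (simp add: \<theta>_def diff_divide_distrib)
    then have one: "(1 - \<theta>) * \<rho>2 = 1" using bx by (simp add: \<rho>2_def)
    have "(1 - \<theta>) * (mb + \<rho>2 * (y - mb)) + \<theta> * mb = ((1 - \<theta>) * \<rho>2) * (y - mb) + mb" by (simp add: algebra_simps)
    also have "\<dots> = y" unfolding one by simp
    finally have "(1 - \<theta>) * (mb + \<rho>2 * (y - mb)) + \<theta> * mb = y" .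
    then show ?thesis using G_right[OF _ _ \<theta>(1,2), of x "mb + \<rho>2 * (y - mb)"] xx h_width unfolding H_def c1 c2 \<theta>(3) by simp
  qed
  have up: "H (x + r) y \<le> H x (ma + \<rho>1 * (y - ma))"
  proof -
    define \<theta> where "\<theta> = r / (x + r - a)"
    have \<theta>: "0 \<le> \<theta>" "\<theta> < 1" "\<theta> * (x + r - a) = r" using xx r h_width by (auto simp: \<theta>_def field_simps)
    have r1: "\<rho>1 = 1 - \<theta>" by (simp add: \<rho>1_def \<theta>_def)
    have "(1 - \<theta>) * y + \<theta> * ma = ma + \<rho>1 * (y - ma)" unfolding r1 by (simp add: algebra_simps)
    then show ?thesis using G_left[OF _ _ \<theta>(1,2), of "x + r" y] xx r h_width unfolding H_def c1 c2 \<theta>(3) by simp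
  qed
  have "(H (x + r) y - H x y)\<^sup>2 \<le> (H x (mb + \<rho>2 * (y - mb)) - H x y)\<^sup>2 + (H x (ma + \<rho>1 * (y - ma)) - H x y)\<^sup>2"
    using lo up by (intro squeeze_square) auto
  then show ?thesis by (simp add: power2_commute)
qed

lemma dilation_ratios:
  assumes x: "\<bar>x - mid\<bar> < h" and r: "0 < r" "r \<le> h / 4" and \<rho>: "\<rho> = 1 - r / (x + r - a) \<or> \<rho> = (b - x) / (b - x - r)"
  shows "1/2 \<le> \<rho>" "\<rho> \<le> 2" "\<bar>\<rho> - 1\<bar> \<le> 2 * r / h" "\<bar>\<rho> - 1 / \<rho>\<bar> \<le> 6 * r / h"
proof -
  have xx: "h < x - a" "h < b - x" using x h_width by (auto simp: abs_less_iff)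
  have "\<bar>\<rho> - 1\<bar> \<le> 2 * r / h"
    using \<rho>
  proof
    assume e: "\<rho> = 1 - r / (x + r - a)"
    then have "\<bar>\<rho> - 1\<bar> = r / (x + r - a)" using xx r h_width by simp
    also have "\<dots> \<le> r / h" using xx r h_width by (intro divide_left_mono) auto
    also have "\<dots> \<le> 2 * r / h" using r h_width by (simp add: field_simps)
    finally show ?thesis .
  next
    assume e: "\<rho> = (b - x) / (b - x - r)"
    have "\<rho> - 1 = r / (b - x - r)" unfolding e using xx r h_width by (simp add: field_simps)
    then have "\<bar>\<rho> - 1\<bar> = r / (b - x - r)" using xx r h_width by simp
    also have "\<dots> \<le> r / (h / 2)" using xx r h_width by (intro divide_left_mono) auto
    finally show ?thesis by (simp add: mult.commute)
  qed
  then show "\<bar>\<rho> - 1\<bar> \<le> 2 * r / h" .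
  moreover have "2 * r / h \<le> 1 / 2" using r h_width by (simp add: field_simps)
  ultimately show \<rho>b: "1/2 \<le> \<rho>" "\<rho> \<le> 2" by (auto simp: abs_le_iff)
  have "\<rho> - 1 / \<rho> = (\<rho> - 1) * (1 + 1 / \<rho>)" using \<rho>b by (simp add: field_simps)
  then have "\<bar>\<rho> - 1 / \<rho>\<bar> = \<bar>\<rho> - 1\<bar> * (1 + 1 / \<rho>)" using \<rho>b by (simp add: abs_mult)
  also have "\<dots> \<le> (2 * r / h) * 3"
  proof (rule mult_mono)
    show "1 + 1 / \<rho> \<le> 3" using \<rho>b by (simp add: field_simps)
  qed (use \<open>\<bar>\<rho> - 1\<bar> \<le> 2 * r / h\<close> \<rho>b r h_width in auto)
  finally show "\<bar>\<rho> - 1 / \<rho>\<bar> \<le> 6 * r / h" by simp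
qed

text \<open>
  The potential term of the dilation energy is \<open>(M - V) (y - m)\<^sup>2 u\<^sup>2\<close>, which the weight assumption bounds
  by \<open>k u\<^sup>2\<close>.
\<close>

lemma slice_dilation:
  assumes x: "\<bar>x - mid\<bar> < h" and r: "0 < r" "r \<le> h / 4" and \<rho>: "\<rho> = 1 - r / (x + r - a) \<or> \<rho> = (b - x) / (b - x - r)"
    and m: "m \<in> {ma, mb}" and R: "\<And>z. z \<in> snd ` T \<Longrightarrow> \<bar>z - m\<bar> \<le> R" "R * (6 * r / h) < d" "0 \<le> R"
    and \<omega>: "0 < \<omega>" and d: "\<And>x z z'. \<bar>z - z'\<bar> < d \<Longrightarrow> \<bar>Z (x, z) - Z (x, z')\<bar> < \<omega>"
  shows "(\<integral>y. (u (x, y) - u (x, m + \<rho> * (y - m)))\<^sup>2 \<partial>lborel)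
    \<le> 12 * r\<^sup>2 / h\<^sup>2 * ((1 + k) * (\<integral>y. (u (x, y))\<^sup>2 \<partial>lborel) + \<omega> * (\<integral>y. (y - m)\<^sup>2 * u (x, y) \<partial>lborel))"
proof -
  note \<rho>b = dilation_ratios[OF x r \<rho>]
  have "(\<integral>y. (u (x, y) - u (x, m + \<rho> * (y - m)))\<^sup>2 \<partial>lborel) \<le> 3 * (\<rho> - 1)\<^sup>2 *
    ((\<integral>y. (u (x, y))\<^sup>2 \<partial>lborel) + (\<integral>y. - Z (x, y) * (y - m)\<^sup>2 * u (x, y) \<partial>lborel) + \<omega> * (\<integral>y. (y - m)\<^sup>2 * u (x, y) \<partial>lborel))"
  proof (rule dilation_energy[OF u_slice u_nonneg Z_slice u_below \<omega> d \<rho>b(1,2)])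
    show "\<bar>z - m\<bar> \<le> R" if "u (x, z) \<noteq> 0" for z
      using H_support[of z x] that by (intro R(1)) (auto simp: u_def)
    have "R * \<bar>\<rho> - 1 / \<rho>\<bar> \<le> R * (6 * r / h)" by (rule mult_left_mono[OF \<rho>b(4) R(3)])
    then show "R * \<bar>\<rho> - 1 / \<rho>\<bar> < d" using R(2) by linarith
  qed
  also have "\<dots> \<le> 3 * (\<rho> - 1)\<^sup>2 * ((1 + k) * (\<integral>y. (u (x, y))\<^sup>2 \<partial>lborel) + \<omega> * (\<integral>y. (y - m)\<^sup>2 * u (x, y) \<partial>lborel))"
  proof (rule mult_left_mono)
    have "(\<integral>y. - Z (x, y) * (y - m)\<^sup>2 * u (x, y) \<partial>lborel) \<le> (\<integral>y. k * (u (x, y))\<^sup>2 \<partial>lborel)"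
    proof (rule integral_mono)
      have "integrable lborel (\<lambda>y. u (x, y) * (- Z (x, y) * (y - m)\<^sup>2))"
        by (intro compactly_supported_integrable compactly_supported_mult_left u_slice continuous_intros Z_slice)
      then show "integrable lborel (\<lambda>y. - Z (x, y) * (y - m)\<^sup>2 * u (x, y))" by (simp add: mult_ac)
      show "integrable lborel (\<lambda>y. k * (u (x, y))\<^sup>2)"
        by (intro integrable_mult_right compactly_supported_integrable compactly_supported_power2 u_slice)
      fix y
      show "- Z (x, y) * (y - m)\<^sup>2 * u (x, y) \<le> k * (u (x, y))\<^sup>2"
      proof (cases "u (x, y) = 0")
        case False
        then have "(x, y) \<in> \<Omega>" using u_support[of "(x, y)"] K_compact_subset(2) by auto
        then have "(M - V (x, y)) * (y - m)\<^sup>2 \<le> k" by (rule weight[OF _ m])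
        then have "(M - V (x, y)) * (y - m)\<^sup>2 * (u (x, y))\<^sup>2 \<le> k * (u (x, y))\<^sup>2" by (rule mult_right_mono) simp
        then show ?thesis by (simp add: Z_def power2_eq_square algebra_simps)
      qed simp
    qed
    then show "(\<integral>y. (u (x, y))\<^sup>2 \<partial>lborel) + (\<integral>y. - Z (x, y) * (y - m)\<^sup>2 * u (x, y) \<partial>lborel) + \<omega> * (\<integral>y. (y - m)\<^sup>2 * u (x, y) \<partial>lborel)
      \<le> (1 + k) * (\<integral>y. (u (x, y))\<^sup>2 \<partial>lborel) + \<omega> * (\<integral>y. (y - m)\<^sup>2 * u (x, y) \<partial>lborel)"
      by (simp add: algebra_simps)
  qed simp
  also have "\<dots> \<le> 3 * (2 * r / h)\<^sup>2 * ((1 + k) * (\<integral>y. (u (x, y))\<^sup>2 \<partial>lborel) + \<omega> * (\<integral>y. (y - m)\<^sup>2 * u (x, y) \<partial>lborel))"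
  proof (rule mult_right_mono)
    have "\<bar>\<rho> - 1\<bar>\<^sup>2 \<le> (2 * r / h)\<^sup>2" by (rule power_mono[OF \<rho>b(3)]) simp
    then show "3 * (\<rho> - 1)\<^sup>2 \<le> 3 * (2 * r / h)\<^sup>2" by simp
    show "0 \<le> (1 + k) * (\<integral>y. (u (x, y))\<^sup>2 \<partial>lborel) + \<omega> * (\<integral>y. (y - m)\<^sup>2 * u (x, y) \<partial>lborel)"
      using k \<omega> by (intro add_nonneg_nonneg mult_nonneg_nonneg integral_nonneg_AE AE_I2 u_nonneg) auto
  qed
  also have "3 * (2 * r / h)\<^sup>2 = 12 * r\<^sup>2 / h\<^sup>2" by (simp add: power_divide power_mult_distrib)
  finally show ?thesis .
qed


text \<open>
  The product rule for \<open>u = \<eta> H\<close>: the difference of the cutoff is at most \<open>r\<close> and is supported near the middle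
  of the interval, and the difference of \<open>H\<close> is controlled by two dilations.
\<close>

lemma horizontal_slice:
  assumes r: "0 < r" "r \<le> h / 4"
    and R: "\<And>z m. z \<in> snd ` T \<Longrightarrow> m \<in> {ma, mb} \<Longrightarrow> \<bar>z - m\<bar> \<le> R" "R * (6 * r / h) < d" "0 \<le> R"
    and \<omega>: "0 < \<omega>" and d: "\<And>x z z'. \<bar>z - z'\<bar> < d \<Longrightarrow> \<bar>Z (x, z) - Z (x, z')\<bar> < \<omega>"
  shows "(\<integral>y. (u (x + r, y) - u (x, y))\<^sup>2 \<partial>lborel) \<le> indicator {mid - 2 * h .. mid + 2 * h} x *\<^sub>R (4 * r\<^sup>2 * W)
    + 24 * r\<^sup>2 / h\<^sup>2 * (2 * (1 + k) * (\<integral>y. (u (x, y))\<^sup>2 \<partial>lborel)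
        + \<omega> * ((\<integral>y. (y - ma)\<^sup>2 * u (x, y) \<partial>lborel) + (\<integral>y. (y - mb)\<^sup>2 * u (x, y) \<partial>lborel)))"
proof -
  let ?w = "\<integral>y. (u (x, y))\<^sup>2 \<partial>lborel" and ?q = "\<lambda>m. \<integral>y. (y - m)\<^sup>2 * u (x, y) \<partial>lborel"
  let ?I = "\<integral>y. (H (x + r) y)\<^sup>2 \<partial>lborel" and ?e = "\<eta> (x + r) - \<eta> x"
  have iH: "integrable lborel (\<lambda>y. (H x' y)\<^sup>2)" for x'
    by (rule compactly_supported_integrable[OF compactly_supported_power2[OF H_slice]])
  have iL: "integrable lborel (\<lambda>y. (u (x + r, y) - u (x, y))\<^sup>2)"
    by (intro compactly_supported_integrable compactly_supported_power2 compactly_supported_diff u_slice)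
  have q0: "0 \<le> ?w" "0 \<le> ?q m" for m by (intro integral_nonneg_AE AE_I2 mult_nonneg_nonneg u_nonneg; simp)+
  have I2: "?e\<^sup>2 * ?I \<le> indicator {mid - 2 * h .. mid + 2 * h} x *\<^sub>R (2 * r\<^sup>2 * W)"
  proof (cases "x \<in> {mid - 2 * h .. mid + 2 * h}")
    case True
    have "\<bar>?e\<bar>\<^sup>2 \<le> r\<^sup>2" using \<eta>_diff[of "x + r" x] r by (intro power_mono) auto
    then have "?e\<^sup>2 * ?I \<le> r\<^sup>2 * (2 * W)" using slice_mass(1)[of "x + r"] by (intro mult_mono) auto
    then show ?thesis using True by simp
  next
    case False
    then consider "x < mid - 2 * h" | "mid + 2 * h < x" by fastforce
    then have "\<not> \<bar>x - mid\<bar> < h \<and> \<not> \<bar>x + r - mid\<bar> < h"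
    proof cases
      case 1
      then have "h \<le> - (x - mid)" "h \<le> - (x + r - mid)" using r h_width(1) by linarith+
      then show ?thesis by linarith
    next
      case 2
      then have "h \<le> x - mid" "h \<le> x + r - mid" using r h_width(1) by linarith+
      then show ?thesis by linarith
    qed
    then have "\<eta> x = 0" "\<eta> (x + r) = 0" using \<eta>_pos by blast+
    then show ?thesis using less_imp_le[OF W_pos] by simp
  qed
  show ?thesis
  proof (cases "\<bar>x - mid\<bar> < h")
    case False
    then have x0: "\<eta> x = 0" using \<eta>_pos by blast
    have "(\<integral>y. (u (x + r, y) - u (x, y))\<^sup>2 \<partial>lborel) = ?e\<^sup>2 * ?I"
      by (simp add: u_def x0 power_mult_distrib)
    also have "\<dots> \<le> 2 * (?e\<^sup>2 * ?I)" by simp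
    also have "\<dots> \<le> indicator {mid - 2 * h .. mid + 2 * h} x *\<^sub>R (4 * r\<^sup>2 * W)" using I2 by (simp add: mult.commute)
    finally show ?thesis using q0 \<omega> k by (simp add: add_increasing2)
  next
    case True
    define \<rho>1 \<rho>2 where "\<rho>1 = 1 - r / (x + r - a)" and "\<rho>2 = (b - x) / (b - x - r)"
    let ?D = "\<lambda>\<rho> m y. (u (x, y) - u (x, m + \<rho> * (y - m)))\<^sup>2"
    have iD: "integrable lborel (?D \<rho> m)" if "\<rho> = \<rho>1 \<or> \<rho> = \<rho>2" for \<rho> m
    proof -
      have "\<rho> \<noteq> 0" using dilation_ratios(1)[OF True r, of \<rho>] that by (auto simp: \<rho>1_def \<rho>2_def)
      then show ?thesis
        by (intro compactly_supported_integrable compactly_supported_power2 compactly_supported_diff u_slice compactly_supported_dilation)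
    qed
    have "(\<integral>y. (u (x + r, y) - u (x, y))\<^sup>2 \<partial>lborel) \<le> (\<integral>y. 2 * ?e\<^sup>2 * (H (x + r) y)\<^sup>2 + 2 * (?D \<rho>2 mb y + ?D \<rho>1 ma y) \<partial>lborel)"
    proof (rule integral_mono[OF iL])
      show "integrable lborel (\<lambda>y. 2 * ?e\<^sup>2 * (H (x + r) y)\<^sup>2 + 2 * (?D \<rho>2 mb y + ?D \<rho>1 ma y))"
        by (intro Bochner_Integration.integrable_add integrable_mult_right iH iD) auto
      fix y
      let ?s = "?e * H (x + r) y" and ?t = "\<eta> x * (H (x + r) y - H x y)"
      have "u (x + r, y) - u (x, y) = ?s + ?t" by (simp add: u_def algebra_simps)
      then have "(u (x + r, y) - u (x, y))\<^sup>2 \<le> 2 * ?s\<^sup>2 + 2 * ?t\<^sup>2"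
        using sum_squares_ge_zero[of "?s - ?t" 0] by (simp add: power2_sum power2_diff power2_eq_square[symmetric])
      moreover have "?t\<^sup>2 \<le> ?D \<rho>2 mb y + ?D \<rho>1 ma y"
      proof -
        have "?t\<^sup>2 = (\<eta> x)\<^sup>2 * (H (x + r) y - H x y)\<^sup>2" by (simp add: power_mult_distrib)
        also have "\<dots> \<le> (\<eta> x)\<^sup>2 * ((H x y - H x (mb + \<rho>2 * (y - mb)))\<^sup>2 + (H x y - H x (ma + \<rho>1 * (y - ma)))\<^sup>2)"
          unfolding \<rho>1_def \<rho>2_def by (intro mult_left_mono horizontal_difference[OF True r]) simp
        also have "\<dots> = ?D \<rho>2 mb y + ?D \<rho>1 ma y"
          by (simp add: u_def distrib_left power_mult_distrib[symmetric] right_diff_distrib)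
        finally show ?thesis .
      qed
      ultimately show "(u (x + r, y) - u (x, y))\<^sup>2 \<le> 2 * ?e\<^sup>2 * (H (x + r) y)\<^sup>2 + 2 * (?D \<rho>2 mb y + ?D \<rho>1 ma y)"
        by (simp add: power_mult_distrib)
    qed
    also have "\<dots> = 2 * (?e\<^sup>2 * ?I) + 2 * ((\<integral>y. ?D \<rho>2 mb y \<partial>lborel) + (\<integral>y. ?D \<rho>1 ma y \<partial>lborel))"
      using iH[of "x + r"] iD[of \<rho>2 mb] iD[of \<rho>1 ma] by simp
    also have "\<dots> \<le> 2 * (indicator {mid - 2 * h .. mid + 2 * h} x *\<^sub>R (2 * r\<^sup>2 * W))
      + 2 * (12 * r\<^sup>2 / h\<^sup>2 * ((1 + k) * ?w + \<omega> * ?q mb) + 12 * r\<^sup>2 / h\<^sup>2 * ((1 + k) * ?w + \<omega> * ?q ma))"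
    proof (intro add_mono mult_left_mono I2)
      show "(\<integral>y. ?D \<rho>2 mb y \<partial>lborel) \<le> 12 * r\<^sup>2 / h\<^sup>2 * ((1 + k) * ?w + \<omega> * ?q mb)"
        by (rule slice_dilation[OF True r _ _ _ R(2,3) \<omega> d]) (auto simp: \<rho>2_def R(1))
      show "(\<integral>y. ?D \<rho>1 ma y \<partial>lborel) \<le> 12 * r\<^sup>2 / h\<^sup>2 * ((1 + k) * ?w + \<omega> * ?q ma)"
        by (rule slice_dilation[OF True r _ _ _ R(2,3) \<omega> d]) (auto simp: \<rho>1_def R(1))
    qed auto
    also have "\<dots> = indicator {mid - 2 * h .. mid + 2 * h} x *\<^sub>R (4 * r\<^sup>2 * W) + 24 * r\<^sup>2 / h\<^sup>2 * (2 * (1 + k) * ?w + \<omega> * (?q ma + ?q mb))"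
    proof -
      have "2 * (c * (A + \<omega> * p) + c * (A + \<omega> * p')) = 2 * c * (2 * A + \<omega> * (p' + p))" for c A p p' :: real by (simp add: algebra_simps)
      from this[of "12 * r\<^sup>2 / h\<^sup>2" "(1 + k) * ?w" "?q mb" "?q ma"] show ?thesis by simp
    qed
    finally show ?thesis .
  qed
qed

lemma horizontal_energy:
  assumes \<epsilon>: "0 < \<epsilon>"
  shows "\<exists>r0>0. \<forall>r. 0 < r \<and> r < r0 \<longrightarrow> (\<integral>p. (u (p + r *\<^sub>R (1, 0)) - u p)\<^sup>2 \<partial>lborel) \<le> r\<^sup>2 * ((304 + 48 * k) / h\<^sup>2 * N + \<epsilon>)"
proof -
  define q where "q m = (\<integral>p. (snd p - m)\<^sup>2 * u p \<partial>lborel)" for m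
  have iq: "integrable lborel (\<lambda>p. (snd p - m)\<^sup>2 * u p)" for m
  proof -
    have "integrable lborel (\<lambda>p. u p * (snd p - m)\<^sup>2)"
      by (intro compactly_supported_integrable compactly_supported_mult_left u_compact continuous_intros)
    then show ?thesis by (simp add: mult.commute)
  qed
  have q0: "0 \<le> q m" for m unfolding q_def by (intro integral_nonneg_AE AE_I2 mult_nonneg_nonneg u_nonneg) simp
  define Q where "Q = q ma + q mb"
  have Q0: "0 \<le> Q" using q0 by (simp add: Q_def)
  define \<omega> where "\<omega> = \<epsilon> * h\<^sup>2 / (24 * (Q + 1))"
  have \<omega>: "0 < \<omega>" using \<epsilon> h_width(1) Q0 by (simp add: \<omega>_def)
  have \<omega>Q: "24 / h\<^sup>2 * (\<omega> * Q) \<le> \<epsilon>"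
  proof -
    have "24 / h\<^sup>2 * (\<omega> * Q) = \<epsilon> * (Q / (Q + 1))" using h_width(1) Q0 by (simp add: \<omega>_def field_simps)
    also have "\<dots> \<le> \<epsilon> * 1" using \<epsilon> Q0 by (intro mult_left_mono) auto
    finally show ?thesis by simp
  qed
  obtain d where d: "0 < d" "\<And>x z z'. \<bar>z - z'\<bar> < d \<Longrightarrow> \<bar>Z (x, z) - Z (x, z')\<bar> < \<omega>" using Z_modulus[OF \<omega>] by blast
  obtain B where B: "\<And>z. z \<in> snd ` T \<Longrightarrow> \<bar>z\<bar> \<le> B" using compact_imp_bounded[OF compact_snd_T] unfolding bounded_real by blast
  define R where "R = \<bar>B\<bar> + \<bar>ma\<bar> + \<bar>mb\<bar> + 1"
  have R: "0 < R" "\<bar>z - m\<bar> \<le> R" if "z \<in> snd ` T" "m \<in> {ma, mb}" for z m using B[OF that(1)] that(2) by (auto simp: R_def)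
  have R0: "0 < R" by (simp add: R_def)
  define r0 where "r0 = min (h / 4) (d * h / (6 * R))"
  have r0: "0 < r0" using h_width(1) d(1) R0 by (simp add: r0_def)
  have iu: "integrable lborel (\<lambda>p. (u p)\<^sup>2)" by (rule compactly_supported_integrable[OF compactly_supported_power2[OF u_compact]])
  have "(\<integral>p. (u (p + r *\<^sub>R (1, 0)) - u p)\<^sup>2 \<partial>lborel) \<le> r\<^sup>2 * ((304 + 48 * k) / h\<^sup>2 * N + \<epsilon>)" if r: "0 < r" "r < r0" for r
  proof -
    have r1: "r \<le> h / 4" "r < d * h / (6 * R)" using r by (auto simp: r0_def)
    have r2: "R * (6 * r / h) < d" using r1(2) R0 h_width(1) by (simp add: field_simps)
    have i1: "integrable lborel (\<lambda>p. (u (p + r *\<^sub>R (1, 0)) - u p)\<^sup>2)"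
      by (intro compactly_supported_integrable compactly_supported_power2 compactly_supported_diff compactly_supported_shift u_compact)
    have ind: "integrable lborel (\<lambda>x. indicator {mid - 2 * h .. mid + 2 * h} x *\<^sub>R (4 * r\<^sup>2 * W))"
      by (rule integrable_scaleR_left) (use h_width in \<open>auto intro!: integrable_real_indicator\<close>)
    have iqs: "integrable lborel (\<lambda>x. \<integral>y. (y - m)\<^sup>2 * u (x, y) \<partial>lborel)" "(\<integral>x. \<integral>y. (y - m)\<^sup>2 * u (x, y) \<partial>lborel \<partial>lborel) = q m" for m
      using integral_lborel_prod[OF iq[of m]] by (auto simp: q_def)
    note ius = integral_lborel_prod[OF iu, folded N_def]
    have "(\<integral>p. (u (p + r *\<^sub>R (1, 0)) - u p)\<^sup>2 \<partial>lborel) = (\<integral>x. \<integral>y. (u (x + r, y) - u (x, y))\<^sup>2 \<partial>lborel \<partial>lborel)"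
      using integral_lborel_prod(2)[OF i1] by simp
    also have "\<dots> \<le> (\<integral>x. indicator {mid - 2 * h .. mid + 2 * h} x *\<^sub>R (4 * r\<^sup>2 * W)
      + 24 * r\<^sup>2 / h\<^sup>2 * (2 * (1 + k) * (\<integral>y. (u (x, y))\<^sup>2 \<partial>lborel)
        + \<omega> * ((\<integral>y. (y - ma)\<^sup>2 * u (x, y) \<partial>lborel) + (\<integral>y. (y - mb)\<^sup>2 * u (x, y) \<partial>lborel))) \<partial>lborel)"
    proof (rule integral_mono)
      show "integrable lborel (\<lambda>x. \<integral>y. (u (x + r, y) - u (x, y))\<^sup>2 \<partial>lborel)" using integral_lborel_prod(1)[OF i1] by simp
    qed (intro Bochner_Integration.integrable_add integrable_mult_right ind iqs ius horizontal_slice[OF r(1) r1(1) R(2) r2 _ \<omega> d(2)] less_imp_le[OF R0] | assumption)+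
    also have "\<dots> = 4 * r\<^sup>2 * W * (4 * h) + 24 * r\<^sup>2 / h\<^sup>2 * (2 * (1 + k) * N + \<omega> * Q)"
    proof -
      have ii: "integrable lborel (indicat_real {mid - 2 * h .. mid + 2 * h})"
        by (rule integrable_real_indicator) (use h_width(1) in auto)
      have "(\<integral>x. indicat_real {mid - 2 * h .. mid + 2 * h} x \<partial>lborel) = 4 * h" using h_width(1) by simp
      then have A: "(\<integral>x. indicator {mid - 2 * h .. mid + 2 * h} x *\<^sub>R (4 * r\<^sup>2 * W) \<partial>lborel) = 4 * r\<^sup>2 * W * (4 * h)"
        using integral_scaleR_left[OF ii, of "4 * r\<^sup>2 * W"] by (simp add: mult.commute)
      have i3: "integrable lborel (\<lambda>x. 24 * r\<^sup>2 / h\<^sup>2 * (2 * (1 + k) * (\<integral>y. (u (x, y))\<^sup>2 \<partial>lborel)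
          + \<omega> * ((\<integral>y. (y - ma)\<^sup>2 * u (x, y) \<partial>lborel) + (\<integral>y. (y - mb)\<^sup>2 * u (x, y) \<partial>lborel))))"
        by (intro Bochner_Integration.integrable_add integrable_mult_right iqs(1) ius(1))
      have B: "(\<integral>x. 24 * r\<^sup>2 / h\<^sup>2 * (2 * (1 + k) * (\<integral>y. (u (x, y))\<^sup>2 \<partial>lborel)
          + \<omega> * ((\<integral>y. (y - ma)\<^sup>2 * u (x, y) \<partial>lborel) + (\<integral>y. (y - mb)\<^sup>2 * u (x, y) \<partial>lborel))) \<partial>lborel)
          = 24 * r\<^sup>2 / h\<^sup>2 * (2 * (1 + k) * N + \<omega> * Q)"
        using iqs(1)[of ma] iqs(1)[of mb] ius(1) by (simp add: iqs(2) ius(2) Q_def)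
      show ?thesis unfolding Bochner_Integration.integral_add[OF ind i3] A B ..
    qed
    also have "\<dots> = r\<^sup>2 * (16 * (W * h) + 48 * (1 + k) * N / h\<^sup>2 + 24 / h\<^sup>2 * (\<omega> * Q))" by (simp add: algebra_simps add_divide_distrib)
    also have "\<dots> \<le> r\<^sup>2 * (16 * (16 * N / h\<^sup>2) + 48 * (1 + k) * N / h\<^sup>2 + \<epsilon>)"
    proof -
      have "W * h \<le> 16 * N / h\<^sup>2" using mass_bound h_width(1) by (simp add: field_simps power2_eq_square power3_eq_cube)
      then show ?thesis using \<omega>Q by (intro mult_left_mono add_mono) auto
    qed
    also have "16 * (16 * N / h\<^sup>2) + 48 * (1 + k) * N / h\<^sup>2 = (304 + 48 * k) / h\<^sup>2 * N" by (simp add: add_divide_distrib algebra_simps)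
    finally show ?thesis .
  qed
  then show ?thesis using r0 by blast
qed

text \<open>
  The bound for the vertical energy and the potential energy add up to \<open>M\<close> times the mass, so only the
  horizontal energy remains.
\<close>

lemma ground_energy_bound: "ground_energy \<Omega> V \<le> M + (4864 + 768 * k) / (b - a)\<^sup>2"
proof -
  define E where "E i = (if i = (1, 0) then (304 + 48 * k) / h\<^sup>2 * N else (\<integral>p. (M - V p) * (u p)\<^sup>2 \<partial>lborel))" for i :: "real \<times> real"
  have basis: "(Basis :: (real \<times> real) set) = {(1, 0), (0, 1)}" by (auto simp: Basis_prod_def)
  have "ground_energy \<Omega> V * (\<integral>p. (u p)\<^sup>2 \<partial>lborel) \<le> (\<Sum>i\<in>Basis. E i) + (\<integral>p. V p * (u p)\<^sup>2 \<partial>plane.M)"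
  proof (rule plane.trial_function[OF u_continuous K_compact_subset u_support])
    fix i :: "real \<times> real" and \<epsilon> :: real assume "i \<in> Basis" and \<epsilon>: "0 < \<epsilon>"
    then have "i = (1, 0) \<or> i = (0, 1)" by (simp add: basis)
    then show "\<exists>r0>0. \<forall>r. 0 < r \<and> r < r0 \<longrightarrow> (\<integral>p. (u (p + r *\<^sub>R i) - u p)\<^sup>2 \<partial>lborel) \<le> r\<^sup>2 * (E i + \<epsilon>)"
    proof
      assume i: "i = (1, 0)" show ?thesis using horizontal_energy[OF \<epsilon>] by (simp add: i E_def)
    next
      assume i: "i = (0, 1)" show ?thesis using vertical_energy[OF \<epsilon>] by (simp add: i E_def)
    qed
  qed
  also have "(\<Sum>i\<in>Basis. E i) = (304 + 48 * k) / h\<^sup>2 * N + (\<integral>p. (M - V p) * (u p)\<^sup>2 \<partial>lborel)" by (simp add: basis E_def)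
  also have "(\<integral>p. V p * (u p)\<^sup>2 \<partial>plane.M) = (\<integral>p. indicator \<Omega> p * V p * (u p)\<^sup>2 \<partial>lborel)"
    unfolding plane.M_def using plane.U_sets by (subst integral_restrict_space) (auto simp: mult.assoc)
  also have "(304 + 48 * k) / h\<^sup>2 * N + (\<integral>p. (M - V p) * (u p)\<^sup>2 \<partial>lborel) + (\<integral>p. indicator \<Omega> p * V p * (u p)\<^sup>2 \<partial>lborel)
      = (304 + 48 * k) / h\<^sup>2 * N + M * N"
  proof -
    have u2: "continuous_on UNIV (\<lambda>p. (u p)\<^sup>2)" by (rule continuous_on_power[OF u_continuous])
    have i1: "integrable lborel (\<lambda>p. indicator \<Omega> p * V p * (u p)\<^sup>2)"
      by (rule compactly_supported_integrable[OF compactly_supported_mult_potential[OF open_\<Omega> V_continuous u2 K_compact_subset]]) (simp add: u_support)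
    have iu: "integrable lborel (\<lambda>p. (u p)\<^sup>2)" by (rule compactly_supported_integrable[OF compactly_supported_power2[OF u_compact]])
    have "(\<integral>p. (M - V p) * (u p)\<^sup>2 \<partial>lborel) = (\<integral>p. M * (u p)\<^sup>2 - indicator \<Omega> p * V p * (u p)\<^sup>2 \<partial>lborel)"
    proof (rule Bochner_Integration.integral_cong)
      show "(M - V p) * (u p)\<^sup>2 = M * (u p)\<^sup>2 - indicator \<Omega> p * V p * (u p)\<^sup>2" for p
        using u_support[of p] K_compact_subset(2) by (cases "p \<in> \<Omega>") (auto simp: algebra_simps)
    qed simp
    then show ?thesis using i1 iu by (simp add: N_def)
  qed
  finally have "ground_energy \<Omega> V * N \<le> ((304 + 48 * k) / h\<^sup>2 + M) * N" by (simp add: N_def distrib_right)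
  then have "ground_energy \<Omega> V \<le> (304 + 48 * k) / h\<^sup>2 + M" using N_pos by (simp add: mult_le_cancel_right)
  also have "(304 + 48 * k) / h\<^sup>2 = (4864 + 768 * k) / (b - a)\<^sup>2" by (simp add: h_def power_divide algebra_simps add_divide_distrib)
  finally show ?thesis by simp
qed

end

section \<open>An upper bound from two sections\<close>

lemma convex_on_affine_line:
  fixes V :: "real \<times> real \<Rightarrow> real"
  assumes V: "convex_on \<Omega> V" and S: "convex S" "\<And>y. y \<in> S \<Longrightarrow> (x, y) \<in> \<Omega>"
  shows "convex_on S (\<lambda>y. V (x, y) - M)"
proof (rule convex_onI[OF _ S(1)])
  fix t y z :: real assume t: "0 < t" "t < 1" and yz: "y \<in> S" "z \<in> S"
  have "V ((1 - t) *\<^sub>R (x, y) + t *\<^sub>R (x, z)) \<le> (1 - t) * V (x, y) + t * V (x, z)"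
    using t yz by (intro convex_onD[OF V] S) auto
  moreover have "(1 - t) *\<^sub>R (x, y) + t *\<^sub>R (x, z) = (x, (1 - t) *\<^sub>R y + t *\<^sub>R z)" by (simp add: algebra_simps)
  ultimately show "V (x, (1 - t) *\<^sub>R y + t *\<^sub>R z) - M \<le> (1 - t) * (V (x, y) - M) + t * (V (x, z) - M)"
    by (simp add: algebra_simps)
qed

context planar_schroedinger
begin

text \<open>
  A test function with energy below \<open>M\<close> lives on a compact interval inside the section, where \<open>V\<close> is
  continuous; the profile is found there.  At the maximum of the profile the equation gives \<open>V \<le> M\<close>.
\<close>

lemma section_profile:
  assumes O: "convex \<Omega>" and V: "convex_on \<Omega> V" and x: "x \<in> fst ` \<Omega>" and M: "mu x < M"
  shows "\<exists>\<psi> \<psi>' l r m. profile (\<lambda>y. V (x, y) - M) \<psi> \<psi>' l r m \<and> {x} \<times> {l..r} \<subseteq> \<Omega> \<and> V (x, m) \<le> M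
    \<and> concave_on {l<..<r} (\<lambda>y. ln (\<psi> y))"
proof -
  interpret S: schroedinger "cross_section \<Omega> x" "\<lambda>y. V (x, y)" by (rule section_schroedinger[OF x])
  obtain \<phi> G where C: "C1_compact (cross_section \<Omega> x) \<phi> G" and N: "(\<integral>y. (\<phi> y)\<^sup>2 \<partial>lborel) = 1" and E: "S.energy \<phi> G < M"
    using S.ground_energy_approx[of M] M unfolding mu_eq[OF x] by blast
  obtain K where K: "compact K" "K \<subseteq> cross_section \<Omega> x" "\<And>p. p \<notin> K \<Longrightarrow> \<phi> p = 0" "\<And>p. p \<notin> K \<Longrightarrow> G p = 0"
    by (rule C1_compactD[OF C]) (rule that)
  note cs = C1_compact_continuous[OF C]
  have Kn: "K \<noteq> {}"
  proof
    assume "K = {}"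
    then have "(\<lambda>y. (\<phi> y)\<^sup>2) = (\<lambda>y. 0)" using K(3) by auto
    then show False using N by simp
  qed
  obtain k1 where k1: "k1 \<in> K" "\<And>y. y \<in> K \<Longrightarrow> k1 \<le> y" using compact_attains_inf[OF K(1) Kn] by blast
  obtain k2 where k2: "k2 \<in> K" "\<And>y. y \<in> K \<Longrightarrow> y \<le> k2" using compact_attains_sup[OF K(1) Kn] by blast
  have sec: "convex (cross_section \<Omega> x)"
    unfolding convex_alt cross_section_def
  proof (intro ballI allI impI CollectI)
    fix y z u :: real assume "y \<in> {y. (x, y) \<in> \<Omega>}" "z \<in> {y. (x, y) \<in> \<Omega>}" "0 \<le> u \<and> u \<le> 1"
    then have "(1 - u) *\<^sub>R (x, y) + u *\<^sub>R (x, z) \<in> \<Omega>" using O unfolding convex_alt by blast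
    then show "(x, (1 - u) *\<^sub>R y + u *\<^sub>R z) \<in> \<Omega>" by (simp add: algebra_simps)
  qed
  obtain e1 where e1: "0 < e1" "cball k1 e1 \<subseteq> cross_section \<Omega> x" using open_contains_cball[THEN iffD1, OF open_cross_section, of x] k1(1) K(2) by blast
  obtain e2 where e2: "0 < e2" "cball k2 e2 \<subseteq> cross_section \<Omega> x" using open_contains_cball[THEN iffD1, OF open_cross_section, of x] k2(1) K(2) by blast
  define l \<beta> where "l = k1 - e1" and "\<beta> = k2 + e2"
  have "k1 \<le> k2" using k1 k2 by blast
  then have l\<beta>: "l < \<beta>" using e1 e2 by (simp add: l_def \<beta>_def)
  have "l \<in> cball k1 e1" "\<beta> \<in> cball k2 e2" using e1(1) e2(1) by (auto simp: l_def \<beta>_def dist_real_def)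
  then have "l \<in> cross_section \<Omega> x" "\<beta> \<in> cross_section \<Omega> x" using e1(2) e2(2) by blast+
  then have "closed_segment l \<beta> \<subseteq> cross_section \<Omega> x" using sec by (rule closed_segment_subset)
  then have sub: "{l..\<beta>} \<subseteq> cross_section \<Omega> x" using l\<beta> by (simp add: closed_segment_eq_real_ivl)
  have KI: "K \<subseteq> {l<..<\<beta>}" using k1(2) k2(2) e1(1) e2(1) by (force simp: l_def \<beta>_def)
  have C': "C1_compact {l<..<\<beta>} \<phi> G"
    using C by (intro C1_compactI[OF _ _ K(1) KI K(3)]) (auto simp: C1_compact_def)
  have cV: "continuous_on {l..\<beta>} (\<lambda>y. V (x, y))"
    by (rule continuous_on_compose2[OF V_continuous]) (use sub in \<open>auto simp: cross_section_def intro!: continuous_intros\<close>)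
  then have c: "continuous_on {l..\<beta>} (\<lambda>y. V (x, y) - M)" by (intro continuous_intros)
  have neg: "integral {l..\<beta>} (\<lambda>y. (G y)\<^sup>2 + (V (x, y) - M) * (\<phi> y)\<^sup>2) < 0"
  proof -
    let ?f = "\<lambda>y. (G y)\<^sup>2 + (V (x, y) - M) * (\<phi> y)\<^sup>2"
    have cf: "continuous_on {l..\<beta>} ?f"
      by (intro continuous_intros c continuous_on_subset[OF cs(1)] continuous_on_subset[OF cs(2)]) auto
    have "integral {l..\<beta>} ?f = (LINT y:{l..\<beta>}|lborel. ?f y)"
      by (rule set_borel_integral_eq_integral(2)[symmetric]) (rule borel_integrable_atLeastAtMost'[OF cf])
    also have "\<dots> = (\<integral>y. (G y)\<^sup>2 + indicator (cross_section \<Omega> x) y * V (x, y) * (\<phi> y)\<^sup>2 - M * (\<phi> y)\<^sup>2 \<partial>lborel)"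
      unfolding set_lebesgue_integral_def
    proof (rule Bochner_Integration.integral_cong)
      fix y
      show "indicator {l..\<beta>} y *\<^sub>R ?f y = (G y)\<^sup>2 + indicator (cross_section \<Omega> x) y * V (x, y) * (\<phi> y)\<^sup>2 - M * (\<phi> y)\<^sup>2"
      proof (cases "y \<in> K")
        case True
        then have "y \<in> {l..\<beta>}" "y \<in> cross_section \<Omega> x" using KI K(2) by auto
        then show ?thesis by (simp add: algebra_simps)
      qed (simp add: K)
    qed simp
    also have "\<dots> = (\<integral>y. (G y)\<^sup>2 \<partial>lborel) + (\<integral>y. indicator (cross_section \<Omega> x) y * V (x, y) * (\<phi> y)\<^sup>2 \<partial>lborel) - M * (\<integral>y. (\<phi> y)\<^sup>2 \<partial>lborel)"
    proof -
      note cc = C1_compact_compactly_supported[OF C]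
      have "integrable lborel (\<lambda>y. (G y)\<^sup>2)" "integrable lborel (\<lambda>y. (\<phi> y)\<^sup>2)"
        by (intro compactly_supported_integrable compactly_supported_power2 cc)+
      moreover have "continuous_on (cross_section \<Omega> x) (\<lambda>y. V (x, y))"
        by (rule continuous_on_compose2[OF V_continuous]) (auto simp: cross_section_def intro!: continuous_intros)
      then have "integrable lborel (\<lambda>y. indicator (cross_section \<Omega> x) y * V (x, y) * (\<phi> y)\<^sup>2)"
        by (intro compactly_supported_integrable compactly_supported_mult_potential[OF open_cross_section _ continuous_on_power[OF cs(1)] K(1,2)])
          (simp_all add: K(3))
      ultimately show ?thesis by simp
    qed
    also have "(\<integral>y. indicator (cross_section \<Omega> x) y * V (x, y) * (\<phi> y)\<^sup>2 \<partial>lborel) = (\<integral>y. V (x, y) * (\<phi> y)\<^sup>2 \<partial>S.M)"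
      unfolding S.M_def using S.U_sets by (subst integral_restrict_space) (auto simp: mult.assoc)
    finally show ?thesis using E N S.energy_alt[OF C] by simp
  qed
  obtain \<psi> \<psi>' r m where r: "r < \<beta>" and P: "profile (\<lambda>y. V (x, y) - M) \<psi> \<psi>' l r m"
    using profile_exists[OF l\<beta> c C' neg] by blast
  have m: "m \<in> {l<..<r}" using P by (simp add: profile_def)
  have inO: "(x, y) \<in> \<Omega>" if "y \<in> {l..r}" for y using that sub r by (auto simp: cross_section_def subset_iff)
  have "concave_on {l<..<r} (\<lambda>y. ln (\<psi> y))"
    by (rule profile_log_concave[OF P convex_on_affine_line[OF V]]) (auto intro: inO)
  moreover have "V (x, m) \<le> M"
  proof -
    define d where "d = min (m - l) (r - m)"
    have d: "0 < d" using m by (auto simp: d_def)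
    have "(V (x, m) - M) * \<psi> m \<le> 0"
    proof (rule second_derivative_at_max(2)[OF d])
      show "(\<psi> has_real_derivative \<psi>' s) (at s)" if "\<bar>s - m\<bar> < d" for s
      proof -
        have "s \<in> {l<..<r}" using that by (auto simp: d_def abs_less_iff)
        then show ?thesis using P by (auto simp: profile_def)
      qed
      show "(\<psi>' has_real_derivative (V (x, m) - M) * \<psi> m) (at m)" using P m unfolding profile_def by blast
      show "\<psi> s \<le> \<psi> m" for s using P by (simp add: profile_def)
    qed
    then show ?thesis using P by (simp add: profile_def)
  qed
  moreover have "{x} \<times> {l..r} \<subseteq> \<Omega>" using inO by auto
  ultimately show ?thesis using P by blast
qed

text \<open>
  The trapezoid spanned by the supports of the two profiles lies in \<open>\<Omega>\<close> by convexity and contains the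
  support of the interpolation.
\<close>

lemma two_section_bound:
  assumes O: "convex \<Omega>" and V: "convex_on \<Omega> V" and ab: "a < b" and a: "a \<in> fst ` \<Omega>" "mu a < M" and b: "b \<in> fst ` \<Omega>" "mu b < M"
    and k: "0 \<le> k" "\<And>p q. p \<in> \<Omega> \<Longrightarrow> q \<in> \<Omega> \<Longrightarrow> V p \<le> M \<Longrightarrow> V q \<le> M \<Longrightarrow> (M - V p) * (snd p - snd q)\<^sup>2 \<le> k"
  shows "ground_energy \<Omega> V \<le> M + (4864 + 768 * k) / (b - a)\<^sup>2"
proof -
  obtain \<psi>1 \<psi>1' l1 r1 m1 where 1: "profile (\<lambda>y. V (a, y) - M) \<psi>1 \<psi>1' l1 r1 m1" "{a} \<times> {l1..r1} \<subseteq> \<Omega>" "V (a, m1) \<le> M"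
      "concave_on {l1<..<r1} (\<lambda>y. ln (\<psi>1 y))" using section_profile[OF O V a] by blast
  obtain \<psi>2 \<psi>2' l2 r2 m2 where 2: "profile (\<lambda>y. V (b, y) - M) \<psi>2 \<psi>2' l2 r2 m2" "{b} \<times> {l2..r2} \<subseteq> \<Omega>" "V (b, m2) \<le> M"
      "concave_on {l2<..<r2} (\<lambda>y. ln (\<psi>2 y))" using section_profile[OF O V b] by blast
  interpret P: profile_pair "\<lambda>y. V (a, y) - M" \<psi>1 \<psi>1' l1 r1 m1 "\<lambda>y. V (b, y) - M" \<psi>2 \<psi>2' l2 r2 m2
    by unfold_locales (fact 1 2)+
  have am: "(a, m1) \<in> \<Omega>" and bm: "(b, m2) \<in> \<Omega>" using 1(2) 2(2) P.profile_max(3,4) by auto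
  define t where "t x = (x - a) / (b - a)" for x
  have t: "0 < t x" "t x < 1" if "a < x" "x < b" for x using that by (auto simp: t_def)
  have tx: "(1 - t x) * a + t x * b = x" for x
  proof -
    have "(1 - t x) * a + t x * b = a + t x * (b - a)" by (simp add: algebra_simps)
    then show ?thesis using ab by (simp add: t_def)
  qed
  define T where "T = convex hull ({a} \<times> {l1..r1} \<union> {b} \<times> {l2..r2})"
  have in_seg: "(x, y) \<in> convex hull {(a, y1), (b, y2)}" if "a < x" "x < b" "y = (1 - t x) * y1 + t x * y2" for x y y1 y2
  proof -
    have "(x, y) = (1 - t x) *\<^sub>R (a, y1) + t x *\<^sub>R (b, y2)" using tx[of x] that(3) by simp
    then show ?thesis unfolding convex_hull_2_alt using t[OF that(1,2)] by (auto intro!: exI[of _ "t x"] simp: algebra_simps)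
  qed
  interpret F: subsolution_family \<Omega> V "\<lambda>x. P.F (t x)" M a b m1 m2 k T
  proof unfold_locales
    show "a < b" by (rule ab)
    show "continuous_on ({a<..<b} \<times> UNIV) (\<lambda>(x, y). P.F (t x) y)"
    proof -
      have "continuous_on ({a<..<b} \<times> UNIV) (\<lambda>p. (\<lambda>(t, y). P.F t y) (t (fst p), snd p))"
        by (rule continuous_on_compose2[OF P.interp_continuous]) (use t ab in \<open>auto simp: t_def intro!: continuous_intros\<close>)
      then show ?thesis by (simp add: case_prod_unfold)
    qed
    show "compact T" unfolding T_def by (intro compact_convex_hull compact_Un compact_Times) auto
    show "T \<subseteq> \<Omega>" unfolding T_def using 1(2) 2(2) O by (intro hull_minimal) auto
    show "0 \<le> k" by (rule k)
    show "\<exists>y. P.F (t ((a + b) / 2)) y \<noteq> 0"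
    proof -
      have "a < (a + b) / 2" "(a + b) / 2 < b" using ab by auto
      from P.interp_peak[OF t[OF this]] show ?thesis by (metis zero_neq_one)
    qed
    show "(M - V (x, y)) * (y - m)\<^sup>2 \<le> k" if p: "(x, y) \<in> \<Omega>" and m: "m \<in> {m1, m2}" for x y m
    proof (cases "V (x, y) \<le> M")
      case False
      then have "(M - V (x, y)) * (y - m)\<^sup>2 \<le> 0" by (intro mult_nonpos_nonneg) auto
      then show ?thesis using k(1) by simp
    next
      case True
      then show ?thesis using m k(2)[OF p am _ 1(3)] k(2)[OF p bm _ 2(3)] by auto
    qed
    fix x assume x: "a < x" "x < b"
    note tt = t[OF x]
    show "0 \<le> P.F (t x) y" for y by (rule P.interp_bounds(1)[OF tt])
    show "(x, y) \<in> T" if "P.F (t x) y \<noteq> 0" for y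
    proof -
      have "0 < P.F (t x) y" using that P.interp_bounds(1)[OF tt, of y] by simp
      then obtain y1 y2 where y: "y = (1 - t x) * y1 + t x * y2" "y1 \<in> {l1<..<r1}" "y2 \<in> {l2<..<r2}"
        using P.decompose_pos[OF tt] by metis
      have "(x, y) \<in> convex hull {(a, y1), (b, y2)}" by (rule in_seg[OF x y(1)])
      also have "\<dots> \<subseteq> T" unfolding T_def using y by (intro hull_mono) auto
      finally show ?thesis .
    qed
    show "P.F (t x) y \<le> P.F (t (x + \<theta> * (b - x))) ((1 - \<theta>) * y + \<theta> * m2)" if "0 \<le> \<theta>" "\<theta> < 1" for y \<theta>
    proof -
      have "t (x + \<theta> * (b - x)) = t x + \<theta> * (1 - t x)"
      proof -
        have "1 - t x = (b - x) / (b - a)" using ab by (simp add: t_def field_simps)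
        moreover have "x + \<theta> * (b - x) - a = (x - a) + \<theta> * (b - x)" by simp
        then have "t (x + \<theta> * (b - x)) = t x + \<theta> * ((b - x) / (b - a))" by (simp only: t_def add_divide_distrib times_divide_eq_right)
        ultimately show ?thesis by simp
      qed
      then show ?thesis using P.contraction_right[OF tt that] by simp
    qed
    show "P.F (t x) y \<le> P.F (t (x - \<theta> * (x - a))) ((1 - \<theta>) * y + \<theta> * m1)" if "0 \<le> \<theta>" "\<theta> < 1" for y \<theta>
    proof -
      have "x - \<theta> * (x - a) - a = (1 - \<theta>) * (x - a)" by (simp add: algebra_simps)
      then have "t (x - \<theta> * (x - a)) = (1 - \<theta>) * t x" by (simp add: t_def)
      then show ?thesis using P.contraction_left[OF tt that] by simp
    qed
    show "below_parabolas (\<lambda>y. (V (x, y) - M) * P.F (t x) y) (P.F (t x))"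
    proof (rule below_parabolasI)
      fix l r y c assume lr: "l < r" and y: "y \<in> {l..r}" and c: "\<And>z. z \<in> {l..r} \<Longrightarrow> c < (V (x, z) - M) * P.F (t x) z"
      show "P.F (t x) y \<le> (r - y) / (r - l) * P.F (t x) l + (y - l) / (r - l) * P.F (t x) r + c / 2 * ((y - l) * (y - r))"
      proof (rule below_parabola[OF _ _ y lr])
        have "continuous_on {l..r} (\<lambda>y. (\<lambda>(t, y). P.F t y) (t x, y))"
          by (rule continuous_on_compose2[OF P.interp_continuous]) (use tt in \<open>auto intro!: continuous_intros\<close>)
        then show "continuous_on {l..r} (P.F (t x))" by simp
        fix z assume z: "z \<in> {l<..<r}"
        have cz: "c < (V (x, z) - M) * P.F (t x) z" using z by (intro c) auto
        show "\<exists>\<theta> \<theta>' D d. 0 < d \<and> (\<forall>s. \<bar>s\<bar> < d \<longrightarrow> (\<theta> has_real_derivative \<theta>' s) (at s) \<and> \<theta> s \<le> P.F (t x) (z + s)) \<and> \<theta> 0 = P.F (t x) z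
          \<and> (\<theta>' has_real_derivative D) (at 0) \<and> c < D"
        proof (cases "P.F (t x) z = 0")
          case True
          then have "c < 0" using cz by simp
          then show ?thesis
            using P.interp_bounds(1)[OF tt] True by (intro exI[of _ "\<lambda>_. 0"] exI[of _ 0] exI[of _ 1]) auto
        next
          case False
          then have pos: "0 < P.F (t x) z" using P.interp_bounds(1)[OF tt, of z] by simp
          have "V (x, z) - M \<le> (1 - t x) * (V (a, y1) - M) + t x * (V (b, y2) - M)"
            if y: "y1 \<in> {l1<..<r1}" "y2 \<in> {l2<..<r2}" "z = (1 - t x) * y1 + t x * y2" for y1 y2
          proof -
            have "(a, y1) \<in> \<Omega>" "(b, y2) \<in> \<Omega>" using y 1(2) 2(2) by auto
            then have "V ((1 - t x) *\<^sub>R (a, y1) + t x *\<^sub>R (b, y2)) \<le> (1 - t x) * V (a, y1) + t x * V (b, y2)"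
              using tt by (intro convex_onD[OF V]) auto
            moreover have "(1 - t x) *\<^sub>R (a, y1) + t x *\<^sub>R (b, y2) = (x, z)" using tx[of x] y(3) by simp
            ultimately show ?thesis by (simp add: algebra_simps)
          qed
          from P.lower_support[OF tt pos this]
          obtain \<theta> \<theta>' D d where "0 < d" "\<forall>s. \<bar>s\<bar> < d \<longrightarrow> (\<theta> has_real_derivative \<theta>' s) (at s) \<and> \<theta> s \<le> P.F (t x) (z + s)"
            "\<theta> 0 = P.F (t x) z" "(\<theta>' has_real_derivative D) (at 0)" "(V (x, z) - M) * P.F (t x) z \<le> D" by blast
          then show ?thesis using cz by (meson less_le_trans)
        qed
      qed
    qed
  qed
  show ?thesis by (rule F.ground_energy_bound)
qed

end

section \<open>The scale of the effective potential and the upper bound\<close>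

lemma interval_between_extremes:
  fixes I :: "real set"
  assumes I: "is_interval I" "bounded I" and L: "0 < L" "L \<le> diameter I"
  obtains \<alpha> \<beta> where "L \<le> \<beta> - \<alpha>" "{\<alpha><..<\<beta>} \<subseteq> I"
proof (rule that)
  have ne: "I \<noteq> {}" using L by auto
  have bdd: "bdd_below I" "bdd_above I" using I(2) by (auto intro: bounded_imp_bdd_below bounded_imp_bdd_above)
  have "diameter I \<le> Sup I - Inf I"
  proof (rule diameter_le)
    fix x y assume "x \<in> I" "y \<in> I"
    then have "x \<le> Sup I" "Inf I \<le> x" "y \<le> Sup I" "Inf I \<le> y" using bdd by (auto intro: cSup_upper cInf_lower)
    then show "norm (x - y) \<le> Sup I - Inf I" by (simp add: abs_le_iff)
  qed (use ne in simp)
  then show "L \<le> Sup I - Inf I" using L by simp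
  show "{Inf I<..<Sup I} \<subseteq> I"
  proof
    fix x assume x: "x \<in> {Inf I<..<Sup I}"
    obtain u where "u \<in> I" "u < x" using cInf_lessD[OF ne, of x] x by auto
    moreover obtain v where "v \<in> I" "x < v" using less_cSupD[OF ne, of x] x by auto
    ultimately show "x \<in> I" using mem_is_interval_1_I[OF I(1)] by (meson less_imp_le)
  qed
qed

text \<open>
  The end points of almost optimal intervals accumulate by compactness, and every point between the limits
  lies in almost all of these intervals.  This makes the \<open>GREATEST\<close> in the definition of \<open>L\<^sub>2\<close> meaningful;
  the local bound near \<open>x0\<close> provides an admissible scale to start with.
\<close>

lemma greatest_interval_scale:
  fixes f :: "real \<Rightarrow> real" and J :: "real set"
  assumes J: "bounded J" and x0: "x0 \<in> J" and near: "\<And>t. f x0 < t \<Longrightarrow> \<exists>d>0. \<forall>x. \<bar>x - x0\<bar> < d \<longrightarrow> x \<in> J \<and> f x < t"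
    and s: "\<And>x. x \<in> J \<Longrightarrow> s \<le> f x"
  defines "P \<equiv> \<lambda>L. 0 < L \<and> (\<exists>I. is_interval I \<and> I \<subseteq> J \<and> L \<le> diameter I \<and> (\<forall>x\<in>I. s \<le> f x \<and> f x \<le> s + 1 / L\<^sup>2))"
  shows "P (Greatest P)"
proof -
  define Q where "Q L \<alpha> \<beta> \<longleftrightarrow> L \<le> \<beta> - \<alpha> \<and> (\<forall>x\<in>{\<alpha><..<\<beta>}. x \<in> J \<and> f x \<le> s + 1 / L\<^sup>2)" for L \<alpha> \<beta>
  have PQ: "\<exists>\<alpha> \<beta>. Q L \<alpha> \<beta>" if L: "P L" for L
  proof -
    obtain I where I: "is_interval I" "I \<subseteq> J" "L \<le> diameter I" "\<forall>x\<in>I. f x \<le> s + 1 / L\<^sup>2" and L0: "0 < L" using L by (auto simp: P_def)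
    obtain \<alpha> \<beta> where "L \<le> \<beta> - \<alpha>" "{\<alpha><..<\<beta>} \<subseteq> I"
      by (rule interval_between_extremes[OF I(1) bounded_subset[OF J I(2)] L0 I(3)])
    then show ?thesis using I by (intro exI[of _ \<alpha>] exI[of _ \<beta>]) (auto simp: Q_def)
  qed
  have QP: "P L" if L: "0 < L" "Q L \<alpha> \<beta>" for L \<alpha> \<beta>
  proof -
    have "\<alpha> < \<beta>" using L by (auto simp: Q_def)
    then have "diameter {\<alpha><..<\<beta>} = \<beta> - \<alpha>" by simp
    then have "is_interval {\<alpha><..<\<beta>} \<and> {\<alpha><..<\<beta>} \<subseteq> J \<and> L \<le> diameter {\<alpha><..<\<beta>} \<and> (\<forall>x\<in>{\<alpha><..<\<beta>}. s \<le> f x \<and> f x \<le> s + 1 / L\<^sup>2)"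
      using L s by (auto simp: Q_def)
    then show ?thesis using L(1) unfolding P_def by blast
  qed
  have ex: "\<exists>L. P L"
  proof -
    obtain d where d: "0 < d" "\<And>x. \<bar>x - x0\<bar> < d \<Longrightarrow> x \<in> J \<and> f x < f x0 + 1" using near[of "f x0 + 1"] by auto
    define D where "D = f x0 + 1 - s"
    have D: "1 \<le> D" using s[OF x0] by (simp add: D_def)
    define L where "L = min d (1 / sqrt D)"
    have L: "0 < L" "L \<le> d" "L \<le> 1 / sqrt D" using d D by (auto simp: L_def)
    have "L\<^sup>2 \<le> (1 / sqrt D)\<^sup>2" using L by (intro power_mono) auto
    then have "D \<le> 1 / L\<^sup>2" using D L by (simp add: power_divide field_simps)
    then have "f x \<le> s + 1 / L\<^sup>2" if "\<bar>x - x0\<bar> < d" for x using d(2)[OF that] by (simp add: D_def)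
    then have "Q L (x0 - d) (x0 + d)" unfolding Q_def using L d by (auto simp: abs_less_iff)
    then show ?thesis using QP[OF L(1)] by blast
  qed
  have bnd: "L \<le> diameter J" if "P L" for L
    using that diameter_subset[OF _ J] unfolding P_def by (meson order_trans)
  define S where "S = Sup (Collect P)"
  have bdd: "bdd_above (Collect P)" by (rule bdd_aboveI[of _ "diameter J"]) (use bnd in auto)
  have up: "L \<le> S" if "P L" for L unfolding S_def using that bdd by (intro cSup_upper) auto
  have S0: "0 < S" using ex up unfolding P_def by (meson less_le_trans)
  have "\<exists>L. P L \<and> S - inverse (real (Suc n)) < L" for n
    using less_cSupD[of "Collect P" "S - inverse (real (Suc n))"] ex by (auto simp: S_def)
  then obtain L where L: "\<And>n. P (L n)" "\<And>n. S - inverse (real (Suc n)) < L n" by metis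
  have L0: "0 < L n" for n using L(1)[of n] by (simp add: P_def)
  obtain \<alpha> \<beta> where \<alpha>\<beta>: "\<And>n. Q (L n) (\<alpha> n) (\<beta> n)" using PQ[OF L(1)] by metis
  have less: "\<alpha> n < \<beta> n" for n using \<alpha>\<beta>[of n] L0[of n] by (auto simp: Q_def)
  have cl: "{\<alpha> n .. \<beta> n} \<subseteq> closure J" for n
  proof -
    have "{\<alpha> n<..<\<beta> n} \<subseteq> J" using \<alpha>\<beta>[of n] by (auto simp: Q_def)
    then have "closure {\<alpha> n<..<\<beta> n} \<subseteq> closure J" by (rule closure_mono)
    then show ?thesis using less[of n] by simp
  qed
  have "\<alpha> n \<in> closure J" "\<beta> n \<in> closure J" for n using less[of n] by (auto intro!: subsetD[OF cl[of n]])
  then have "range (\<lambda>n. (\<alpha> n, \<beta> n)) \<subseteq> closure J \<times> closure J" by auto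
  then have "bounded (range (\<lambda>n. (\<alpha> n, \<beta> n)))" using bounded_Times[OF bounded_closure[OF J] bounded_closure[OF J]] bounded_subset by blast
  then obtain l r where r: "strict_mono r" and l: "((\<lambda>n. (\<alpha> n, \<beta> n)) \<circ> r) \<longlonglongrightarrow> l"
    using bounded_imp_convergent_subsequence by blast
  have la: "(\<lambda>n. \<alpha> (r n)) \<longlonglongrightarrow> fst l" and lb: "(\<lambda>n. \<beta> (r n)) \<longlonglongrightarrow> snd l"
    using tendsto_fst[OF l] tendsto_snd[OF l] by (auto simp: o_def)
  have "L \<longlonglongrightarrow> S"
  proof (rule tendsto_sandwich)
    show "\<forall>\<^sub>F n in sequentially. S - inverse (real (Suc n)) \<le> L n" using L(2) by (auto intro: always_eventually less_imp_le)
    show "\<forall>\<^sub>F n in sequentially. L n \<le> S" using up[OF L(1)] by (auto intro: always_eventually)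
    show "(\<lambda>n. S - inverse (real (Suc n))) \<longlonglongrightarrow> S" using tendsto_diff[OF tendsto_const LIMSEQ_inverse_real_of_nat, of S] by simp
  qed simp
  then have lL: "(\<lambda>n. L (r n)) \<longlonglongrightarrow> S" using LIMSEQ_subseq_LIMSEQ[OF _ r] by (auto simp: o_def)
  have "Q S (fst l) (snd l)" unfolding Q_def
  proof (intro conjI ballI)
    show "S \<le> snd l - fst l"
      by (rule LIMSEQ_le[OF lL tendsto_diff[OF lb la]]) (use \<alpha>\<beta> in \<open>auto simp: Q_def\<close>)
    fix x assume x: "x \<in> {fst l<..<snd l}"
    have ev: "\<forall>\<^sub>F n in sequentially. x \<in> {\<alpha> (r n)<..<\<beta> (r n)}"
      using order_tendstoD(2)[OF la, of x] order_tendstoD(1)[OF lb, of x] x by (auto elim: eventually_elim2)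
    then obtain n where "x \<in> {\<alpha> (r n)<..<\<beta> (r n)}" by (auto simp: eventually_sequentially)
    then show "x \<in> J" using \<alpha>\<beta>[of "r n"] by (auto simp: Q_def)
    show "f x \<le> s + 1 / S\<^sup>2"
    proof (rule tendsto_lowerbound)
      show "(\<lambda>n. s + 1 / (L (r n))\<^sup>2) \<longlonglongrightarrow> s + 1 / S\<^sup>2" using S0 by (intro tendsto_intros lL) auto
      show "\<forall>\<^sub>F n in sequentially. f x \<le> s + 1 / (L (r n))\<^sup>2"
        using ev by eventually_elim (use \<alpha>\<beta> in \<open>auto simp: Q_def\<close>)
    qed simp
  qed
  then have PS: "P S" by (rule QP[OF S0])
  then have "Greatest P = S" using up by (intro Greatest_equality)
  then show ?thesis using PS by simp
qed

text \<open>
  With \<open>M - 1 \<le> 411 L\<^sub>1\<^sup>-\<^sup>2\<close>, the set \<open>V \<le> M\<close> lies in a strip of width \<open>240 * 411 * L\<^sub>1\<close>, so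
  \<open>(M - V)(y - m)\<^sup>2\<close> is at most this number there.
\<close>

definition strip_constant :: real where "strip_constant = 411 * (240 * 411)\<^sup>2"
definition gap_constant :: real where "gap_constant = 819 + 4 * (4864 + 768 * strip_constant)"

context concave_well
begin

lemma mu_star_le: "x \<in> fst ` \<Omega> \<Longrightarrow> mu_star \<Omega> W \<le> mu x"
  unfolding mu_star_def by (rule cINF_lower) (auto intro!: bdd_belowI2[of _ 1] mu_ge_1)

lemma mu_star_upper: "mu_star \<Omega> W \<le> 1 + 409 / L1\<^sup>2"
proof -
  obtain c where c: "cball c (L1 / 2) \<subseteq> \<Omega>" "\<And>p. p \<in> cball c (L1 / 2) \<Longrightarrow> W p \<le> 1 + 1 / L1\<^sup>2" by (rule L1_ball) (rule that)
  have "c \<in> \<Omega>" using c(1) L1_attained(1) by auto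
  then have x: "fst c \<in> fst ` \<Omega>" by blast
  interpret S: schroedinger "cross_section \<Omega> (fst c)" "\<lambda>y. W (fst c, y)" by (rule section_schroedinger[OF x])
  have ball: "(fst c, y) \<in> cball c (L1 / 2)" if "y \<in> cball (snd c) (L1 / 2)" for y
    using that by (simp add: dist_prod_def)
  have "mu_star \<Omega> W \<le> mu (fst c)" by (rule mu_star_le[OF x])
  also have "\<dots> \<le> 1 + 1 / L1\<^sup>2 + 51 * 2 ^ DIM(real) / (L1 / 2)\<^sup>2"
    unfolding mu_eq[OF x] using L1_attained(1) ball c
    by (intro S.ground_energy_le_ball[of "L1 / 2" "snd c"]) (auto simp: cross_section_def)
  also have "\<dots> = 1 + 409 / L1\<^sup>2" by (simp add: power_divide add_divide_distrib[symmetric])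
  finally show ?thesis .
qed

lemma ground_energy_upper: "ground_energy \<Omega> W \<le> 1 + 817 / L1\<^sup>2"
proof -
  obtain c where c: "cball c (L1 / 2) \<subseteq> \<Omega>" "\<And>p. p \<in> cball c (L1 / 2) \<Longrightarrow> W p \<le> 1 + 1 / L1\<^sup>2" by (rule L1_ball) (rule that)
  have "ground_energy \<Omega> W \<le> 1 + 1 / L1\<^sup>2 + 51 * 2 ^ DIM(real \<times> real) / (L1 / 2)\<^sup>2"
    using L1_attained(1) c by (intro plane.ground_energy_le_ball) auto
  also have "\<dots> = 1 + 817 / L1\<^sup>2" by (simp add: power_divide add_divide_distrib[symmetric])
  finally show ?thesis .
qed

lemma gap_constant: "817 \<le> gap_constant" "0 \<le> strip_constant" "0 < gap_constant"
  by (auto simp: gap_constant_def strip_constant_def)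

lemma bound_of_small_scale:
  assumes "0 < L" "L \<le> L1"
  shows "ground_energy \<Omega> W \<le> ground_energy (fst ` \<Omega>) mu + gap_constant / L\<^sup>2"
proof -
  have "817 / L1\<^sup>2 \<le> gap_constant / L\<^sup>2" using assms gap_constant by (intro frac_le power_mono) auto
  moreover have "1 \<le> ground_energy (fst ` \<Omega>) mu" by (rule line.ground_energy_ge[OF mu_ge_1])
  ultimately show ?thesis using ground_energy_upper by linarith
qed

text \<open>
  The abscissae \<open>a\<close> and \<open>b\<close> are taken strictly inside the interval.  The section eigenvalues there are below \<open>M\<close>,
  and \<open>L1 \<le> L\<close> keeps \<open>M\<close> low enough for the set \<open>V \<le> M\<close> to be confined to a strip.
\<close>

lemma bound_of_large_scale:
  assumes wo: "well_oriented \<Omega> W" and L: "L1 \<le> L" "L \<le> \<beta> - \<alpha>"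
    and I: "\<And>x. x \<in> {\<alpha><..<\<beta>} \<Longrightarrow> x \<in> fst ` \<Omega> \<and> mu x \<le> mu_star \<Omega> W + 1 / L\<^sup>2"
  shows "ground_energy \<Omega> W \<le> ground_energy (fst ` \<Omega>) mu + gap_constant / L\<^sup>2"
proof -
  have L0: "0 < L" using L L1_attained(1) by simp
  define a b where "a = \<alpha> + (\<beta> - \<alpha>) / 4" and "b = \<beta> - (\<beta> - \<alpha>) / 4"
  have ab: "a \<in> {\<alpha><..<\<beta>}" "b \<in> {\<alpha><..<\<beta>}" "a < b" "L / 2 \<le> b - a" using L(2) L0 by (auto simp: a_def b_def field_simps)
  define M where "M = mu_star \<Omega> W + 2 / L\<^sup>2"
  have lt: "mu_star \<Omega> W + 1 / L\<^sup>2 < M" using L0 by (simp add: M_def divide_strict_right_mono)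
  have "2 / L\<^sup>2 \<le> 2 / L1\<^sup>2" using L L1_attained(1) by (intro divide_left_mono power_mono) auto
  moreover have "409 / L1\<^sup>2 + 2 / L1\<^sup>2 = 411 / L1\<^sup>2" by (simp add: add_divide_distrib[symmetric])
  ultimately have M1: "M \<le> 1 + 411 / L1\<^sup>2" using mu_star_upper unfolding M_def by linarith
  have "ground_energy \<Omega> W \<le> M + (4864 + 768 * strip_constant) / (b - a)\<^sup>2"
  proof (rule two_section_bound[OF convex_O W_convex ab(3)])
    show "a \<in> fst ` \<Omega>" "b \<in> fst ` \<Omega>" using I ab by auto
    show "mu a < M" "mu b < M" using I[OF ab(1)] I[OF ab(2)] lt by auto
    show "0 \<le> strip_constant" by (rule gap_constant)
    fix p q assume p: "p \<in> \<Omega>" "W p \<le> M" and q: "q \<in> \<Omega>" "W q \<le> M"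
    have "\<bar>snd p - snd q\<bar> \<le> 240 * 411 * L1"
      using p q M1 by (intro low_set_strip[OF wo]) (auto simp: low_set_def)
    then have "\<bar>snd p - snd q\<bar>\<^sup>2 \<le> (240 * 411 * L1)\<^sup>2" by (intro power_mono) auto
    moreover have "M - W p \<le> 411 / L1\<^sup>2" using M1 W_ge_1[OF p(1)] by simp
    ultimately have "(M - W p) * (snd p - snd q)\<^sup>2 \<le> (411 / L1\<^sup>2) * (240 * 411 * L1)\<^sup>2" using p(2) by (intro mult_mono) auto
    also have "\<dots> = strip_constant" using L1_attained(1) by (simp add: strip_constant_def power_mult_distrib)
    finally show "(M - W p) * (snd p - snd q)\<^sup>2 \<le> strip_constant" .
  qed
  also have "(4864 + 768 * strip_constant) / (b - a)\<^sup>2 \<le> (4864 + 768 * strip_constant) / (L / 2)\<^sup>2"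
    using ab(4) L0 gap_constant(2) by (intro divide_left_mono power_mono mult_pos_pos zero_less_power) auto
  also have "M + (4864 + 768 * strip_constant) / (L / 2)\<^sup>2 = mu_star \<Omega> W + (gap_constant - 817) / L\<^sup>2"
    by (simp add: M_def gap_constant_def power_divide add_divide_distrib[symmetric])
  also have "\<dots> \<le> ground_energy (fst ` \<Omega>) mu + gap_constant / L\<^sup>2"
    by (intro add_mono line.ground_energy_ge mu_star_le divide_right_mono) auto
  finally show ?thesis by simp
qed

lemma eigenvalue_gap:
  assumes wo: "well_oriented \<Omega> W"
  shows "ground_energy \<Omega> W \<le> ground_energy (fst ` \<Omega>) mu + gap_constant / (scale_L2 K \<Omega> W)\<^sup>2"
proof (cases "scale_L1_tilde \<Omega> W < K * L1")
  case True
  then have "scale_L2 K \<Omega> W = L1" by (simp add: scale_L2_def)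
  then show ?thesis using bound_of_small_scale[OF L1_attained(1)] by simp
next
  case False
  define P where "P = (\<lambda>L. 0 < L \<and> (\<exists>I. is_interval I \<and> I \<subseteq> fst ` \<Omega> \<and> L \<le> diameter I \<and>
     (\<forall>x\<in>I. mu_star \<Omega> W \<le> mu x \<and> mu x \<le> mu_star \<Omega> W + 1 / L\<^sup>2)))"
  have L: "scale_L2 K \<Omega> W = Greatest P" using False by (simp add: scale_L2_def P_def)
  obtain x0 where x0: "x0 \<in> fst ` \<Omega>" using nonempty_O by blast
  have "P (Greatest P)" unfolding P_def
    by (rule greatest_interval_scale[OF bounded_fst[OF bounded_O] x0 mu_upper_semicontinuous[OF x0] mu_star_le])
  then obtain I where L0: "0 < Greatest P" and I: "is_interval I" "I \<subseteq> fst ` \<Omega>" "Greatest P \<le> diameter I"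
      "\<forall>x\<in>I. mu x \<le> mu_star \<Omega> W + 1 / (Greatest P)\<^sup>2" unfolding P_def by blast
  obtain \<alpha> \<beta> where \<alpha>\<beta>: "Greatest P \<le> \<beta> - \<alpha>" "{\<alpha><..<\<beta>} \<subseteq> I"
    by (rule interval_between_extremes[OF I(1) bounded_subset[OF bounded_fst[OF bounded_O] I(2)] L0 I(3)])
  show ?thesis
  proof (cases "Greatest P \<le> L1")
    case True
    show ?thesis unfolding L by (rule bound_of_small_scale[OF L0 True])
  next
    case False
    show ?thesis unfolding L
      by (rule bound_of_large_scale[OF wo _ \<alpha>\<beta>(1)]) (use False \<alpha>\<beta>(2) I in auto)
  qed
qed

end

lemma inner_radius_empty: "inner_radius {} = 0"
proof -
  have "{r. 0 \<le> r \<and> (\<exists>c :: real \<times> real. ball c r \<subseteq> {})} = {0}" by auto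
  then show ?thesis by (simp add: inner_radius_def)
qed

theorem theorem1p12:
  fixes c\<^sub>1 :: real
  assumes "0 < c\<^sub>1"
  shows "\<exists>c\<^sub>0>0. \<exists>K\<^sub>0>0. \<forall>c\<^sub>2\<ge>c\<^sub>0. \<forall>K\<ge>K\<^sub>0. \<exists>C>0.
    \<forall>(\<Omega> :: (real \<times> real) set) (h :: real \<times> real \<Rightarrow> real) V lam mu.
      open \<Omega> \<and> convex \<Omega> \<and> bounded \<Omega> \<and>
      c\<^sub>1 \<le> inner_radius \<Omega> \<and> c\<^sub>2 \<le> diameter \<Omega> \<and>
      concave_on (closure \<Omega>) h \<and> (\<forall>p\<in>closure \<Omega>. 0 \<le> h p \<and> h p \<le> 1) \<and>
      (\<exists>p\<in>closure \<Omega>. h p = 1) \<and>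
      V = potential h \<and>
      well_oriented \<Omega> V \<and>
      lam = first_dirichlet_eigenvalue \<Omega> V \<and>
      mu = first_dirichlet_eigenvalue (fst ` \<Omega>) (section_eigenvalue \<Omega> V)
      \<longrightarrow> mu \<le> lam \<and> lam \<le> mu + C / (scale_L2 K \<Omega> V)\<^sup>2"
proof -
  have main: "mu \<le> lam \<and> lam \<le> mu + gap_constant / (scale_L2 K \<Omega> V)\<^sup>2"
    if hyps: "open \<Omega>" "convex \<Omega>" "bounded \<Omega>" "c\<^sub>1 \<le> inner_radius \<Omega>" "concave_on (closure \<Omega>) h"
      "\<forall>p\<in>closure \<Omega>. 0 \<le> h p \<and> h p \<le> 1" "\<exists>p\<in>closure \<Omega>. h p = 1" and V: "V = potential h" and wo: "well_oriented \<Omega> V"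
      and lam: "lam = first_dirichlet_eigenvalue \<Omega> V" and mu: "mu = first_dirichlet_eigenvalue (fst ` \<Omega>) (section_eigenvalue \<Omega> V)"
    for \<Omega> h V lam mu K
  proof -
    obtain p0 where p0: "p0 \<in> closure \<Omega>" "h p0 = 1" using hyps(7) by blast
    have "\<Omega> \<noteq> {}" using hyps(4) assms inner_radius_empty by auto
    then interpret concave_well \<Omega> h p0 by unfold_locales (use hyps p0 in auto)
    have "lam = ground_energy \<Omega> V" unfolding lam V by (rule plane.first_dirichlet_eigenvalue_eq)
    moreover have "mu = ground_energy (fst ` \<Omega>) (section_eigenvalue \<Omega> V)" unfolding mu V by (rule line.first_dirichlet_eigenvalue_eq)
    ultimately show ?thesis using mu_le_lambda eigenvalue_gap[of K] wo by (simp add: V)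
  qed
  show ?thesis
  proof (rule exI[of _ 1], rule conjI[OF zero_less_one], rule exI[of _ 1], rule conjI[OF zero_less_one], intro allI impI)
    fix c\<^sub>2 K :: real
    show "\<exists>C>0. \<forall>(\<Omega> :: (real \<times> real) set) (h :: real \<times> real \<Rightarrow> real) V lam mu.
      open \<Omega> \<and> convex \<Omega> \<and> bounded \<Omega> \<and>
      c\<^sub>1 \<le> inner_radius \<Omega> \<and> c\<^sub>2 \<le> diameter \<Omega> \<and>
      concave_on (closure \<Omega>) h \<and> (\<forall>p\<in>closure \<Omega>. 0 \<le> h p \<and> h p \<le> 1) \<and>
      (\<exists>p\<in>closure \<Omega>. h p = 1) \<and>
      V = potential h \<and>
      well_oriented \<Omega> V \<and>
      lam = first_dirichlet_eigenvalue \<Omega> V \<and>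
      mu = first_dirichlet_eigenvalue (fst ` \<Omega>) (section_eigenvalue \<Omega> V)
      \<longrightarrow> mu \<le> lam \<and> lam \<le> mu + C / (scale_L2 K \<Omega> V)\<^sup>2"
      by (rule exI[of _ gap_constant]) (use main in \<open>auto simp: gap_constant_def strip_constant_def\<close>)
  qed
qed

end
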